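(* Let $I=[\eta,\xi]\subset\mathbb{R}$ be a compact interval, let $0<c_1\le c_2$, and let $f\in\mathcal{F}(I;c_1,c_2)$ have a Lipschitz continuous second derivative. Then for any $\varepsilon>0$, any $\delta$ with $0<\delta\le 1/2$ and any integer $Q>1$, $$N_f(Q,\delta)=|I|\delta Q^2+O\left(\delta^{1/2}\left(\log\frac1\delta\right)Q^{3/2}+Q^{1+\varepsilon}\right),$$ where the implied constant depends only on $I$, $c_1$, $c_2$, $\varepsilon$ and the Lipschitz constant of $f''$ (in particular it is independent of $f$, $\delta$ and $Q$).
   Context: $\mathcal{F}(I;c_1,c_2)$ denotes the set of $C^2$ functions $f:I\to\mathbb{R}$ with $c_1\le |f''(x)|\le c_2$ for all $x\in I$. $|I|$ is the length of $I$. For $x\in\mathbb{R}$, $\|x\|=\min_{k\in\mathbb{Z}}|x-k|$. For $Q\ge1$ and $\delta>0$, $$N_f(Q,\delta)=\#\left\{(a,q)\in\mathbb{Z}\times\mathbb{N}:\ q\le Q,\ a/q\in I,\ \|qf(a/q)\|<\delta\right\}$$ (here $a$ and $q$ are not required to be coprime). *)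

theory Defs
  imports "HOL-Analysis.Analysis"
begin

(* Derivatives are taken within I, hence one-sided at the endpoints, and do not depend on
   the values of f outside I. They are uniquely determined when I is a nondegenerate interval. *)
definition deriv_on :: "real set \<Rightarrow> (real \<Rightarrow> real) \<Rightarrow> real \<Rightarrow> real" where
  "deriv_on I f x = vector_derivative f (at x within I)"

definition C2_on :: "real set \<Rightarrow> (real \<Rightarrow> real) \<Rightarrow> bool" where
  "C2_on I f \<longleftrightarrow>
     f differentiable_on I \<and>
     deriv_on I f differentiable_on I \<and>
     continuous_on I (deriv_on I (deriv_on I f))"

definition F_class :: "real set \<Rightarrow> real \<Rightarrow> real \<Rightarrow> (real \<Rightarrow> real) set" where
  "F_class I c1 c2 =
     {f. C2_on I f \<and>
         (\<forall>x\<in>I. c1 \<le> \<bar>deriv_on I (deriv_on I f) x\<bar> \<and> \<bar>deriv_on I (deriv_on I f) x\<bar> \<le> c2)}"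

(* The infimum is attained, see dist_int_attained. *)
definition dist_int :: "real \<Rightarrow> real" where
  "dist_int x = (INF k::int. \<bar>x - of_int k\<bar>)"

definition rat_pts :: "real set \<Rightarrow> (real \<Rightarrow> real) \<Rightarrow> real \<Rightarrow> real \<Rightarrow> (int \<times> nat) set" where
  "rat_pts I f Q \<delta> =
     {(a, q). 1 \<le> q \<and> real q \<le> Q \<and> of_int a / real q \<in> I \<and>
              dist_int (real q * f (of_int a / real q)) < \<delta>}"

definition N_count :: "real set \<Rightarrow> (real \<Rightarrow> real) \<Rightarrow> real \<Rightarrow> real \<Rightarrow> nat" where
  "N_count I f Q \<delta> = card (rat_pts I f Q \<delta>)"

lemma dist_int_attained: "\<exists>k::int. dist_int x = \<bar>x - of_int k\<bar>"
proof -
  have *: "\<bar>x - of_int (round x)\<bar> \<le> \<bar>x - of_int k\<bar>" for k :: int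
    by (rule round_diff_minimal)
  have "dist_int x = \<bar>x - of_int (round x)\<bar>"
    unfolding dist_int_def
    by (rule cInf_eq_minimum) (use * in auto)
  then show ?thesis by blast
qed

lemma finite_rat_pts:
  assumes "bounded I"
  shows "finite (rat_pts I f Q \<delta>)"
proof -
  obtain B where B: "\<And>x. x \<in> I \<Longrightarrow> \<bar>x\<bar> \<le> B"
    using assms by (auto simp: bounded_iff)
  define M where "M = \<lceil>B * Q\<rceil>"
  have "rat_pts I f Q \<delta> \<subseteq> {-M..M} \<times> {..nat \<lfloor>Q\<rfloor>}"
  proof
    fix p assume p: "p \<in> rat_pts I f Q \<delta>"
    obtain a q where aq: "p = (a, q)" by (cases p)
    have q: "1 \<le> q" "real q \<le> Q" and "of_int a / real q \<in> I"
      using p by (auto simp: rat_pts_def aq)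
    then have a: "\<bar>of_int a / real q\<bar> \<le> B"
      using B by blast
    then have "0 \<le> B" by linarith
    have "\<bar>real_of_int a\<bar> \<le> B * real q"
      using a q by (simp add: abs_divide field_simps)
    also have "\<dots> \<le> B * Q"
      using q \<open>0 \<le> B\<close> by (intro mult_left_mono) auto
    finally have "\<bar>real_of_int a\<bar> \<le> of_int M"
      unfolding M_def by linarith
    then have "\<bar>a\<bar> \<le> M" by linarith
    moreover have "q \<le> nat \<lfloor>Q\<rfloor>" using q by linarith
    ultimately show "p \<in> {-M..M} \<times> {..nat \<lfloor>Q\<rfloor>}" by (auto simp: aq)
  qed
  then show ?thesis by (rule finite_subset) auto
qed

end

theory Submission
  imports Defs
begin

text \<open>Trapezoids whose sides have width \<open>h = 1/Q\<close> bound the indicator of \<open>\<parallel>t\<parallel> < \<delta>\<close> from above and below. Their mean gives the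
  main term, and the other Fourier coefficients leave an average over frequencies \<open>j\<close> of the exponential sums of
  \<open>e(j q f(a/q))\<close>. Truncated Poisson summation in \<open>a\<close> and stationary phase replace the sum over \<open>a\<close> by \<open>\<surd>q\<close> times a sum
  of \<open>e(- q j h(k/j))\<close> over the slopes \<open>k/j\<close> in the range of \<open>f'\<close>, where \<open>h\<close> is the Legendre dual of \<open>f\<close>. Summing over
  \<open>q\<close> first, only those \<open>k/j\<close> matter for which \<open>j h(k/j)\<close> is close to an integer, so an upper bound of the correct
  order, up to \<open>Q\<^sup>\<epsilon>\<close>, for the number of rational points near the dual curve suffices. This bound follows by induction
  on the denominators: rational points over a short arc are collinear, and a line with many of them is itself a
  rational point of smaller denominator near the dual curve.\<close>

text \<open>The smoothing width \<open>1 / Q\<close> changes the count by \<open>O(Q)\<close> only,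
  yet makes the trapezoid coefficients decay like \<open>Q / j\<^sup>2\<close>, so that frequencies
  up to about \<open>Q ^ 4\<close> can be carried. The obstacle is the count near the dual curve:
  the determinant argument fails exactly on the arcs whose points share a line, and what saves it is
  that these lines are counted by the same problem for the other curve, at a denominator smaller by
  a fixed factor. The induction has to give away a factor \<open>r > 1\<close>, as close to 1 as
  desired, per doubling of the denominator; this is the source of \<open>Q powr \<epsilon>\<close>.
  The logarithm of the theorem has another origin: points with a common factor, to which every
  dyadic range of primitive points contributes equally. Regularity is needed unevenly. The point
  count uses only quadratic bounds for the tangent gap and Lipschitz slopes, which hold for
  \<open>f\<close> and \<open>h\<close> alike; the Lipschitz constant of the second derivative
  enters only in stationary phase, where it gives the error \<open>O(log R / R)\<close>.\<close>

section \<open>Rational points near a curve and its Legendre dual\<close>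

text \<open>Here \<open>p = f'\<close>, \<open>g = h'\<close> is its inverse, and \<open>h\<close> is the Legendre dual of \<open>f\<close>. All derivatives enter only
  through finite-difference inequalities, which makes the notion symmetric in the two curves.\<close>

definition dual_pair ::
  "real \<Rightarrow> (real \<Rightarrow> real) \<Rightarrow> (real \<Rightarrow> real) \<Rightarrow> (real \<Rightarrow> real) \<Rightarrow> (real \<Rightarrow> real) \<Rightarrow> bool" where
  "dual_pair \<kappa> f p h g \<longleftrightarrow> 1 \<le> \<kappa> \<and>
     (\<forall>x. g (p x) = x) \<and> (\<forall>y. p (g y) = y) \<and> (\<forall>x. f x + h (p x) = x * p x) \<and>
     (\<forall>x y. \<bar>p x - p y\<bar> \<le> \<kappa> * \<bar>x - y\<bar>) \<and> (\<forall>x y. \<bar>g x - g y\<bar> \<le> \<kappa> * \<bar>x - y\<bar>) \<and>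
     (\<forall>x y. (x - y)\<^sup>2 / \<kappa> \<le> f x - f y - p y * (x - y) \<and> f x - f y - p y * (x - y) \<le> \<kappa> * (x - y)\<^sup>2) \<and>
     (\<forall>x y. (x - y)\<^sup>2 / \<kappa> \<le> h x - h y - g y * (x - y) \<and> h x - h y - g y * (x - y) \<le> \<kappa> * (x - y)\<^sup>2)"

text \<open>A triple \<open>(q, a, b)\<close> stands for the point \<open>(a/q, b/q)\<close> of the plane; it need not have \<open>gcd a q = 1\<close>.\<close>

definition near_prim :: "(real \<Rightarrow> real) \<Rightarrow> real \<Rightarrow> nat \<Rightarrow> real \<Rightarrow> (int \<times> int \<times> int) set" where
  "near_prim f X n V = {(q, a, b). 2 ^ n \<le> q \<and> q < 2 ^ Suc n \<and> gcd q (gcd a b) = 1 \<and>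
     X \<le> of_int a / of_int q \<and> of_int a / of_int q \<le> X + 1 \<and>
     \<bar>of_int q * f (of_int a / of_int q) - of_int b\<bar> \<le> V}"

lemma dual_pair_sym:
  assumes "dual_pair \<kappa> f p h g"
  shows "dual_pair \<kappa> h g f p"
proof -
  have "h y + f (g y) = y * g y" for y
    using assms unfolding dual_pair_def by (metis add.commute mult.commute)
  then show ?thesis using assms unfolding dual_pair_def by blast
qed

lemma finite_near_triples:
  fixes f :: "real \<Rightarrow> real" and X Y V :: real
  assumes "finite Q"
  shows "finite {(q::int, a::int, b::int). q \<in> Q \<and> 0 < q \<and> X \<le> of_int a / of_int q \<and>
           of_int a / of_int q \<le> Y \<and> \<bar>of_int q * f (of_int a / of_int q) - of_int b\<bar> \<le> (V::real)}"
    (is "finite ?S")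
proof -
  have "?S \<subseteq> Sigma Q (\<lambda>q. Sigma {\<lfloor>of_int q * X\<rfloor>..\<lceil>of_int q * Y\<rceil>}
     (\<lambda>a. {\<lfloor>of_int q * f (of_int a / of_int q) - V\<rfloor>..\<lceil>of_int q * f (of_int a / of_int q) + V\<rceil>}))"
  proof
    fix z assume z: "z \<in> ?S"
    obtain q a b where zq: "z = (q, a, b)" by (cases z)
    from z zq have qQ: "q \<in> Q" and q: "0 < q" and 1: "X \<le> of_int a / of_int q"
      and 2: "of_int a / of_int q \<le> Y"
      and 3: "\<bar>of_int q * f (of_int a / of_int q) - of_int b\<bar> \<le> V" by auto
    have "of_int q * X \<le> of_int a" "of_int a \<le> of_int q * Y"
      using 1 2 q by (auto simp: field_simps)
    then have "\<lfloor>of_int q * X\<rfloor> \<le> a \<and> a \<le> \<lceil>of_int q * Y\<rceil> \<and>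
      \<lfloor>of_int q * f (of_int a / of_int q) - V\<rfloor> \<le> b \<and> b \<le> \<lceil>of_int q * f (of_int a / of_int q) + V\<rceil>"
      using 3 by linarith
    then show "z \<in> Sigma Q (\<lambda>q. Sigma {\<lfloor>of_int q * X\<rfloor>..\<lceil>of_int q * Y\<rceil>}
     (\<lambda>a. {\<lfloor>of_int q * f (of_int a / of_int q) - V\<rfloor>..\<lceil>of_int q * f (of_int a / of_int q) + V\<rceil>}))"
      using qQ zq by auto
  qed
  then show ?thesis
    by (rule finite_subset) (use assms in auto)
qed

lemma finite_near_prim: "finite (near_prim f X n V)"
proof -
  have "near_prim f X n V \<subseteq> {(q, a, b). q \<in> {1..2 ^ Suc n} \<and> 0 < q \<and> X \<le> of_int a / of_int q \<and>
           of_int a / of_int q \<le> X + 1 \<and> \<bar>of_int q * f (of_int a / of_int q) - of_int b\<bar> \<le> V}"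
  proof -
    have "1 \<le> q" if "2 ^ n \<le> q" for q :: int
      using that by (meson one_le_power order_trans one_le_numeral)
    then show ?thesis by (fastforce simp: near_prim_def)
  qed
  then show ?thesis
    by (rule finite_subset) (rule finite_near_triples, simp)
qed

text \<open>The offset from the leftmost value, measured in units of \<open>s\<close> and rounded
  down, is injective on \<open>Z\<close>.\<close>

lemma card_spaced_le:
  fixes \<xi> :: "'a \<Rightarrow> real"
  assumes fin: "finite Z" and s: "0 < s" and lam: "0 \<le> w"
    and sep: "\<And>z z'. z \<in> Z \<Longrightarrow> z' \<in> Z \<Longrightarrow> z \<noteq> z' \<Longrightarrow> s \<le> \<bar>\<xi> z - \<xi> z'\<bar>"
    and diam: "\<And>z z'. z \<in> Z \<Longrightarrow> z' \<in> Z \<Longrightarrow> \<bar>\<xi> z - \<xi> z'\<bar> \<le> w"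
  shows "real (card Z) \<le> 1 + w / s"
proof (cases "Z = {}")
  case True
  then show ?thesis using s lam by simp
next
  case False
  define u where "u = Min (\<xi> ` Z)"
  have "u \<in> \<xi> ` Z" unfolding u_def using fin False by (intro Min_in) auto
  then obtain z0 where z0: "z0 \<in> Z" "u = \<xi> z0" by auto
  have ule: "u \<le> \<xi> z" if "z \<in> Z" for z
    unfolding u_def using fin that by (intro Min_le) auto
  define F where "F z = \<lfloor>(\<xi> z - u) / s\<rfloor>" for z
  have "inj_on F Z"
  proof (rule inj_onI, rule ccontr)
    fix z z' assume z: "z \<in> Z" "z' \<in> Z" "F z = F z'" "z \<noteq> z'"
    have "\<bar>(\<xi> z - u) / s - (\<xi> z' - u) / s\<bar> < 1" using z(3) unfolding F_def by linarith
    then have "\<bar>\<xi> z - \<xi> z'\<bar> / s < 1" using s by (simp add: diff_divide_distrib[symmetric] abs_divide)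
    then show False using sep[OF z(1,2,4)] s by (simp add: field_simps)
  qed
  moreover have "F ` Z \<subseteq> {0..\<lfloor>w / s\<rfloor>}"
  proof
    fix i assume "i \<in> F ` Z"
    then obtain z where z: "z \<in> Z" "i = F z" by auto
    have "0 \<le> (\<xi> z - u) / s" using ule[OF z(1)] s by simp
    moreover have "(\<xi> z - u) / s \<le> w / s"
      using diam[OF z(1) z0(1)] z0(2) s by (intro divide_right_mono) auto
    ultimately show "i \<in> {0..\<lfloor>w / s\<rfloor>}" unfolding z(2) F_def by (auto intro: floor_mono)
  qed
  ultimately have "card Z \<le> card {0..\<lfloor>w / s\<rfloor>}"
    by (intro card_inj_on_le) auto
  also have "real \<dots> \<le> 1 + w / s"
    using lam s by (auto simp: field_simps) (metis divide_nonneg_pos floor_divide_lower mult.commute of_int_floor_le zero_le_floor le_floor_iff)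
  finally show ?thesis by simp
qed

context
  fixes \<kappa> :: real and f p h g :: "real \<Rightarrow> real"
  assumes dp: "dual_pair \<kappa> f p h g"
begin

lemma dual_kappa: "1 \<le> \<kappa>"
  and dual_inv: "g (p x) = x" "p (g y) = y"
  and dual_legendre: "f x + h (p x) = x * p x"
  and dual_lip: "\<bar>p x - p y\<bar> \<le> \<kappa> * \<bar>x - y\<bar>" "\<bar>g x - g y\<bar> \<le> \<kappa> * \<bar>x - y\<bar>"
  and dual_lower: "(x - y)\<^sup>2 / \<kappa> \<le> f x - f y - p y * (x - y)"
  and dual_upper: "f x - f y - p y * (x - y) \<le> \<kappa> * (x - y)\<^sup>2"
  using dp unfolding dual_pair_def by blast+

text \<open>The lower tangent bounds based at \<open>x\<close> and at \<open>y\<close> add up to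
  twice this.\<close>

lemma slope_monotone: "(x - y)\<^sup>2 / \<kappa> \<le> (p x - p y) * (x - y)"
proof -
  have "(x - y)\<^sup>2 / \<kappa> \<le> f x - f y - p y * (x - y)" by (rule dual_lower)
  moreover have "(y - x)\<^sup>2 / \<kappa> \<le> f y - f x - p x * (y - x)" by (rule dual_lower)
  moreover have "0 \<le> (x - y)\<^sup>2 / \<kappa>" using dual_kappa by simp
  ultimately show ?thesis by (simp add: power2_commute algebra_simps)
qed

text \<open>The hypothesis puts \<open>x\<close> between \<open>y\<close> and \<open>x'\<close>.
  From \<open>x\<close> to \<open>x'\<close> the gap over the tangent at \<open>y\<close> grows by
  the gap of \<open>x'\<close> over the tangent at \<open>x\<close>, at least
  \<open>(x' - x)\<^sup>2 / \<kappa>\<close>, plus the change of slope from \<open>y\<close> to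
  \<open>x\<close> times \<open>x' - x\<close>, at least
  \<open>(x - y) * (x' - x) / \<kappa>\<close>.\<close>

lemma tangent_gap_growth:
  assumes "0 \<le> (x' - x) * (x - y)"
  shows "(x' - x) * (x' - y) / \<kappa> \<le>
    (f x' - f y - p y * (x' - y)) - (f x - f y - p y * (x - y))"
proof -
  have 1: "(x' - x)\<^sup>2 / \<kappa> \<le> f x' - f x - p x * (x' - x)" by (rule dual_lower)
  \<comment> \<open>\<open>slope_monotone\<close> speaks of the direction \<open>x - y\<close>.
    Multiplication by the nonnegative \<open>(x' - x) * (x - y)\<close> and cancellation of
    \<open>(x - y)\<^sup>2\<close> turn it into the direction \<open>x' - x\<close>.\<close>
  have 2: "(x - y) * (x' - x) / \<kappa> \<le> (p x - p y) * (x' - x)"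
  proof (cases "x = y")
    case False
    then have nz: "0 < (x - y)\<^sup>2" by simp
    have "((x - y)\<^sup>2 / \<kappa>) * ((x' - x) * (x - y)) \<le> ((p x - p y) * (x - y)) * ((x' - x) * (x - y))"
      using slope_monotone assms by (rule mult_right_mono)
    then have "(x - y)\<^sup>2 * ((x - y) * (x' - x) / \<kappa>) \<le> (x - y)\<^sup>2 * ((p x - p y) * (x' - x))"
      by (simp add: power2_eq_square mult_ac)
    then show ?thesis using nz by (simp only: mult_le_cancel_left_pos)
  qed simp
  have "(x' - x) * (x' - y) / \<kappa> = (x' - x)\<^sup>2 / \<kappa> + (x - y) * (x' - x) / \<kappa>"
    by (simp add: add_divide_distrib[symmetric] power2_eq_square algebra_simps)
  also have "\<dots> \<le> (f x' - f x - p x * (x' - x)) + (p x - p y) * (x' - x)"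
    using 1 2 by linarith
  finally show ?thesis by (simp add: algebra_simps)
qed

end

text \<open>Proportionality makes \<open>q\<close> divide every entry of \<open>q'\<close> times the
  first vector, hence \<open>q'\<close> times a gcd equal to 1; by symmetry
  \<open>q = q'\<close>.\<close>

lemma primitive_parallel_eq:
  fixes q a b q' a' b' :: int
  assumes "gcd q (gcd a b) = 1" "gcd q' (gcd a' b') = 1" "0 < q" "0 < q'"
    and "q * a' = q' * a" "q * b' = q' * b"
  shows "q = q' \<and> a = a' \<and> b = b'"
proof -
  have "q dvd q' * gcd q (gcd a b)"
  proof -
    have "q dvd q' * q" "q dvd q' * a" "q dvd q' * b"
      using assms(5,6)[symmetric] by auto
    then have "q dvd gcd (q' * q) (gcd (q' * a) (q' * b))" by simp
    also have "gcd (q' * q) (gcd (q' * a) (q' * b)) = q' * gcd q (gcd a b)"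
      using assms(4) by (simp add: gcd_mult_left)
    finally show ?thesis .
  qed
  then have 1: "q dvd q'" using assms(1) by simp
  have "q' dvd q * gcd q' (gcd a' b')"
  proof -
    have "q' dvd q * q'" "q' dvd q * a'" "q' dvd q * b'"
      using assms(5,6) by auto
    then have "q' dvd gcd (q * q') (gcd (q * a') (q * b'))" by simp
    also have "gcd (q * q') (gcd (q * a') (q * b')) = q * gcd q' (gcd a' b')"
      using assms(3) by (simp add: gcd_mult_left)
    finally show ?thesis .
  qed
  then have 2: "q' dvd q" using assms(2) by simp
  have "q = q'" using 1 2 assms(3,4) by (simp add: zdvd_antisym_nonneg)
  then show ?thesis using assms(3-6) by auto
qed

section \<open>Near points on a common line\<close>

definition line_pts ::
  "(real \<Rightarrow> real) \<Rightarrow> real \<Rightarrow> nat \<Rightarrow> real \<Rightarrow> int \<Rightarrow> int \<Rightarrow> int \<Rightarrow> (int \<times> int \<times> int) set" where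
  "line_pts f X n V j k m = {(q, a, b) \<in> near_prim f X n V. j * b = k * a + m * q}"

definition xcoord :: "int \<times> int \<times> int \<Rightarrow> real" where
  "xcoord z = (case z of (q, a, b) \<Rightarrow> of_int a / of_int q)"

lemma near_primD:
  assumes "(q, a, b) \<in> near_prim f X n V"
  shows "2 ^ n \<le> real_of_int q" "real_of_int q < 2 * 2 ^ n" "0 < q" "gcd q (gcd a b) = 1"
    "X \<le> of_int a / of_int q" "of_int a / of_int q \<le> X + 1"
    "\<bar>of_int q * f (of_int a / of_int q) - of_int b\<bar> \<le> V"
proof -
  have q: "2 ^ n \<le> q" "q < 2 * 2 ^ n" using assms by (auto simp: near_prim_def)
  have "real_of_int (2 ^ n) \<le> real_of_int q" using q(1) by (simp only: of_int_le_iff)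
  then show "2 ^ n \<le> real_of_int q" by simp
  have "real_of_int q < real_of_int (2 * 2 ^ n)" using q(2) by (simp only: of_int_less_iff)
  then show "real_of_int q < 2 * 2 ^ n" by simp
  have "(0::int) < 2 ^ n" by simp
  then show "0 < q" using q(1) by linarith
qed (use assms in \<open>auto simp: near_prim_def\<close>)

lemma gcd3_mult_left:
  fixes G a b c :: int
  shows "gcd (G * a) (gcd (G * b) (G * c)) = \<bar>G\<bar> * gcd a (gcd b c)"
proof -
  have "gcd (G * b) (G * c) = \<bar>G\<bar> * gcd b c" by (simp only: gcd_mult_distrib_int)
  moreover have "gcd (G * a) (\<bar>G\<bar> * gcd b c) = gcd (G * a) (G * gcd b c)"
    by (cases "0 \<le> G") simp_all
  ultimately show ?thesis by (simp only: gcd_mult_distrib_int)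
qed

text \<open>The cross product of two vectors on the line is an integer multiple of the primitive
  normal vector \<open>(m, k, - j)\<close>, so \<open>E = q * a' - q' * a\<close> is a multiple of
  \<open>j\<close>, and nonzero because the vectors are not parallel. Division by
  \<open>q * q'\<close>, which is below \<open>4 * 4 ^ n\<close>, gives the gap.\<close>

lemma line_pts_separated:
  assumes z: "(q, a, b) \<in> line_pts f X n V j k m" and z': "(q', a', b') \<in> line_pts f X n V j k m"
    and ne: "(q, a, b) \<noteq> (q', a', b')" and j: "0 < j" and co: "gcd j (gcd k m) = 1"
  shows "of_int j / (4 * 4 ^ n) \<le> \<bar>xcoord (q, a, b) - xcoord (q', a', b')\<bar>"
proof -
  have l: "j * b = k * a + m * q" "j * b' = k * a' + m * q'"
    and P: "(q, a, b) \<in> near_prim f X n V" "(q', a', b') \<in> near_prim f X n V"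
    using z z' by (auto simp: line_pts_def)
  note D = near_primD[OF P(1)] and D' = near_primD[OF P(2)]
  define E where "E = q * a' - q' * a"
  have kE: "k * E = j * (q * b' - q' * b)"
  proof -
    have "j * (q * b' - q' * b) = q * (j * b') - q' * (j * b)" by (simp add: algebra_simps)
    then show ?thesis unfolding E_def l by (simp add: algebra_simps)
  qed
  have mE: "m * E = j * (a' * b - a * b')"
  proof -
    have "j * (a' * b - a * b') = a' * (j * b) - a * (j * b')" by (simp add: algebra_simps)
    then show ?thesis unfolding E_def l by (simp add: algebra_simps)
  qed
  have "j dvd gcd (E * j) (gcd (E * k) (E * m))"
    using kE mE by (metis dvd_triv_left dvd_triv_right gcd_greatest mult.commute)
  also have "gcd (E * j) (gcd (E * k) (E * m)) = \<bar>E\<bar>"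
    using co by (simp add: gcd3_mult_left)
  finally have jE: "j dvd E" by simp
  have "E \<noteq> 0"
  proof
    assume "E = 0"
    then have 1: "q * a' = q' * a" by (simp add: E_def)
    moreover have "q * b' = q' * b" using kE \<open>E = 0\<close> j by simp
    ultimately show False
      using primitive_parallel_eq[OF D(4) D'(4) D(3) D'(3)] ne by auto
  qed
  then have "j \<le> \<bar>E\<bar>" using jE j by (simp add: zdvd_imp_le)
  then have jE': "real_of_int j \<le> \<bar>real_of_int E\<bar>" by linarith
  have "xcoord (q, a, b) - xcoord (q', a', b') = - real_of_int E / (real_of_int q * real_of_int q')"
    unfolding xcoord_def E_def using D(3) D'(3) by (simp add: field_simps)
  then have eq: "\<bar>xcoord (q, a, b) - xcoord (q', a', b')\<bar> = \<bar>real_of_int E\<bar> / (real_of_int q * real_of_int q')"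
    using D(3) D'(3) by (simp add: abs_divide abs_mult)
  have "real_of_int q * real_of_int q' \<le> (2 * 2 ^ n) * (2 * 2 ^ n)"
    using D(2,3) D'(2,3) by (intro mult_mono) auto
  also have "\<dots> = (4::real) * 4 ^ n" by (simp add: power_mult_distrib[symmetric])
  finally show ?thesis unfolding eq
    using D(3) D'(3) jE' j by (intro frac_le) auto
qed

context
  fixes \<kappa> :: real and f p h g :: "real \<Rightarrow> real"
  assumes dp: "dual_pair \<kappa> f p h g"
begin


text \<open>At \<open>y\<close> the curve has the slope of the line, and its tangent there has
  intercept \<open>- h (k / j)\<close>. So \<open>h (k / j) + m / j\<close> is the height of the
  line over this tangent and the gap is the height of the curve over it; they differ by
  \<open>f x - b / q\<close>.\<close>

lemma line_pts_gap:
  assumes z: "z \<in> line_pts f X n V j k m" and j: "0 < j"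
  defines "y \<equiv> g (of_int k / of_int j)"
  shows "\<bar>(f (xcoord z) - f y - p y * (xcoord z - y)) - (h (of_int k / of_int j) + of_int m / of_int j)\<bar> \<le> V / 2 ^ n"
proof -
  obtain q a b where zz: "z = (q, a, b)" by (cases z)
  have l: "j * b = k * a + m * q" and P: "(q, a, b) \<in> near_prim f X n V"
    using z zz by (auto simp: line_pts_def)
  note D = near_primD[OF P]
  define x where "x = real_of_int a / real_of_int q"
  have py: "p y = of_int k / of_int j" unfolding y_def by (rule dual_inv(2)[OF dp])
  have hy: "f y + h (of_int k / of_int j) = y * (of_int k / of_int j)"
    using dual_legendre[OF dp, of y] py by simp
  have "real_of_int j * real_of_int b = real_of_int k * real_of_int a + real_of_int m * real_of_int q"
    using l by (metis of_int_add of_int_mult)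
  then have b: "of_int b / of_int q = of_int k / of_int j * x + of_int m / of_int j"
    using D(3) j unfolding x_def by (simp add: field_simps)
  have "(f x - f y - p y * (x - y)) - (h (of_int k / of_int j) + of_int m / of_int j) = f x - of_int b / of_int q"
  proof -
    define s where "s = real_of_int k / real_of_int j"
    have "h s = y * s - f y" using hy by (simp add: s_def)
    then show ?thesis unfolding b py s_def[symmetric] by (simp add: algebra_simps)
  qed
  also have "\<bar>\<dots>\<bar> = \<bar>of_int q * f x - of_int b\<bar> / of_int q"
    using D(3) by (simp add: field_simps abs_divide abs_mult)
  also have "\<dots> \<le> V / 2 ^ n"
    using D(1,3,7) unfolding x_def by (intro frac_le) auto
  finally show ?thesis unfolding zz xcoord_def x_def by simp
qed

text \<open>By \<open>line_pts_gap\<close> the tangent gaps at the two points differ by at most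
  \<open>2 * V / 2 ^ n\<close>, while \<open>tangent_gap_growth\<close> bounds that difference from
  below.\<close>

lemma line_pts_same_side:
  assumes z: "z \<in> line_pts f X n V j k m" "z' \<in> line_pts f X n V j k m" and j: "0 < j"
  defines "y \<equiv> g (of_int k / of_int j)"
  assumes side: "0 \<le> (xcoord z' - xcoord z) * (xcoord z - y)"
  shows "(xcoord z' - xcoord z) * (xcoord z' - y) \<le> 2 * \<kappa> * V / 2 ^ n"
proof -
  have "(xcoord z' - xcoord z) * (xcoord z' - y) / \<kappa> \<le> 2 * (V / 2 ^ n)"
    using tangent_gap_growth[OF dp side] line_pts_gap[OF z(1) j] line_pts_gap[OF z(2) j]
    unfolding y_def by linarith
  then show ?thesis using dual_kappa[OF dp] by (simp add: field_simps)
qed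

text \<open>The previous lemma applies with \<open>z'\<close> as the point farther from
  \<open>y\<close>. Its distance to \<open>y\<close> is at least the distance of the two points, so
  the product bound also bounds the square.\<close>

lemma line_pts_same_side_dist:
  assumes z: "z \<in> line_pts f X n V j k m" "z' \<in> line_pts f X n V j k m" and j: "0 < j"
  defines "y \<equiv> g (of_int k / of_int j)"
  assumes side: "(y \<le> xcoord z) = (y \<le> xcoord z')"
  shows "(xcoord z' - xcoord z)\<^sup>2 \<le> 2 * \<kappa> * V / 2 ^ n"
    and "\<exists>x\<in>{xcoord z, xcoord z'}. \<bar>xcoord z' - xcoord z\<bar> * \<bar>x - y\<bar> \<le> 2 * \<kappa> * V / 2 ^ n"
proof -
  have wl: "(v - u)\<^sup>2 \<le> 2 * \<kappa> * V / 2 ^ n \<and> \<bar>v - u\<bar> * \<bar>v - y\<bar> \<le> 2 * \<kappa> * V / 2 ^ n"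
    if w: "w \<in> line_pts f X n V j k m" "w' \<in> line_pts f X n V j k m"
      and u: "u = xcoord w" "v = xcoord w'" and sd: "0 \<le> (v - u) * (u - y)" for w w' u v
  proof -
    have 1: "(v - u) * (v - y) \<le> 2 * \<kappa> * V / 2 ^ n"
      using line_pts_same_side[OF w j] sd unfolding u y_def by simp
    have 2: "(v - u) * (v - y) = (v - u)\<^sup>2 + (v - u) * (u - y)"
      by (simp add: power2_eq_square algebra_simps)
    then have "0 \<le> (v - u) * (v - y)" using sd by simp
    then have "\<bar>v - u\<bar> * \<bar>v - y\<bar> = (v - u) * (v - y)" by (metis abs_mult abs_of_nonneg)
    then show ?thesis using 1 2 sd by linarith
  qed
  have "0 \<le> (xcoord z' - xcoord z) * (xcoord z - y) \<or> 0 \<le> (xcoord z - xcoord z') * (xcoord z' - y)"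
    using side by (auto simp: zero_le_mult_iff)
  then show "(xcoord z' - xcoord z)\<^sup>2 \<le> 2 * \<kappa> * V / 2 ^ n"
    and "\<exists>x\<in>{xcoord z, xcoord z'}. \<bar>xcoord z' - xcoord z\<bar> * \<bar>x - y\<bar> \<le> 2 * \<kappa> * V / 2 ^ n"
    using wl[OF z refl refl] wl[OF z(2,1) refl refl]
    by (auto simp: power2_commute abs_minus_commute)
qed

text \<open>Column operations: the determinant does not change when \<open>a\<close> and
  \<open>b\<close> are replaced by the offsets from \<open>x0\<close> and from the tangent at
  \<open>x0\<close>. Its columns are then bounded by \<open>2 * T\<close>, \<open>2 * T * l\<close>
  and \<open>V + 2 * \<kappa> * T * l\<^sup>2\<close>, and its six products add up to less than
  1.\<close>

lemma near_prim_det_zero: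
  assumes z: "(q1, a1, b1) \<in> near_prim f X n V" "(q2, a2, b2) \<in> near_prim f X n V"
      "(q3, a3, b3) \<in> near_prim f X n V"
    and x: "\<bar>xcoord (q1, a1, b1) - x0\<bar> \<le> l" "\<bar>xcoord (q2, a2, b2) - x0\<bar> \<le> l"
      "\<bar>xcoord (q3, a3, b3) - x0\<bar> \<le> l"
    and small: "24 * 4 ^ n * l * (V + 2 * \<kappa> * 2 ^ n * l\<^sup>2) < 1"
  shows "(q1 * a2 - a1 * q2) * b3 = (q1 * b2 - b1 * q2) * a3 + (b1 * a2 - a1 * b2) * q3"
proof -
  define T :: real where "T = 2 ^ n"
  have T: "0 < T" by (simp add: T_def)
  define al where "al a q = real_of_int a - x0 * real_of_int q" for a q
  define be where "be a q b = real_of_int b - f x0 * real_of_int q - p x0 * al a q" for a q b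
  have l0: "0 \<le> l" using x(1) by linarith
  have B: "\<bar>real_of_int q\<bar> \<le> 2 * T \<and> \<bar>al a q\<bar> \<le> 2 * T * l \<and> \<bar>be a q b\<bar> \<le> V + 2 * \<kappa> * T * l\<^sup>2"
    if P: "(q, a, b) \<in> near_prim f X n V" and xx: "\<bar>xcoord (q, a, b) - x0\<bar> \<le> l" for q a b
  proof -
    note D = near_primD[OF P]
    define x where "x = real_of_int a / real_of_int q"
    have xl: "\<bar>x - x0\<bar> \<le> l" using xx by (simp add: xcoord_def x_def)
    have q0: "0 < real_of_int q" using D(3) by simp
    have al: "al a q = real_of_int q * (x - x0)" unfolding al_def x_def using q0 by (simp add: field_simps)
    have q2: "real_of_int q \<le> 2 * T" using D(2) T_def by simp
    have "\<bar>al a q\<bar> \<le> 2 * T * l" unfolding al abs_mult using xl q2 q0 l0 by (intro mult_mono) auto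
    moreover have "be a q b = (of_int b - of_int q * f x) + of_int q * (f x - f x0 - p x0 * (x - x0))"
      unfolding be_def al by (simp add: algebra_simps)
    moreover have "\<bar>of_int b - of_int q * f x\<bar> \<le> V" using D(7) by (simp add: x_def abs_minus_commute)
    moreover have "\<bar>of_int q * (f x - f x0 - p x0 * (x - x0))\<bar> \<le> 2 * \<kappa> * T * l\<^sup>2"
    proof -
      have "0 \<le> (x - x0)\<^sup>2 / \<kappa>" using dual_kappa[OF dp] by simp
      then have "0 \<le> f x - f x0 - p x0 * (x - x0)" using dual_lower[OF dp, of x x0] by linarith
      moreover have "f x - f x0 - p x0 * (x - x0) \<le> \<kappa> * l\<^sup>2"
      proof -
        have "(x - x0)\<^sup>2 \<le> l\<^sup>2" using xl by (metis abs_le_square_iff abs_of_nonneg l0)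
        then have "\<kappa> * (x - x0)\<^sup>2 \<le> \<kappa> * l\<^sup>2" using dual_kappa[OF dp] by (intro mult_left_mono) auto
        then show ?thesis using dual_upper[OF dp, of x x0] by linarith
      qed
      ultimately have "\<bar>of_int q * (f x - f x0 - p x0 * (x - x0))\<bar> \<le> 2 * T * (\<kappa> * l\<^sup>2)"
        unfolding abs_mult using q2 q0 by (intro mult_mono) auto
      then show ?thesis by (simp add: mult_ac)
    qed
    ultimately show ?thesis using q2 q0 by linarith
  qed
  define U where "U = V + 2 * \<kappa> * T * l\<^sup>2"
  note B1 = B[OF z(1) x(1), folded U_def] and B2 = B[OF z(2) x(2), folded U_def] and B3 = B[OF z(3) x(3), folded U_def]
  have U0: "0 \<le> U" using B1 by linarith
  have tri: "u * v * w \<le> 2 * T * (2 * T * l) * U \<and> - (u * v * w) \<le> 2 * T * (2 * T * l) * U"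
    if "\<bar>u\<bar> \<le> 2 * T" "\<bar>v\<bar> \<le> 2 * T * l" "\<bar>w\<bar> \<le> U" for u v w
  proof -
    have "\<bar>u * v * w\<bar> \<le> 2 * T * (2 * T * l) * U"
      unfolding abs_mult using that T l0 U0 by (intro mult_mono) auto
    then show ?thesis by (simp only: abs_le_iff)
  qed
  define De where "De = (q1 * a2 - a1 * q2) * b3 - (q1 * b2 - b1 * q2) * a3 - (b1 * a2 - a1 * b2) * q3"
  have "real_of_int De = real_of_int q1 * al a2 q2 * be a3 q3 b3 - real_of_int q2 * al a1 q1 * be a3 q3 b3
     - real_of_int q1 * al a3 q3 * be a2 q2 b2 + real_of_int q2 * al a3 q3 * be a1 q1 b1
     - real_of_int q3 * al a2 q2 * be a1 q1 b1 + real_of_int q3 * al a1 q1 * be a2 q2 b2"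
    unfolding De_def be_def al_def by (simp add: algebra_simps)
  also have "\<bar>\<dots>\<bar> \<le> 6 * (2 * T * (2 * T * l) * U)"
    unfolding abs_le_iff
    using tri[OF conjunct1[OF B1] conjunct1[OF conjunct2[OF B2]] conjunct2[OF conjunct2[OF B3]]]
      tri[OF conjunct1[OF B2] conjunct1[OF conjunct2[OF B1]] conjunct2[OF conjunct2[OF B3]]]
      tri[OF conjunct1[OF B1] conjunct1[OF conjunct2[OF B3]] conjunct2[OF conjunct2[OF B2]]]
      tri[OF conjunct1[OF B2] conjunct1[OF conjunct2[OF B3]] conjunct2[OF conjunct2[OF B1]]]
      tri[OF conjunct1[OF B3] conjunct1[OF conjunct2[OF B2]] conjunct2[OF conjunct2[OF B1]]]
      tri[OF conjunct1[OF B3] conjunct1[OF conjunct2[OF B1]] conjunct2[OF conjunct2[OF B2]]]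
    by linarith
  also have "\<dots> = 24 * T\<^sup>2 * l * U" by (simp add: power2_eq_square)
  also have "T\<^sup>2 = 4 ^ n" unfolding T_def by (simp add: power2_eq_square power_mult_distrib[symmetric])
  finally have "\<bar>real_of_int De\<bar> < 1" using small unfolding U_def T_def by simp
  then have "De = 0" by linarith
  then show ?thesis unfolding De_def by simp
qed

end

lemma int_line_exists:
  fixes J K M :: int
  assumes "J \<noteq> 0"
  obtains j k m where "0 < j" "gcd j (gcd k m) = 1"
    "\<And>q a b :: int. J * b = K * a + M * q \<Longrightarrow> j * b = k * a + m * q"
proof -
  \<comment> \<open>The sign goes into \<open>G\<close> so that \<open>j\<close> comes out
    positive.\<close>
  define G where "G = sgn J * gcd J (gcd K M)"
  have g0: "gcd J (gcd K M) > 0" using assms by simp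
  have G0: "G \<noteq> 0" unfolding G_def using assms g0 by (simp add: sgn_if)
  have "G dvd J" "G dvd K" "G dvd M"
    unfolding G_def using assms by (auto simp: sgn_if intro: dvd_trans[OF gcd_dvd2])
  then obtain j k m where J: "J = G * j" and K: "K = G * k" and M: "M = G * m" by (auto elim!: dvdE)
  have "0 < j"
  proof -
    show ?thesis
    proof (cases "0 < J")
      case True
      then have "0 < G" using g0 unfolding G_def by simp
      then show ?thesis using True J by (simp add: zero_less_mult_iff)
    next
      case False
      then have "J < 0" using assms by simp
      then have "G < 0" using g0 unfolding G_def by (simp add: sgn_if)
      then show ?thesis using \<open>J < 0\<close> J by (simp add: mult_less_0_iff)
    qed
  qed
  note j0 = this
  have co: "gcd j (gcd k m) = 1"
  proof -
    have "\<bar>G\<bar> = gcd J (gcd K M)" unfolding G_def using assms by (simp add: abs_mult sgn_if)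
    moreover have "gcd J (gcd K M) = \<bar>G\<bar> * gcd j (gcd k m)"
      unfolding J K M by (rule gcd3_mult_left)
    ultimately show ?thesis using G0 by simp
  qed
  have "j * b = k * a + m * q" if "J * b = K * a + M * q" for q a b
  proof -
    have "G * (j * b) = G * (k * a + m * q)" using that unfolding J K M by (simp add: algebra_simps)
    then show ?thesis using G0 by simp
  qed
  then show ?thesis by (rule that[OF j0 co])
qed

text \<open>The determinants of one fixed pair with all other points give a single line. That it is
  not vertical is where \<open>4 * 2 ^ n * V < 1\<close> is used.\<close>

lemma near_prim_common_line:
  assumes z: "z1 \<in> near_prim f X n V" "z2 \<in> near_prim f X n V" "z1 \<noteq> z2" "Z \<subseteq> near_prim f X n V"
    and V: "4 * 2 ^ n * V < 1"
    and det: "\<And>q a b. (q, a, b) \<in> Z \<Longrightarrow> (case z1 of (q1, a1, b1) \<Rightarrow> case z2 of (q2, a2, b2) \<Rightarrow>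
      (q1 * a2 - a1 * q2) * b = (q1 * b2 - b1 * q2) * a + (b1 * a2 - a1 * b2) * q)"
  obtains j k m where "0 < j" "gcd j (gcd k m) = 1" "Z \<subseteq> line_pts f X n V j k m"
proof -
  obtain q1 a1 b1 q2 a2 b2 where zz: "z1 = (q1, a1, b1)" "z2 = (q2, a2, b2)" by (cases z1, cases z2)
  note D1 = near_primD[OF z(1)[unfolded zz]] and D2 = near_primD[OF z(2)[unfolded zz]]
  have "q1 * a2 - a1 * q2 \<noteq> 0"
  proof
    \<comment> \<open>Two points with the same abscissa are both near \<open>f x\<close>, which
      makes the integer \<open>q1 * b2 - b1 * q2\<close> smaller than 1; the vectors are then
      parallel and, being primitive, equal.\<close>
    assume J: "q1 * a2 - a1 * q2 = 0"
    define x where "x = real_of_int a1 / real_of_int q1"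
    have "real_of_int q1 * real_of_int a2 = real_of_int a1 * real_of_int q2"
      using J by (metis eq_iff_diff_eq_0 of_int_mult)
    then have x2: "x = real_of_int a2 / real_of_int q2"
      unfolding x_def using D1(3) D2(3) by (simp add: field_simps)
    define e1 where "e1 = of_int q1 * f x - of_int b1"
    define e2 where "e2 = of_int q2 * f x - of_int b2"
    have e: "\<bar>e1\<bar> \<le> V" "\<bar>e2\<bar> \<le> V" using D1(7) D2(7) by (simp_all add: e1_def e2_def x_def[symmetric] x2[symmetric])
    have q: "0 < real_of_int q1" "0 < real_of_int q2" using D1(3) D2(3) by auto
    have "real_of_int (q1 * b2 - b1 * q2) = of_int q2 * e1 - of_int q1 * e2"
      by (simp add: e1_def e2_def algebra_simps)
    moreover have "\<bar>of_int q2 * e1\<bar> \<le> (2 * 2 ^ n) * V" "\<bar>of_int q1 * e2\<bar> \<le> (2 * 2 ^ n) * V"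
      unfolding abs_mult using D1(2) D2(2) q e by (auto intro!: mult_mono)
    ultimately have "\<bar>real_of_int (q1 * b2 - b1 * q2)\<bar> < 1" using V by linarith
    then have "q1 * b2 - b1 * q2 = 0" by linarith
    then have "z1 = z2" unfolding zz
      using primitive_parallel_eq[OF D1(4) D2(4) D1(3) D2(3)] J by (simp add: mult.commute)
    then show False using z(3) by simp
  qed
  then obtain j k m where jkm: "0 < j" "gcd j (gcd k m) = 1"
    and L: "\<And>q a b :: int. (q1 * a2 - a1 * q2) * b = (q1 * b2 - b1 * q2) * a + (b1 * a2 - a1 * b2) * q \<Longrightarrow> j * b = k * a + m * q"
    using int_line_exists[of "q1 * a2 - a1 * q2" "q1 * b2 - b1 * q2" "b1 * a2 - a1 * b2"] by metis
  have "Z \<subseteq> line_pts f X n V j k m"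
    unfolding line_pts_def using L det z(4) zz by auto
  then show thesis by (rule that[OF jkm])
qed

lemma real_card_UN_le:
  assumes "finite I"
  shows "real (card (\<Union>i\<in>I. A i)) \<le> (\<Sum>i\<in>I. real (card (A i)))"
proof -
  have "real (card (\<Union>i\<in>I. A i)) \<le> real (\<Sum>i\<in>I. card (A i))"
    unfolding of_nat_le_iff by (rule card_UN_le[OF assms])
  then show ?thesis by simp
qed

lemma three_elements:
  assumes "3 \<le> card Z"
  obtains z1 z2 z3 where "z1 \<in> Z" "z2 \<in> Z" "z3 \<in> Z" "z1 \<noteq> z2" "z1 \<noteq> z3" "z2 \<noteq> z3"
proof -
  obtain W where "W \<subseteq> Z" "card W = 3" using obtain_subset_with_card_n[OF assms] by metis
  then show thesis using that unfolding card_3_iff by blast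
qed

section \<open>The recursion on the denominator\<close>

context
  fixes \<kappa> c V X :: real and f p h g :: "real \<Rightarrow> real" and n :: nat
  assumes dp: "dual_pair \<kappa> f p h g"
    and c: "0 < c" "80 * \<kappa> ^ 3 * c \<le> 1" and V: "0 < V" "V \<le> c / 2 ^ n"
begin

private definition "ar z = nat \<lfloor>(xcoord z - X) / (c / 2 ^ n)\<rfloor>"
private definition "cell i = {z \<in> near_prim f X n V. ar z = i}"
private definition "lines = {(j, k, m). 0 < j \<and> gcd j (gcd k m) = 1 \<and>
   (\<exists>i. 3 \<le> card (cell i) \<and> cell i \<subseteq> line_pts f X n V j k m)}"

private lemma k1: "1 \<le> \<kappa>" by (rule dual_kappa[OF dp])

private lemma c1: "c \<le> 1 / 80" "\<kappa> * c \<le> 1 / 80"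
proof -
  have "\<kappa> \<le> \<kappa> ^ 3" using k1 by (metis power_increasing[of 1 3 \<kappa>] numeral_le_one_iff one_le_numeral power_one_right)
  then have "\<kappa> * c \<le> \<kappa> ^ 3 * c" using c by (intro mult_right_mono) auto
  then show 2: "\<kappa> * c \<le> 1 / 80" using c by linarith
  have "c \<le> \<kappa> * c" using k1 c by simp
  then show "c \<le> 1 / 80" using 2 by linarith
qed

private lemma VT: "V * 2 ^ n \<le> c" using V(2) by (simp add: field_simps)

private lemma cell_bounds:
  assumes "z \<in> cell i"
  shows "real i * (c / 2 ^ n) \<le> xcoord z - X" "xcoord z - X \<le> real i * (c / 2 ^ n) + c / 2 ^ n"
proof -
  obtain q a b where zz: "z = (q, a, b)" by (cases z)
  have z: "(q, a, b) \<in> near_prim f X n V" "ar z = i" using assms by (auto simp: cell_def zz)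
  define l where "l = c / 2 ^ n"
  have l: "0 < l" using c by (simp add: l_def)
  have "X \<le> xcoord z" using near_primD(5)[OF z(1)] by (simp add: xcoord_def zz)
  then have "0 \<le> (xcoord z - X) / l" using l by simp
  then have "real i \<le> (xcoord z - X) / l" "(xcoord z - X) / l \<le> real i + 1"
    using z(2) unfolding ar_def l_def[symmetric] by linarith+
  then show "real i * (c / 2 ^ n) \<le> xcoord z - X" "xcoord z - X \<le> real i * (c / 2 ^ n) + c / 2 ^ n"
    unfolding l_def[symmetric] using l by (auto simp: field_simps)
qed

private lemma cell_diam:
  assumes "z \<in> cell i"
  shows "\<bar>xcoord z - (X + real i * (c / 2 ^ n))\<bar> \<le> c / 2 ^ n"
  using cell_bounds[OF assms] by linarith

private lemma cell_on_line:
  assumes "3 \<le> card (cell i)"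
  obtains j k m where "(j, k, m) \<in> lines" "cell i \<subseteq> line_pts f X n V j k m"
proof -
  obtain z1 z2 z3 where z: "z1 \<in> cell i" "z2 \<in> cell i" "z1 \<noteq> z2"
    using three_elements[OF assms] by metis
  have sub: "cell i \<subseteq> near_prim f X n V" by (auto simp: cell_def)
  define l where "l = c / 2 ^ n"
  have small: "24 * 4 ^ n * l * (V + 2 * \<kappa> * 2 ^ n * l\<^sup>2) < 1"
  proof -
    have "24 * 4 ^ n * l * (V + 2 * \<kappa> * 2 ^ n * l\<^sup>2) = 24 * c * (V * 2 ^ n + 2 * (\<kappa> * c) * c)"
    proof -
      have "(4::real) ^ n = 2 ^ n * 2 ^ n" by (simp add: power_mult_distrib[symmetric])
      then show ?thesis unfolding l_def by (simp add: field_simps power2_eq_square)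
    qed
    also have "\<dots> \<le> 24 * c * (c + 2 * (1 / 80) * c)"
      using c1 c VT by (intro mult_left_mono add_mono mult_right_mono) auto
    also have "\<dots> \<le> 24 * (1 / 80) * (1/80 + 2 * (1 / 80) * (1/80))"
      using c1 c by (intro mult_mono add_mono) auto
    finally show ?thesis by (simp add: field_simps)
  qed
  have V4: "4 * 2 ^ n * V < 1" using VT c1 by (simp add: mult.commute) 
  have zp: "z1 \<in> near_prim f X n V" "z2 \<in> near_prim f X n V" using z sub by auto
  have det: "case z1 of (q1, a1, b1) \<Rightarrow> case z2 of (q2, a2, b2) \<Rightarrow>
      (q1 * a2 - a1 * q2) * b = (q1 * b2 - b1 * q2) * a + (b1 * a2 - a1 * b2) * q"
    if q: "(q, a, b) \<in> cell i" for q a b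
  proof -
    obtain q1 a1 b1 q2 a2 b2 where zz: "z1 = (q1, a1, b1)" "z2 = (q2, a2, b2)" by (cases z1, cases z2)
    have qp: "(q, a, b) \<in> near_prim f X n V" using q sub by auto
    show ?thesis
      unfolding zz prod.case
      using near_prim_det_zero[OF dp zp[unfolded zz] qp cell_diam[OF z(1)[unfolded zz], folded l_def]
        cell_diam[OF z(2)[unfolded zz], folded l_def] cell_diam[OF q, folded l_def] small] .
  qed
  obtain j k m where "0 < j" "gcd j (gcd k m) = 1" "cell i \<subseteq> line_pts f X n V j k m"
    by (rule near_prim_common_line[OF zp z(3) sub V4 det])
  then show thesis using assms by (intro that[of j k m]) (auto simp: lines_def)
qed

text \<open>Of three points over one arc, two lie on the same side of the point of tangency
  \<open>y\<close>. Their distance is at least \<open>j / (4 * 4 ^ n)\<close> and at most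
  \<open>c / 2 ^ n\<close>, which bounds \<open>j\<close>. That distance times the distance from
  \<open>y\<close> of one of them is at most \<open>2 * \<kappa> * V / 2 ^ n\<close>, so this point
  is within \<open>8 * \<kappa> * c / j\<close> of \<open>y\<close>; there the tangent gap is of
  order \<open>1 / j\<^sup>2\<close>, and so is the height of the line over the tangent.\<close>

private lemma line_props:
  assumes L: "(j, k, m) \<in> lines"
  shows "real_of_int j \<le> 4 * c * 2 ^ n"
    and "\<bar>of_int j * h (of_int k / of_int j) + of_int m\<bar> \<le> c / of_int j"
    and "X - 1 \<le> g (of_int k / of_int j)" "g (of_int k / of_int j) \<le> X + 2"
    and "real (card (line_pts f X n V j k m)) \<le> 16 * 4 ^ n * sqrt (2 * \<kappa> * V / 2 ^ n) / of_int j"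
proof -
  from L obtain i where j: "0 < j" and co: "gcd j (gcd k m) = 1" and i: "3 \<le> card (cell i)"
    and sub: "cell i \<subseteq> line_pts f X n V j k m" by (auto simp: lines_def)
  obtain z1 z2 z3 where z: "z1 \<in> cell i" "z2 \<in> cell i" "z3 \<in> cell i" "z1 \<noteq> z2" "z1 \<noteq> z3" "z2 \<noteq> z3"
    using three_elements[OF i] by metis
  define y where "y = g (of_int k / of_int j)"
  define Hh where "Hh = h (of_int k / of_int j) + real_of_int m / of_int j"
  define lam where "lam = sqrt (2 * \<kappa> * V / 2 ^ n)"
  have j': "0 < real_of_int j" "1 \<le> real_of_int j" using j by auto
  obtain w w' where w: "w \<in> cell i" "w' \<in> cell i" "w \<noteq> w'" "(y \<le> xcoord w) = (y \<le> xcoord w')"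
    using z by metis
  then have wl: "w \<in> line_pts f X n V j k m" "w' \<in> line_pts f X n V j k m" using sub by auto
  have sep: "of_int j / (4 * 4 ^ n) \<le> \<bar>xcoord u - xcoord v\<bar>"
    if "u \<in> line_pts f X n V j k m" "v \<in> line_pts f X n V j k m" "u \<noteq> v" for u v
    using line_pts_separated[OF _ _ _ j co] that by (cases u, cases v) auto
  have s1: "of_int j / (4 * 4 ^ n) \<le> \<bar>xcoord w' - xcoord w\<bar>" using sep[OF wl(2,1)] w(3) by auto
  have "\<bar>xcoord w' - xcoord w\<bar> \<le> c / 2 ^ n"
  proof -
    show ?thesis using cell_bounds[OF w(1)] cell_bounds[OF w(2)] by linarith
  qed
  with s1 have "of_int j / (4 * 4 ^ n) \<le> c / 2 ^ n" by linarith
  moreover have four: "(4::real) ^ n = 2 ^ n * 2 ^ n" by (simp add: power_mult_distrib[symmetric])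
  ultimately show jc: "real_of_int j \<le> 4 * c * 2 ^ n" by (simp add: field_simps)
  obtain x where x: "x \<in> {xcoord w, xcoord w'}" "\<bar>xcoord w' - xcoord w\<bar> * \<bar>x - y\<bar> \<le> 2 * \<kappa> * V / 2 ^ n"
    using line_pts_same_side_dist(2)[OF dp wl j] w(4) unfolding y_def by blast
  have xy: "\<bar>x - y\<bar> \<le> 8 * \<kappa> * c / of_int j"
  proof -
    have "of_int j / (4 * 4 ^ n) * \<bar>x - y\<bar> \<le> \<bar>xcoord w' - xcoord w\<bar> * \<bar>x - y\<bar>"
      using s1 by (intro mult_right_mono) auto
    also have "\<dots> \<le> 2 * \<kappa> * V / 2 ^ n" by (rule x(2))
    finally have "of_int j * \<bar>x - y\<bar> \<le> 8 * \<kappa> * (V * 2 ^ n)"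
      unfolding four by (simp add: field_simps)
    also have "\<dots> \<le> 8 * \<kappa> * c" using VT k1 by (intro mult_left_mono) auto
    finally show ?thesis using j' by (simp add: field_simps)
  qed
  have "8 * \<kappa> * c / of_int j \<le> 1"
  proof -
    have "8 * \<kappa> * c \<le> 1" using c1 by linarith
    then show ?thesis using j' by (simp add: field_simps)
  qed
  with xy have xy1: "\<bar>x - y\<bar> \<le> 1" by linarith
  obtain u where u: "u \<in> line_pts f X n V j k m" "x = xcoord u" using x(1) wl by blast
  have "X \<le> x \<and> x \<le> X + 1"
    using u unfolding line_pts_def xcoord_def by (auto dest: near_primD)
  then show "X - 1 \<le> g (of_int k / of_int j)" "g (of_int k / of_int j) \<le> X + 2"
    using xy1 unfolding y_def[symmetric] by auto
  define E where "E = f x - f y - p y * (x - y)"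
  have EH: "\<bar>E - Hh\<bar> \<le> V / 2 ^ n"
    using line_pts_gap[OF dp u(1) j] unfolding u(2) E_def Hh_def y_def by simp
  have E0: "0 \<le> E" 
  proof -
    have "0 \<le> (x - y)\<^sup>2 / \<kappa>" using k1 by simp
    then show ?thesis using dual_lower[OF dp, of x y] unfolding E_def by linarith
  qed
  have E1: "E \<le> \<kappa> * (8 * \<kappa> * c / of_int j)\<^sup>2"
  proof -
    have "(x - y)\<^sup>2 \<le> (8 * \<kappa> * c / of_int j)\<^sup>2" using xy by (metis abs_ge_zero power2_abs power_mono)
    then have "\<kappa> * (x - y)\<^sup>2 \<le> \<kappa> * (8 * \<kappa> * c / of_int j)\<^sup>2" using k1 by (intro mult_left_mono) auto
    then show ?thesis using dual_upper[OF dp, of x y] unfolding E_def by linarith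
  qed
  \<comment> \<open>The bound on \<open>j\<close> is read backwards:
    \<open>1 / 2 ^ n \<le> 4 * c / j\<close> makes the vertical error of order
    \<open>1 / j\<^sup>2\<close> too.\<close>
  have VT2: "V / 2 ^ n \<le> 16 * c ^ 3 / (of_int j)\<^sup>2"
  proof -
    have "V / 2 ^ n \<le> c / (2 ^ n)\<^sup>2" using V by (simp add: field_simps power2_eq_square)
    moreover have "(real_of_int j)\<^sup>2 \<le> (4 * c * 2 ^ n)\<^sup>2" using jc j' by (intro power_mono) auto
    then have "c / (2 ^ n)\<^sup>2 \<le> 16 * c ^ 3 / (of_int j)\<^sup>2"
      using c j' by (simp add: field_simps power2_eq_square power3_eq_cube)
    ultimately show ?thesis by linarith
  qed
  have "\<bar>Hh\<bar> \<le> \<kappa> * (8 * \<kappa> * c / of_int j)\<^sup>2 + 16 * c ^ 3 / (of_int j)\<^sup>2"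
    using EH E0 E1 VT2 by linarith
  also have "\<dots> = (64 * \<kappa> ^ 3 * c + 16 * c * c) * c / (of_int j)\<^sup>2"
    by (simp add: field_simps power2_eq_square power3_eq_cube add_divide_distrib)
  \<comment> \<open>This is the purpose of \<open>80 * \<kappa> ^ 3 * c \<le> 1\<close>: the tangent
    gap takes 64 of the 80, and the rest covers the vertical error.\<close>
  also have "\<dots> \<le> 1 * c / (of_int j)\<^sup>2"
  proof (intro divide_right_mono mult_right_mono)
    have "16 * c * c \<le> 16 * (1/80) * c" using c1 c by (intro mult_right_mono) auto
    moreover have "c \<le> \<kappa> ^ 3 * c" using k1 c by simp
    ultimately show "64 * \<kappa> ^ 3 * c + 16 * c * c \<le> 1" using c by linarith
  qed (use c in auto)
  finally have H: "\<bar>Hh\<bar> \<le> c / (of_int j)\<^sup>2" by simp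
  have "of_int j * h (of_int k / of_int j) + of_int m = of_int j * Hh"
    unfolding Hh_def using j' by (simp add: field_simps)
  then have "\<bar>of_int j * h (of_int k / of_int j) + of_int m\<bar> = of_int j * \<bar>Hh\<bar>"
    using j' by (simp add: abs_mult)
  also have "\<dots> \<le> of_int j * (c / (of_int j)\<^sup>2)" using H j' by (intro mult_left_mono) auto
  also have "\<dots> = c / of_int j" using j' by (simp add: power2_eq_square)
  finally show "\<bar>of_int j * h (of_int k / of_int j) + of_int m\<bar> \<le> c / of_int j" .
  have lam0: "0 \<le> lam" unfolding lam_def using k1 V by simp
  have lamd: "\<bar>xcoord u - xcoord v\<bar> \<le> lam"
    if "u \<in> line_pts f X n V j k m" "v \<in> line_pts f X n V j k m" "(y \<le> xcoord u) = (y \<le> xcoord v)" for u v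
  proof -
    have "(xcoord u - xcoord v)\<^sup>2 \<le> 2 * \<kappa> * V / 2 ^ n"
      using line_pts_same_side_dist(1)[OF dp that(2,1) j] that(3) unfolding y_def by auto
    then show ?thesis unfolding lam_def by (metis real_sqrt_abs real_sqrt_le_mono)
  qed
  define s where "s = real_of_int j / (4 * 4 ^ n)"
  have s: "0 < s" using j' by (simp add: s_def)
  have sl: "s \<le> lam" using s1 lamd[OF wl(2,1)] w(4) unfolding s_def by auto
  define A where "A = {z \<in> line_pts f X n V j k m. y \<le> xcoord z}"
  define B where "B = {z \<in> line_pts f X n V j k m. \<not> y \<le> xcoord z}"
  have fin: "finite (line_pts f X n V j k m)"
    by (rule finite_subset[OF _ finite_near_prim[of f X n V]]) (auto simp: line_pts_def)
  have "real (card A) \<le> 1 + lam / s"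
    by (rule card_spaced_le[where \<xi> = xcoord]) (use fin s lam0 sep lamd in \<open>auto simp: A_def s_def\<close>)
  moreover have "real (card B) \<le> 1 + lam / s"
    by (rule card_spaced_le[where \<xi> = xcoord]) (use fin s lam0 sep lamd in \<open>auto simp: B_def s_def\<close>)
  moreover have "line_pts f X n V j k m = A \<union> B" by (auto simp: A_def B_def)
  then have "card (line_pts f X n V j k m) \<le> card A + card B" by (metis card_Un_le)
  ultimately have "real (card (line_pts f X n V j k m)) \<le> 2 + 2 * (lam / s)" by linarith
  \<comment> \<open>Two points of the line lie on the same side, so \<open>lam\<close> is at least
    the spacing and the constant term is absorbed.\<close>
  also have "1 \<le> lam / s" using sl s by simp
  then have "2 + 2 * (lam / s) \<le> 4 * (lam / s)" by linarith
  also have "\<dots> = 16 * 4 ^ n * lam / of_int j" unfolding s_def by simp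
  finally show "real (card (line_pts f X n V j k m)) \<le> 16 * 4 ^ n * sqrt (2 * \<kappa> * V / 2 ^ n) / of_int j"
    unfolding lam_def .
qed

text \<open>Over an arc of length \<open>c / 2^n\<close> the determinant of any three points is an integer less than \<open>1\<close> in modulus, so the
  points lie on one line \<open>j b = k a + m q\<close>. A line that carries at least three of them is nearly tangent to the curve,
  which says that \<open>(j, k, - m)\<close> is a point near the dual curve, of denominator at most \<open>4 c 2^n\<close>. The arcs
  with at most two points account for the first term.\<close>

lemma near_prim_recursion:
  assumes \<beta>: "\<And>Y s. 2 ^ s \<le> 4 * c * 2 ^ n \<Longrightarrow> real (card (near_prim h Y s (c / 2 ^ s))) \<le> \<beta> s"
  shows "real (card (near_prim f X n V)) \<le> 2 * (2 ^ n / c + 1) +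
    16 * (3 * \<kappa> + 1) * 4 ^ n * sqrt (2 * \<kappa> * V / 2 ^ n) *
      (\<Sum>s | s < n \<and> 2 ^ s \<le> 4 * c * 2 ^ n. \<beta> s / 2 ^ s)"
proof -
  define S where "S = {s. s < n \<and> 2 ^ s \<le> 4 * c * 2 ^ n}"
  \<comment> \<open>The points of tangency lie in \<open>{X - 1..X + 2}\<close>, where
    \<open>p\<close> varies by at most \<open>3 * \<kappa>\<close>; the slopes are covered by the
    unit windows that start at \<open>Y w\<close> with \<open>w \<in> W\<close>.\<close>
  define W where "W = {..nat \<lfloor>3 * \<kappa>\<rfloor>}"
  define Y where "Y w = p (X - 1) + real w" for w
  define N where "N = nat \<lfloor>2 ^ n / c\<rfloor>"
  define R where "R = 16 * 4 ^ n * sqrt (2 * \<kappa> * V / 2 ^ n)"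
  define La where "La s w = {(j, k, m) \<in> lines. 2 ^ s \<le> j \<and> (j, k, - m) \<in> near_prim h (Y w) s (c / 2 ^ s)}" for s w
  have R0: "0 \<le> R" unfolding R_def using k1 V by simp
  have fS: "finite S" "finite W" by (auto simp: S_def W_def)
  have cover: "v \<in> (\<Union>s\<in>S. \<Union>w\<in>W. La s w)" if "v \<in> lines" for v
  proof -
    obtain j k m where v: "v = (j, k, m)" by (cases v)
    have L: "(j, k, m) \<in> lines" using that v by simp
    have j: "0 < j" and co: "gcd j (gcd k m) = 1" using L by (auto simp: lines_def)
    note P = line_props[OF L]
    have "1 \<le> nat j" using j by linarith
    then obtain s where s: "2 ^ s \<le> nat j" "nat j < 2 ^ (s + 1)"
      using ex_power_ivl1[OF order_refl, of "nat j"] by blast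
    have s1: "2 ^ s \<le> j" 
      using s(1) j by (metis int_nat_eq less_imp_le of_nat_le_iff of_nat_numeral of_nat_power)
    have s2: "j < 2 ^ Suc s"
      using s(2) j by (metis Suc_eq_plus1 int_nat_eq less_imp_le of_nat_less_iff of_nat_numeral of_nat_power)
    have "real_of_int (2 ^ s) \<le> real_of_int j" using s1 by (simp only: of_int_le_iff)
    then have s3: "2 ^ s \<le> real_of_int j" by simp
    then have s4: "2 ^ s \<le> 4 * c * 2 ^ n" using P(1) by linarith
    \<comment> \<open>\<open>4 * c < 1\<close> makes the dual denominators strictly smaller in the
      dyadic scale, on which the induction rests.\<close>
    moreover have "4 * c * 2 ^ n < (1::real) * 2 ^ n" using c1 by (intro mult_strict_right_mono) auto
    ultimately have "(2::real) ^ s < 2 ^ n" by linarith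
    then have "s < n" by simp
    with s4 have sS: "s \<in> S" by (simp add: S_def)
    define y where "y = g (of_int k / of_int j)"
    have py: "p y = of_int k / of_int j" unfolding y_def by (rule dual_inv(2)[OF dp])
    define t where "t = of_int k / of_int j - p (X - 1)"
    have t0: "0 \<le> t"
    proof (cases "y = X - 1")
      case False
      then have "X - 1 < y" using P(3) unfolding y_def by simp
      moreover have "0 \<le> (y - (X - 1))\<^sup>2 / \<kappa>" using k1 by simp
      then have "0 \<le> (p y - p (X - 1)) * (y - (X - 1))" using slope_monotone[OF dp, of y "X - 1"] by linarith
      ultimately show ?thesis unfolding t_def py[symmetric] by (simp add: zero_le_mult_iff)
    qed (simp add: t_def py[symmetric])
    have "\<bar>p y - p (X - 1)\<bar> \<le> \<kappa> * \<bar>y - (X - 1)\<bar>" by (rule dual_lip(1)[OF dp])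
    also have "\<dots> \<le> \<kappa> * 3" using P(3,4) k1 unfolding y_def[symmetric] by (intro mult_left_mono) auto
    finally have t3: "t \<le> 3 * \<kappa>" unfolding t_def py[symmetric] by linarith
    define w where "w = nat \<lfloor>t\<rfloor>"
    have w: "real w \<le> t" "t \<le> real w + 1" using t0 unfolding w_def by linarith+
    have wW: "w \<in> W" unfolding W_def w_def using t3 by (auto intro!: nat_mono floor_mono)
    have "\<bar>of_int j * h (of_int k / of_int j) - of_int (- m)\<bar> \<le> c / 2 ^ s"
    proof -
      have "c / of_int j \<le> c / 2 ^ s" using s3 c by (intro frac_le) auto
      then show ?thesis using P(2) by simp
    qed
    then have "(j, k, - m) \<in> near_prim h (Y w) s (c / 2 ^ s)"
      unfolding near_prim_def Y_def using s1 s2 co w unfolding t_def by auto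
    then show ?thesis using sS wW L s1 unfolding v La_def by auto
  qed
  have cardLa: "finite (La s w)" "card (La s w) \<le> card (near_prim h (Y w) s (c / 2 ^ s))" for s w
  proof -
    have inj: "inj_on (\<lambda>(j, k, m). (j, k, - m)) (La s w)" by (auto simp: inj_on_def)
    have im: "(\<lambda>(j, k, m). (j, k, - m)) ` La s w \<subseteq> near_prim h (Y w) s (c / 2 ^ s)"
      by (auto simp: La_def)
    show "card (La s w) \<le> card (near_prim h (Y w) s (c / 2 ^ s))"
      by (rule card_inj_on_le[OF inj im finite_near_prim])
    show "finite (La s w)"
      by (rule finite_imageD[OF finite_subset[OF im finite_near_prim] inj])
  qed
  define pts where "pts v = (case v of (j, k, m) \<Rightarrow> line_pts f X n V j k m)" for v
  have fpts: "finite (pts v)" for v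
    unfolding pts_def by (cases v) (auto intro: finite_subset[OF _ finite_near_prim[of f X n V]] simp: line_pts_def)
  have cardpts: "real (card (pts v)) \<le> R / 2 ^ s" if "v \<in> La s w" for v s w
  proof -
    obtain j k m where v: "v = (j, k, m)" by (cases v)
    have L: "(j, k, m) \<in> lines" "2 ^ s \<le> j" using that unfolding v La_def by auto
    have "real_of_int (2 ^ s) \<le> real_of_int j" using L(2) by (simp only: of_int_le_iff)
    then have s3: "2 ^ s \<le> real_of_int j" by simp
    have "real (card (pts v)) \<le> R / of_int j"
      using line_props(5)[OF L(1)] unfolding v pts_def R_def by simp
    also have "\<dots> \<le> R / 2 ^ s" using s3 R0 by (intro frac_le) auto
    finally show ?thesis .
  qed
  define small where "small = {i \<in> {..N}. card (cell i) \<le> 2}"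
  define UL where "UL = (\<Union>s\<in>S. \<Union>w\<in>W. \<Union>v\<in>La s w. pts v)"
  have "near_prim f X n V \<subseteq> (\<Union>i\<in>small. cell i) \<union> UL"
  proof
    fix z assume z: "z \<in> near_prim f X n V"
    then have zc: "z \<in> cell (ar z)" by (simp add: cell_def)
    show "z \<in> (\<Union>i\<in>small. cell i) \<union> UL"
    proof (cases "card (cell (ar z)) \<le> 2")
      case True
      have "xcoord z \<le> X + 1" using z by (cases z) (auto simp: xcoord_def dest: near_primD)
      then have "(xcoord z - X) / (c / 2 ^ n) \<le> 1 / (c / 2 ^ n)" using c by (intro divide_right_mono) auto
      then have "ar z \<le> N" unfolding ar_def N_def by (intro nat_mono floor_mono) simp
      then show ?thesis using True zc unfolding small_def by auto
    next
      case False
      then obtain j k m where l: "(j, k, m) \<in> lines" "cell (ar z) \<subseteq> line_pts f X n V j k m"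
        using cell_on_line[of "ar z"] by auto
      then have "z \<in> pts (j, k, m)" using zc by (auto simp: pts_def)
      then show ?thesis using cover[OF l(1)] unfolding UL_def by blast
    qed
  qed
  moreover have fcell: "finite (cell i)" for i
    by (rule finite_subset[OF _ finite_near_prim[of f X n V]]) (auto simp: cell_def)
  have "finite UL" unfolding UL_def using fS cardLa fpts by auto
  ultimately have "card (near_prim f X n V) \<le> card ((\<Union>i\<in>small. cell i) \<union> UL)"
    using fcell by (intro card_mono) (auto simp: small_def)
  also have "\<dots> \<le> card (\<Union>i\<in>small. cell i) + card UL" by (rule card_Un_le)
  finally have 1: "real (card (near_prim f X n V)) \<le> real (card (\<Union>i\<in>small. cell i)) + real (card UL)" by linarith
  have "card (\<Union>i\<in>small. cell i) \<le> (\<Sum>i\<in>small. card (cell i))"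
    by (rule card_UN_le) (simp add: small_def)
  also have "\<dots> \<le> (\<Sum>i\<in>small. 2)" by (rule sum_mono) (simp add: small_def)
  also have "\<dots> \<le> 2 * card {..N}"
  proof -
    have "card small \<le> card {..N}" unfolding small_def by (rule card_mono) auto
    then show ?thesis by simp
  qed
  finally have "real (card (\<Union>i\<in>small. cell i)) \<le> 2 * (real N + 1)" by simp
  also have "real N \<le> 2 ^ n / c" unfolding N_def using c by simp
  finally have 2: "real (card (\<Union>i\<in>small. cell i)) \<le> 2 * (2 ^ n / c + 1)" by simp
  have "real (card UL) \<le> (\<Sum>s\<in>S. real (card (\<Union>w\<in>W. \<Union>v\<in>La s w. pts v)))"
    unfolding UL_def by (rule real_card_UN_le) (rule fS(1))
  also have "\<dots> \<le> (\<Sum>s\<in>S. \<Sum>w\<in>W. real (card (\<Union>v\<in>La s w. pts v)))"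
  proof (rule sum_mono)
    fix s show "real (card (\<Union>w\<in>W. \<Union>v\<in>La s w. pts v)) \<le> (\<Sum>w\<in>W. real (card (\<Union>v\<in>La s w. pts v)))" by (rule real_card_UN_le) (rule fS(2))
  qed
  also have "\<dots> \<le> (\<Sum>s\<in>S. \<Sum>w\<in>W. \<beta> s * (R / 2 ^ s))"
  proof (intro sum_mono)
    fix s w assume s: "s \<in> S"
    have "real (card (\<Union>v\<in>La s w. pts v)) \<le> (\<Sum>v\<in>La s w. real (card (pts v)))" by (rule real_card_UN_le) (rule cardLa(1))
    also have "\<dots> \<le> (\<Sum>v\<in>La s w. R / 2 ^ s)" by (rule sum_mono) (rule cardpts)
    also have "\<dots> = real (card (La s w)) * (R / 2 ^ s)" by simp
    also have "\<dots> \<le> \<beta> s * (R / 2 ^ s)"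
    proof (rule mult_right_mono)
      have "real (card (near_prim h (Y w) s (c / 2 ^ s))) \<le> \<beta> s" using s by (intro \<beta>) (simp add: S_def)
      then show "real (card (La s w)) \<le> \<beta> s" using cardLa(2)[of s w] by linarith
    qed (use R0 in simp)
    finally show "real (card (\<Union>v\<in>La s w. pts v)) \<le> \<beta> s * (R / 2 ^ s)" .
  qed
  also have "\<dots> = real (card W) * R * (\<Sum>s\<in>S. \<beta> s / 2 ^ s)"
    by (simp add: sum_distrib_left mult_ac)
  also have "\<dots> \<le> (3 * \<kappa> + 1) * R * (\<Sum>s\<in>S. \<beta> s / 2 ^ s)"
  proof (intro mult_right_mono sum_nonneg)
    show "real (card W) \<le> 3 * \<kappa> + 1" unfolding W_def using k1 by (simp add: floor_le_iff)
    fix s assume "s \<in> S"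
    then have "real (card (near_prim h 0 s (c / 2 ^ s))) \<le> \<beta> s" by (intro \<beta>) (simp add: S_def)
    then have "0 \<le> \<beta> s" by (meson of_nat_0_le_iff order_trans)
    then show "0 \<le> \<beta> s / 2 ^ s" by simp
  qed (rule R0)
  finally have 3: "real (card UL) \<le> (3 * \<kappa> + 1) * R * (\<Sum>s\<in>S. \<beta> s / 2 ^ s)" .
  have "(3 * \<kappa> + 1) * R = 16 * (3 * \<kappa> + 1) * 4 ^ n * sqrt (2 * \<kappa> * V / 2 ^ n)" by (simp add: R_def)
  with 1 2 3 show ?thesis unfolding S_def by simp
qed

end

lemma geometric_sum_le:
  fixes r :: real
  assumes "1 < r"
  shows "(\<Sum>s | s < n \<and> P s. r ^ s) \<le> r ^ n / (r - 1)"
proof -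
  have "(\<Sum>s | s < n \<and> P s. r ^ s) \<le> (\<Sum>s<n. r ^ s)"
    using assms by (intro sum_mono2) auto
  also have "\<dots> = (r ^ n - 1) / (r - 1)" using assms by (intro geometric_sum) auto
  also have "\<dots> \<le> r ^ n / (r - 1)" using assms by (intro divide_right_mono) auto
  finally show ?thesis .
qed

text \<open>Choosing \<open>c\<close> small makes the recursion a contraction, so the induction closes with a constant
  independent of \<open>n\<close>. It passes to the dual curve at each step.\<close>

lemma near_prim_diagonal_bound:
  fixes \<kappa> r :: real
  assumes \<kappa>: "1 \<le> \<kappa>" and r: "1 < r"
  obtains c C where "0 < c" "80 * \<kappa> ^ 3 * c \<le> 1" "0 < C"
    "\<And>n f p h g X. dual_pair \<kappa> f p h g \<Longrightarrow> real (card (near_prim f X n (c / 2 ^ n))) \<le> C * 2 ^ n * r ^ n"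
proof -
  \<comment> \<open>Up to \<open>sqrt c\<close>, the factor by which one step of the recursion
    multiplies the inductive constant; \<open>1 / (r - 1)\<close> is the geometric series over the
    dual levels.\<close>
  define D where "D = 16 * (3 * \<kappa> + 1) * sqrt (2 * \<kappa>) / (r - 1)"
  have D: "0 < D" unfolding D_def using \<kappa> r by simp
  \<comment> \<open>The first entry is what the recursion demands, the second makes
    \<open>sqrt c * D \<le> 1 / 2\<close>.\<close>
  define c where "c = min (1 / (80 * \<kappa> ^ 3)) (1 / (4 * D\<^sup>2))"
  have c: "0 < c" unfolding c_def using \<kappa> D by simp
  have "c \<le> 1 / (80 * \<kappa> ^ 3)" by (simp add: c_def)
  then have c80: "80 * \<kappa> ^ 3 * c \<le> 1" using \<kappa> by (simp add: field_simps)
  have sD: "sqrt c * D \<le> 1 / 2"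
  proof -
    have "sqrt c \<le> sqrt (1 / (4 * D\<^sup>2))" by (intro real_sqrt_le_mono) (simp add: c_def)
    also have "\<dots> = 1 / (2 * D)" using D by (simp add: real_sqrt_divide real_sqrt_mult)
    finally show ?thesis using D by (simp add: field_simps)
  qed
  \<comment> \<open>Half of \<open>C * 2 ^ n\<close> is \<open>2 * (2 ^ n / c + 2 ^ n)\<close> and
    pays for the arcs with at most two points; the other half is left for the inductive
    part.\<close>
  define C where "C = 4 / c + 4"
  have C: "0 < C" unfolding C_def using c by (simp add: add_pos_pos)
  have "real (card (near_prim f X n (c / 2 ^ n))) \<le> C * 2 ^ n * r ^ n" if "dual_pair \<kappa> f p h g" for n f p h g X
    using that
  proof (induction n arbitrary: f p h g X rule: less_induct)
    case (less n)
    have V: "0 < c / 2 ^ n" using c by simp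
    have "real (card (near_prim h Y s (c / 2 ^ s))) \<le> (if s < n then C * 2 ^ s * r ^ s else 0)"
      if s: "2 ^ s \<le> 4 * c * 2 ^ n" for Y s
    proof -
      have "1 \<le> \<kappa> ^ 3" using \<kappa> by simp
      then have "c \<le> \<kappa> ^ 3 * c" using c by simp
      then have "4 * c < 1" using c80 by linarith
      then have "4 * c * 2 ^ n < 1 * 2 ^ n" by (intro mult_strict_right_mono) auto
      then have "(2::real) ^ s < 2 ^ n" using s by linarith
      then have "s < n" by simp
      then show ?thesis using less.IH[OF _ dual_pair_sym[OF less.prems]] by simp
    qed
    note near_prim_recursion[OF less.prems c c80 V order_refl this, of X]
    also have "(\<Sum>s | s < n \<and> 2 ^ s \<le> 4 * c * 2 ^ n. (if s < n then C * 2 ^ s * r ^ s else 0) / 2 ^ s)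
       = C * (\<Sum>s | s < n \<and> 2 ^ s \<le> 4 * c * 2 ^ n. r ^ s)"
      unfolding sum_distrib_left by (rule sum.cong) auto
    also have "16 * (3 * \<kappa> + 1) * 4 ^ n * sqrt (2 * \<kappa> * (c / 2 ^ n) / 2 ^ n) *
        (C * (\<Sum>s | s < n \<and> 2 ^ s \<le> 4 * c * 2 ^ n. r ^ s))
        \<le> 16 * (3 * \<kappa> + 1) * 4 ^ n * sqrt (2 * \<kappa> * (c / 2 ^ n) / 2 ^ n) * (C * (r ^ n / (r - 1)))"
      using geometric_sum_le[OF r] C \<kappa> c by (intro mult_left_mono) auto
    also have "\<dots> = (sqrt c * D) * (C * 2 ^ n * r ^ n)"
    proof -
      have "2 * \<kappa> * (c / 2 ^ n) / 2 ^ n = (2 * \<kappa>) * c / (2 ^ n)\<^sup>2"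
        by (simp add: field_simps power2_eq_square)
      then have e: "sqrt (2 * \<kappa> * (c / 2 ^ n) / 2 ^ n) = sqrt (2 * \<kappa>) * sqrt c / 2 ^ n"
        by (simp only: real_sqrt_divide real_sqrt_mult real_sqrt_abs) simp
      have "(4::real) ^ n = 2 ^ n * 2 ^ n" by (simp add: power_mult_distrib[symmetric])
      then show ?thesis unfolding D_def e by simp
    qed
    also have "\<dots> \<le> (1 / 2) * (C * 2 ^ n * r ^ n)" using sD C r by (intro mult_right_mono) auto
    also have "2 * (2 ^ n / c + 1) \<le> (1 / 2) * (C * 2 ^ n * r ^ n)"
    proof -
      have "2 * (2 ^ n / c + 1) \<le> 2 * (2 ^ n / c + 2 ^ n)" by simp
      also have "\<dots> = (1 / 2) * (C * 2 ^ n)" unfolding C_def by (simp add: field_simps)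
      also have "\<dots> \<le> (1 / 2) * (C * 2 ^ n) * r ^ n" using C r by (simp add: field_simps)
      finally show ?thesis by simp
    qed
    finally show ?case by (simp add: mult_ac)
  qed
  then show thesis using that c c80 C by blast
qed

text \<open>One more step of the recursion, with the diagonal bound inserted for the dual curve. It
  yields the geometric mean of \<open>2 ^ n\<close> and \<open>V * 4 ^ n * (r\<^sup>2) ^ n\<close>,
  hence at most their sum; apart from the power of \<open>r\<close>, the second is the expected
  number of points.\<close>

lemma near_prim_bound:
  fixes \<kappa> r :: real
  assumes \<kappa>: "1 \<le> \<kappa>" and r: "1 < r"
  obtains c C where "0 < c" "c \<le> 1" "0 < C"
    "\<And>n f p h g X V. dual_pair \<kappa> f p h g \<Longrightarrow> 0 < V \<Longrightarrow> V \<le> c / 2 ^ n \<Longrightarrow>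
       real (card (near_prim f X n V)) \<le> C * (2 ^ n + V * 4 ^ n * (r\<^sup>2) ^ n)"
proof -
  obtain c C where c: "0 < c" "80 * \<kappa> ^ 3 * c \<le> 1" and C: "0 < C"
    and diag: "\<And>n f p h g X. dual_pair \<kappa> f p h g \<Longrightarrow> real (card (near_prim f X n (c / 2 ^ n))) \<le> C * 2 ^ n * r ^ n"
    using near_prim_diagonal_bound[OF assms] by blast
  define D where "D = 16 * (3 * \<kappa> + 1) * sqrt (2 * \<kappa>) * C / (r - 1)"
  have D: "0 < D" unfolding D_def using \<kappa> r C by simp
  define C' where "C' = 2 / c + 2 + D"
  have C': "0 < C'" unfolding C'_def using c D by (simp add: add_pos_pos)
  have c1: "c \<le> 1"
  proof -
    have "1 \<le> \<kappa> ^ 3" using \<kappa> by simp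
    then have "c \<le> \<kappa> ^ 3 * c" using c by simp
    then show ?thesis using c by linarith
  qed
  have "real (card (near_prim f X n V)) \<le> C' * (2 ^ n + V * 4 ^ n * (r\<^sup>2) ^ n)"
    if dp: "dual_pair \<kappa> f p h g" and V: "0 < V" "V \<le> c / 2 ^ n" for n f p h g X V
  proof -
    note near_prim_recursion[OF dp c V diag[OF dual_pair_sym[OF dp]], of X]
    also have "(\<Sum>s | s < n \<and> 2 ^ s \<le> 4 * c * 2 ^ n. C * 2 ^ s * r ^ s / 2 ^ s)
       = C * (\<Sum>s | s < n \<and> 2 ^ s \<le> 4 * c * 2 ^ n. r ^ s)"
      unfolding sum_distrib_left by (rule sum.cong) auto
    also have "16 * (3 * \<kappa> + 1) * 4 ^ n * sqrt (2 * \<kappa> * V / 2 ^ n) *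
        (C * (\<Sum>s | s < n \<and> 2 ^ s \<le> 4 * c * 2 ^ n. r ^ s))
        \<le> 16 * (3 * \<kappa> + 1) * 4 ^ n * sqrt (2 * \<kappa> * V / 2 ^ n) * (C * (r ^ n / (r - 1)))"
      using geometric_sum_le[OF r] C \<kappa> V by (intro mult_left_mono) auto
    also have "\<dots> = D * sqrt (2 ^ n * (V * 4 ^ n * (r\<^sup>2) ^ n))"
    proof -
      have "2 ^ n * (V * 4 ^ n * (r\<^sup>2) ^ n) = (V / 2 ^ n) * (4 ^ n * r ^ n)\<^sup>2"
      proof -
        have "(4::real) ^ n = 2 ^ n * 2 ^ n" by (simp add: power_mult_distrib[symmetric])
        moreover have "(r\<^sup>2) ^ n = (r ^ n)\<^sup>2" by (simp add: power_mult[symmetric] mult.commute)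
        ultimately show ?thesis by (simp add: field_simps power2_eq_square)
      qed
      then have e1: "sqrt (2 ^ n * (V * 4 ^ n * (r\<^sup>2) ^ n)) = sqrt (V / 2 ^ n) * (4 ^ n * r ^ n)"
        using r by (simp only: real_sqrt_mult real_sqrt_abs) simp
      have e2: "sqrt (2 * \<kappa> * V / 2 ^ n) = sqrt (2 * \<kappa>) * sqrt (V / 2 ^ n)"
        by (simp only: real_sqrt_mult[symmetric] times_divide_eq_right)
      show ?thesis unfolding D_def e1 e2 by simp
    qed
    also have "\<dots> \<le> D * (2 ^ n + V * 4 ^ n * (r\<^sup>2) ^ n)"
    proof (rule mult_left_mono)
      have nn: "0 \<le> V * 4 ^ n * (r\<^sup>2) ^ n" using V by simp
      have "sqrt (2 ^ n * (V * 4 ^ n * (r\<^sup>2) ^ n)) \<le> (2 ^ n + V * 4 ^ n * (r\<^sup>2) ^ n) / 2"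
        by (rule arith_geo_mean_sqrt) (use nn in auto)
      also have "\<dots> \<le> 2 ^ n + V * 4 ^ n * (r\<^sup>2) ^ n" using nn by simp
      finally show "sqrt (2 ^ n * (V * 4 ^ n * (r\<^sup>2) ^ n)) \<le> 2 ^ n + V * 4 ^ n * (r\<^sup>2) ^ n" .
    qed (use D in simp)
    also have "2 * (2 ^ n / c + 1) \<le> (2 / c + 2) * (2 ^ n + V * 4 ^ n * (r\<^sup>2) ^ n)"
    proof -
      have "2 * (2 ^ n / c + 1) \<le> 2 * (2 ^ n / c + 2 ^ n)" by simp
      also have "\<dots> = (2 / c + 2) * 2 ^ n" by (simp add: field_simps)
      also have "\<dots> \<le> (2 / c + 2) * (2 ^ n + V * 4 ^ n * (r\<^sup>2) ^ n)"
        using c V by (intro mult_left_mono) auto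
      finally show ?thesis .
    qed
    finally show ?thesis unfolding C'_def by (simp add: algebra_simps)
  qed
  then show thesis using that c c1 C' by blast
qed

section \<open>Points with a common factor\<close>

definition near_pts :: "(real \<Rightarrow> real) \<Rightarrow> real \<Rightarrow> nat \<Rightarrow> real \<Rightarrow> (int \<times> int \<times> int) set" where
  "near_pts f X n V = {(q, a, b). 1 \<le> q \<and> q < 2 ^ n \<and>
     X \<le> of_int a / of_int q \<and> of_int a / of_int q \<le> X + 1 \<and>
     \<bar>of_int q * f (of_int a / of_int q) - of_int b\<bar> \<le> V}"

lemma finite_near_pts: "finite (near_pts f X n V)"
proof -
  have "near_pts f X n V \<subseteq> {(q, a, b). q \<in> {1..2 ^ n} \<and> 0 < q \<and> X \<le> of_int a / of_int q \<and>
           of_int a / of_int q \<le> X + 1 \<and> \<bar>of_int q * f (of_int a / of_int q) - of_int b\<bar> \<le> V}"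
    by (auto simp: near_pts_def)
  then show ?thesis
    by (rule finite_subset) (rule finite_near_triples, simp)
qed

text \<open>Division of a triple by its gcd \<open>d\<close> leaves the abscissa unchanged and
  shrinks the error, so the same \<open>V\<close> serves. If the primitive denominator is at least
  \<open>2 ^ i\<close>, then \<open>d \<le> 2 ^ (n - i)\<close>.\<close>

lemma near_pts_subset_multiples:
  assumes V: "0 \<le> V"
  shows "near_pts f X n V \<subseteq>
    (\<Union>i<n. \<Union>d\<in>{1..(2::nat) ^ (n - i)}. (\<lambda>(q, a, b). (int d * q, int d * a, int d * b)) ` near_prim f X i V)"
proof
  fix z assume z: "z \<in> near_pts f X n V"
  obtain q a b where zz: "z = (q, a, b)" by (cases z)
  have q: "1 \<le> q" "q < 2 ^ n" and x: "X \<le> of_int a / of_int q" "of_int a / of_int q \<le> X + 1"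
    and fb: "\<bar>of_int q * f (of_int a / of_int q) - of_int b\<bar> \<le> V"
    using z unfolding zz near_pts_def by auto
  define d where "d = gcd q (gcd a b)"
  have d: "1 \<le> d" using q(1) unfolding d_def
    by (metis gcd_ge_0_int gcd_eq_0_iff linorder_not_less order_antisym_conv zero_less_one_class.zero_le_one not_one_le_zero int_one_le_iff_zero_less less_le)
  have "d dvd q" "d dvd a" "d dvd b" unfolding d_def by (auto intro: dvd_trans[OF gcd_dvd2])
  then obtain q' a' b' where q': "q = d * q'" "a = d * a'" "b = d * b'" by (auto elim!: dvdE)
  have "gcd (d * q') (gcd (d * a') (d * b')) = d" by (simp only: q'[symmetric] d_def[symmetric])
  then have "d * 1 = \<bar>d\<bar> * gcd q' (gcd a' b')" using gcd3_mult_left[of d q' a' b'] by (simp only: mult_1_right)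
  moreover have "\<bar>d\<bar> = d" using d by simp
  ultimately have "d * gcd q' (gcd a' b') = d * 1" by metis
  then have co: "gcd q' (gcd a' b') = 1" using d by (simp only: mult_cancel_left) simp
  have q'pos: "1 \<le> q'" using q(1) d unfolding q'(1)
    by (metis int_one_le_iff_zero_less zero_less_mult_iff not_less order_less_le_trans zero_less_one order.asym)
  have "1 \<le> nat q'" using q'pos by linarith
  then obtain i where i: "2 ^ i \<le> nat q'" "nat q' < 2 ^ (i + 1)"
    using ex_power_ivl1[OF order_refl, of "nat q'"] by blast
  have i1: "2 ^ i \<le> q'" 
    using i(1) q'pos by (metis int_nat_eq order_trans zero_le_one of_nat_le_iff of_nat_numeral of_nat_power)
  have i2: "q' < 2 ^ Suc i"
    using i(2) q'pos by (metis Suc_eq_plus1 int_nat_eq order_trans zero_le_one of_nat_less_iff of_nat_numeral of_nat_power)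
  have "d * 2 ^ i \<le> d * q'" using i1 d by simp
  then have di: "d * 2 ^ i < 2 ^ n" using q(2) unfolding q'(1) by linarith
  have "1 * (2::int) ^ i \<le> d * 2 ^ i" using d by (intro mult_right_mono) auto
  then have "(2::int) ^ i < 2 ^ n" using di by linarith
  then have "i < n" by simp
  then have "(2::int) ^ n = 2 ^ (n - i) * 2 ^ i" by (simp add: power_add[symmetric])
  then have "d < 2 ^ (n - i)" using di by simp
  then have dn: "nat d \<in> {1..(2::nat) ^ (n - i)}" using d by (auto simp: nat_le_iff)
  have x': "real_of_int a / real_of_int q = real_of_int a' / real_of_int q'"
    unfolding q' using d by simp
  have "\<bar>of_int q * f (of_int a / of_int q) - of_int b\<bar> = of_int d * \<bar>of_int q' * f (of_int a' / of_int q') - of_int b'\<bar>"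
  proof -
    have "of_int q * f (of_int a / of_int q) - of_int b = of_int d * (of_int q' * f (of_int a' / of_int q') - of_int b')"
      unfolding x' by (simp add: q' algebra_simps)
    then show ?thesis using d by (simp add: abs_mult)
  qed
  also have "\<dots> \<ge> 1 * \<bar>of_int q' * f (of_int a' / of_int q') - of_int b'\<bar>"
    using d by (intro mult_right_mono) auto
  finally have "(q', a', b') \<in> near_prim f X i V"
    unfolding near_prim_def using i1 i2 co x fb unfolding x' by auto
  moreover have "z = (\<lambda>(q, a, b). (int (nat d) * q, int (nat d) * a, int (nat d) * b)) (q', a', b')"
    unfolding zz q' using d by simp
  ultimately show "z \<in> (\<Union>i<n. \<Union>d\<in>{1..(2::nat) ^ (n - i)}. (\<lambda>(q, a, b). (int d * q, int d * a, int d * b)) ` near_prim f X i V)"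
    using dn \<open>i < n\<close> by blast
qed

text \<open>Range \<open>i\<close> of primitive points contributes
  \<open>2 ^ (n - i) * 2 ^ i\<close> for every \<open>i < n\<close>. These equal terms produce the
  factor \<open>real n\<close>, which becomes the logarithm of the final theorem; the other term
  grows geometrically in \<open>i\<close>.\<close>

lemma near_pts_small_bound:
  fixes \<kappa> r :: real
  assumes \<kappa>: "1 \<le> \<kappa>" and r: "1 < r"
  obtains c C where "0 < c" "c \<le> 1" "0 < C"
    "\<And>n f p h g X V. dual_pair \<kappa> f p h g \<Longrightarrow> 0 < V \<Longrightarrow> V \<le> c / 2 ^ n \<Longrightarrow>
       real (card (near_pts f X n V)) \<le> C * (real n * 2 ^ n + V * 4 ^ n * r ^ n)"
proof -
  \<comment> \<open>\<open>near_prim_bound\<close> returns the square of its parameter.\<close>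
  have sr: "1 < sqrt r" using r by simp
  have sr2: "(sqrt r)\<^sup>2 = r" using r by simp
  obtain c C where c: "0 < c" "c \<le> 1" and C: "0 < C"
    and bd: "\<And>n f p h g X V. dual_pair \<kappa> f p h g \<Longrightarrow> 0 < V \<Longrightarrow> V \<le> c / 2 ^ n \<Longrightarrow>
       real (card (near_prim f X n V)) \<le> C * (2 ^ n + V * 4 ^ n * r ^ n)"
    using near_prim_bound[OF \<kappa> sr] unfolding sr2 by blast
  have "real (card (near_pts f X n V)) \<le> C * (real n * 2 ^ n + V * 4 ^ n * r ^ n)"
    if dp: "dual_pair \<kappa> f p h g" and V: "0 < V" "V \<le> c / 2 ^ n" for n f p h g X V
  proof -
    define I where "I i d = (\<lambda>(q, a, b). (int d * q, int d * a, int d * b)) ` near_prim f X i V" for i d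
    have fI: "finite (I i d)" "card (I i d) \<le> card (near_prim f X i V)" for i d
      unfolding I_def using finite_near_prim by (auto intro: card_image_le)
    have "card (near_pts f X n V) \<le> card (\<Union>i<n. \<Union>d\<in>{1..(2::nat) ^ (n - i)}. I i d)"
      using near_pts_subset_multiples[of V f X n] V unfolding I_def[symmetric]
      by (intro card_mono) (auto simp: fI)
    also have "\<dots> \<le> (\<Sum>i<n. card (\<Union>d\<in>{1..(2::nat) ^ (n - i)}. I i d))" by (rule card_UN_le) simp
    also have "\<dots> \<le> (\<Sum>i<n. \<Sum>d\<in>{1..(2::nat) ^ (n - i)}. card (I i d))"
      by (intro sum_mono card_UN_le) simp
    also have "\<dots> \<le> (\<Sum>i<n. \<Sum>d\<in>{1..(2::nat) ^ (n - i)}. card (near_prim f X i V))"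
      by (intro sum_mono fI)
    also have "\<dots> = (\<Sum>i<n. 2 ^ (n - i) * card (near_prim f X i V))" by simp
    finally have "real (card (near_pts f X n V)) \<le> real (\<Sum>i<n. 2 ^ (n - i) * card (near_prim f X i V))"
      by (simp only: of_nat_le_iff)
    also have "\<dots> = (\<Sum>i<n. 2 ^ (n - i) * real (card (near_prim f X i V)))" by simp
    also have "\<dots> \<le> (\<Sum>i<n. C * (2 ^ n + V * 2 ^ n * (2 * r) ^ i))"
    proof (rule sum_mono)
      fix i assume "i \<in> {..<n}"
      then have i: "i < n" by simp
      have "c / 2 ^ n \<le> c / 2 ^ i" using i c by (intro divide_left_mono) (auto intro: power_increasing)
      then have "V \<le> c / 2 ^ i" using V by linarith
      then have "2 ^ (n - i) * real (card (near_prim f X i V)) \<le> 2 ^ (n - i) * (C * (2 ^ i + V * 4 ^ i * r ^ i))"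
        using bd[OF dp V(1)] by (intro mult_left_mono) auto
      also have "\<dots> = C * (2 ^ n + V * 2 ^ n * (2 * r) ^ i)"
      proof -
        have "(4::real) ^ i = 2 ^ i * 2 ^ i" by (simp add: power_mult_distrib[symmetric])
        moreover have "(2::real) ^ n = 2 ^ (n - i) * 2 ^ i" using i by (simp add: power_add[symmetric])
        ultimately show ?thesis by (simp add: algebra_simps power_mult_distrib)
      qed
      finally show "2 ^ (n - i) * real (card (near_prim f X i V)) \<le> C * (2 ^ n + V * 2 ^ n * (2 * r) ^ i)" .
    qed
    also have "\<dots> = C * (real n * 2 ^ n + V * 2 ^ n * (\<Sum>i<n. (2 * r) ^ i))"
      by (simp add: sum_distrib_left sum.distrib algebra_simps)
    also have "\<dots> \<le> C * (real n * 2 ^ n + V * 2 ^ n * (2 * r) ^ n)"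
    proof -
      have "(\<Sum>i<n. (2 * r) ^ i) \<le> (2 * r) ^ n"
      proof (induction n)
        case (Suc n)
        have "(2 * r) ^ n + (2 * r) ^ n \<le> (2 * r) * (2 * r) ^ n"
          using mult_right_mono[of 2 "2 * r" "(2 * r) ^ n"] r by simp
        then show ?case using Suc unfolding sum.lessThan_Suc power_Suc by linarith
      qed simp
      then show ?thesis using C V by (intro mult_left_mono add_left_mono) auto
    qed
    also have "V * 2 ^ n * (2 * r) ^ n = V * 4 ^ n * r ^ n"
    proof -
      have "(4::real) ^ n = 2 ^ n * 2 ^ n" by (simp add: power_mult_distrib[symmetric])
      then show ?thesis by (simp add: power_mult_distrib)
    qed
    finally show ?thesis .
  qed
  then show thesis using that c C by blast
qed

lemma card_le_fibres:
  assumes "finite A" "finite K" "F ` A \<subseteq> K"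
    and fib: "\<And>s. s \<in> A \<Longrightarrow> card {t \<in> A. F t = F s} \<le> M"
  shows "card A \<le> card K * M"
proof -
  have "A = (\<Union>k\<in>K. {t \<in> A. F t = k})" using assms(3) by auto
  then have "card A \<le> (\<Sum>k\<in>K. card {t \<in> A. F t = k})"
    using card_UN_le[OF assms(2), of "\<lambda>k. {t \<in> A. F t = k}"] by simp
  also have "\<dots> \<le> (\<Sum>k\<in>K. M)"
  proof (rule sum_mono)
    fix k assume "k \<in> K"
    show "card {t \<in> A. F t = k} \<le> M"
    proof (cases "\<exists>s\<in>A. F s = k")
      case True
      then show ?thesis using fib by blast
    next
      case False
      then have "{t \<in> A. F t = k} = {}" by auto
      then show ?thesis by (simp only: card.empty zero_le)
    qed
  qed
  finally show ?thesis by simp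
qed

lemma card_grid_near:
  fixes l w u :: real
  assumes "0 < l" "0 \<le> w" "finite I"
  shows "real (card {i \<in> I. \<bar>u - real i * l\<bar> \<le> w}) \<le> 1 + 2 * w / l"
proof (rule card_spaced_le[where \<xi> = "\<lambda>i. real i * l"])
  fix i j :: nat assume "i \<noteq> j"
  then have "1 \<le> \<bar>real i - real j\<bar>" by linarith
  then have "1 * l \<le> \<bar>real i - real j\<bar> * l" using assms(1) by (intro mult_right_mono) auto
  then show "l \<le> \<bar>real i * l - real j * l\<bar>"
    using assms(1) by (simp add: left_diff_distrib[symmetric] abs_mult)
qed (use assms in auto)

lemma floor_cell_bounds:
  fixes u M :: real and N :: nat
  assumes "0 \<le> u" "u \<le> M" "0 < M"
  shows "nat \<lfloor>u * real N / M\<rfloor> \<le> N"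
proof -
  have "u * real N / M \<le> real N" using assms by (simp add: field_simps mult_right_mono)
  then show ?thesis by linarith
qed

lemma floor_cell_eq:
  fixes u v M :: real and N :: nat
  assumes "0 \<le> u" "0 \<le> v" "0 < M" "0 < N" and eq: "nat \<lfloor>u * real N / M\<rfloor> = nat \<lfloor>v * real N / M\<rfloor>"
  shows "\<bar>u - v\<bar> \<le> M / real N"
proof -
  have "0 \<le> u * real N / M" "0 \<le> v * real N / M" using assms by auto
  then have "\<bar>u * real N / M - v * real N / M\<bar> \<le> 1" using eq by linarith
  moreover have "u * real N / M - v * real N / M = (u - v) * (real N / M)" by (simp add: diff_divide_distrib left_diff_distrib)
  ultimately have "\<bar>u - v\<bar> * (real N / M) \<le> 1" using assms(3) by (simp add: abs_mult)
  then show ?thesis using assms(3,4) by (simp add: field_simps)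
qed

text \<open>Points far from the curve: over an arc of length \<open>len\<close> they lie in a parallelepiped, which is divided into about \<open>N\<^sup>3\<close>
  translates of a box shrunk by \<open>N\<close>. Differences of two points in the same cell lie in the shrunk box, where the
  bound for points near the curve applies.\<close>

context
  fixes \<kappa> c C1 r1 V X :: real and f p h g :: "real \<Rightarrow> real" and n :: nat
  assumes dp: "dual_pair \<kappa> f p h g"
    and c: "0 < c" "c \<le> 1" and r1: "1 < r1" and C1: "0 < C1"
    and diag: "\<And>m Y. real (card (near_pts f Y m (c / 2 ^ m))) \<le> C1 * 2 ^ m * r1 ^ m"
    and V: "c / 2 ^ n \<le> V" "V \<le> 1"
begin

text \<open>The 8 is the 4 in the error \<open>4 * ta / q\<close> of a box point of denominator
  \<open>q\<close>, times the 2 lost in passing to the dyadic bound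
  \<open>c / 2 ^ Suc s\<close>.\<close>

private definition "ta = c / 8"
private definition "tb = sqrt (ta / \<kappa>)"
text \<open>Chosen so that \<open>V / N = ta / T'\<close>: at the shrunk denominator
  \<open>T'\<close> the shrunk error is one that the bound near the curve accepts.\<close>

private definition "N = sqrt (2 ^ n * V / ta)"
private definition "T' = 2 ^ n / N"
text \<open>This makes \<open>\<kappa> * 2 ^ n * len\<^sup>2 = V\<close>: over such an arc the curve
  leaves its tangent, in units of \<open>1 / q\<close>, by at most \<open>V\<close>.\<close>

private definition "len = tb / T'"
private definition "x0 i = X + real i * len"
text \<open>\<open>off\<close> and \<open>res\<close> are linear in the triple, hence apply to
  differences. For \<open>q \<noteq> 0\<close> they are \<open>q\<close> times the distance from
  \<open>x0 i\<close> and \<open>q\<close> times the height over the tangent there.\<close>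

private definition "off i a q = real_of_int a - x0 i * real_of_int q"
private definition "res i q a b = real_of_int b - f (x0 i) * real_of_int q - p (x0 i) * off i a q"
private definition "bx i = {(q, a, b). \<bar>real_of_int q\<bar> \<le> T' \<and> \<bar>off i a q\<bar> \<le> tb \<and> \<bar>res i q a b\<bar> \<le> 3 * V / N}"
private definition "pbx i = {(q, a, b). 1 \<le> q \<and> (q, a, b) \<in> bx i}"
private definition "I = nat \<lfloor>1 / len\<rfloor>"
private definition "S = {s. s \<le> n \<and> 2 ^ s \<le> T'}"
private definition "U s = near_pts f (X - 1) (Suc s) (c / 2 ^ Suc s) \<union> near_pts f X (Suc s) (c / 2 ^ Suc s)
  \<union> near_pts f (X + 1) (Suc s) (c / 2 ^ Suc s)"

private lemma kappa1: "1 \<le> \<kappa>" by (rule dual_kappa[OF dp])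

private lemma ta: "0 < ta" "ta \<le> 1 / 8" using c by (auto simp: ta_def)

private lemma tb: "0 < tb" "tb < 1" "\<kappa> * tb\<^sup>2 = ta"
proof -
  show "0 < tb" unfolding tb_def using ta kappa1 by simp
  have "ta / \<kappa> < 1" using ta kappa1 by simp
  then show "tb < 1" unfolding tb_def by simp
  show "\<kappa> * tb\<^sup>2 = ta" unfolding tb_def using ta kappa1 by simp
qed

private lemma V0: "0 < V" using V c by (metis divide_pos_pos less_le_trans zero_less_numeral zero_less_power)

private lemma N: "1 \<le> N" "N\<^sup>2 = 2 ^ n * V / ta"
proof -
  have "c \<le> 2 ^ n * V" using V(1) by (simp add: field_simps)
  then have "8 \<le> 2 ^ n * V / ta" unfolding ta_def using c by (simp add: field_simps)
  then show "1 \<le> N" unfolding N_def by simp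
  show "N\<^sup>2 = 2 ^ n * V / ta" unfolding N_def using ta V0 by simp
qed

private lemma T': "0 < T'" "T' * N = 2 ^ n" "T' \<le> 2 ^ n" "V / N = ta / T'" "sqrt ta \<le> T'"
proof -
  show T0: "0 < T'" unfolding T'_def using N by simp
  show TN: "T' * N = 2 ^ n" unfolding T'_def using N by simp
  show "T' \<le> 2 ^ n" unfolding T'_def using N by (simp add: field_simps)
  have "V * 2 ^ n = ta * N\<^sup>2" using N ta by (simp add: field_simps)
  also have "2 ^ n = T' * N" using TN by simp
  finally have "V * T' = ta * N" using N by (simp add: power2_eq_square)
  then show VN: "V / N = ta / T'" using N T0 by (simp add: field_simps)
  have "T'\<^sup>2 * V = ta * (T' * N)" using \<open>V * T' = ta * N\<close> by (simp add: power2_eq_square mult_ac)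
  then have "T'\<^sup>2 * V = ta * 2 ^ n" by (simp only: TN)
  moreover have "T'\<^sup>2 * V \<le> T'\<^sup>2 * 1" using V by (intro mult_left_mono) auto
  moreover have "ta * 1 \<le> ta * 2 ^ n" using ta by (intro mult_left_mono) auto
  ultimately have "ta \<le> T'\<^sup>2" by linarith
  then show "sqrt ta \<le> T'" using T0 by (simp add: real_le_lsqrt)
qed

private lemma len: "0 < len" "2 ^ n * len = tb * N" "\<kappa> * 2 ^ n * len\<^sup>2 = V" "len * T' = tb"
proof -
  show "0 < len" unfolding len_def using tb T' by simp
  show lT: "len * T' = tb" unfolding len_def using T' by simp
  have "2 ^ n * len = (T' * N) * len" by (simp only: T'(2))
  also have "\<dots> = tb * N" using lT by (simp add: mult_ac)
  finally show l2: "2 ^ n * len = tb * N" .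
  have "\<kappa> * 2 ^ n * len\<^sup>2 * 2 ^ n = \<kappa> * (2 ^ n * len)\<^sup>2" by (simp add: power2_eq_square)
  also have "\<dots> = (\<kappa> * tb\<^sup>2) * N\<^sup>2" unfolding l2 by (simp add: power2_eq_square)
  also have "\<dots> = V * 2 ^ n" unfolding tb(3) N(2) using ta by simp
  finally show "\<kappa> * 2 ^ n * len\<^sup>2 = V" by simp
qed

private lemma res_eq:
  assumes "q \<noteq> 0"
  shows "off i a q = of_int q * (of_int a / of_int q - x0 i)"
    and "res i q a b = (of_int b - of_int q * f (of_int a / of_int q)) +
      of_int q * (f (of_int a / of_int q) - f (x0 i) - p (x0 i) * (of_int a / of_int q - x0 i))"
proof -
  show 1: "off i a q = of_int q * (of_int a / of_int q - x0 i)"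
    unfolding off_def using assms by (simp add: field_simps)
  show "res i q a b = (of_int b - of_int q * f (of_int a / of_int q)) +
      of_int q * (f (of_int a / of_int q) - f (x0 i) - p (x0 i) * (of_int a / of_int q - x0 i))"
    unfolding res_def 1 by (simp add: algebra_simps)
qed

private lemma tangent_gap: "0 \<le> f x - f y - p y * (x - y)"
proof -
  have "0 \<le> (x - y)\<^sup>2 / \<kappa>" using kappa1 by simp
  then show ?thesis using dual_lower[OF dp, of x y] by linarith
qed

text \<open>In the shrunk box the tangent is again as good as the curve: the quadratic term costs
  \<open>\<kappa> * tb\<^sup>2 / q = ta / q\<close>, and the residue is at most
  \<open>3 * V / N = 3 * ta / T'\<close>, where \<open>q \<le> T'\<close>. Since
  \<open>tb < 1\<close>, three unit windows contain all abscissae.\<close>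

private lemma pbox_subset:
  assumes i: "i \<le> I"
  shows "pbx i \<subseteq> (\<Union>s\<in>S. {z \<in> U s. \<bar>xcoord z - X - real i * len\<bar> \<le> tb / 2 ^ s})"
proof
  fix z assume z: "z \<in> pbx i"
  obtain q a b where zz: "z = (q, a, b)" by (cases z)
  have q: "1 \<le> q" and b: "\<bar>real_of_int q\<bar> \<le> T'" "\<bar>off i a q\<bar> \<le> tb" "\<bar>res i q a b\<bar> \<le> 3 * V / N"
    using z unfolding zz pbx_def bx_def by auto
  have q0: "q \<noteq> 0" "1 \<le> real_of_int q" using q by auto
  define x where "x = real_of_int a / real_of_int q"
  have "1 \<le> nat q" using q by linarith
  then obtain s where s: "2 ^ s \<le> nat q" "nat q < 2 ^ (s + 1)"
    using ex_power_ivl1[OF order_refl, of "nat q"] by blast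
  have s1: "2 ^ s \<le> q" 
    using s(1) q by (metis int_nat_eq order_trans zero_le_one of_nat_le_iff of_nat_numeral of_nat_power)
  have s2: "q < 2 ^ Suc s"
    using s(2) q by (metis Suc_eq_plus1 int_nat_eq order_trans zero_le_one of_nat_less_iff of_nat_numeral of_nat_power)
  have "real_of_int (2 ^ s) \<le> real_of_int q" using s1 by (simp only: of_int_le_iff)
  then have s3: "2 ^ s \<le> real_of_int q" by simp
  have "real_of_int q < real_of_int (2 ^ Suc s)" using s2 by (simp only: of_int_less_iff)
  then have "real_of_int q < 2 * 2 ^ s" by simp
  have qT: "real_of_int q \<le> T'" using b(1) q by simp
  then have sT: "2 ^ s \<le> T'" using s3 by linarith
  then have "(2::real) ^ s \<le> 2 ^ n" using T'(3) by linarith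
  then have sS: "s \<in> S" using sT unfolding S_def by simp
  have "real_of_int q * \<bar>x - x0 i\<bar> \<le> tb"
    using b(2) res_eq(1)[OF q0(1), of i a] q0(2) unfolding x_def by (simp add: abs_mult)
  then have xq: "\<bar>x - x0 i\<bar> \<le> tb / of_int q" using q0 by (simp add: field_simps)
  also have "\<dots> \<le> tb / 2 ^ s" using s3 tb by (intro frac_le) auto
  finally have xs: "\<bar>x - x0 i\<bar> \<le> tb / 2 ^ s" .
  also have "\<dots> \<le> tb / 1" using tb by (intro frac_le) auto
  finally have x1: "\<bar>x - x0 i\<bar> \<le> 1" using tb by simp
  have "real I \<le> 1 / len" unfolding I_def using len by simp
  then have "real i \<le> 1 / len" using i by linarith
  then have "real i * len \<le> 1" using len by (simp add: field_simps)
  then have "X \<le> x0 i \<and> x0 i \<le> X + 1" unfolding x0_def using len by simp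
  then have xX: "X - 1 \<le> x" "x \<le> X + 2" using x1 by linarith+
  define E where "E = f x - f (x0 i) - p (x0 i) * (x - x0 i)"
  have "E \<le> \<kappa> * (x - x0 i)\<^sup>2" unfolding E_def by (rule dual_upper[OF dp])
  also have "\<dots> \<le> \<kappa> * (tb / of_int q)\<^sup>2"
    using xq kappa1 by (intro mult_left_mono) (metis abs_ge_zero power2_abs power_mono, simp)
  finally have "of_int q * E \<le> of_int q * (\<kappa> * (tb / of_int q)\<^sup>2)" using q0 by (intro mult_left_mono) auto
  also have "\<dots> = (\<kappa> * tb\<^sup>2) / of_int q" using q0 by (simp add: power2_eq_square)
  finally have qE: "of_int q * E \<le> ta / of_int q" unfolding tb(3) .
  have E0: "0 \<le> of_int q * E" using tangent_gap[of x "x0 i"] q0 unfolding E_def by simp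
  have "3 * V / N = 3 * (ta / T')" using T'(4) by simp
  also have "\<dots> \<le> 3 * (ta / of_int q)" using qT q0 ta by (intro mult_left_mono frac_le) auto
  finally have "\<bar>res i q a b\<bar> \<le> 3 * (ta / of_int q)" using b(3) by linarith
  then have "\<bar>of_int b - of_int q * f x\<bar> \<le> 4 * (ta / of_int q)"
    using qE E0 res_eq(2)[OF q0(1), of i a b, folded x_def, folded E_def] by linarith
  also have "\<dots> \<le> 4 * (ta / 2 ^ s)" using s3 ta q0 by (intro mult_left_mono frac_le) auto
  also have "\<dots> = c / 2 ^ Suc s" unfolding ta_def by simp
  finally have fb: "\<bar>of_int q * f x - of_int b\<bar> \<le> c / 2 ^ Suc s" by (simp only: abs_minus_commute)
  have "z \<in> U s" unfolding zz U_def near_pts_def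
    using q s2 xX fb unfolding x_def by auto
  moreover have "\<bar>xcoord z - X - real i * len\<bar> \<le> tb / 2 ^ s"
    using xs unfolding zz xcoord_def x_def x0_def by (simp add: algebra_simps)
  ultimately show "z \<in> (\<Union>s\<in>S. {z \<in> U s. \<bar>xcoord z - X - real i * len\<bar> \<le> tb / 2 ^ s})" using sS by blast
qed

private lemma finU: "finite (U s)" unfolding U_def by (simp add: finite_near_pts)

private lemma finS: "finite S" unfolding S_def by simp

private lemma pbox_finite: "i \<le> I \<Longrightarrow> finite (pbx i)"
  by (rule finite_subset[OF pbox_subset]) (auto simp: finU finS)

text \<open>The box is symmetric under negation, so besides \<open>pbx i\<close> and its mirror
  image only \<open>q = 0\<close> occurs. There \<open>tb < 1\<close> forces \<open>a = 0\<close>,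
  and \<open>3 * V / N \<le> 3\<close> leaves seven values of \<open>b\<close>.\<close>

private lemma box_card:
  assumes i: "i \<le> I"
  shows "finite (bx i)" "card (bx i) \<le> 7 + 2 * card (pbx i)"
proof -
  define ng where "ng = (\<lambda>(q::int, a::int, b::int). (- q, - a, - b))"
  define Z where "Z = (\<lambda>b::int. (0::int, 0::int, b)) ` {-3..3}"
  have "bx i \<subseteq> Z \<union> (pbx i \<union> ng ` pbx i)"
  proof
    fix z assume z: "z \<in> bx i"
    obtain q a b where zz: "z = (q, a, b)" by (cases z)
    consider "q = 0" | "1 \<le> q" | "q \<le> -1" by linarith
    then show "z \<in> Z \<union> (pbx i \<union> ng ` pbx i)"
    proof cases
      case 1
      have b: "\<bar>off i a q\<bar> \<le> tb" "\<bar>res i q a b\<bar> \<le> 3 * V / N" using z unfolding zz bx_def by auto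
      have "\<bar>real_of_int a\<bar> < 1" using b(1) tb 1 unfolding off_def by simp
      then have a: "a = 0" by linarith
      have "3 * V / N \<le> 3 * 1 / 1" using V V0 N by (intro frac_le) auto
      then have "\<bar>real_of_int b\<bar> \<le> 3" using b(2) unfolding res_def off_def 1 a by simp
      then have "-3 \<le> b \<and> b \<le> 3" by linarith
      then show ?thesis unfolding Z_def zz 1 a by auto
    next
      case 2
      then show ?thesis using z unfolding zz pbx_def by auto
    next
      case 3
      have "off i (- a) (- q) = - off i a q" unfolding off_def by simp
      moreover have "res i (- q) (- a) (- b) = - res i q a b"
        unfolding res_def off_def by (simp add: algebra_simps)
      ultimately have "(- q, - a, - b) \<in> pbx i" using z 3 unfolding zz bx_def pbx_def by auto
      then have "ng (- q, - a, - b) \<in> ng ` pbx i" by (rule imageI)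
      then show ?thesis unfolding ng_def zz by simp
    qed
  qed
  moreover have fin: "finite Z" "finite (pbx i)" "finite (ng ` pbx i)"
    using pbox_finite[OF i] by (auto simp: Z_def)
  ultimately show "finite (bx i)" by (meson finite_UnI finite_subset)
  have "card (bx i) \<le> card (Z \<union> (pbx i \<union> ng ` pbx i))"
    using fin by (intro card_mono) (use \<open>bx i \<subseteq> _\<close> in auto)
  also have "\<dots> \<le> card Z + (card (pbx i) + card (ng ` pbx i))"
    by (meson card_Un_le add_left_mono order_trans)
  also have "card Z \<le> 7" unfolding Z_def using card_image_le[of "{-3..3::int}" "\<lambda>b. (0::int, 0::int, b)"] by simp
  also have "card (ng ` pbx i) \<le> card (pbx i)" using fin by (intro card_image_le) auto
  finally show "card (bx i) \<le> 7 + 2 * card (pbx i)" by simp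
qed

text \<open>After exchanging the sums, a point of level \<open>s\<close> is close to at most
  \<open>3 * T' / 2 ^ s\<close> of the base points \<open>x0 i\<close>, which are
  \<open>tb / T'\<close> apart, and there are about \<open>2 ^ s\<close> points of that level. Every
  level thus contributes about \<open>T'\<close>.\<close>

private lemma pbox_sum:
  "(\<Sum>i\<le>I. real (card (pbx i))) \<le> 18 * C1 * (real n + 1) * r1 ^ Suc n * T'"
proof -
  define R where "R s i z \<longleftrightarrow> \<bar>xcoord z - X - real i * len\<bar> \<le> tb / 2 ^ s" for s :: nat and i :: nat and z
  have "(\<Sum>i\<le>I. real (card (pbx i))) \<le> (\<Sum>i\<le>I. \<Sum>s\<in>S. real (card {z \<in> U s. R s i z}))"
  proof (rule sum_mono)
    fix i assume "i \<in> {..I}"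
    then have i: "i \<le> I" by simp
    have "card (pbx i) \<le> card (\<Union>s\<in>S. {z \<in> U s. R s i z})"
      using pbox_subset[OF i] unfolding R_def by (intro card_mono) (auto simp: finU finS)
    then show "real (card (pbx i)) \<le> (\<Sum>s\<in>S. real (card {z \<in> U s. R s i z}))"
      using real_card_UN_le[OF finS, of "\<lambda>s. {z \<in> U s. R s i z}"] by linarith
  qed
  also have "\<dots> = (\<Sum>s\<in>S. \<Sum>i\<le>I. real (card {z \<in> U s. R s i z}))" by (rule sum.swap)
  also have "\<dots> \<le> (\<Sum>s\<in>S. 18 * C1 * r1 ^ Suc n * T')"
  proof (rule sum_mono)
    fix s assume s: "s \<in> S"
    have "(\<Sum>i\<le>I. card {z \<in> U s. R s i z}) = (\<Sum>z\<in>U s. card {i \<in> {..I}. R s i z})"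
      by (rule sum_multicount_gen) (auto simp: finU)
    then have "(\<Sum>i\<le>I. real (card {z \<in> U s. R s i z})) = (\<Sum>z\<in>U s. real (card {i \<in> {..I}. R s i z}))"
      by (simp only: of_nat_sum[symmetric])
    also have "\<dots> \<le> (\<Sum>z\<in>U s. 3 * T' / 2 ^ s)"
    proof (rule sum_mono)
      fix z
      have "real (card {i \<in> {..I}. R s i z}) \<le> 1 + 2 * (tb / 2 ^ s) / len"
        unfolding R_def by (rule card_grid_near) (use len tb in auto)
      also have "2 * (tb / 2 ^ s) / len = 2 * T' / 2 ^ s"
        using len by (simp add: field_simps)
      also have "1 \<le> T' / 2 ^ s" using s unfolding S_def by simp
      finally show "real (card {i \<in> {..I}. R s i z}) \<le> 3 * T' / 2 ^ s" by simp
    qed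
    also have "\<dots> = real (card (U s)) * (3 * T' / 2 ^ s)" by simp
    also have "\<dots> \<le> (3 * (C1 * 2 ^ Suc s * r1 ^ Suc s)) * (3 * T' / 2 ^ s)"
    proof (rule mult_right_mono)
      have "card (U s) \<le> card (near_pts f (X - 1) (Suc s) (c / 2 ^ Suc s)) + card (near_pts f X (Suc s) (c / 2 ^ Suc s))
         + card (near_pts f (X + 1) (Suc s) (c / 2 ^ Suc s))"
        unfolding U_def by (meson card_Un_le add_right_mono order_trans)
      then show "real (card (U s)) \<le> 3 * (C1 * 2 ^ Suc s * r1 ^ Suc s)"
        using diag[of "X - 1" "Suc s"] diag[of X "Suc s"] diag[of "X + 1" "Suc s"] by linarith
    qed (use T' in simp)
    also have "\<dots> = 18 * C1 * r1 ^ Suc s * T'" by simp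
    also have "\<dots> \<le> 18 * C1 * r1 ^ Suc n * T'"
      using s r1 C1 T' unfolding S_def by (intro mult_right_mono mult_left_mono power_increasing) auto
    finally show "(\<Sum>i\<le>I. real (card {z \<in> U s. R s i z})) \<le> 18 * C1 * r1 ^ Suc n * T'" .
  qed
  also have "\<dots> = real (card S) * (18 * C1 * r1 ^ Suc n * T')" by simp
  also have "\<dots> \<le> (real n + 1) * (18 * C1 * r1 ^ Suc n * T')"
  proof (rule mult_right_mono)
    have "card S \<le> card {..n}" unfolding S_def by (intro card_mono) auto
    then show "real (card S) \<le> real n + 1" by simp
  qed (use r1 C1 T' in simp)
  finally show ?thesis by (simp only: mult_ac)
qed

private lemma cell_card:
  "real (card {z \<in> near_pts f X n V. nat \<lfloor>(xcoord z - X) / len\<rfloor> = i}) \<le> 27 * N ^ 3 * real (card (bx i))"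
  if i: "i \<le> I"
proof -
  define A where "A = {z \<in> near_pts f X n V. nat \<lfloor>(xcoord z - X) / len\<rfloor> = i}"
  \<comment> \<open>\<open>N \<ge> 1\<close> gives \<open>M + 1 \<le> 3 * N\<close>, whence the
    factor 27.\<close>
  define M where "M = nat \<lceil>N\<rceil>"
  have M: "N \<le> real M" "real M + 1 \<le> 3 * N" "0 < M" unfolding M_def using N by linarith+
  define F where "F = (\<lambda>(q, a, b). (nat \<lfloor>real_of_int q * real M / 2 ^ n\<rfloor>,
    nat \<lfloor>off i a q * real M / (2 ^ n * len)\<rfloor>, nat \<lfloor>(res i q a b + V) * real M / (3 * V)\<rfloor>))"
  have finA: "finite A" unfolding A_def by (simp add: finite_near_pts)
  \<comment> \<open>The coordinates fill intervals of lengths \<open>2 ^ n\<close>,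
    \<open>2 ^ n * len = tb * N\<close> and \<open>3 * V\<close>; divided by \<open>N\<close>, these
    are the bounds that define \<open>bx i\<close>.\<close>
  have bd: "0 \<le> real_of_int q \<and> real_of_int q \<le> 2 ^ n \<and> 0 \<le> off i a q \<and> off i a q \<le> 2 ^ n * len \<and>
     0 \<le> res i q a b + V \<and> res i q a b + V \<le> 3 * V" if z: "(q, a, b) \<in> A" for q a b
  proof -
    have q: "1 \<le> q" "q < 2 ^ n" and x: "X \<le> of_int a / of_int q" 
      and fb: "\<bar>of_int q * f (of_int a / of_int q) - of_int b\<bar> \<le> V"
      and ii: "nat \<lfloor>(of_int a / of_int q - X) / len\<rfloor> = i"
      using z unfolding A_def near_pts_def xcoord_def by auto
    define x where "x = real_of_int a / real_of_int q"
    have q1: "1 \<le> real_of_int q" using q by simp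
    have "real_of_int q < real_of_int (2 ^ n)" using q(2) by (simp only: of_int_less_iff)
    then have q2: "real_of_int q \<le> 2 ^ n" by simp
    have "0 \<le> (x - X) / len" using x len unfolding x_def by simp
    then have "real i \<le> (x - X) / len" "(x - X) / len \<le> real i + 1" using ii unfolding x_def[symmetric] by linarith+
    then have d: "0 \<le> x - x0 i" "x - x0 i \<le> len" unfolding x0_def using len by (auto simp: field_simps)
    define E where "E = f x - f (x0 i) - p (x0 i) * (x - x0 i)"
    have qn: "q \<noteq> 0" using q by auto
    have E0: "0 \<le> E" unfolding E_def by (rule tangent_gap)
    have "E \<le> \<kappa> * (x - x0 i)\<^sup>2" unfolding E_def by (rule dual_upper[OF dp])
    also have "\<dots> \<le> \<kappa> * len\<^sup>2" using d kappa1 by (intro mult_left_mono power_mono) auto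
    finally have "of_int q * E \<le> 2 ^ n * (\<kappa> * len\<^sup>2)" using q1 q2 E0 by (intro mult_mono) auto
    also have "\<dots> = V" using len(3) by (simp add: mult_ac)
    finally have qE: "of_int q * E \<le> V" .
    have qE0: "0 \<le> of_int q * E" using E0 q1 by simp
    have "off i a q \<le> 2 ^ n * len" unfolding res_eq(1)[OF qn] x_def[symmetric]
      using d q1 q2 by (intro mult_mono) auto
    moreover have "0 \<le> off i a q" unfolding res_eq(1)[OF qn] x_def[symmetric] using d q1 by simp
    moreover have "0 \<le> res i q a b + V \<and> res i q a b + V \<le> 3 * V"
      unfolding res_eq(2)[OF qn] x_def[symmetric] E_def[symmetric] using fb qE qE0 unfolding x_def[symmetric] by linarith
    ultimately show ?thesis using q1 q2 by linarith
  qed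
  have pos: "(0::real) < 2 ^ n" "0 < 2 ^ n * len" "0 < 3 * V" using len(1) V0 by auto
  have sub: "F ` A \<subseteq> {..M} \<times> {..M} \<times> {..M}"
  proof
    fix y assume "y \<in> F ` A"
    then obtain q a b where qab: "(q, a, b) \<in> A" "y = F (q, a, b)" by auto
    note b = bd[OF qab(1)]
    show "y \<in> {..M} \<times> {..M} \<times> {..M}" unfolding qab(2) F_def
      using floor_cell_bounds[of "real_of_int q" "2 ^ n" M] floor_cell_bounds[of "off i a q" "2 ^ n * len" M]
        floor_cell_bounds[of "res i q a b + V" "3 * V" M] b pos by auto
  qed
  have "card {t \<in> A. F t = F s} \<le> card (bx i)" if s: "s \<in> A" for s
  proof -
    obtain q a b where ss: "s = (q, a, b)" by (cases s)
    define sh where "sh = (\<lambda>(q', a', b'). (q' - q, a' - a, b' - b))"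
    have "inj_on sh {t \<in> A. F t = F s}" unfolding sh_def by (auto simp: inj_on_def)
    moreover have "sh ` {t \<in> A. F t = F s} \<subseteq> bx i"
    proof
      fix y assume "y \<in> sh ` {t \<in> A. F t = F s}"
      then obtain q' a' b' where t: "(q', a', b') \<in> A" "F (q', a', b') = F s" "y = (q' - q, a' - a, b' - b)"
        unfolding sh_def by auto
      note b = bd[OF s[unfolded ss]] and b' = bd[OF t(1)]
      have Feq: "nat \<lfloor>real_of_int q' * real M / 2 ^ n\<rfloor> = nat \<lfloor>real_of_int q * real M / 2 ^ n\<rfloor>"
        "nat \<lfloor>off i a' q' * real M / (2 ^ n * len)\<rfloor> = nat \<lfloor>off i a q * real M / (2 ^ n * len)\<rfloor>"
        "nat \<lfloor>(res i q' a' b' + V) * real M / (3 * V)\<rfloor> = nat \<lfloor>(res i q a b + V) * real M / (3 * V)\<rfloor>"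
        using t(2) unfolding ss F_def by auto
      have "\<bar>real_of_int q' - real_of_int q\<bar> \<le> 2 ^ n / real M"
        by (rule floor_cell_eq[OF _ _ _ _ Feq(1)]) (use b b' pos M in auto)
      also have "\<dots> \<le> T'" unfolding T'_def using M N by (intro frac_le) auto
      finally have 1: "\<bar>real_of_int (q' - q)\<bar> \<le> T'" by simp
      have "\<bar>off i a' q' - off i a q\<bar> \<le> (2 ^ n * len) / real M"
        by (rule floor_cell_eq[OF _ _ _ _ Feq(2)]) (use b b' pos M in auto)
      also have "\<dots> \<le> tb" unfolding len(2) using M N tb by (simp add: field_simps)
      also have "off i a' q' - off i a q = off i (a' - a) (q' - q)" unfolding off_def by (simp add: algebra_simps)
      finally have 2: "\<bar>off i (a' - a) (q' - q)\<bar> \<le> tb" .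
      have "\<bar>(res i q' a' b' + V) - (res i q a b + V)\<bar> \<le> (3 * V) / real M"
        by (rule floor_cell_eq[OF _ _ _ _ Feq(3)]) (use b b' pos M in auto)
      also have "\<dots> \<le> 3 * V / N" using M N V0 by (intro frac_le) auto
      also have "(res i q' a' b' + V) - (res i q a b + V) = res i (q' - q) (a' - a) (b' - b)"
        unfolding res_def off_def by (simp add: algebra_simps)
      finally have 3: "\<bar>res i (q' - q) (a' - a) (b' - b)\<bar> \<le> 3 * V / N" .
      show "y \<in> bx i" unfolding t(3) bx_def using 1 2 3 by auto
    qed
    ultimately show ?thesis using box_card(1)[OF i] by (rule card_inj_on_le)
  qed
  from card_le_fibres[OF finA _ sub this]
  have "card A \<le> card ({..M} \<times> {..M} \<times> {..M}) * card (bx i)" by simp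
  also have "card ({..M} \<times> {..M} \<times> {..M}) = (M + 1) ^ 3" by (simp add: card_cartesian_product power3_eq_cube)
  finally have "real (card A) \<le> real ((M + 1) ^ 3 * card (bx i))" by (simp only: of_nat_le_iff)
  also have "\<dots> = (real M + 1) ^ 3 * real (card (bx i))" by (simp add: add.commute)
  also have "\<dots> \<le> (3 * N) ^ 3 * real (card (bx i))" using M by (intro mult_right_mono power_mono) auto
  finally show ?thesis unfolding A_def by (simp add: power_mult_distrib)
qed

text \<open>Every arc costs \<open>27 * N ^ 3\<close> times the size of its box, the boxes add up to
  about \<open>T'\<close>, and \<open>N ^ 3 * T' = V * 4 ^ n / ta\<close> is the expected number of
  points.\<close>

lemma near_pts_wide_bound:
  "real (card (near_pts f X n V)) \<le>
     27 / ta * (7 / tb + 7 / sqrt ta + 36 * C1 * (real n + 1) * r1 ^ Suc n) * (V * 4 ^ n)"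
proof -
  define A where "A i = {z \<in> near_pts f X n V. nat \<lfloor>(xcoord z - X) / len\<rfloor> = i}" for i
  have "near_pts f X n V \<subseteq> (\<Union>i\<le>I. A i)"
  proof
    fix z assume z: "z \<in> near_pts f X n V"
    have "xcoord z \<le> X + 1" using z unfolding near_pts_def xcoord_def by auto
    then have "(xcoord z - X) / len \<le> 1 / len" using len by (intro divide_right_mono) auto
    then have "nat \<lfloor>(xcoord z - X) / len\<rfloor> \<le> I" unfolding I_def by (intro nat_mono floor_mono)
    then show "z \<in> (\<Union>i\<le>I. A i)" using z unfolding A_def by blast
  qed
  then have "card (near_pts f X n V) \<le> card (\<Union>i\<le>I. A i)"
    by (intro card_mono) (auto simp: A_def finite_near_pts)
  then have "real (card (near_pts f X n V)) \<le> real (card (\<Union>i\<le>I. A i))" by simp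
  also have "\<dots> \<le> (\<Sum>i\<le>I. real (card (A i)))" by (rule real_card_UN_le) simp
  also have "\<dots> \<le> (\<Sum>i\<le>I. 27 * N ^ 3 * (7 + 2 * real (card (pbx i))))"
  proof (rule sum_mono)
    fix i assume i: "i \<in> {..I}"
    then have "real (card (A i)) \<le> 27 * N ^ 3 * real (card (bx i))" unfolding A_def by (intro cell_card) simp
    also have "\<dots> \<le> 27 * N ^ 3 * (7 + 2 * real (card (pbx i)))"
      using box_card(2)[of i] i N by (intro mult_left_mono) auto
    finally show "real (card (A i)) \<le> 27 * N ^ 3 * (7 + 2 * real (card (pbx i)))" .
  qed
  also have "\<dots> = 27 * N ^ 3 * (7 * (real I + 1) + 2 * (\<Sum>i\<le>I. real (card (pbx i))))"
    by (simp add: sum_distrib_left[symmetric] sum.distrib) 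
  \<comment> \<open>\<open>T' / sqrt ta \<ge> 1\<close> pays for the one arc beyond
    \<open>1 / len\<close>.\<close>
  also have "\<dots> \<le> 27 * N ^ 3 * (7 * (T' / tb + T' / sqrt ta) + 2 * (18 * C1 * (real n + 1) * r1 ^ Suc n * T'))"
  proof (intro mult_left_mono add_mono pbox_sum)
    have "real I \<le> 1 / len" unfolding I_def using len by simp
    then show "real I \<le> T' / tb" unfolding len_def by simp
    show "1 \<le> T' / sqrt ta" using T' ta by simp
  qed (use N in auto)
  also have "\<dots> = 27 * (N ^ 3 * T') * (7 / tb + 7 / sqrt ta + 36 * C1 * (real n + 1) * r1 ^ Suc n)"
    by (simp add: algebra_simps)
  also have "N ^ 3 * T' = V * 4 ^ n / ta"
  proof -
    have "N ^ 3 * T' = N\<^sup>2 * (T' * N)" by (simp add: power2_eq_square power3_eq_cube)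
    also have "\<dots> = 2 ^ n * V / ta * 2 ^ n" unfolding T'(2) N(2) ..
    also have "\<dots> = V * (2 ^ n * 2 ^ n) / ta" by simp
    also have "(2::real) ^ n * 2 ^ n = 4 ^ n" by (simp add: power_mult_distrib[symmetric])
    finally show ?thesis .
  qed
  finally have 1: "real (card (near_pts f X n V)) \<le>
     27 * (V * 4 ^ n / ta) * (7 / tb + 7 / sqrt ta + 36 * C1 * (real n + 1) * r1 ^ Suc n)" .
  have "27 * (w / ta) * e = 27 / ta * e * w" for w e by simp
  then show ?thesis using 1 by (simp only:)
qed

text \<open>Removes the constants that are private to the context.\<close>

lemmas near_pts_wide = near_pts_wide_bound[unfolded tb_def ta_def]

end

lemma nat_le_geometric:
  fixes r :: real
  assumes "1 < r"
  shows "real n \<le> r ^ n / (r - 1)"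
proof -
  have "1 + real n * (r - 1) \<le> (1 + (r - 1)) ^ n" by (rule Bernoulli_inequality) (use assms in simp)
  then have "real n * (r - 1) \<le> r ^ n" by simp
  then show ?thesis using assms by (simp add: field_simps)
qed

text \<open>The two ranges of \<open>V\<close> meet at \<open>c / 2 ^ n\<close>. The wide one loses
  a factor \<open>real n + 1\<close>, which the passage from \<open>sqrt r\<close> to
  \<open>r\<close> absorbs.\<close>

theorem near_pts_bound:
  fixes \<kappa> r :: real
  assumes \<kappa>: "1 \<le> \<kappa>" and r: "1 < r"
  obtains C where "0 < C"
    "\<And>n f p h g X V. dual_pair \<kappa> f p h g \<Longrightarrow> 0 < V \<Longrightarrow> V \<le> 1 \<Longrightarrow>
       real (card (near_pts f X n V)) \<le> C * (real n * 2 ^ n + V * 4 ^ n * r ^ n)"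
proof -
  define r1 where "r1 = sqrt r"
  have r1: "1 < r1" "r1\<^sup>2 = r" unfolding r1_def using r by auto
  obtain c C where c: "0 < c" "c \<le> 1" and C: "0 < C"
    and bd: "\<And>n f p h g X V. dual_pair \<kappa> f p h g \<Longrightarrow> 0 < V \<Longrightarrow> V \<le> c / 2 ^ n \<Longrightarrow>
       real (card (near_pts f X n V)) \<le> C * (real n * 2 ^ n + V * 4 ^ n * r1 ^ n)"
    using near_pts_small_bound[OF \<kappa> r1(1)] by blast
  define C1 where "C1 = C * (1 / (r1 - 1) + 1)"
  have C1: "0 < C1" unfolding C1_def using C r1 by (simp add: add_pos_pos)
  have diag: "real (card (near_pts f Y m (c / 2 ^ m))) \<le> C1 * 2 ^ m * r1 ^ m"
    if dp: "dual_pair \<kappa> f p h g" for f p h g Y m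
  proof -
    have "real (card (near_pts f Y m (c / 2 ^ m))) \<le> C * (real m * 2 ^ m + c / 2 ^ m * 4 ^ m * r1 ^ m)"
      using c by (intro bd[OF dp]) auto
    also have "c / 2 ^ m * 4 ^ m * r1 ^ m = c * (2 ^ m * r1 ^ m)"
    proof -
      have "(4::real) ^ m = 2 ^ m * 2 ^ m" by (simp add: power_mult_distrib[symmetric])
      then show ?thesis by simp
    qed
    also have "C * (real m * 2 ^ m + c * (2 ^ m * r1 ^ m)) \<le> C * (r1 ^ m / (r1 - 1) * 2 ^ m + 1 * (2 ^ m * r1 ^ m))"
      using nat_le_geometric[OF r1(1), of m] C c r1 by (intro mult_left_mono add_mono mult_right_mono) auto
    also have "\<dots> = C1 * 2 ^ m * r1 ^ m" unfolding C1_def by (simp add: algebra_simps)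
    finally show ?thesis .
  qed
  define B where "B = 7 / sqrt (c / 8 / \<kappa>) + 7 / sqrt (c / 8)"
  have B: "0 \<le> B" unfolding B_def using c \<kappa> by simp
  define D where "D = 27 / (c / 8) * (B + 36 * C1 * (r / (r1 - 1)))"
  have D: "0 \<le> D" unfolding D_def using c B C1 r r1 by simp
  have "real (card (near_pts f X n V)) \<le> (C + D) * (real n * 2 ^ n + V * 4 ^ n * r ^ n)"
    if dp: "dual_pair \<kappa> f p h g" and V: "0 < V" "V \<le> 1" for n f p h g X V
  proof (cases "V \<le> c / 2 ^ n")
    case True
    have "real (card (near_pts f X n V)) \<le> C * (real n * 2 ^ n + V * 4 ^ n * r1 ^ n)"
      by (rule bd[OF dp V(1) True])
    also have "\<dots> \<le> C * (real n * 2 ^ n + V * 4 ^ n * r ^ n)"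
    proof (intro mult_left_mono add_left_mono power_mono)
      show "r1 \<le> r" using r1 self_le_power[of r1 2] by simp
    qed (use V C r1 in auto)
    also have "\<dots> \<le> (C + D) * (real n * 2 ^ n + V * 4 ^ n * r ^ n)"
      using D V r by (intro mult_right_mono) auto
    finally show ?thesis .
  next
    case False
    then have Vc: "c / 2 ^ n \<le> V" by simp
    have "real (card (near_pts f X n V)) \<le>
       27 / (c / 8) * (7 / sqrt (c / 8 / \<kappa>) + 7 / sqrt (c / 8) + 36 * C1 * (real n + 1) * r1 ^ Suc n) * (V * 4 ^ n)"
      by (rule near_pts_wide[OF dp c r1(1) C1 diag[OF dp] Vc V(2)])
    also have "\<dots> \<le> 27 / (c / 8) * (B + 36 * C1 * (r / (r1 - 1))) * r ^ n * (V * 4 ^ n)"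
    proof (rule mult_right_mono)
      have "(real n + 1) * r1 ^ Suc n \<le> r1 ^ Suc n / (r1 - 1) * r1 ^ Suc n"
        using nat_le_geometric[OF r1(1), of "Suc n"] r1 by (intro mult_right_mono) auto
      also have "\<dots> = (r1\<^sup>2) ^ Suc n / (r1 - 1)" by (simp add: power2_eq_square power_mult_distrib)
      also have "\<dots> = r / (r1 - 1) * r ^ n" unfolding r1(2) by simp
      finally have 1: "(real n + 1) * r1 ^ Suc n \<le> r / (r1 - 1) * r ^ n" .
      have "B * 1 \<le> B * r ^ n" using B r by (intro mult_left_mono) auto
      then have "B + 36 * C1 * ((real n + 1) * r1 ^ Suc n) \<le> B * r ^ n + 36 * C1 * (r / (r1 - 1) * r ^ n)"
        using 1 C1 by (intro add_mono mult_left_mono) auto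
      also have "\<dots> = (B + 36 * C1 * (r / (r1 - 1))) * r ^ n" by (simp add: algebra_simps)
      finally have "27 / (c / 8) * (B + 36 * C1 * ((real n + 1) * r1 ^ Suc n)) \<le>
         27 / (c / 8) * ((B + 36 * C1 * (r / (r1 - 1))) * r ^ n)" using c by (intro mult_left_mono) auto
      then show "27 / (c / 8) * (7 / sqrt (c / 8 / \<kappa>) + 7 / sqrt (c / 8) + 36 * C1 * (real n + 1) * r1 ^ Suc n)
        \<le> 27 / (c / 8) * (B + 36 * C1 * (r / (r1 - 1))) * r ^ n"
        unfolding B_def by (simp only: mult.assoc)
    qed (use V in simp)
    also have "\<dots> = D * (V * 4 ^ n * r ^ n)" unfolding D_def by (simp only: mult_ac)
    also have "\<dots> \<le> (C + D) * (real n * 2 ^ n + V * 4 ^ n * r ^ n)"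
      using D C V r by (intro mult_mono) auto
    finally show ?thesis .
  qed
  then show thesis using that[of "C + D"] C D by simp
qed

section \<open>The Fejer kernel\<close>

text \<open>The additive character of period 1, commonly written e(x).\<close>

definition ee :: "real \<Rightarrow> complex" where "ee x = cis (2 * pi * x)"

text \<open>Normalised to have integral 1 over a period; \<open>fejer_sin\<close> is the closed
  form.\<close>

definition fejer :: "nat \<Rightarrow> real \<Rightarrow> real" where
  "fejer M x = 1 + 2 * (\<Sum>m\<in>{1..<M}. (1 - real m / real M) * cos (2 * pi * (real m * x)))"

lemma ee_add: "ee (x + y) = ee x * ee y"
  by (simp add: ee_def cis_mult algebra_simps)

lemma norm_ee [simp]: "norm (ee x) = 1"
  by (simp add: ee_def)

lemma ee_int [simp]: "ee (of_int k) = 1"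
  by (simp add: ee_def cis_multiple_2pi)

lemma ee_0 [simp]: "ee 0 = 1"
  by (simp add: ee_def)

lemma ee_minus: "ee (- x) = cnj (ee x)"
  by (simp add: ee_def cis_cnj)

lemma ee_cos: "ee x + ee (- x) = 2 * of_real (cos (2 * pi * x))"
  by (simp add: ee_def complex_eq_iff)

lemma has_vector_derivative_ee:
  assumes "(f has_real_derivative f') (at x within S)"
  shows "((\<lambda>x. ee (f x)) has_vector_derivative (2 * pi * f') *\<^sub>R (\<i> * ee (f x))) (at x within S)"
proof -
  have "((\<lambda>x. 2 * pi * f x) has_real_derivative 2 * pi * f') (at x within S)"
    using assms by (auto intro!: derivative_eq_intros)
  then have 1: "((\<lambda>x. 2 * pi * f x) has_vector_derivative 2 * pi * f') (at x within S)"
    by (simp add: has_real_derivative_iff_has_vector_derivative)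
  have 2: "(cis has_vector_derivative \<i> * cis y) (at y)" for y
  proof -
    have "((\<lambda>t. exp (\<i> * of_real t)) has_vector_derivative \<i> * exp (\<i> * of_real y)) (at y)"
      by (auto intro!: derivative_eq_intros has_vector_derivative_real_field simp: mult.commute)
    then show ?thesis by (simp add: cis_conv_exp[abs_def])
  qed
  show ?thesis
    using vector_diff_chain_within[OF 1 has_vector_derivative_at_within[OF 2]]
    unfolding ee_def by (simp add: o_def)
qed

lemma continuous_on_ee [continuous_intros]:
  assumes "continuous_on S f"
  shows "continuous_on S (\<lambda>x. ee (f x))"
  unfolding ee_def cis_conv_exp by (intro continuous_intros assms)

lemma dirichlet_kernel_sin:
  "sin a * (1 + 2 * (\<Sum>m\<in>{1..M}. cos (2 * real m * a))) = sin ((2 * real M + 1) * a)"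
proof (induction M)
  case (Suc M)
  have "2 * (sin a * cos (2 * real (Suc M) * a)) = sin ((2 * real (Suc M) + 1) * a) - sin ((2 * real M + 1) * a)"
  proof -
    have "(2 * real (Suc M) + 1) * a = 2 * real (Suc M) * a + a" "(2 * real M + 1) * a = 2 * real (Suc M) * a - a"
      by (simp_all add: algebra_simps)
    then show ?thesis by (simp only: sin_add sin_diff) simp
  qed
  then show ?case using Suc by (simp add: distrib_left)
qed simp

text \<open>Raising \<open>M\<close> by one adds a Dirichlet kernel, and the squares of
  \<open>sin (M a)\<close> and \<open>sin ((M + 1) a)\<close> differ by
  \<open>sin a * sin ((2 M + 1) a)\<close>. The factor \<open>(sin a)\<^sup>2\<close> stays on the
  left so that its zeros need no separate case.\<close>

lemma fejer_kernel_sin: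
  "(sin a)\<^sup>2 * (real M + 2 * (\<Sum>m\<in>{1..<M}. (real M - real m) * cos (2 * real m * a))) = (sin (real M * a))\<^sup>2"
proof (induction M)
  case (Suc M)
  have "(\<Sum>m\<in>{1..<Suc M}. (real (Suc M) - real m) * cos (2 * real m * a))
     = (\<Sum>m\<in>{1..M}. (real M - real m) * cos (2 * real m * a)) + (\<Sum>m\<in>{1..M}. cos (2 * real m * a))"
    by (simp add: sum.distrib[symmetric] atLeastLessThanSuc_atLeastAtMost algebra_simps)
  also have "(\<Sum>m\<in>{1..M}. (real M - real m) * cos (2 * real m * a)) = (\<Sum>m\<in>{1..<M}. (real M - real m) * cos (2 * real m * a))"
  proof (cases M)
    case (Suc k)
    then have "{1..M} = insert M {1..<M}" by auto
    then show ?thesis by simp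
  qed simp
  finally have "(sin a)\<^sup>2 * (real (Suc M) + 2 * (\<Sum>m\<in>{1..<Suc M}. (real (Suc M) - real m) * cos (2 * real m * a)))
     = (sin a)\<^sup>2 * (real M + 2 * (\<Sum>m\<in>{1..<M}. (real M - real m) * cos (2 * real m * a))) +
       sin a * (sin a * (1 + 2 * (\<Sum>m\<in>{1..M}. cos (2 * real m * a))))"
    by (simp add: algebra_simps power2_eq_square)
  also have "\<dots> = (sin (real M * a))\<^sup>2 + sin a * sin ((2 * real M + 1) * a)"
    by (simp only: Suc dirichlet_kernel_sin)
  also have "\<dots> = (sin (real (Suc M) * a))\<^sup>2"
  proof -
    define b where "b = real M * a"
    have e: "(2 * real M + 1) * a = (b + b) + a" "real (Suc M) * a = b + a"
      by (simp_all add: b_def algebra_simps)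
    have c: "(cos b)\<^sup>2 = 1 - (sin b)\<^sup>2" "(cos a)\<^sup>2 = 1 - (sin a)\<^sup>2" by (simp_all add: cos_squared_eq)
    have s1: "sin ((b + b) + a) = 2 * (sin b * cos b) * cos a + ((cos b)\<^sup>2 - (sin b)\<^sup>2) * sin a"
      by (simp only: sin_add[of "b + b" a] sin_add[of b b] cos_add[of b b]) (simp add: power2_eq_square)
    have "(sin b)\<^sup>2 + sin a * sin ((b + b) + a) - (sin (b + a))\<^sup>2
      = (sin b)\<^sup>2 + 2 * sin a * cos a * sin b * cos b + (sin a)\<^sup>2 * ((cos b)\<^sup>2 - (sin b)\<^sup>2)
        - ((sin b)\<^sup>2 * (cos a)\<^sup>2 + 2 * sin a * cos a * sin b * cos b + (cos b)\<^sup>2 * (sin a)\<^sup>2)"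
      unfolding s1 sin_add[of b a] by (simp add: power2_eq_square algebra_simps)
    also have "\<dots> = 0" unfolding c by (simp add: algebra_simps)
    finally show ?thesis unfolding e b_def[symmetric] by simp
  qed
  finally show ?case .
qed simp

lemma fejer_sin:
  assumes "0 < M"
  shows "(sin (pi * x))\<^sup>2 * (real M * fejer M x) = (sin (real M * (pi * x)))\<^sup>2"
proof -
  have "real M * fejer M x = real M + 2 * (\<Sum>m\<in>{1..<M}. (real M - real m) * cos (2 * real m * (pi * x)))"
  proof -
    have "real M * ((1 - real m / real M) * cos (2 * pi * (real m * x))) = (real M - real m) * cos (2 * real m * (pi * x))" for m
    proof -
      have "2 * pi * (real m * x) = 2 * real m * (pi * x)" by (simp only: mult_ac)
      moreover have "real M * (1 - real m / real M) = real M - real m" using assms by (simp add: right_diff_distrib)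
      ultimately show ?thesis by (metis mult.assoc)
    qed
    then show ?thesis unfolding fejer_def
      by (simp only: distrib_left mult.left_commute[of "real M" 2] sum_distrib_left mult_1_right)
  qed
  then show ?thesis by (simp only: fejer_kernel_sin)
qed

text \<open>\<open>y = pi * x\<close> is at most 2 because \<open>pi < 4\<close>, so Taylor's
  formula gives \<open>sin y \<ge> y - y ^ 3 / 6 \<ge> y / 3\<close>, and
  \<open>y \<ge> 2 * x\<close>.\<close>

lemma sin_pi_lower:
  assumes "0 \<le> x" "x \<le> 1 / 2"
  shows "x / 2 \<le> sin (pi * x)"
proof -
  define y where "y = pi * x"
  have y: "0 \<le> y" "y \<le> 2" unfolding y_def using assms pi_less_4 mult_mono[of pi 4 x "1/2"] by auto
  have "\<bar>sin y - (\<Sum>m<3. sin_coeff m * y ^ m)\<bar> \<le> inverse (fact 3) * \<bar>y\<bar> ^ 3"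
    by (rule Maclaurin_sin_bound)
  moreover have "(\<Sum>m<3. sin_coeff m * y ^ m) = y"
    by (simp add: eval_nat_numeral sin_coeff_def)
  ultimately have "\<bar>sin y - y\<bar> \<le> y ^ 3 / 6" using y by (simp add: eval_nat_numeral fact_numeral)
  moreover have "y ^ 3 \<le> 4 * y"
  proof -
    have "y * y \<le> 2 * 2" using y by (intro mult_mono) auto
    then have "(y * y) * y \<le> 4 * y" using y by (intro mult_right_mono) auto
    then show ?thesis by (simp add: power3_eq_cube)
  qed
  ultimately have "y / 3 \<le> sin y" by linarith
  moreover have "2 * x \<le> y" unfolding y_def using pi_ge_two assms by (intro mult_right_mono) auto
  ultimately show ?thesis unfolding y_def[symmetric] using assms by linarith
qed

lemma fejer_bounds:
  assumes M: "0 < M" and x: "0 \<le> x" "x \<le> 1 / 2"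
  shows "0 \<le> fejer M x" "x\<^sup>2 * fejer M x \<le> 4 / real M"
proof -
  show 0: "0 \<le> fejer M x"
  proof (cases "x = 0")
    case True
    then show ?thesis unfolding fejer_def using M by (auto intro!: add_nonneg_nonneg sum_nonneg simp: field_simps)
  next
    case False
    then have "0 < (sin (pi * x))\<^sup>2" using sin_pi_lower[OF x] x by simp
    then show ?thesis using fejer_sin[OF M, of x] M
      by (metis mult_less_0_iff not_le of_nat_0_less_iff order_less_imp_not_less zero_le_power2)
  qed
  have "(x / 2)\<^sup>2 \<le> (sin (pi * x))\<^sup>2" using sin_pi_lower[OF x] x by (intro power_mono) auto
  then have "(x / 2)\<^sup>2 * (real M * fejer M x) \<le> (sin (pi * x))\<^sup>2 * (real M * fejer M x)"
    using 0 by (intro mult_right_mono) auto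
  also have "\<dots> \<le> 1" unfolding fejer_sin[OF M] by (simp add: abs_square_le_1)
  finally show "x\<^sup>2 * fejer M x \<le> 4 / real M" using M by (simp add: power_divide field_simps)
qed

lemma continuous_fejer [continuous_intros]:
  fixes g :: "real \<Rightarrow> real"
  shows
  "continuous_on S g \<Longrightarrow> continuous_on S (\<lambda>x. fejer M (g x))"
  unfolding fejer_def by (auto intro!: continuous_intros)

lemma fejer_half_integral: "(fejer M has_integral 1 / 2) {0..1 / 2}"
proof -
  define H where "H x = x + 2 * (\<Sum>m\<in>{1..<M}. (1 - real m / real M) * (sin (2 * pi * (real m * x)) / (2 * pi * real m)))" for x
  have d: "(H has_vector_derivative fejer M x) (at x within {0..1/2})" for x
    unfolding has_real_derivative_iff_has_vector_derivative[symmetric] H_def fejer_def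
    by (auto intro!: derivative_eq_intros sum.cong simp: sum_distrib_left)
  have "(fejer M has_integral H (1 / 2) - H 0) {0..1 / 2}"
    by (rule fundamental_theorem_of_calculus) (use d in auto)
  moreover have "H (1 / 2) = 1 / 2"
  proof -
    have "sin (2 * pi * (real m * (1 / 2))) = 0" for m
      using sin_npi[of m] by (simp add: mult_ac)
    then show ?thesis by (simp add: H_def del: sin_npi)
  qed
  ultimately show ?thesis by (simp add: H_def)
qed

lemma fejer_int_shift: "fejer M (x + of_int k) = fejer M x"
proof -
  have "cos (2 * pi * (real m * (x + of_int k))) = cos (2 * pi * (real m * x))" for m
  proof -
    have "2 * pi * (real m * (x + of_int k)) = 2 * pi * (real m * x) + 2 * pi * of_int (int m * k)"
      by (simp add: algebra_simps)
    then show ?thesis by (simp only: cos_add sin_int_2pin cos_int_2pin)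
  qed
  then show ?thesis by (simp add: fejer_def)
qed

lemma fejer_minus: "fejer M (- x) = fejer M x"
  by (simp add: fejer_def)

text \<open>Half of the mass of the kernel lies on \<open>{0..1 / 2}\<close> and concentrates at 0.
  The one-sided form gives the integers at the ends of a summation interval their weight one
  half.\<close>

lemma fejer_half:
  fixes g :: "real \<Rightarrow> complex"
  assumes M: "0 < M" and cont: "continuous_on {0..1 / 2} g"
    and lip: "\<And>x. 0 \<le> x \<Longrightarrow> x \<le> 1 / 2 \<Longrightarrow> norm (g x - g 0) \<le> \<Lambda> * x" and L: "0 \<le> \<Lambda>"
  shows "norm (integral {0..1 / 2} (\<lambda>x. fejer M x *\<^sub>R g x) - g 0 / 2) \<le> 2 * \<Lambda> / sqrt (real M)"
proof -
  \<comment> \<open>Up to \<open>s\<close> the integral of the kernel is used, beyond it the decay;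
    this choice makes \<open>4 / (real M * s) = s\<close>, which balances the two.\<close>
  define s where "s = 2 / sqrt (real M)"
  have s: "0 < s" using M by (simp add: s_def)
  have 1: "((\<lambda>x. fejer M x *\<^sub>R g 0) has_integral (1 / 2) *\<^sub>R g 0) {0..1 / 2}"
    by (rule has_integral_scaleR_left[OF fejer_half_integral])
  have int1: "(\<lambda>x. fejer M x *\<^sub>R g x) integrable_on {0..1 / 2}"
    by (intro integrable_continuous_interval continuous_intros cont)
  have eq: "integral {0..1 / 2} (\<lambda>x. fejer M x *\<^sub>R g x) - g 0 / 2
     = integral {0..1 / 2} (\<lambda>x. fejer M x *\<^sub>R (g x - g 0))"
  proof -
    have "integral {0..1 / 2} (\<lambda>x. fejer M x *\<^sub>R g x - fejer M x *\<^sub>R g 0) =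
        integral {0..1 / 2} (\<lambda>x. fejer M x *\<^sub>R g x) - integral {0..1 / 2} (\<lambda>x. fejer M x *\<^sub>R g 0)"
      by (rule integral_diff[OF int1 has_integral_integrable[OF 1]])
    also have "integral {0..1 / 2} (\<lambda>x. fejer M x *\<^sub>R g 0) = g 0 / 2"
      using integral_unique[OF 1] by (simp add: scaleR_conv_of_real)
    finally show ?thesis by (simp add: scaleR_diff_right)
  qed
  have maj: "((\<lambda>x. \<Lambda> * (s * fejer M x + 4 / (real M * s))) has_integral \<Lambda> * (s * (1 / 2) + 4 / (real M * s) * (1 / 2))) {0..1 / 2}"
  proof (intro has_integral_mult_right has_integral_add fejer_half_integral)
    show "((\<lambda>x. 4 / (real M * s)) has_integral 4 / (real M * s) * (1 / 2)) {0..1 / 2 :: real}"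
      using has_integral_const_real[of "4 / (real M * s)" 0 "1/2"] by (simp add: mult.commute)
  qed
  have "norm (integral {0..1 / 2} (\<lambda>x. fejer M x *\<^sub>R (g x - g 0))) \<le>
      integral {0..1 / 2} (\<lambda>x. \<Lambda> * (s * fejer M x + 4 / (real M * s)))"
  proof (rule integral_norm_bound_integral)
    show "(\<lambda>x. fejer M x *\<^sub>R (g x - g 0)) integrable_on {0..1 / 2}"
      by (intro integrable_continuous_interval continuous_intros cont)
    show "(\<lambda>x. \<Lambda> * (s * fejer M x + 4 / (real M * s))) integrable_on {0..1 / 2}"
      using maj by (rule has_integral_integrable)
    fix x :: real assume "x \<in> {0..1 / 2}"
    then have x: "0 \<le> x" "x \<le> 1 / 2" by auto
    note F = fejer_bounds[OF M x]
    have "norm (fejer M x *\<^sub>R (g x - g 0)) \<le> fejer M x * (\<Lambda> * x)"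
      using F lip[OF x] by (simp add: mult_left_mono)
    also have "fejer M x * x \<le> s * fejer M x + 4 / (real M * s)"
    proof (cases "x \<le> s")
      case True
      then have "fejer M x * x \<le> fejer M x * s" using F by (intro mult_left_mono) auto
      also have "\<dots> = s * fejer M x" by (rule mult.commute)
      finally have "fejer M x * x \<le> s * fejer M x" .
      moreover have "0 \<le> 4 / (real M * s)" using s by simp
      ultimately show ?thesis by linarith
    next
      case False
      then have "s * (x * fejer M x) \<le> x * (x * fejer M x)" using F x by (intro mult_right_mono) auto
      also have "\<dots> \<le> 4 / real M" using F by (simp add: power2_eq_square mult_ac)
      finally have "x * fejer M x \<le> (4 / real M) / s" using s by (simp only: pos_le_divide_eq mult.commute)
      then have "fejer M x * x \<le> 4 / (real M * s)" by (simp add: mult.commute)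
      moreover have "0 \<le> s * fejer M x" using s F by simp
      ultimately show ?thesis by linarith
    qed
    then have "fejer M x * (\<Lambda> * x) \<le> \<Lambda> * (s * fejer M x + 4 / (real M * s))"
      using L by (metis mult.left_commute mult_left_mono)
    finally show "norm (fejer M x *\<^sub>R (g x - g 0)) \<le> \<Lambda> * (s * fejer M x + 4 / (real M * s))"
      using \<open>fejer M x * (\<Lambda> * x) \<le> _\<close> by linarith
  qed
  also have "\<dots> = \<Lambda> * (s * (1 / 2) + 4 / (real M * s) * (1 / 2))" by (rule integral_unique[OF maj])
  also have "\<dots> = 2 * \<Lambda> / sqrt (real M)"
  proof -
    have "real M = sqrt (real M) * sqrt (real M)" by simp
    then have "4 / (real M * s) = s" unfolding s_def using M by (simp add: field_simps)
    then show ?thesis unfolding s_def by simp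
  qed
  finally show ?thesis unfolding eq .
qed


lemma integral_reverse_unit:
  fixes f :: "real \<Rightarrow> complex"
  assumes "continuous_on {1 / 2..1} f"
  shows "integral {1 / 2..1} f = integral {0..1 / 2} (\<lambda>x. f (1 - x))"
proof -
  have "(f has_integral integral {1 / 2..1} f) (cbox (1 / 2) 1)"
    using integrable_integral[OF integrable_continuous_interval[OF assms]] by simp
  from has_integral_affinity[OF this, of "-1" 1]
  have "((\<lambda>x. f (1 - x)) has_integral integral {1 / 2..1} f) ((\<lambda>x. 1 - x) ` {1 / 2..1})"
    by simp
  moreover have "(\<lambda>x::real. 1 - x) ` {1 / 2..1} = {0..1 / 2}"
    by (auto simp: image_iff intro!: bexI[of _ "1 - _"])
  ultimately show ?thesis by (simp add: integral_unique)
qed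

lemma fejer_unit:
  fixes g :: "real \<Rightarrow> complex"
  assumes M: "0 < M" and L: "0 \<le> \<Lambda>"
    and lip: "\<And>x y. x \<in> {0..1} \<Longrightarrow> y \<in> {0..1} \<Longrightarrow> norm (g x - g y) \<le> \<Lambda> * \<bar>x - y\<bar>"
  shows "norm (integral {0..1} (\<lambda>x. fejer M x *\<^sub>R g x) - (g 0 + g 1) / 2) \<le> 4 * \<Lambda> / sqrt (real M)"
proof -
  have "\<Lambda>-lipschitz_on {0..1} g" by (rule lipschitz_onI) (use lip L in \<open>auto simp: dist_norm\<close>)
  then have cont: "continuous_on {0..1} g" by (rule lipschitz_on_continuous_on)
  have c1: "continuous_on {0..1 / 2} g" "continuous_on {1 / 2..1} g"
    by (auto intro: continuous_on_subset[OF cont])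
  have c2: "continuous_on {0..1 / 2} (\<lambda>x. g (1 - x))"
    by (rule continuous_on_compose2[OF cont]) (auto intro!: continuous_intros)
  have F1: "fejer M (1 - x) = fejer M x" for x
    using fejer_int_shift[of M "- x" 1] fejer_minus[of M x] by simp
  have "integral {0..1} (\<lambda>x. fejer M x *\<^sub>R g x) =
     integral {0..1 / 2} (\<lambda>x. fejer M x *\<^sub>R g x) + integral {1 / 2..1} (\<lambda>x. fejer M x *\<^sub>R g x)"
    by (rule Henstock_Kurzweil_Integration.integral_combine[symmetric])
      (auto intro!: integrable_continuous_interval continuous_intros cont)
  also have "integral {1 / 2..1} (\<lambda>x. fejer M x *\<^sub>R g x) = integral {0..1 / 2} (\<lambda>x. fejer M x *\<^sub>R g (1 - x))"
    by (subst integral_reverse_unit) (auto intro!: continuous_intros c1 simp: F1)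
  finally have eq: "integral {0..1} (\<lambda>x. fejer M x *\<^sub>R g x) - (g 0 + g 1) / 2
     = (integral {0..1 / 2} (\<lambda>x. fejer M x *\<^sub>R g x) - g 0 / 2) + (integral {0..1 / 2} (\<lambda>x. fejer M x *\<^sub>R g (1 - x)) - g 1 / 2)"
    by (simp add: add_divide_distrib)
  have 1: "norm (integral {0..1 / 2} (\<lambda>x. fejer M x *\<^sub>R g x) - g 0 / 2) \<le> 2 * \<Lambda> / sqrt (real M)"
    by (rule fejer_half[OF M c1(1) _ L]) (use lip[of _ 0] in auto)
  have 2: "norm (integral {0..1 / 2} (\<lambda>x. fejer M x *\<^sub>R g (1 - x)) - g (1 - 0) / 2) \<le> 2 * \<Lambda> / sqrt (real M)"
    by (rule fejer_half[OF M c2 _ L]) (use lip[of "1 - _" 1] in auto)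
  show ?thesis unfolding eq using 1 2 norm_triangle_ineq[of "integral {0..1 / 2} (\<lambda>x. fejer M x *\<^sub>R g x) - g 0 / 2"
     "integral {0..1 / 2} (\<lambda>x. fejer M x *\<^sub>R g (1 - x)) - g 1 / 2"] by simp
qed

lemma integral_int_shift:
  fixes f :: "real \<Rightarrow> complex"
  assumes "continuous_on {c..c + 1} f"
  shows "integral {c..c + 1} f = integral {0..1} (\<lambda>x. f (x + c))"
proof -
  have "(f has_integral integral {c..c + 1} f) (cbox c (c + 1))"
    using integrable_integral[OF integrable_continuous_interval[OF assms]] by simp
  from has_integral_affinity'[OF this, of 1 c]
  show ?thesis by (simp add: integral_unique)
qed

text \<open>Poisson summation with an explicit error: by \<open>fejer_integral_expand\<close> the
  integral is a weighted sum of Fourier integrals, and each integer gets weight 1, with one half at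
  both ends.\<close>

lemma fejer_interval:
  fixes g :: "real \<Rightarrow> complex"
  assumes M: "0 < M" and L: "0 \<le> \<Lambda>"
    and lip: "\<And>x y. x \<in> {of_int A..of_int A + of_nat k} \<Longrightarrow> y \<in> {of_int A..of_int A + of_nat k} \<Longrightarrow> norm (g x - g y) \<le> \<Lambda> * \<bar>x - y\<bar>"
  shows "norm (integral {of_int A..of_int A + of_nat k} (\<lambda>x. fejer M x *\<^sub>R g x)
     - (\<Sum>i<k. (g (of_int A + of_nat i) + g (of_int A + of_nat (Suc i))) / 2)) \<le> real k * (4 * \<Lambda> / sqrt (real M))"
  using lip
proof (induction k)
  case (Suc k)
  define c where "c = real_of_int A + real k"
  have lc: "\<Lambda>-lipschitz_on {of_int A..of_int A + of_nat (Suc k)} g"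
    by (rule lipschitz_onI) (use Suc.prems L in \<open>auto simp: dist_norm\<close>)
  have cont: "continuous_on {of_int A..c + 1} g"
    using lipschitz_on_continuous_on[OF lc] by (simp add: c_def add_ac)
  have Ac: "of_int A \<le> c" by (simp add: c_def)
  have "integral {of_int A..c + 1} (\<lambda>x. fejer M x *\<^sub>R g x) =
     integral {of_int A..c} (\<lambda>x. fejer M x *\<^sub>R g x) + integral {c..c + 1} (\<lambda>x. fejer M x *\<^sub>R g x)"
    by (rule Henstock_Kurzweil_Integration.integral_combine[symmetric])
      (use Ac in \<open>auto intro!: integrable_continuous_interval continuous_intros cont\<close>)
  also have "integral {c..c + 1} (\<lambda>x. fejer M x *\<^sub>R g x) = integral {0..1} (\<lambda>x. fejer M x *\<^sub>R g (x + c))"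
  proof -
    have "c = of_int (A + int k)" by (simp add: c_def)
    then have "fejer M (x + c) = fejer M x" for x by (simp only: fejer_int_shift)
    moreover have "continuous_on {c..c + 1} g" by (rule continuous_on_subset[OF cont]) (use Ac in auto)
    ultimately show ?thesis by (subst integral_int_shift) (auto intro!: continuous_intros)
  qed
  finally have eq: "integral {of_int A..c + 1} (\<lambda>x. fejer M x *\<^sub>R g x) =
     integral {of_int A..c} (\<lambda>x. fejer M x *\<^sub>R g x) + integral {0..1} (\<lambda>x. fejer M x *\<^sub>R g (x + c))" .
  have 1: "norm (integral {of_int A..c} (\<lambda>x. fejer M x *\<^sub>R g x)
     - (\<Sum>i<k. (g (of_int A + of_nat i) + g (of_int A + of_nat (Suc i))) / 2)) \<le> real k * (4 * \<Lambda> / sqrt (real M))"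
    unfolding c_def by (rule Suc.IH) (use Suc.prems in auto)
  have 2: "norm (integral {0..1} (\<lambda>x. fejer M x *\<^sub>R g (x + c)) - (g (0 + c) + g (1 + c)) / 2) \<le> 4 * \<Lambda> / sqrt (real M)"
  proof (rule fejer_unit[OF M L])
    fix x y :: real assume "x \<in> {0..1}" "y \<in> {0..1}"
    then show "norm (g (x + c) - g (y + c)) \<le> \<Lambda> * \<bar>x - y\<bar>"
      using Suc.prems[of "x + c" "y + c"] by (simp add: c_def)
  qed
  have c1: "of_int A + real (Suc k) = c + 1" by (simp add: c_def)
  define P where "P = integral {of_int A..c} (\<lambda>x. fejer M x *\<^sub>R g x)"
  define S where "S = (\<Sum>i<k. (g (of_int A + of_nat i) + g (of_int A + of_nat (Suc i))) / 2)"
  define P' where "P' = integral {0..1} (\<lambda>x. fejer M x *\<^sub>R g (x + c))"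
  have "norm ((P - S) + (P' - (g (0 + c) + g (1 + c)) / 2)) \<le> real k * (4 * \<Lambda> / sqrt (real M)) + 4 * \<Lambda> / sqrt (real M)"
    using 1 2 unfolding P_def S_def P'_def by (rule norm_triangle_le[OF add_mono])
  also have "\<dots> = real (Suc k) * (4 * \<Lambda> / sqrt (real M))" by (simp add: distrib_right add_divide_distrib)
  also have "(P - S) + (P' - (g (0 + c) + g (1 + c)) / 2) = P + P' - (S + (g c + g (c + 1)) / 2)"
    by (simp add: add.commute)
  finally show ?case unfolding c1 eq sum.lessThan_Suc c_def[symmetric] P_def[symmetric] P'_def[symmetric] S_def[symmetric] .
qed simp

lemma fejer_integral_expand:
  fixes g :: "real \<Rightarrow> complex"
  assumes cont: "continuous_on {a..b} g"
  shows "integral {a..b} (\<lambda>x. fejer M x *\<^sub>R g x) = integral {a..b} g +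
    (\<Sum>m\<in>{1..<M}. of_real (1 - real m / real M) *
       (integral {a..b} (\<lambda>x. ee (- (real m * x)) * g x) + integral {a..b} (\<lambda>x. ee (real m * x) * g x)))"
proof -
  have ig: "g integrable_on {a..b}" by (intro integrable_continuous_interval cont)
  have ie: "(\<lambda>x. ee (- (real m * x)) * g x) integrable_on {a..b}" "(\<lambda>x. ee (real m * x) * g x) integrable_on {a..b}" for m
    by (intro integrable_continuous_interval continuous_intros cont)+
  have "((\<lambda>x. g x + (\<Sum>m\<in>{1..<M}. of_real (1 - real m / real M) * (ee (- (real m * x)) * g x + ee (real m * x) * g x)))
    has_integral (integral {a..b} g + (\<Sum>m\<in>{1..<M}. of_real (1 - real m / real M) *
       (integral {a..b} (\<lambda>x. ee (- (real m * x)) * g x) + integral {a..b} (\<lambda>x. ee (real m * x) * g x))))) {a..b}"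
    by (intro has_integral_add has_integral_sum has_integral_mult_right integrable_integral ig ie) simp
  moreover have "g x + (\<Sum>m\<in>{1..<M}. of_real (1 - real m / real M) * (ee (- (real m * x)) * g x + ee (real m * x) * g x))
     = fejer M x *\<^sub>R g x" for x
  proof -
    have "of_real (1 - real m / real M) * (ee (- (real m * x)) * g x + ee (real m * x) * g x)
       = of_real (2 * ((1 - real m / real M) * cos (2 * pi * (real m * x)))) * g x" for m
    proof -
      have "ee (- (real m * x)) * g x + ee (real m * x) * g x = (ee (real m * x) + ee (- (real m * x))) * g x"
        by (simp add: algebra_simps)
      also have "\<dots> = of_real (2 * cos (2 * pi * (real m * x))) * g x" unfolding ee_cos by simp
      finally show ?thesis by simp
    qed
    then have "(\<Sum>m\<in>{1..<M}. of_real (1 - real m / real M) * (ee (- (real m * x)) * g x + ee (real m * x) * g x))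
      = (\<Sum>m\<in>{1..<M}. of_real (2 * ((1 - real m / real M) * cos (2 * pi * (real m * x)))) * g x)"
      by (simp only:)
    also have "\<dots> = of_real (2 * (\<Sum>m\<in>{1..<M}. (1 - real m / real M) * cos (2 * pi * (real m * x)))) * g x"
      by (simp only: sum_distrib_right[symmetric] of_real_sum[symmetric] sum_distrib_left[symmetric])
    finally show ?thesis unfolding fejer_def
      by (simp only: scaleR_conv_of_real distrib_right of_real_add of_real_1 mult_1_left)
  qed
  ultimately show ?thesis by (simp add: integral_unique)
qed

section \<open>Truncated Poisson summation\<close>

text \<open>One integration by parts. As \<open>F2 \<ge> 0\<close>, the factor
  \<open>1 / (F1 x - m)\<close> is monotone, and the remaining integral is bounded by its total
  variation. The boundary terms are kept exactly because those of \<open>m\<close> and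
  \<open>- m\<close> have to cancel later.\<close>

lemma phase_integral_boundary:
  fixes F F1 F2 :: "real \<Rightarrow> real"
  assumes ab: "a \<le> b"
    and d1: "\<And>x. x \<in> {a..b} \<Longrightarrow> (F has_real_derivative F1 x) (at x within {a..b})"
    and d2: "\<And>x. x \<in> {a..b} \<Longrightarrow> (F1 has_real_derivative F2 x) (at x within {a..b})"
    and pos: "\<And>x. x \<in> {a..b} \<Longrightarrow> 0 \<le> F2 x"
    and ne: "\<And>x. x \<in> {a..b} \<Longrightarrow> F1 x \<noteq> m"
  shows "norm (integral {a..b} (\<lambda>x. ee (F x - m * x)) -
     (ee (F b - m * b) * of_real (1 / (F1 b - m)) - ee (F a - m * a) * of_real (1 / (F1 a - m))) / (2 * of_real pi * \<i>))
     \<le> (1 / (F1 a - m) - 1 / (F1 b - m)) / (2 * pi)"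
proof -
  define r where "r x = 1 / (F1 x - m)" for x
  define R where "R x = ee (F x - m * x) * of_real (r x) / (2 * of_real pi * \<i>)" for x
  define h where "h x = ee (F x - m * x) * of_real (F2 x / (F1 x - m)\<^sup>2) / (2 * of_real pi * \<i>)" for x
  have dr: "(r has_real_derivative - (F2 x / (F1 x - m)\<^sup>2)) (at x within {a..b})" if x: "x \<in> {a..b}" for x
    unfolding r_def using ne[OF x] by (auto intro!: derivative_eq_intros d2[OF x] simp: power2_eq_square)
  have dF: "((\<lambda>x. F x - m * x) has_real_derivative F1 x - m) (at x within {a..b})" if x: "x \<in> {a..b}" for x
    by (auto intro!: derivative_eq_intros d1[OF x])
  have cF: "continuous_on {a..b} (\<lambda>x. F x - m * x)"
    using dF by (intro DERIV_continuous_on) 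
  have dR: "(R has_vector_derivative (ee (F x - m * x) - h x)) (at x within {a..b})" if x: "x \<in> {a..b}" for x
  proof -
    have 1: "((\<lambda>x. ee (F x - m * x)) has_vector_derivative (2 * pi * (F1 x - m)) *\<^sub>R (\<i> * ee (F x - m * x))) (at x within {a..b})"
      by (rule has_vector_derivative_ee[OF dF[OF x]])
    have 2: "((\<lambda>x. complex_of_real (r x)) has_vector_derivative of_real (- (F2 x / (F1 x - m)\<^sup>2))) (at x within {a..b})"
      by (rule has_vector_derivative_of_real[OF dr[OF x]])
    have "(R has_vector_derivative (ee (F x - m * x) * of_real (- (F2 x / (F1 x - m)\<^sup>2)) +
        (2 * pi * (F1 x - m)) *\<^sub>R (\<i> * ee (F x - m * x)) * of_real (r x)) / (2 * of_real pi * \<i>)) (at x within {a..b})"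
      unfolding R_def by (intro has_vector_derivative_divide has_vector_derivative_mult 1 2)
    moreover have "(ee (F x - m * x) * of_real (- (F2 x / (F1 x - m)\<^sup>2)) +
        (2 * pi * (F1 x - m)) *\<^sub>R (\<i> * ee (F x - m * x)) * of_real (r x)) / (2 * of_real pi * \<i>)
        = ee (F x - m * x) - h x"
    proof -
      have "(F1 x - m) * r x = 1" unfolding r_def using ne[OF x] by simp
      then have "complex_of_real (F1 x - m) * of_real (r x) = 1" by (metis of_real_1 of_real_mult)
      then have e1: "complex_of_real (F1 x - m) * of_real (r x) * w = w" for w by simp
      have "(2 * pi * (F1 x - m)) *\<^sub>R (\<i> * ee (F x - m * x)) * of_real (r x)
         = complex_of_real (F1 x - m) * of_real (r x) * ((2 * of_real pi * \<i>) * ee (F x - m * x))"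
        by (simp only: scaleR_conv_of_real of_real_mult of_real_numeral mult_ac)
      then have "(2 * pi * (F1 x - m)) *\<^sub>R (\<i> * ee (F x - m * x)) * of_real (r x) = (2 * of_real pi * \<i>) * ee (F x - m * x)"
        by (simp only: e1)
      then show ?thesis unfolding h_def by (simp add: add_divide_distrib diff_divide_distrib)
    qed
    ultimately show ?thesis by simp
  qed
  have ei: "(\<lambda>x. ee (F x - m * x)) integrable_on {a..b}"
    by (intro integrable_continuous_interval continuous_intros cF)
  have "((\<lambda>x. ee (F x - m * x) - h x) has_integral R b - R a) {a..b}"
    by (rule fundamental_theorem_of_calculus[OF ab dR])
  from has_integral_diff[OF integrable_integral[OF ei] this]
  have hI: "(h has_integral integral {a..b} (\<lambda>x. ee (F x - m * x)) - (R b - R a)) {a..b}" by simp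
  have "((\<lambda>x. - r x / (2 * pi)) has_real_derivative (F2 x / (F1 x - m)\<^sup>2) / (2 * pi)) (at x within {a..b})" if "x \<in> {a..b}" for x
    by (auto intro!: derivative_eq_intros dr[OF that])
  then have "((\<lambda>x. (F2 x / (F1 x - m)\<^sup>2) / (2 * pi)) has_integral - r b / (2 * pi) - (- r a / (2 * pi))) {a..b}"
    by (intro fundamental_theorem_of_calculus[OF ab]) (simp add: has_real_derivative_iff_has_vector_derivative)
  then have gI: "((\<lambda>x. (F2 x / (F1 x - m)\<^sup>2) / (2 * pi)) has_integral (r a - r b) / (2 * pi)) {a..b}"
    by (simp add: diff_divide_distrib)
  have "norm (integral {a..b} h) \<le> integral {a..b} (\<lambda>x. (F2 x / (F1 x - m)\<^sup>2) / (2 * pi))"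
  proof (rule integral_norm_bound_integral)
    fix x assume "x \<in> {a..b}"
    then show "norm (h x) \<le> (F2 x / (F1 x - m)\<^sup>2) / (2 * pi)"
      unfolding h_def norm_divide norm_mult norm_ee norm_of_real using pos by (simp add: abs_of_nonneg)
  qed (use hI gI in \<open>auto intro: has_integral_integrable\<close>)
  then have "norm (integral {a..b} (\<lambda>x. ee (F x - m * x)) - (R b - R a)) \<le> (r a - r b) / (2 * pi)"
    by (simp only: integral_unique[OF hI] integral_unique[OF gI])
  moreover have "R b - R a = (ee (F b - m * b) * of_real (1 / (F1 b - m)) - ee (F a - m * a) * of_real (1 / (F1 a - m))) / (2 * of_real pi * \<i>)"
    unfolding R_def r_def by (simp add: diff_divide_distrib)
  ultimately show ?thesis unfolding r_def by simp
qed

lemma sum_trapezoid: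
  fixes g :: "nat \<Rightarrow> complex"
  shows "(\<Sum>i<k. (g i + g (Suc i)) / 2) = (\<Sum>i\<le>k. g i) - (g 0 + g k) / 2"
proof (induction k)
  case (Suc k)
  show ?case unfolding sum.lessThan_Suc Suc.IH by (simp add: field_simps)
qed simp

text \<open>Both sums are pieces of the harmonic series, the second starting \<open>2 * K\<close>
  terms later.\<close>

lemma harm_telescope:
  "(\<Sum>m\<in>{Suc K..<Suc K + j}. 1 / (real m - real K) - 1 / (real m + real K)) \<le> harm (2 * K)"
proof -
  have "(\<Sum>m\<in>{Suc K..<Suc K + j}. 1 / (real m - real K) - 1 / (real m + real K)) = harm j - harm (2 * K + j) + harm (2 * K)"
  proof (induction j)
    case (Suc j)
    then show ?case by (simp add: harm_Suc inverse_eq_divide algebra_simps)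
  qed (simp add: harm_def)
  moreover have "harm j \<le> (harm (2 * K + j) :: real)" by (rule harm_mono) simp
  ultimately show ?thesis by simp
qed

lemma norm_ee_comp_diff:
  assumes d: "\<And>x. x \<in> {a..b} \<Longrightarrow> (F has_real_derivative F1 x) (at x within {a..b})"
    and B: "\<And>x. x \<in> {a..b} \<Longrightarrow> \<bar>F1 x\<bar> \<le> B"
    and xy: "x \<in> {a..b}" "y \<in> {a..b}"
  shows "norm (ee (F x) - ee (F y)) \<le> (2 * pi * B) * \<bar>x - y\<bar>"
proof -
  have "norm (ee (F x) - ee (F y)) \<le> (2 * pi * B) * norm (x - y)"
  proof (rule differentiable_bound[where S = "{a..b}"])
    fix z assume z: "z \<in> {a..b}"
    show "((\<lambda>x. ee (F x)) has_derivative (\<lambda>h. h *\<^sub>R ((2 * pi * F1 z) *\<^sub>R (\<i> * ee (F z))))) (at z within {a..b})"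
      using has_vector_derivative_ee[OF d[OF z]] unfolding has_vector_derivative_def .
    have "0 \<le> B" using B[OF z] by linarith
    then show "onorm (\<lambda>h. h *\<^sub>R ((2 * pi * F1 z) *\<^sub>R (\<i> * ee (F z)))) \<le> 2 * pi * B"
      using B[OF z] by (intro onorm_bound) (auto simp: norm_mult abs_mult mult.commute[of _ "\<bar>F1 z\<bar>"] intro!: mult_right_mono)
  qed (use xy in auto)
  then show ?thesis by simp
qed

context
  fixes F F1 F2 :: "real \<Rightarrow> real" and A :: int and k K :: nat and a b :: real
  assumes a: "a = of_int A" and b: "b = of_int A + of_nat k"
    and d1: "\<And>x. (F has_real_derivative F1 x) (at x)"
    and d2: "\<And>x. (F1 has_real_derivative F2 x) (at x)"
    and pos: "\<And>x. 0 \<le> F2 x"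
    and F1a: "0 \<le> F1 a" and F1b: "F1 b \<le> real K"
begin

text \<open>The derivative of the phase stays in \<open>{0..K}\<close>, so among the integer
  frequencies only \<open>0..K\<close> can have a stationary point.\<close>

private definition "J m = integral {a..b} (\<lambda>x. ee (F x - m * x))"

private lemma ab: "a \<le> b" using a b by simp

private lemma F1_mono: "x \<le> y \<Longrightarrow> F1 x \<le> F1 y"
  by (rule DERIV_nonneg_imp_nondecreasing[of x y F1]) (use d2 pos in blast)+

private lemma F1_range:
  assumes "x \<in> {a..b}" shows "0 \<le> F1 x" "F1 x \<le> real K"
  using F1_mono[of a x] F1_mono[of x b] assms F1a F1b by auto

text \<open>At the integer endpoints \<open>ee (F x - m * x)\<close> equals \<open>ee (F x)\<close>,
  so the boundary terms depend on \<open>m\<close> only through \<open>1 / (F1 - m)\<close>.\<close>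

private lemma J_bound:
  assumes "\<And>x. x \<in> {a..b} \<Longrightarrow> F1 x \<noteq> m" and m: "m = of_int m'"
  shows "norm (J m - (ee (F b) * of_real (1 / (F1 b - m)) - ee (F a) * of_real (1 / (F1 a - m))) / (2 * of_real pi * \<i>))
     \<le> (1 / (F1 a - m) - 1 / (F1 b - m)) / (2 * pi)"
proof -
  have "ee (F x - m * x) = ee (F x)" if "x = of_int i" for x i
  proof -
    have "F x - m * x = F x + of_int (- m' * i)" using m that by simp
    then show ?thesis by (simp only: ee_add ee_int mult_1_right)
  qed
  from this[OF a] this[of b "A + int k"] have e: "ee (F a - m * a) = ee (F a)" "ee (F b - m * b) = ee (F b)" using b by simp_all
  show ?thesis
    unfolding J_def
    using phase_integral_boundary[OF ab DERIV_subset[OF d1 subset_UNIV] DERIV_subset[OF d2 subset_UNIV] pos assms(1)]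
    unfolding e by simp
qed

private lemma J_neg:
  assumes n: "1 \<le> n"
  shows "norm (J (- real n)) \<le> 1 / real n"
proof -
  define z where "z = (ee (F b) * of_real (1 / (F1 b - (- real n))) - ee (F a) * of_real (1 / (F1 a - (- real n)))) / (2 * of_real pi * \<i>)"
  have n0: "0 < real n" using n by simp
  have r: "0 \<le> F1 a" "0 \<le> F1 b" "F1 a \<le> F1 b" using F1_range[of a] F1_range[of b] F1_mono[OF ab] ab by auto
  have 1: "norm (J (- real n) - z) \<le> (1 / (F1 a - (- real n)) - 1 / (F1 b - (- real n))) / (2 * pi)"
    unfolding z_def
  proof (rule J_bound)
    fix x assume "x \<in> {a..b}"
    then show "F1 x \<noteq> - real n" using F1_range[of x] n0 by linarith
  next
    show "- real n = of_int (- int n)" by simp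
  qed
  have 2: "norm z \<le> (1 / (F1 b - (- real n)) + 1 / (F1 a - (- real n))) / (2 * pi)"
    unfolding z_def norm_divide
  proof -
    have "norm (ee (F b) * of_real (1 / (F1 b - (- real n))) - ee (F a) * of_real (1 / (F1 a - (- real n))))
      \<le> norm (ee (F b) * of_real (1 / (F1 b - (- real n)))) + norm (ee (F a) * of_real (1 / (F1 a - (- real n))))"
      by (rule norm_triangle_ineq4)
    also have "\<dots> = 1 / (F1 b - (- real n)) + 1 / (F1 a - (- real n))"
      using r n0 by (simp add: norm_mult norm_divide del: of_real_add)
    finally show "norm (ee (F b) * of_real (1 / (F1 b - (- real n))) - ee (F a) * of_real (1 / (F1 a - (- real n)))) / norm (2 * complex_of_real pi * \<i>)
      \<le> (1 / (F1 b - (- real n)) + 1 / (F1 a - (- real n))) / (2 * pi)"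
      by (simp add: norm_mult divide_right_mono)
  qed
  have "norm (J (- real n)) \<le> norm (J (- real n) - z) + norm z" by (metis norm_triangle_sub add.commute)
  also have "\<dots> \<le> (1 / (F1 a - (- real n))) / pi"
  proof -
    have e: "(u - v) / (2 * pi) + (v + u) / (2 * pi) = u / pi" for u v by (simp add: field_simps)
    show ?thesis using add_mono[OF 1 2] unfolding e .
  qed
  also have "\<dots> \<le> (1 / real n) / 1"
    using r n0 pi_ge_two by (intro frac_le) auto
  finally show ?thesis by simp
qed

text \<open>A single integral is only known to be of order \<open>1 / (n - K)\<close>, which is not
  summable. For \<open>n\<close> together with \<open>- n\<close> the boundary factors
  \<open>1 / (F1 - n)\<close> and \<open>1 / (F1 + n)\<close> have opposite signs and nearly
  cancel.\<close>

private lemma J_pair: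
  assumes n: "K < n"
  shows "norm (J (real n) + J (- real n)) \<le> 1 / (real n - real K) - 1 / (real n + real K)"
proof -
  define t where "t = 1 / (real n - real K) - 1 / (real n + real K)"
  define r where "r m x = 1 / (F1 x - m)" for m x
  have n0: "real K < real n" using n by simp
  have R: "0 \<le> F1 a" "F1 b \<le> real K" "F1 a \<le> F1 b" using F1_range[of a] F1_range[of b] F1_mono[OF ab] ab by auto
  define z where "z m = (ee (F b) * of_real (r m b) - ee (F a) * of_real (r m a)) / (2 * of_real pi * \<i>)" for m
  have 1: "norm (J (real n) - z (real n)) \<le> (r (real n) a - r (real n) b) / (2 * pi)"
    unfolding z_def r_def
  proof (rule J_bound)
    fix x assume "x \<in> {a..b}"
    then show "F1 x \<noteq> real n" using F1_range[of x] n0 by linarith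
  next
    show "real n = of_int (int n)" by simp
  qed
  have 2: "norm (J (- real n) - z (- real n)) \<le> (r (- real n) a - r (- real n) b) / (2 * pi)"
    unfolding z_def r_def
  proof (rule J_bound)
    fix x assume "x \<in> {a..b}"
    then show "F1 x \<noteq> - real n" using F1_range[of x] n0 by linarith
  next
    show "- real n = of_int (- int n)" by simp
  qed
  have bnd: "\<bar>r (real n) x + r (- real n) x\<bar> \<le> t" "r (real n) a - r (real n) b \<le> t" "r (- real n) a - r (- real n) b \<le> t"
    if "0 \<le> F1 x" "F1 x \<le> real K" for x
  proof -
    have m1: "1 / (real n - y) \<le> 1 / (real n - real K)" "1 / (real n + real K) \<le> 1 / (real n + y)"
      "1 / real n \<le> 1 / (real n - y)" "1 / (real n + y) \<le> 1 / real n"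
      "1 / (real n + y) \<le> 1 / (real n - y)"
      if "0 \<le> y" "y \<le> real K" for y using that n0 by (auto intro!: frac_le)
    have s: "r (real n) y = - (1 / (real n - F1 y))" "r (- real n) y = 1 / (real n + F1 y)" for y
      unfolding r_def by (simp_all add: minus_divide_right add.commute)
    have Ka: "0 \<le> F1 a" "F1 a \<le> real K" "0 \<le> F1 b" "F1 b \<le> real K" using R by auto
    show "\<bar>r (real n) x + r (- real n) x\<bar> \<le> t" unfolding s t_def using m1[OF that] by linarith
    show "r (real n) a - r (real n) b \<le> t" unfolding s t_def using m1[OF Ka(1,2)] m1[OF Ka(3,4)] by linarith
    show "r (- real n) a - r (- real n) b \<le> t" unfolding s t_def using m1[OF Ka(1,2)] m1[OF Ka(3,4)] by linarith
  qed
  have zz: "z (real n) + z (- real n) = (ee (F b) * of_real (r (real n) b + r (- real n) b)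
      - ee (F a) * of_real (r (real n) a + r (- real n) a)) / (2 * of_real pi * \<i>)"
    unfolding z_def by (simp add: add_divide_distrib[symmetric] algebra_simps)
  have "norm (ee (F b) * of_real (r (real n) b + r (- real n) b) - ee (F a) * of_real (r (real n) a + r (- real n) a))
    \<le> norm (ee (F b) * of_real (r (real n) b + r (- real n) b)) + norm (ee (F a) * of_real (r (real n) a + r (- real n) a))"
    by (rule norm_triangle_ineq4)
  also have "\<dots> = \<bar>r (real n) b + r (- real n) b\<bar> + \<bar>r (real n) a + r (- real n) a\<bar>"
    by (simp only: norm_mult norm_ee norm_of_real real_norm_def mult_1_left)
  also have "\<dots> \<le> t + t" using bnd(1)[of a] bnd(1)[of b] R by (intro add_mono) auto
  finally have nt: "norm (ee (F b) * of_real (r (real n) b + r (- real n) b) - ee (F a) * of_real (r (real n) a + r (- real n) a)) \<le> t + t" .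
  have 3: "norm (z (real n) + z (- real n)) \<le> (t + t) / (2 * pi)"
  proof -
    have n2: "norm (2 * complex_of_real pi * \<i>) = 2 * pi" by (simp add: norm_mult)
    show ?thesis unfolding zz norm_divide n2 using nt by (intro divide_right_mono) auto
  qed
  have "J (real n) + J (- real n) = (J (real n) - z (real n)) + (J (- real n) - z (- real n)) + (z (real n) + z (- real n))" by simp
  then have "norm (J (real n) + J (- real n)) \<le> norm (J (real n) - z (real n)) + norm (J (- real n) - z (- real n)) + norm (z (real n) + z (- real n))"
    by (metis norm_triangle_le norm_triangle_ineq add_right_mono)
  also have "\<dots> \<le> t / (2 * pi) + t / (2 * pi) + (t + t) / (2 * pi)"
  proof (intro add_mono)
    show "norm (J (real n) - z (real n)) \<le> t / (2 * pi)"
      using 1 bnd(2)[of a] R by (meson divide_right_mono order_trans pi_ge_zero mult_nonneg_nonneg zero_le_numeral)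
    show "norm (J (- real n) - z (- real n)) \<le> t / (2 * pi)"
      using 2 bnd(3)[of a] R by (meson divide_right_mono order_trans pi_ge_zero mult_nonneg_nonneg zero_le_numeral)
  qed (rule 3)
  also have "\<dots> = t * (2 / pi)" by (simp add: field_simps)
  also have "\<dots> \<le> t * 1"
  proof (rule mult_left_mono)
    show "0 \<le> t" unfolding t_def using n0 by (simp add: frac_le)
  qed (use pi_ge_two in simp)
  finally show ?thesis unfolding t_def by simp
qed

text \<open>The frequencies \<open>- K..- 1\<close> cost a harmonic sum, the pairs beyond
  \<open>K\<close> another one by \<open>harm_telescope\<close>, and the half weights at the two
  ends at most 1. The Fejer weights and the Fejer error disappear as \<open>M\<close> tends to
  infinity with everything else fixed.\<close>

private lemma poisson_core:
  "norm ((\<Sum>i\<le>k. ee (F (of_int A + of_nat i))) - (\<Sum>m\<le>K. J (real m))) \<le> 1 + 2 * harm (2 * K)"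
proof -
  define g where "g x = ee (F x)" for x
  define S where "S = (\<Sum>i<k. (g (of_int A + of_nat i) + g (of_int A + of_nat (Suc i))) / 2)"
  define La where "La = 2 * pi * real K"
  have lip: "norm (g x - g y) \<le> La * \<bar>x - y\<bar>" if "x \<in> {a..b}" "y \<in> {a..b}" for x y
    unfolding g_def La_def
    by (rule norm_ee_comp_diff[OF DERIV_subset[OF d1 subset_UNIV] _ that]) (use F1_range in auto)
  have cg: "continuous_on {a..b} g"
    unfolding g_def by (intro continuous_on_ee DERIV_continuous_on[OF DERIV_subset[OF d1 subset_UNIV]])
  have Jm: "integral {a..b} (\<lambda>x. ee (- (real m * x)) * g x) = J (real m)" "integral {a..b} (\<lambda>x. ee (real m * x) * g x) = J (- real m)" for m
    unfolding J_def g_def by (simp_all add: ee_add[symmetric] add.commute)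
  have J0: "integral {a..b} g = J 0" unfolding J_def g_def by simp
  define er where "er M = real k * (4 * La / sqrt (real M))" for M
  have est: "norm (S - (J 0 + (\<Sum>m\<in>{1..K}. of_real (1 - real m / real M) * J (real m)))) \<le> er M + harm K + harm (2 * K)"
    if M: "Suc K \<le> M" for M
  proof -
    define w where "w m = complex_of_real (1 - real m / real M)" for m
    have M0: "0 < M" using M by simp
    have wn: "norm (w m) \<le> 1" if "m \<in> {1..<M}" for m
    proof -
      have "0 \<le> 1 - real m / real M \<and> 1 - real m / real M \<le> 1" using that by auto
      then show ?thesis unfolding w_def norm_of_real by linarith
    qed
    have La0: "0 \<le> La" by (simp add: La_def)
    have "norm (integral {a..b} (\<lambda>x. fejer M x *\<^sub>R g x) - S) \<le> er M"
      unfolding er_def S_def a b by (rule fejer_interval[OF M0 La0]) (use lip in \<open>simp add: a b\<close>)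
    then have 1: "norm (S - (J 0 + (\<Sum>m\<in>{1..<M}. w m * (J (real m) + J (- real m))))) \<le> er M"
      unfolding fejer_integral_expand[OF cg] Jm J0 w_def by (simp add: norm_minus_commute)
    have "{1..<M} = {1..K} \<union> {Suc K..<M}" using M by auto
    then have "(\<Sum>m\<in>{1..<M}. w m * (J (real m) + J (- real m))) =
       (\<Sum>m\<in>{1..K}. w m * (J (real m) + J (- real m))) + (\<Sum>m\<in>{Suc K..<M}. w m * (J (real m) + J (- real m)))"
      by (simp only:) (rule sum.union_disjoint, auto)
    also have "(\<Sum>m\<in>{1..K}. w m * (J (real m) + J (- real m))) = (\<Sum>m\<in>{1..K}. w m * J (real m)) + (\<Sum>m\<in>{1..K}. w m * J (- real m))"
      by (simp add: distrib_left sum.distrib)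
    finally have sp: "S - (J 0 + (\<Sum>m\<in>{1..K}. w m * J (real m))) =
       (S - (J 0 + (\<Sum>m\<in>{1..<M}. w m * (J (real m) + J (- real m))))) + (\<Sum>m\<in>{1..K}. w m * J (- real m))
        + (\<Sum>m\<in>{Suc K..<M}. w m * (J (real m) + J (- real m)))" by simp
    have 2: "norm (\<Sum>m\<in>{1..K}. w m * J (- real m)) \<le> harm K"
    proof -
      have "norm (\<Sum>m\<in>{1..K}. w m * J (- real m)) \<le> (\<Sum>m\<in>{1..K}. inverse (real m))"
      proof (rule sum_norm_le)
        fix m assume m: "m \<in> {1..K}"
        have "norm (w m) * norm (J (- real m)) \<le> 1 * (1 / real m)"
          using wn[of m] J_neg[of m] m M by (intro mult_mono) auto
        then show "norm (w m * J (- real m)) \<le> inverse (real m)" by (simp add: norm_mult inverse_eq_divide)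
      qed
      then show ?thesis by (simp add: harm_def)
    qed
    have 3: "norm (\<Sum>m\<in>{Suc K..<M}. w m * (J (real m) + J (- real m))) \<le> harm (2 * K)"
    proof -
      have "norm (\<Sum>m\<in>{Suc K..<M}. w m * (J (real m) + J (- real m))) \<le>
         (\<Sum>m\<in>{Suc K..<M}. 1 / (real m - real K) - 1 / (real m + real K))"
      proof (rule sum_norm_le)
        fix m assume m: "m \<in> {Suc K..<M}"
        have "norm (w m) * norm (J (real m) + J (- real m)) \<le> 1 * (1 / (real m - real K) - 1 / (real m + real K))"
          using wn[of m] J_pair[of m] m by (intro mult_mono) auto
        then show "norm (w m * (J (real m) + J (- real m))) \<le> 1 / (real m - real K) - 1 / (real m + real K)"
          by (simp add: norm_mult)
      qed
      also have "\<dots> \<le> harm (2 * K)" using harm_telescope[of K "M - Suc K"] M by simp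
      finally show ?thesis .
    qed
    show ?thesis unfolding w_def[symmetric] sp
      using norm_triangle_le[OF add_mono[OF norm_triangle_le[OF add_mono[OF 1 2]] 3]] by simp
  qed
  have "(\<lambda>M. norm (S - (J 0 + (\<Sum>m\<in>{1..K}. of_real (1 - real m / real M) * J (real m)))))
     \<longlonglongrightarrow> norm (S - (J 0 + (\<Sum>m\<in>{1..K}. of_real (1 - 0) * J (real m))))"
    by (intro tendsto_intros lim_const_over_n)
  moreover have "(\<lambda>M. er M + harm K + harm (2 * K)) \<longlonglongrightarrow> real k * 0 + harm K + harm (2 * K)"
  proof -
    have "filterlim (\<lambda>M. sqrt (real M)) at_top sequentially"
      by (rule filterlim_compose[OF sqrt_at_top filterlim_real_sequentially])
    then have "(\<lambda>M. 4 * La / sqrt (real M)) \<longlonglongrightarrow> 0"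
      by (intro tendsto_divide_0[OF tendsto_const] filterlim_at_top_imp_at_infinity)
    then show ?thesis unfolding er_def by (intro tendsto_intros)
  qed
  ultimately have "norm (S - (J 0 + (\<Sum>m\<in>{1..K}. of_real (1 - 0) * J (real m)))) \<le> real k * 0 + harm K + harm (2 * K)"
    by (rule LIMSEQ_le) (use est in blast)
  moreover have "J 0 + (\<Sum>m\<in>{1..K}. of_real (1 - 0) * J (real m)) = (\<Sum>m\<le>K. J (real m))"
  proof -
    have "{..K} = insert 0 {1..K}" by auto
    then show ?thesis by simp
  qed
  ultimately have "norm (S - (\<Sum>m\<le>K. J (real m))) \<le> harm K + harm (2 * K)" by simp
  moreover have "harm K \<le> (harm (2 * K) :: real)" by (rule harm_mono) simp
  ultimately have 1: "norm (S - (\<Sum>m\<le>K. J (real m))) \<le> 2 * harm (2 * K)" by linarith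
  have eq: "(\<Sum>i\<le>k. ee (F (of_int A + of_nat i))) - (\<Sum>m\<le>K. J (real m)) =
     (g (of_int A + of_nat 0) + g (of_int A + of_nat k)) / 2 + (S - (\<Sum>m\<le>K. J (real m)))"
    unfolding S_def sum_trapezoid[of "\<lambda>i. g (of_int A + of_nat i)" k] by (simp add: g_def)
  have 2: "norm ((g (of_int A + of_nat 0) + g (of_int A + of_nat k)) / 2) \<le> 1"
    using norm_triangle_ineq[of "g (of_int A + of_nat 0)" "g (of_int A + of_nat k)"] unfolding g_def by (simp add: norm_divide)
  show ?thesis unfolding eq by (rule norm_triangle_le[OF add_mono[OF 2 1]])
qed

lemmas poisson_core' = poisson_core[unfolded J_def]

end

text \<open>Subtracting \<open>K0 * x\<close> from the phase changes no term of the sum, since the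
  points are integers, and brings the derivative into \<open>{0..K}\<close>.\<close>

lemma truncated_poisson:
  fixes F F1 F2 :: "real \<Rightarrow> real" and A :: int and k :: nat
  assumes d1: "\<And>x. (F has_real_derivative F1 x) (at x)"
    and d2: "\<And>x. (F1 has_real_derivative F2 x) (at x)"
    and pos: "\<And>x. 0 \<le> F2 x"
  defines "K0 \<equiv> \<lfloor>F1 (of_int A)\<rfloor>" and "K \<equiv> nat (\<lceil>F1 (of_int A + of_nat k)\<rceil> - \<lfloor>F1 (of_int A)\<rfloor>)"
  shows "norm ((\<Sum>i\<le>k. ee (F (of_int A + of_nat i))) -
     (\<Sum>m\<le>K. integral {of_int A..of_int A + of_nat k} (\<lambda>x. ee (F x - (of_int K0 + real m) * x)))) \<le> 1 + 2 * harm (2 * K)"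
proof -
  have mono: "F1 (of_int A) \<le> F1 (of_int A + of_nat k)"
    by (rule DERIV_nonneg_imp_nondecreasing[of _ _ F1]) (use d2 pos in auto)
  define G where "G x = F x - of_int K0 * x" for x
  have e: "ee (G (of_int A + of_nat i)) = ee (F (of_int A + of_nat i))" for i
  proof -
    have "G (of_int A + of_nat i) = F (of_int A + of_nat i) + of_int (- K0 * (A + int i))" by (simp add: G_def)
    then show ?thesis by (simp only: ee_add ee_int mult_1_right)
  qed
  have "norm ((\<Sum>i\<le>k. ee (G (of_int A + of_nat i))) -
     (\<Sum>m\<le>K. integral {of_int A..of_int A + of_nat k} (\<lambda>x. ee (G x - real m * x)))) \<le> 1 + 2 * harm (2 * K)"
  proof (rule poisson_core'[where ?F1.0 = "\<lambda>x. F1 x - of_int K0" and ?F2.0 = F2, OF refl refl])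
    show "(G has_real_derivative F1 x - of_int K0) (at x)" for x
      unfolding G_def by (auto intro!: derivative_eq_intros d1)
    show "((\<lambda>x. F1 x - of_int K0) has_real_derivative F2 x) (at x)" for x
      by (auto intro!: derivative_eq_intros d2)
    show "0 \<le> F1 (of_int A) - of_int K0" unfolding K0_def by simp
    show "F1 (of_int A + of_nat k) - of_int K0 \<le> real K"
      unfolding K_def K0_def using mono by linarith
  qed (rule pos)
  moreover have "G x - real m * x = F x - (of_int K0 + real m) * x" for m x
    by (simp add: G_def algebra_simps)
  ultimately show ?thesis unfolding e by simp
qed

section \<open>Stationary phase\<close>

lemma antiderivative_exists:
  fixes f :: "real \<Rightarrow> 'a::euclidean_space"
  assumes "continuous_on UNIV f"
  obtains G where "\<And>x. (G has_vector_derivative f x) (at x)" "G 0 = 0"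
proof -
  have "\<exists>F. \<forall>x. - \<infinity> < ereal x \<longrightarrow> ereal x < \<infinity> \<longrightarrow> (F has_vector_derivative f x) (at x)"
    by (rule einterval_antiderivative) (use assms in \<open>auto simp: continuous_on_eq_continuous_at\<close>)
  then obtain F where F: "\<And>x. (F has_vector_derivative f x) (at x)" by auto
  have "((\<lambda>x. F x - F 0) has_vector_derivative f x) (at x)" for x
    using has_vector_derivative_diff[OF F[of x] has_vector_derivative_const] by simp
  then show thesis using that[of "\<lambda>x. F x - F 0"] by simp
qed

lemma antiderivative_integral:
  fixes f :: "real \<Rightarrow> complex"
  assumes "\<And>x. (G has_vector_derivative f x) (at x)" "a \<le> b"
  shows "integral {a..b} f = G b - G a"
  by (rule integral_unique, rule fundamental_theorem_of_calculus[OF assms(2)])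
    (use assms(1) has_vector_derivative_at_within in blast)

text \<open>The rate follows from \<open>phase_integral_boundary\<close> with phase derivative
  \<open>2 * x\<close>, and the limit \<open>C0\<close> from the Cauchy criterion. The form
  \<open>6 / (1 + z)\<close> also covers \<open>z < 1\<close>, where 3 is a trivial bound.\<close>

lemma fresnel_limit:
  obtains Fr C0 where "\<And>x. (Fr has_vector_derivative ee (x\<^sup>2)) (at x)" "Fr 0 = 0"
    "\<And>z. 0 \<le> z \<Longrightarrow> norm (Fr z - C0) \<le> 6 / (1 + z)"
proof -
  have "continuous_on UNIV (\<lambda>x::real. ee (x\<^sup>2))" by (intro continuous_intros)
  then obtain Fr where Fr: "\<And>x. (Fr has_vector_derivative ee (x\<^sup>2)) (at x)" "Fr 0 = 0"
    using antiderivative_exists[of "\<lambda>x. ee (x\<^sup>2)"] by blast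
  have tail: "norm (Fr b - Fr a) \<le> 1 / a" if ab: "1 \<le> a" "a \<le> b" for a b
  proof -
    define z where "z = (ee (b\<^sup>2 - 0 * b) * of_real (1 / (2 * b - 0)) - ee (a\<^sup>2 - 0 * a) * of_real (1 / (2 * a - 0))) / (2 * of_real pi * \<i>)"
    have "norm (integral {a..b} (\<lambda>x. ee (x\<^sup>2 - 0 * x)) - z) \<le> (1 / (2 * a - 0) - 1 / (2 * b - 0)) / (2 * pi)"
      unfolding z_def
      by (rule phase_integral_boundary[where F = "\<lambda>x. x\<^sup>2" and ?F1.0 = "\<lambda>x. 2 * x" and ?F2.0 = "\<lambda>_. 2"])
        (use ab in \<open>auto intro!: derivative_eq_intros\<close>)
    then have 1: "norm ((Fr b - Fr a) - z) \<le> (1 / (2 * a) - 1 / (2 * b)) / (2 * pi)"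
      using antiderivative_integral[OF Fr(1) ab(2)] by simp
    have "norm (ee (b\<^sup>2 - 0 * b) * of_real (1 / (2 * b - 0)) - ee (a\<^sup>2 - 0 * a) * of_real (1 / (2 * a - 0)))
      \<le> norm (ee (b\<^sup>2 - 0 * b) * of_real (1 / (2 * b - 0))) + norm (ee (a\<^sup>2 - 0 * a) * of_real (1 / (2 * a - 0)))"
      by (rule norm_triangle_ineq4)
    also have "\<dots> = 1 / (2 * b) + 1 / (2 * a)"
      unfolding norm_mult norm_ee norm_of_real using ab by simp
    finally have nz: "norm (ee (b\<^sup>2 - 0 * b) * of_real (1 / (2 * b - 0)) - ee (a\<^sup>2 - 0 * a) * of_real (1 / (2 * a - 0)))
      \<le> 1 / (2 * b) + 1 / (2 * a)" .
    have n2: "norm (2 * complex_of_real pi * \<i>) = 2 * pi" by (simp add: norm_mult)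
    have 2: "norm z \<le> (1 / (2 * b) + 1 / (2 * a)) / (2 * pi)"
      unfolding z_def norm_divide n2 using nz by (intro divide_right_mono) auto
    have "norm (((Fr b - Fr a) - z) + z) \<le> (1 / (2 * a) - 1 / (2 * b)) / (2 * pi) + (1 / (2 * b) + 1 / (2 * a)) / (2 * pi)"
      by (rule norm_triangle_le[OF add_mono[OF 1 2]])
    also have "\<dots> = (1 / a) / (2 * pi)" by (simp add: field_simps)
    also have "\<dots> \<le> (1 / a) / 1" using ab pi_ge_two by (intro divide_left_mono) auto
    finally show ?thesis by simp
  qed
  have "Cauchy (\<lambda>n. Fr (real n))"
  proof (rule CauchyI)
    fix e :: real assume e: "0 < e"
    obtain N :: nat where N: "max 1 (2 / e) < real N" using reals_Archimedean2 by blast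
    have "norm (Fr (real m) - Fr (real n)) < e" if mn: "N \<le> m" "N \<le> n" for m n
    proof -
      have "norm (Fr (real m) - Fr (real n)) = norm (Fr (real (max m n)) - Fr (real (min m n)))"
        by (auto simp: max_def min_def norm_minus_commute)
      also have "\<dots> \<le> 1 / real (min m n)" by (rule tail) (use N mn in auto)
      also have "\<dots> \<le> 1 / real N" using N mn by (intro frac_le) auto
      also have "\<dots> < e" using N e by (auto simp: field_simps)
      finally show ?thesis .
    qed
    then show "\<exists>M. \<forall>m\<ge>M. \<forall>n\<ge>M. norm (Fr (real m) - Fr (real n)) < e" by blast
  qed
  then obtain C0 where C0: "(\<lambda>n. Fr (real n)) \<longlonglongrightarrow> C0" using Cauchy_convergent_iff convergent_def by blast
  have big: "norm (Fr z - C0) \<le> 1 / z" if z: "1 \<le> z" for z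
  proof -
    have "(\<lambda>n. norm (Fr (real n) - Fr z)) \<longlonglongrightarrow> norm (C0 - Fr z)" by (intro tendsto_intros C0)
    moreover have "\<forall>n\<ge>nat \<lceil>z\<rceil>. norm (Fr (real n) - Fr z) \<le> 1 / z"
    proof (intro allI impI)
      fix n assume "nat \<lceil>z\<rceil> \<le> n"
      then have "z \<le> real n" by linarith
      then show "norm (Fr (real n) - Fr z) \<le> 1 / z" using tail z by blast
    qed
    ultimately have "norm (C0 - Fr z) \<le> 1 / z" by (intro LIMSEQ_le_const2) blast+
    then show ?thesis by (simp add: norm_minus_commute)
  qed
  have small: "norm (Fr z) \<le> 1" if z: "0 \<le> z" "z \<le> 1" for z
  proof -
    have "norm (integral {0..z} (\<lambda>x. ee (x\<^sup>2))) \<le> integral {0..z} (\<lambda>x. 1)"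
      by (intro integral_norm_bound_integral integrable_continuous_interval continuous_intros) auto
    then show ?thesis using antiderivative_integral[OF Fr(1) z(1)] Fr(2) z by simp
  qed
  have "norm (Fr z - C0) \<le> 6 / (1 + z)" if z: "0 \<le> z" for z
  proof (cases "1 \<le> z")
    case True
    then have "norm (Fr z - C0) \<le> 1 / z" by (rule big)
    also have "\<dots> \<le> 6 / (1 + z)" using True by (simp add: field_simps)
    finally show ?thesis .
  next
    case False
    have "norm (Fr z - C0) \<le> norm (Fr z) + norm (Fr 1) + norm (Fr 1 - C0)"
      using norm_triangle_ineq4[of "Fr z" "Fr 1"] norm_triangle_ineq[of "Fr z - Fr 1" "Fr 1 - C0"] by simp
    also have "\<dots> \<le> 3" using small[of z] small[of 1] big[of 1] False z by simp
    also have "\<dots> \<le> 6 / (1 + z)" using False z by (simp add: field_simps)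
    finally show ?thesis .
  qed
  then show thesis using that Fr by blast
qed

text \<open>A phase translated so that its stationary point and its value there are 0; the analysis
  is one-sided, on \<open>y \<ge> 0\<close>.\<close>

locale phase =
  fixes w w1 w2 :: "real \<Rightarrow> real" and c1 c2 L :: real
  assumes dw: "\<And>x. (w has_real_derivative w1 x) (at x)"
    and dw1: "\<And>x. (w1 has_real_derivative w2 x) (at x)"
    and w0: "w 0 = 0" "w1 0 = 0"
    and c1: "0 < c1" and w2: "\<And>x. c1 \<le> w2 x" "\<And>x. w2 x \<le> c2"
    and L: "0 \<le> L" "\<And>x y. \<bar>w2 x - w2 y\<bar> \<le> L * \<bar>x - y\<bar>"
begin

definition "sg = w2 0"
text \<open>For \<open>w = sg * y\<^sup>2 / 2\<close> and \<open>y \<ge> 0\<close> this is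
  \<open>w1\<close>; in general the difference from \<open>w1\<close> measures how far the phase is
  from quadratic.\<close>

definition "Q y = sqrt (2 * sg * w y)"
definition "B1 = c2 * L / c1"
definition "B2 = (3 * c2 ^ 3 * B1 + L * c2 ^ 3) / c1 ^ 5"

lemma sg: "c1 \<le> sg" "sg \<le> c2" "0 < sg" "0 < c2"
  using w2[of 0] c1 by (auto simp: sg_def)

lemma w1_bounds:
  assumes "0 \<le> y"
  shows "c1 * y \<le> w1 y" "w1 y \<le> c2 * y"
proof -
  have "\<exists>z. w1 y - w1 0 = (y - 0) * w2 z"
  proof (cases "y = 0")
    case False
    then show ?thesis using MVT2[of 0 y w1 w2] dw1 assms by force
  qed simp
  then obtain z where z: "w1 y = y * w2 z" using w0 by auto
  show "c1 * y \<le> w1 y" "w1 y \<le> c2 * y"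
    unfolding z using mult_right_mono[OF w2(1)[of z] assms] mult_right_mono[OF w2(2)[of z] assms]
    by (simp_all add: mult.commute)
qed

lemma w_bounds:
  assumes "0 \<le> y"
  shows "c1 * y\<^sup>2 / 2 \<le> w y" "w y \<le> c2 * y\<^sup>2 / 2"
proof -
  have "(\<lambda>y. w y - c1 * y\<^sup>2 / 2) 0 \<le> (\<lambda>y. w y - c1 * y\<^sup>2 / 2) y"
  proof (rule DERIV_nonneg_imp_nondecreasing[OF assms])
    fix x :: real assume x: "0 \<le> x" "x \<le> y"
    have "((\<lambda>y. w y - c1 * y\<^sup>2 / 2) has_real_derivative w1 x - c1 * x) (at x)"
      by (auto intro!: derivative_eq_intros dw)
    then show "\<exists>d. ((\<lambda>y. w y - c1 * y\<^sup>2 / 2) has_real_derivative d) (at x) \<and> 0 \<le> d"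
      using w1_bounds[OF x(1)] by (intro exI conjI) auto
  qed
  then show "c1 * y\<^sup>2 / 2 \<le> w y" using w0 by simp
  have "(\<lambda>y. c2 * y\<^sup>2 / 2 - w y) 0 \<le> (\<lambda>y. c2 * y\<^sup>2 / 2 - w y) y"
  proof (rule DERIV_nonneg_imp_nondecreasing[OF assms])
    fix x :: real assume x: "0 \<le> x" "x \<le> y"
    have "((\<lambda>y. c2 * y\<^sup>2 / 2 - w y) has_real_derivative c2 * x - w1 x) (at x)"
      by (auto intro!: derivative_eq_intros dw)
    then show "\<exists>d. ((\<lambda>y. c2 * y\<^sup>2 / 2 - w y) has_real_derivative d) (at x) \<and> 0 \<le> d"
      using w1_bounds[OF x(1)] by (intro exI conjI) auto
  qed
  then show "w y \<le> c2 * y\<^sup>2 / 2" using w0 by simp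
qed

lemma w_pos: "0 < y \<Longrightarrow> 0 < w y"
  using w_bounds(1)[of y] c1 by (smt (verit) divide_pos_pos mult_pos_pos zero_less_power)

lemma Q_bounds:
  assumes "0 \<le> y"
  shows "c1 * y \<le> Q y" "Q y \<le> c2 * y" "(Q y)\<^sup>2 = 2 * sg * w y"
proof -
  have wn: "0 \<le> w y" using w_bounds(1)[OF assms] c1 by (smt (verit) divide_nonneg_pos mult_nonneg_nonneg zero_le_power2)
  show "(Q y)\<^sup>2 = 2 * sg * w y" unfolding Q_def using sg wn by simp
  have "(c1 * y)\<^sup>2 \<le> 2 * sg * w y"
  proof -
    have "c1 * (c1 * y\<^sup>2) \<le> sg * (2 * w y)"
      by (rule mult_mono) (use sg w_bounds(1)[OF assms] c1 in auto)
    then show ?thesis by (simp add: power2_eq_square mult_ac)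
  qed
  then show "c1 * y \<le> Q y" unfolding Q_def using real_le_rsqrt by blast
  have "2 * sg * w y \<le> (c2 * y)\<^sup>2"
  proof -
    have "sg * (2 * w y) \<le> c2 * (c2 * y\<^sup>2)"
      by (rule mult_mono) (use sg w_bounds(2)[OF assms] wn in auto)
    then show ?thesis by (simp add: power2_eq_square mult_ac)
  qed
  then show "Q y \<le> c2 * y" unfolding Q_def using sg assms by (intro real_le_lsqrt) auto
qed

lemma B_nonneg: "0 \<le> B1" "0 \<le> B2"
  using sg c1 L by (auto simp: B1_def B2_def)

text \<open>The derivative of \<open>w1\<^sup>2 - 2 * sg * w\<close> is
  \<open>2 * w1 * (w2 - sg)\<close>, of order \<open>y\<^sup>2\<close> by the Lipschitz bound, so no
  third derivative has to exist.\<close>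

lemma square_diff:
  assumes y: "0 < y"
  shows "\<bar>(w1 y)\<^sup>2 - (Q y)\<^sup>2\<bar> \<le> 2 * c2 * L * y ^ 3"
proof -
  have "\<exists>z>0. z < y \<and> ((w1 y)\<^sup>2 - 2 * sg * w y) - ((w1 0)\<^sup>2 - 2 * sg * w 0) = (y - 0) * (2 * w1 z * w2 z - 2 * sg * w1 z)"
    by (rule MVT2[OF y]) (auto intro!: derivative_eq_intros dw dw1)
  then obtain z where z: "0 < z" "z < y" "(w1 y)\<^sup>2 - 2 * sg * w y = y * (2 * w1 z * (w2 z - sg))"
    using w0 by (auto simp: algebra_simps)
  have zy: "0 \<le> z" "z \<le> y" using z by auto
  have "\<bar>w1 z\<bar> \<le> c2 * y"
  proof -
    have "0 \<le> c1 * z" using zy c1 by simp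
    then have "0 \<le> w1 z" "w1 z \<le> c2 * z" using w1_bounds[OF zy(1)] by auto
    moreover have "c2 * z \<le> c2 * y" using zy sg by (intro mult_left_mono) auto
    ultimately show ?thesis by simp
  qed
  moreover have "\<bar>w2 z - sg\<bar> \<le> L * y"
  proof -
    have "\<bar>w2 z - sg\<bar> \<le> L * z" using L(2)[of z 0] zy unfolding sg_def by simp
    moreover have "L * z \<le> L * y" using zy L by (intro mult_left_mono) auto
    ultimately show ?thesis by linarith
  qed
  ultimately have "\<bar>w1 z\<bar> * \<bar>w2 z - sg\<bar> \<le> (c2 * y) * (L * y)" using y sg by (intro mult_mono) auto
  then have "2 * y * (\<bar>w1 z\<bar> * \<bar>w2 z - sg\<bar>) \<le> 2 * y * ((c2 * y) * (L * y))" using y by (intro mult_left_mono) auto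
  moreover have "\<bar>y * (2 * w1 z * (w2 z - sg))\<bar> = 2 * y * (\<bar>w1 z\<bar> * \<bar>w2 z - sg\<bar>)"
  proof -
    have "y * (2 * w1 z * (w2 z - sg)) = 2 * y * (w1 z * (w2 z - sg))" by simp
    also have "\<bar>\<dots>\<bar> = \<bar>2 * y\<bar> * (\<bar>w1 z\<bar> * \<bar>w2 z - sg\<bar>)" by (simp only: abs_mult)
    finally show ?thesis using y by simp
  qed
  ultimately show ?thesis unfolding Q_bounds(3)[OF less_imp_le[OF y]] z(3)
    by (simp add: power3_eq_cube mult_ac)
qed

lemma PQ_diff:
  assumes y: "0 < y"
  shows "\<bar>w1 y - Q y\<bar> \<le> B1 * y\<^sup>2"
proof -
  have P: "c1 * y \<le> w1 y" "c1 * y \<le> Q y" using w1_bounds[of y] Q_bounds[of y] y by auto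
  have cy: "0 < c1 * y" using c1 y by simp
  have "\<bar>w1 y - Q y\<bar> * (2 * (c1 * y)) \<le> \<bar>w1 y - Q y\<bar> * (w1 y + Q y)"
    using P by (intro mult_left_mono) auto
  also have "\<dots> = \<bar>(w1 y)\<^sup>2 - (Q y)\<^sup>2\<bar>"
  proof -
    have "(w1 y)\<^sup>2 - (Q y)\<^sup>2 = (w1 y - Q y) * (w1 y + Q y)" by (simp add: power2_eq_square algebra_simps)
    moreover have "\<bar>w1 y + Q y\<bar> = w1 y + Q y" using P cy by simp
    ultimately show ?thesis by (simp add: abs_mult)
  qed
  also have "\<dots> \<le> 2 * c2 * L * y ^ 3" by (rule square_diff[OF y])
  also have "\<dots> = (B1 * y\<^sup>2) * (2 * (c1 * y))"
    unfolding B1_def using c1 by (simp add: power2_eq_square power3_eq_cube)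
  finally show ?thesis using cy by (simp only: mult_le_cancel_right)
qed

text \<open>\<open>w1 * s\<close> is the discrepancy \<open>1 - w1 / Q\<close> between the integrand
  and the Fresnel integrand; division by \<open>w1\<close> is what integration by parts does to
  it.\<close>

definition "s y = 1 / w1 y - 1 / Q y"
definition "s' y = - (w2 y) / (w1 y)\<^sup>2 + sg * w1 y / (Q y) ^ 3"

lemma pos: 
  assumes "0 < y" shows "0 < w1 y" "0 < Q y"
proof -
  have "0 < c1 * y" using c1 assms by simp
  then show "0 < w1 y" "0 < Q y" using w1_bounds[of y] Q_bounds[of y] assms by auto
qed

lemma s_bound:
  assumes y: "0 < y"
  shows "\<bar>s y\<bar> \<le> B1 / c1\<^sup>2" "\<bar>1 - w1 y / Q y\<bar> \<le> B1 / c1 * y" "w1 y * s y = 1 - w1 y / Q y"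
proof -
  note p = pos[OF y]
  have P: "c1 * y \<le> w1 y" "c1 * y \<le> Q y" using w1_bounds[of y] Q_bounds[of y] y by auto
  have cy: "0 < c1 * y" using c1 y by simp
  have "s y = (Q y - w1 y) / (w1 y * Q y)" unfolding s_def using p by (simp add: field_simps)
  then have "\<bar>s y\<bar> = \<bar>w1 y - Q y\<bar> / (w1 y * Q y)" using p by (simp add: abs_mult abs_minus_commute)
  also have "\<dots> \<le> (B1 * y\<^sup>2) / ((c1 * y) * (c1 * y))"
    using PQ_diff[OF y] P cy B_nonneg mult_pos_pos[OF cy cy] by (intro frac_le mult_mono) auto
  also have "\<dots> = B1 / c1\<^sup>2" using y c1 by (simp add: power2_eq_square)
  finally show "\<bar>s y\<bar> \<le> B1 / c1\<^sup>2" .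
  have "1 - w1 y / Q y = (Q y - w1 y) / Q y" using p by (simp add: field_simps)
  then have "\<bar>1 - w1 y / Q y\<bar> = \<bar>w1 y - Q y\<bar> / Q y" using p by (simp add: abs_minus_commute)
  also have "\<dots> \<le> (B1 * y\<^sup>2) / (c1 * y)"
    using PQ_diff[OF y] P cy B_nonneg by (intro frac_le) auto
  also have "\<dots> = B1 / c1 * y" using y c1 by (simp add: power2_eq_square)
  finally show "\<bar>1 - w1 y / Q y\<bar> \<le> B1 / c1 * y" .
  show "w1 y * s y = 1 - w1 y / Q y" unfolding s_def using p by (simp add: field_simps)
qed

text \<open>Over a common denominator the numerator is \<open>sg * w1 ^ 3 - w2 * Q ^ 3\<close>,
  where both \<open>w1 - Q\<close> and \<open>w2 - sg\<close> are small. The bound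
  \<open>1 / y\<close> is not integrable at 0, which forces the cutoff in \<open>one_sided\<close>
  and its logarithm.\<close>

lemma s'_bound:
  assumes y: "0 < y"
  shows "\<bar>s' y\<bar> \<le> B2 / y"
proof -
  note p = pos[OF y]
  define P where "P = w1 y"
  define q where "q = Q y"
  have b: "c1 * y \<le> P" "P \<le> c2 * y" "c1 * y \<le> q" "q \<le> c2 * y" "0 < P" "0 < q" "\<bar>P - q\<bar> \<le> B1 * y\<^sup>2"
    using w1_bounds[of y] Q_bounds[of y] y p PQ_diff[OF y] by (auto simp: P_def q_def)
  have cy: "0 < c1 * y" using c1 y by simp
  have "s' y = (sg * P ^ 3 - w2 y * q ^ 3) / (P\<^sup>2 * q ^ 3)"
    unfolding s'_def P_def[symmetric] q_def[symmetric] using b by (simp add: field_simps power2_eq_square power3_eq_cube)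
  then have eq: "\<bar>s' y\<bar> = \<bar>sg * P ^ 3 - w2 y * q ^ 3\<bar> / (P\<^sup>2 * q ^ 3)" using b by (simp add: abs_mult)
  have "sg * P ^ 3 - w2 y * q ^ 3 = sg * ((P - q) * (P\<^sup>2 + P * q + q\<^sup>2)) + (sg - w2 y) * q ^ 3"
    by (simp add: algebra_simps power2_eq_square power3_eq_cube)
  then have "\<bar>sg * P ^ 3 - w2 y * q ^ 3\<bar> \<le> \<bar>sg * ((P - q) * (P\<^sup>2 + P * q + q\<^sup>2))\<bar> + \<bar>(sg - w2 y) * q ^ 3\<bar>" by linarith
  also have "\<dots> \<le> c2 * ((B1 * y\<^sup>2) * (3 * (c2 * y)\<^sup>2)) + (L * y) * (c2 * y) ^ 3"
  proof (intro add_mono)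
    have "P\<^sup>2 \<le> (c2 * y)\<^sup>2" "q\<^sup>2 \<le> (c2 * y)\<^sup>2" using b by (auto intro!: power_mono)
    moreover have "P * q \<le> (c2 * y) * (c2 * y)" using b by (intro mult_mono) auto
    ultimately have m: "P\<^sup>2 + P * q + q\<^sup>2 \<le> 3 * (c2 * y)\<^sup>2" by (simp add: power2_eq_square)
    have "0 \<le> P\<^sup>2 + P * q + q\<^sup>2" using b by simp
    then show "\<bar>sg * ((P - q) * (P\<^sup>2 + P * q + q\<^sup>2))\<bar> \<le> c2 * ((B1 * y\<^sup>2) * (3 * (c2 * y)\<^sup>2))"
      unfolding abs_mult using m b sg B_nonneg by (intro mult_mono) auto
    have "\<bar>sg - w2 y\<bar> \<le> L * y" using L(2)[of 0 y] y unfolding sg_def by simp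
    then show "\<bar>(sg - w2 y) * q ^ 3\<bar> \<le> (L * y) * (c2 * y) ^ 3"
      unfolding abs_mult using b L y by (intro mult_mono) (auto intro!: power_mono)
  qed
  also have "\<dots> = (3 * c2 ^ 3 * B1 + L * c2 ^ 3) * y ^ 4"
    by (simp add: algebra_simps eval_nat_numeral)
  finally have num: "\<bar>sg * P ^ 3 - w2 y * q ^ 3\<bar> \<le> (3 * c2 ^ 3 * B1 + L * c2 ^ 3) * y ^ 4" .
  have den: "(c1 * y)\<^sup>2 * (c1 * y) ^ 3 \<le> P\<^sup>2 * q ^ 3"
    using b cy by (intro mult_mono power_mono) auto
  have "\<bar>s' y\<bar> \<le> (3 * c2 ^ 3 * B1 + L * c2 ^ 3) * y ^ 4 / ((c1 * y)\<^sup>2 * (c1 * y) ^ 3)"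
    unfolding eq using num den cy by (intro frac_le) auto
  also have "\<dots> = B2 / y" unfolding B2_def using y c1 by (simp add: field_simps eval_nat_numeral)
  finally show ?thesis .
qed

lemma s_deriv:
  assumes y: "0 < y"
  shows "(s has_real_derivative s' y) (at y)"
proof -
  note p = pos[OF y]
  have dQ: "(Q has_real_derivative sg * w1 y / Q y) (at y)"
  proof -
    have "0 < 2 * sg * w y" using w_pos[OF y] sg by simp
    then show ?thesis unfolding Q_def
      by (auto intro!: derivative_eq_intros dw simp: field_simps)
  qed
  show ?thesis unfolding s_def s'_def
    using p by (auto intro!: derivative_eq_intros dQ dw1 simp: field_simps power2_eq_square power3_eq_cube)
qed

lemma w_cont: "continuous_on S w"
  by (rule DERIV_continuous_on[OF DERIV_subset[OF dw subset_UNIV]])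

text \<open>Compare the integral of \<open>ee (R * w y)\<close> with the Fresnel integral at \<open>sqrt (R * w y)\<close>, whose derivative has the extra
  factor \<open>w1 / Q\<close>; the discrepancy is integrated by parts, where \<open>s\<close> and its derivative are bounded because
  \<open>w2\<close> is Lipschitz.\<close>

lemma one_sided:
  fixes E Fr :: "real \<Rightarrow> complex" and C0 :: complex
  assumes Fr: "\<And>x. (Fr has_vector_derivative ee (x\<^sup>2)) (at x)" "Fr 0 = 0"
    and C0: "\<And>z. 0 \<le> z \<Longrightarrow> norm (Fr z - C0) \<le> 6 / (1 + z)"
    and E: "\<And>x. (E has_vector_derivative ee (R * w x)) (at x)" "E 0 = 0"
    and R: "1 \<le> R" and X: "0 \<le> X" "X \<le> D"
  shows "norm (E X - of_real (2 / sqrt (2 * sg * R)) * C0) \<le>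
    (B1 / c1 + 2 * B1 / c1\<^sup>2 + B2 * (1 + ln (1 + D))) * (1 + ln (1 + R)) / R
     + 12 / (sqrt (2 * c1) * min 1 (sqrt (c1 / 2))) / (sqrt R + R * X)"
proof -
  have R0: "0 < R" using R by simp
  \<comment> \<open>Scaled so that the derivative of \<open>H\<close> is exactly
    \<open>w1 / Q\<close> times the integrand.\<close>
  define la where "la = 2 / sqrt (2 * sg * R)"
  define u where "u y = sqrt (R * w y)" for y
  define H where "H y = of_real la * Fr (u y)" for y
  define Dd where "Dd y = E y - H y" for y
  have la0: "0 < la" unfolding la_def using sg R0 by simp
  have cE: "continuous_on S E" for S
    by (rule continuous_at_imp_continuous_on) (use E(1) has_vector_derivative_continuous in blast)
  have cFr: "continuous_on S Fr" for S
    by (rule continuous_at_imp_continuous_on) (use Fr(1) has_vector_derivative_continuous in blast)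
  have cu: "continuous_on S u" for S unfolding u_def by (intro continuous_intros w_cont)
  have cD: "continuous_on S Dd" for S
    unfolding Dd_def H_def by (intro continuous_intros cE continuous_on_compose2[OF cFr cu]) auto
  have dH: "(H has_vector_derivative of_real (w1 y / Q y) * ee (R * w y)) (at y)" if y: "0 < y" for y
  proof -
    note p = pos[OF y] and wp = w_pos[OF y]
    have Rw: "0 < R * w y" using R0 wp by simp
    have du: "(u has_real_derivative R * w1 y / (2 * u y)) (at y)"
      unfolding u_def using Rw by (auto intro!: derivative_eq_intros dw simp: field_simps)
    have u2: "(u y)\<^sup>2 = R * w y" unfolding u_def using Rw by simp
    have "((Fr \<circ> u) has_vector_derivative (R * w1 y / (2 * u y)) *\<^sub>R ee ((u y)\<^sup>2)) (at y)"
      by (rule vector_diff_chain_at[OF du[unfolded has_real_derivative_iff_has_vector_derivative] Fr(1)])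
    then have "(H has_vector_derivative of_real la * ((R * w1 y / (2 * u y)) *\<^sub>R ee (R * w y))) (at y)"
      unfolding H_def u2 o_def by (intro has_vector_derivative_mult_right)
    moreover have "la * (R * w1 y / (2 * u y)) = w1 y / Q y"
    proof -
      have "sqrt (2 * sg * R) * u y = R * Q y"
      proof -
        have "sqrt (2 * sg * R) * u y = sqrt (R\<^sup>2 * (2 * sg * w y))"
          unfolding u_def real_sqrt_mult[symmetric] by (simp add: power2_eq_square mult_ac)
        also have "\<dots> = R * Q y" unfolding Q_def real_sqrt_mult using R0 by simp
        finally show ?thesis .
      qed
      moreover have "0 < u y" unfolding u_def using Rw by simp
      moreover have "0 < sqrt (2 * sg * R)" using sg R0 by simp
      ultimately have "la * (R * w1 y / (2 * u y)) = R * w1 y / (sqrt (2 * sg * R) * u y)"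
        unfolding la_def by simp
      also have "\<dots> = R * w1 y / (R * Q y)"
        using \<open>sqrt (2 * sg * R) * u y = R * Q y\<close> by (simp only:)
      finally have "la * (R * w1 y / (2 * u y)) = R * w1 y / (R * Q y)" .
      then show ?thesis using R0 by simp
    qed
    then have "of_real la * ((R * w1 y / (2 * u y)) *\<^sub>R ee (R * w y)) = of_real (w1 y / Q y) * ee (R * w y)"
      by (metis mult.assoc of_real_mult scaleR_conv_of_real)
    ultimately show ?thesis by simp
  qed
  have dD: "(Dd has_vector_derivative of_real (1 - w1 y / Q y) * ee (R * w y)) (at y)" if y: "0 < y" for y
    using has_vector_derivative_diff[OF E(1)[of y] dH[OF y]] unfolding Dd_def[abs_def] by (simp add: algebra_simps)
  have D0: "Dd 0 = 0" unfolding Dd_def H_def u_def using E(2) Fr(2) w0 by simp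
  have first: "norm (Dd r) \<le> B1 / c1 * r\<^sup>2" if r: "0 \<le> r" for r
  proof (cases "r = 0")
    case False
    then have r: "0 < r" using that by simp
    have "norm (Dd r - Dd 0) \<le> B1 / c1 * r\<^sup>2 - B1 / c1 * 0\<^sup>2"
    proof (rule differentiable_bound_general[OF r cD, where \<phi> = "\<lambda>y. B1 / c1 * y\<^sup>2"])
      show "continuous_on {0..r} (\<lambda>y. B1 / c1 * y\<^sup>2)" by (intro continuous_intros)
      fix x assume x: "0 < x" "x < r"
      show "(Dd has_vector_derivative of_real (1 - w1 x / Q x) * ee (R * w x)) (at x)" by (rule dD[OF x(1)])
      show "((\<lambda>y. B1 / c1 * y\<^sup>2) has_vector_derivative B1 / c1 * (2 * x)) (at x)"
        unfolding has_real_derivative_iff_has_vector_derivative[symmetric]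
        using c1 by (auto intro!: derivative_eq_intros)
      have "B1 / c1 * x \<le> B1 / c1 * (2 * x)" using B_nonneg c1 x by (intro mult_left_mono) auto
      then show "norm (of_real (1 - w1 x / Q x) * ee (R * w x)) \<le> B1 / c1 * (2 * x)"
        unfolding norm_mult norm_ee norm_of_real mult_1_right using s_bound(2)[OF x(1)] by (rule order_trans[rotated])
    qed
    then show ?thesis using D0 by simp
  qed (simp add: D0)
  have lnR: "0 \<le> ln (1 + R)" "0 \<le> ln (1 + D)" using R X by auto
  define b where "b = B1 / c1"
  define b' where "b' = B1 / c1\<^sup>2"
  have b0: "0 \<le> b" "0 \<le> b'" unfolding b_def b'_def using B_nonneg c1 by auto
  have main: "norm (Dd X) \<le> (b + 2 * b' + B2 * (1 + ln (1 + D))) * (1 + ln (1 + R)) / R"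
  proof (cases "X \<le> 1 / sqrt R")
    case True
    have "X\<^sup>2 \<le> (1 / sqrt R)\<^sup>2" using True X by (intro power_mono) auto
    then have "X\<^sup>2 \<le> 1 / R" using R0 by (simp add: power_divide)
    then have "b * X\<^sup>2 \<le> b * (1 / R)" using b0 by (intro mult_left_mono) auto
    then have "norm (Dd X) \<le> b * 1 / R" using first[OF X(1)] unfolding b_def by simp
    also have "\<dots> \<le> (b + 2 * b' + B2 * (1 + ln (1 + D))) * (1 + ln (1 + R)) / R"
      using b0 B_nonneg lnR R0 by (intro divide_right_mono mult_mono) auto
    finally show ?thesis .
  next
    case False
    \<comment> \<open>Up to \<open>1 / sqrt R\<close> the trivial bound \<open>first\<close> costs
      \<open>1 / R\<close>; from there on the integral of \<open>1 / y\<close> costs a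
      logarithm.\<close>
    define r where "r = 1 / sqrt R"
    have r: "0 < r" "r < X" unfolding r_def using False R0 by auto
    \<comment> \<open>Once the boundary term is subtracted, the contributions of
      \<open>w1 * s\<close> cancel and the derivative contains only \<open>s'\<close>.\<close>
    define G where "G y = Dd y - ee (R * w y) * of_real (s y) / (2 * of_real pi * \<i> * of_real R)" for y
    have dG: "(G has_vector_derivative - (ee (R * w y) * of_real (s' y) / (2 * of_real pi * \<i> * of_real R))) (at y)" if y: "0 < y" for y
    proof -
      have d1: "((\<lambda>y. R * w y) has_real_derivative R * w1 y) (at y)" by (auto intro!: derivative_eq_intros dw)
      have 1: "((\<lambda>y. ee (R * w y)) has_vector_derivative (2 * pi * (R * w1 y)) *\<^sub>R (\<i> * ee (R * w y))) (at y)"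
        by (rule has_vector_derivative_ee[OF d1])
      have 2: "((\<lambda>y. complex_of_real (s y)) has_vector_derivative of_real (s' y)) (at y)"
        by (rule has_vector_derivative_of_real[OF s_deriv[OF y]])
      have 3: "(G has_vector_derivative of_real (1 - w1 y / Q y) * ee (R * w y) - (ee (R * w y) * of_real (s' y) +
        (2 * pi * (R * w1 y)) *\<^sub>R (\<i> * ee (R * w y)) * of_real (s y)) / (2 * of_real pi * \<i> * of_real R)) (at y)"
        unfolding G_def by (intro has_vector_derivative_diff has_vector_derivative_divide has_vector_derivative_mult 1 2 dD[OF y])
      have "(2 * pi * (R * w1 y)) *\<^sub>R (\<i> * ee (R * w y)) * of_real (s y)
        = (2 * of_real pi * \<i> * of_real R) * (of_real (w1 y * s y) * ee (R * w y))"
        by (simp add: scaleR_conv_of_real mult_ac)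
      then have "(2 * pi * (R * w1 y)) *\<^sub>R (\<i> * ee (R * w y)) * of_real (s y) / (2 * of_real pi * \<i> * of_real R)
        = of_real (1 - w1 y / Q y) * ee (R * w y)"
        using R0 unfolding s_bound(3)[OF y] by simp
      then have "of_real (1 - w1 y / Q y) * ee (R * w y) - (ee (R * w y) * of_real (s' y) +
        (2 * pi * (R * w1 y)) *\<^sub>R (\<i> * ee (R * w y)) * of_real (s y)) / (2 * of_real pi * \<i> * of_real R)
        = - (ee (R * w y) * of_real (s' y) / (2 * of_real pi * \<i> * of_real R))"
        unfolding add_divide_distrib by simp
      with 3 show ?thesis by simp
    qed
    have cG: "continuous_on {r..X} G"
    proof (intro continuous_at_imp_continuous_on ballI)
      fix x assume "x \<in> {r..X}"
      then have "0 < x" using r by simp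
      then show "isCont G x" by (rule has_vector_derivative_continuous[OF dG])
    qed
    have n2: "norm (2 * complex_of_real pi * \<i> * of_real R) = 2 * pi * R" using R0 by (simp add: norm_mult)
    have p2: "R \<le> 2 * pi * R" using pi_ge_two R0 by simp
    have "norm (G X - G r) \<le> B2 / R * ln X - B2 / R * ln r"
    proof (rule differentiable_bound_general[OF r(2) cG, where \<phi> = "\<lambda>y. B2 / R * ln y"])
      show "continuous_on {r..X} (\<lambda>y. B2 / R * ln y)" using r by (intro continuous_intros) auto
      fix x assume x: "r < x" "x < X"
      then have x0: "0 < x" using r by simp
      show "(G has_vector_derivative - (ee (R * w x) * of_real (s' x) / (2 * of_real pi * \<i> * of_real R))) (at x)" by (rule dG[OF x0])
      show "((\<lambda>y. B2 / R * ln y) has_vector_derivative B2 / R * (1 / x)) (at x)"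
        unfolding has_real_derivative_iff_has_vector_derivative[symmetric] using x0 R0 by (auto intro!: derivative_eq_intros)
      have "norm (- (ee (R * w x) * of_real (s' x) / (2 * of_real pi * \<i> * of_real R))) = \<bar>s' x\<bar> / (2 * pi * R)"
        unfolding norm_minus_cancel norm_divide n2 norm_mult norm_ee norm_of_real using R0 by simp
      also have "\<dots> \<le> (B2 / x) / R" using s'_bound[OF x0] p2 R0 B_nonneg x0 by (intro frac_le) auto
      finally show "norm (- (ee (R * w x) * of_real (s' x) / (2 * of_real pi * \<i> * of_real R))) \<le> B2 / R * (1 / x)"
        by (simp add: mult.commute)
    qed
    also have "\<dots> = B2 / R * (ln X - ln r)" by (simp add: right_diff_distrib)
    also have "\<dots> \<le> B2 / R * ((1 + ln (1 + D)) * (1 + ln (1 + R)) - 1)"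
    proof (rule mult_left_mono)
      have "ln X \<le> ln (1 + D)" using X r by simp
      moreover have "- ln r \<le> ln (1 + R)"
      proof -
        have "- ln r = ln (sqrt R)" unfolding r_def using R0 by (simp add: ln_div)
        also have "sqrt R \<le> 1 + R" using real_sqrt_le_mono[of R "R\<^sup>2"] R by (simp add: self_le_power) 
        then have "ln (sqrt R) \<le> ln (1 + R)" using R0 by simp
        finally show ?thesis .
      qed
      moreover have "0 \<le> ln (1 + D) * ln (1 + R)" using lnR by simp
      ultimately show "ln X - ln r \<le> (1 + ln (1 + D)) * (1 + ln (1 + R)) - 1" by (simp add: algebra_simps)
    qed (use B_nonneg R0 in simp)
    also have "\<dots> \<le> B2 / R * ((1 + ln (1 + D)) * (1 + ln (1 + R)))"
      using B_nonneg R0 by (intro mult_left_mono) auto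
    finally have g1: "norm (G X - G r) \<le> B2 / R * ((1 + ln (1 + D)) * (1 + ln (1 + R)))" .
    have g2: "norm (ee (R * w y) * of_real (s y) / (2 * of_real pi * \<i> * of_real R)) \<le> b' / R" if y: "0 < y" for y
    proof -
      have "norm (ee (R * w y) * of_real (s y) / (2 * of_real pi * \<i> * of_real R)) = \<bar>s y\<bar> / (2 * pi * R)"
        unfolding norm_divide n2 norm_mult norm_ee norm_of_real using R0 by simp
      also have "\<dots> \<le> b' / R" unfolding b'_def using s_bound(1)[OF y] p2 R0 by (intro frac_le) auto
      finally show ?thesis .
    qed
    have g3: "norm (Dd r) \<le> b / R"
    proof -
      have "r\<^sup>2 = 1 / R" unfolding r_def using R0 by (simp add: power_divide)
      then show ?thesis using first[of r] r unfolding b_def by simp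
    qed
    have "Dd X = (G X - G r) + ee (R * w X) * of_real (s X) / (2 * of_real pi * \<i> * of_real R)
        - ee (R * w r) * of_real (s r) / (2 * of_real pi * \<i> * of_real R) + Dd r"
      unfolding G_def by simp
    also have "norm \<dots> \<le> B2 / R * ((1 + ln (1 + D)) * (1 + ln (1 + R))) + b' / R + b' / R + b / R"
      using r by (intro norm_triangle_le norm_triangle_le_diff add_mono g1 g2 g3) auto
    also have "\<dots> = (B2 * ((1 + ln (1 + D)) * (1 + ln (1 + R))) + (b + 2 * b') * 1) / R"
      by (simp add: add_divide_distrib)
    also have "\<dots> \<le> (B2 * ((1 + ln (1 + D)) * (1 + ln (1 + R))) + (b + 2 * b') * (1 + ln (1 + R))) / R"
      using b0 lnR R0 by (intro divide_right_mono add_left_mono mult_left_mono) auto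
    also have "\<dots> = (b + 2 * b' + B2 * (1 + ln (1 + D))) * (1 + ln (1 + R)) / R" by (simp add: algebra_simps)
    finally show ?thesis .
  qed
  have tail: "norm (H X - of_real la * C0) \<le> 12 / (sqrt (2 * c1) * min 1 (sqrt (c1 / 2))) / (sqrt R + R * X)"
  proof -
    \<comment> \<open>\<open>m * sqrt R * X\<close> is a lower bound for \<open>u X\<close>; the cap
      at 1 allows \<open>m\<close> to be pulled out of \<open>1 + u X\<close>.\<close>
    define m where "m = min 1 (sqrt (c1 / 2))"
    have m: "0 < m" "m \<le> 1" "m \<le> sqrt (c1 / 2)" unfolding m_def using c1 by auto
    have u0: "0 \<le> u X" "m * (sqrt R * X) \<le> u X"
    proof -
      have wX: "c1 * X\<^sup>2 / 2 \<le> w X" using w_bounds[OF X(1)] by simp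
      then have wn: "0 \<le> w X" using c1 by (smt (verit) divide_nonneg_pos mult_nonneg_nonneg zero_le_power2)
      show "0 \<le> u X" unfolding u_def using R0 wn by simp
      have "m * (sqrt R * X) \<le> sqrt (c1 / 2) * (sqrt R * X)" using m X R0 by (intro mult_right_mono) auto
      also have "\<dots> = sqrt (R * (c1 * X\<^sup>2 / 2))" using X by (simp add: real_sqrt_mult real_sqrt_divide)
      also have "\<dots> \<le> u X" unfolding u_def using wX R0 by (intro real_sqrt_le_mono mult_left_mono) auto
      finally show "m * (sqrt R * X) \<le> u X" .
    qed
    have "H X - of_real la * C0 = of_real la * (Fr (u X) - C0)" unfolding H_def by (simp add: algebra_simps)
    then have "norm (H X - of_real la * C0) = la * norm (Fr (u X) - C0)" using la0 by (simp add: norm_mult)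
    also have "\<dots> \<le> la * (6 / (1 + u X))" using C0[OF u0(1)] la0 by (intro mult_left_mono) auto
    also have "\<dots> \<le> (2 / (sqrt (2 * c1) * sqrt R)) * (6 / (m * (1 + sqrt R * X)))"
    proof (intro mult_mono frac_le)
      have "sqrt (2 * c1) * sqrt R = sqrt (2 * c1 * R)" by (simp add: real_sqrt_mult)
      also have "\<dots> \<le> sqrt (2 * sg * R)" using sg R0 by (intro real_sqrt_le_mono mult_right_mono) auto
      finally have "sqrt (2 * c1) * sqrt R \<le> sqrt (2 * sg * R)" .
      then show "la \<le> 2 / (sqrt (2 * c1) * sqrt R)" unfolding la_def using c1 R0 by (intro frac_le) auto
      show "m * (1 + sqrt R * X) \<le> 1 + u X" using u0 m by (simp add: distrib_left)
      show "0 < m * (1 + sqrt R * X)" using m X R0 by (intro mult_pos_pos add_pos_nonneg) auto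
    qed (use c1 R0 u0 in auto)
    also have "\<dots> = 12 / (sqrt (2 * c1) * m) / (sqrt R * (1 + sqrt R * X))"
      by simp
    also have "sqrt R * (1 + sqrt R * X) = sqrt R + R * X"
    proof -
      have "sqrt R * (sqrt R * X) = R * X" using R0 by (simp add: mult.assoc[symmetric])
      then show ?thesis by (simp add: distrib_left)
    qed
    finally show ?thesis unfolding m_def .
  qed
  have eq: "E X - of_real la * C0 = Dd X + (H X - of_real la * C0)" unfolding Dd_def by simp
  show ?thesis
    unfolding la_def[symmetric] eq
    by (rule norm_triangle_le, rule add_mono[OF _ tail]) (use main in \<open>simp only: b_def b'_def times_divide_eq_right\<close>)
qed

end

lemma harm_le_ln:
  assumes "1 \<le> n"
  shows "harm n \<le> 1 + ln (real n)"
  using assms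
proof (induction n rule: dec_induct)
  case base
  then show ?case by (simp add: harm_def)
next
  case (step n)
  have n: "0 < real n" using step by simp
  have "ln (real n / (real n + 1)) \<le> real n / (real n + 1) - 1" using n by (intro ln_le_minus_one) simp
  then have "1 / (real n + 1) \<le> ln (real n + 1) - ln (real n)"
    using n by (simp add: ln_div field_simps)
  then show ?case using step.IH by (simp add: harm_Suc inverse_eq_divide add.commute)
qed

lemma harm_le_ln1: "harm n \<le> 1 + ln (1 + real n)"
proof (cases "n = 0")
  case False
  then have "harm n \<le> 1 + ln (real n)" by (intro harm_le_ln) simp
  also have "\<dots> \<le> 1 + ln (1 + real n)" using False by simp
  finally show ?thesis .
qed (simp add: harm_def)

text \<open>The terms for 0 and 1 may be as large as \<open>1 / s\<close>; from then on
  \<open>d m \<ge> m - 1\<close> gives a harmonic sum.\<close>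

lemma sum_reciprocal_floor:
  fixes s :: real and d :: "nat \<Rightarrow> real"
  assumes s: "0 < s" and d: "\<And>m. m \<le> K \<Longrightarrow> real m - 1 \<le> d m" "\<And>m. m \<le> K \<Longrightarrow> 0 \<le> d m"
  shows "(\<Sum>m\<le>K. 1 / (s + d m)) \<le> 2 / s + harm K"
proof -
  have "(\<Sum>m\<le>n. 1 / (s + d m)) \<le> (if n = 0 then 1 / s else 2 / s + harm (n - 1))" if "n \<le> K" for n
    using that
  proof (induction n)
    case 0
    have "1 / (s + d 0) \<le> 1 / s" using s d(2)[of 0] by (intro frac_le) auto
    then show ?case by simp
  next
    case (Suc n)
    show ?case
    proof (cases "n = 0")
      case True
      have "1 / (s + d 1) \<le> 1 / s" "1 / (s + d 0) \<le> 1 / s"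
        using s d(2)[of 1] d(2)[of 0] Suc.prems True by (auto intro!: frac_le)
      then show ?thesis using True by (simp add: harm_def)
    next
      case False
      have "1 / (s + d (Suc n)) \<le> 1 / real n" using s d[of "Suc n"] Suc.prems False by (intro frac_le) auto
      moreover have "harm n = harm (n - 1) + 1 / real n" 
        using False by (metis Suc_pred' bot_nat_0.not_eq_extremum harm_Suc inverse_eq_divide)
      ultimately show ?thesis using Suc.IH Suc.prems False by simp
    qed
  qed
  from this[of K] have "(\<Sum>m\<le>K. 1 / (s + d m)) \<le> (if K = 0 then 1 / s else 2 / s + harm (K - 1))" by simp
  also have "\<dots> \<le> 2 / s + harm K"
  proof -
    have "harm (K - 1) \<le> (harm K :: real)" by (rule harm_mono) simp
    moreover have "1 / s \<le> 2 / s" using s by (intro divide_right_mono) auto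
    moreover have "0 \<le> (harm K :: real)" by (simp add: harm_nonneg)
    ultimately show ?thesis by (cases "K = 0") (simp_all add: harm_def)
  qed
  finally show ?thesis .
qed

text \<open>The curve is defined on the whole line with a bijective slope \<open>f1\<close>, so that
  \<open>g\<close> and the dual \<open>h\<close> are total; \<open>convex_curve_extension\<close>
  brings a function on an interval into this form.\<close>

locale convex_curve =
  fixes f f1 f2 g :: "real \<Rightarrow> real" and c1 c2 L :: real
  assumes df: "\<And>x. (f has_real_derivative f1 x) (at x)"
    and df1: "\<And>x. (f1 has_real_derivative f2 x) (at x)"
    and c1: "0 < c1" and f2: "\<And>x. c1 \<le> f2 x" "\<And>x. f2 x \<le> c2"
    and L: "0 \<le> L" "\<And>x y. \<bar>f2 x - f2 y\<bar> \<le> L * \<bar>x - y\<bar>"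
    and g: "\<And>x. g (f1 x) = x" "\<And>y. f1 (g y) = y"
begin

definition "h y = y * g y - f (g y)"

lemma c2: "0 < c2" "c1 \<le> c2" using f2[of 0] c1 by auto

lemma f1_diff:
  assumes "x \<le> y"
  shows "c1 * (y - x) \<le> f1 y - f1 x" "f1 y - f1 x \<le> c2 * (y - x)"
proof -
  have "\<exists>z. f1 y - f1 x = (y - x) * f2 z"
  proof (cases "x = y")
    case False
    then show ?thesis using MVT2[of x y f1 f2] df1 assms by force
  qed simp
  then obtain z where z: "f1 y - f1 x = (y - x) * f2 z" by auto
  have yx: "0 \<le> y - x" using assms by simp
  show "c1 * (y - x) \<le> f1 y - f1 x" "f1 y - f1 x \<le> c2 * (y - x)"
    unfolding z using mult_right_mono[OF f2(1)[of z] yx] mult_right_mono[OF f2(2)[of z] yx]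
    by (simp_all add: mult.commute)
qed

lemma f1_less_iff: "f1 x < f1 y \<longleftrightarrow> x < y"
proof -
  have "f1 u < f1 v" if "u < v" for u v
  proof -
    have "0 < c1 * (v - u)" using c1 that by simp
    then show ?thesis using f1_diff(1)[of u v] that by linarith
  qed
  then show ?thesis by (metis linorder_neqE_linordered_idom order.asym)
qed

lemma f1_le_iff: "f1 x \<le> f1 y \<longleftrightarrow> x \<le> y"
  using f1_less_iff[of y x] by (simp add: not_less[symmetric])

lemma f1_abs: "c1 * \<bar>x - y\<bar> \<le> \<bar>f1 x - f1 y\<bar>" "\<bar>f1 x - f1 y\<bar> \<le> c2 * \<bar>x - y\<bar>"
proof -
  have "c1 * \<bar>x - y\<bar> \<le> \<bar>f1 x - f1 y\<bar> \<and> \<bar>f1 x - f1 y\<bar> \<le> c2 * \<bar>x - y\<bar>"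
  proof (cases "x \<le> y")
    case True
    have "0 \<le> c1 * (y - x)" using c1 True by simp
    then show ?thesis using f1_diff[OF True] True by simp
  next
    case False
    then have le: "y \<le> x" by simp
    have "0 \<le> c1 * (x - y)" using c1 le by simp
    then show ?thesis using f1_diff[OF le] le by simp
  qed
  then show "c1 * \<bar>x - y\<bar> \<le> \<bar>f1 x - f1 y\<bar>" "\<bar>f1 x - f1 y\<bar> \<le> c2 * \<bar>x - y\<bar>" by auto
qed

lemma phase_right: "phase (\<lambda>y. f (y0 + y) - f y0 - f1 y0 * y) (\<lambda>y. f1 (y0 + y) - f1 y0) (\<lambda>y. f2 (y0 + y)) c1 c2 L"
proof
  fix x
  have s: "((+) y0 has_real_derivative 1) (at x)" by (auto intro!: derivative_eq_intros)
  show "((\<lambda>y. f (y0 + y) - f y0 - f1 y0 * y) has_real_derivative f1 (y0 + x) - f1 y0) (at x)"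
    by (auto intro!: derivative_eq_intros DERIV_chain'[OF s df])
  show "((\<lambda>y. f1 (y0 + y) - f1 y0) has_real_derivative f2 (y0 + x)) (at x)"
    by (auto intro!: derivative_eq_intros DERIV_chain'[OF s df1])
  show "\<bar>f2 (y0 + x) - f2 (y0 + y)\<bar> \<le> L * \<bar>x - y\<bar>" for y using L(2)[of "y0 + x" "y0 + y"] by simp
qed (use c1 f2 L in auto)

lemma phase_left: "phase (\<lambda>y. f (y0 - y) - f y0 + f1 y0 * y) (\<lambda>y. f1 y0 - f1 (y0 - y)) (\<lambda>y. f2 (y0 - y)) c1 c2 L"
proof
  fix x
  have s: "((-) y0 has_real_derivative -1) (at x)" by (auto intro!: derivative_eq_intros)
  show "((\<lambda>y. f (y0 - y) - f y0 + f1 y0 * y) has_real_derivative f1 y0 - f1 (y0 - x)) (at x)"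
    by (auto intro!: derivative_eq_intros DERIV_chain'[OF s df])
  show "((\<lambda>y. f1 y0 - f1 (y0 - y)) has_real_derivative f2 (y0 - x)) (at x)"
    by (auto intro!: derivative_eq_intros DERIV_chain'[OF s df1])
  show "\<bar>f2 (y0 - x) - f2 (y0 - y)\<bar> \<le> L * \<bar>x - y\<bar>" for y using L(2)[of "y0 - x" "y0 - y"] by (simp add: abs_minus_commute)
qed (use c1 f2 L in auto)

end

text \<open>The constants of \<open>phase.one_sided\<close> written out, to make visible that they
  do not depend on the curve.\<close>

definition phase_const :: "real \<Rightarrow> real \<Rightarrow> real \<Rightarrow> real \<Rightarrow> real" where
  "phase_const c1 c2 L D = (c2 * L / c1) / c1 + 2 * (c2 * L / c1) / c1\<^sup>2 +
     ((3 * c2 ^ 3 * (c2 * L / c1) + L * c2 ^ 3) / c1 ^ 5) * (1 + ln (1 + D))"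

definition endpoint_const :: "real \<Rightarrow> real" where
  "endpoint_const c1 = 12 / (sqrt (2 * c1) * min 1 (sqrt (c1 / 2)))"

context convex_curve
begin

text \<open>Both half-lines at the stationary point \<open>g t\<close> have the same main term. The
  difference of the antiderivative at \<open>\<beta>\<close> and at \<open>\<alpha>\<close> doubles
  it if \<open>g t\<close> lies between them and cancels it otherwise. By duality the phase at
  \<open>g t\<close> is \<open>- R * h t\<close>.\<close>

lemma stationary_phase:
  fixes Fr :: "real \<Rightarrow> complex" and C0 :: complex
  assumes Fr: "\<And>x. (Fr has_vector_derivative ee (x\<^sup>2)) (at x)" "Fr 0 = 0"
    and C0: "\<And>z. 0 \<le> z \<Longrightarrow> norm (Fr z - C0) \<le> 6 / (1 + z)"
    and R: "1 \<le> R" and al: "\<alpha> \<le> \<beta>" and D: "\<bar>\<alpha> - g t\<bar> \<le> D" "\<bar>\<beta> - g t\<bar> \<le> D"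
  shows "norm (integral {\<alpha>..\<beta>} (\<lambda>y. ee (R * (f y - t * y))) -
      (if \<alpha> < g t \<and> g t \<le> \<beta> then 2 else 0) * (of_real (2 / sqrt (2 * f2 (g t) * R)) * C0) * ee (- (R * h t)))
    \<le> 2 * (phase_const c1 c2 L D * (1 + ln (1 + R)) / R) + endpoint_const c1 / (sqrt R + R * \<bar>\<alpha> - g t\<bar>) + endpoint_const c1 / (sqrt R + R * \<bar>\<beta> - g t\<bar>)"
proof -
  define y0 where "y0 = g t"
  define M where "M = of_real (2 / sqrt (2 * f2 y0 * R)) * C0"
  define er where "er X = phase_const c1 c2 L D * (1 + ln (1 + R)) / R + endpoint_const c1 / (sqrt R + R * X)" for X
  have t: "f1 y0 = t" unfolding y0_def by (rule g(2))
  define w where "w y = f (y0 + y) - f y0 - t * y" for y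
  have dw: "(w has_real_derivative f1 (y0 + y) - t) (at y)" for y
    using phase.dw[OF phase_right[of y0]] unfolding w_def t .
  have "continuous_on UNIV (\<lambda>y. ee (R * w y))"
    by (intro continuous_intros continuous_on_ee DERIV_continuous_on[OF DERIV_subset[OF dw subset_UNIV]])
  then obtain E where E: "\<And>x. (E has_vector_derivative ee (R * w x)) (at x)" "E 0 = 0"
    using antiderivative_exists[of "\<lambda>y. ee (R * w y)"] by blast
  \<comment> \<open>The left half-line is the right half-line of the reflected phase.\<close>
  define E' where "E' x = - E (- x)" for x
  have E': "(E' has_vector_derivative ee (R * (f (y0 - x) - f y0 + t * x))) (at x)" "E' 0 = 0" for x
  proof -
    have "((\<lambda>x. - x) has_vector_derivative - 1) (at x)" by (auto intro!: derivative_eq_intros)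
    from vector_diff_chain_at[OF this E(1)]
    have "((\<lambda>x. E (- x)) has_vector_derivative - ee (R * w (- x))) (at x)" by (simp add: o_def)
    then have "(E' has_vector_derivative ee (R * w (- x))) (at x)"
      unfolding E'_def using has_vector_derivative_minus by fastforce
    then show "(E' has_vector_derivative ee (R * (f (y0 - x) - f y0 + t * x))) (at x)" by (simp add: w_def)
    show "E' 0 = 0" by (simp add: E'_def E)
  qed
  have right: "norm (E X - M) \<le> er X" if X: "0 \<le> X" "X \<le> D" for X
    using phase.one_sided[OF phase_right[of y0, unfolded t] Fr C0 E(1)[unfolded w_def] E(2) R X]
    unfolding phase.B1_def[OF phase_right] phase.B2_def[OF phase_right] phase.sg_def[OF phase_right]
    unfolding M_def er_def phase_const_def endpoint_const_def by simp
  have left: "norm (E' X - M) \<le> er X" if X: "0 \<le> X" "X \<le> D" for X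
    using phase.one_sided[OF phase_left[of y0, unfolded t] Fr C0 E'(1) E'(2) R X]
    unfolding phase.B1_def[OF phase_left] phase.B2_def[OF phase_left] phase.sg_def[OF phase_left]
    unfolding M_def er_def phase_const_def endpoint_const_def by simp
  \<comment> \<open>The sign \<open>+1\<close> at 0 fixes the half-open convention
    \<open>\<alpha> < g t \<le> \<beta>\<close>, the one used in \<open>slopes\<close>.\<close>
  define sg where "sg X = (if 0 \<le> X then 1 else - 1 :: complex)" for X :: real
  have both: "norm (E X - sg X * M) \<le> er \<bar>X\<bar>" if "\<bar>X\<bar> \<le> D" for X
  proof (cases "0 \<le> X")
    case True
    then show ?thesis using right[of X] that by (simp add: sg_def)
  next
    case False
    have "E X - sg X * M = - (E' (- X) - M)" unfolding sg_def E'_def using False by simp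
    then show ?thesis using left[of "- X"] False that by (simp add: norm_minus_cancel del: minus_diff_eq)
  qed
  have dEs: "((\<lambda>y. E (y - y0)) has_vector_derivative ee (R * w (y - y0))) (at y)" for y
  proof -
    have "((\<lambda>y. y - y0) has_vector_derivative 1) (at y)" by (auto intro!: derivative_eq_intros)
    from vector_diff_chain_at[OF this E(1)] show ?thesis by (simp add: o_def)
  qed
  have eq: "ee (R * (f y - t * y)) = ee (- (R * h t)) * ee (R * w (y - y0))" for y
  proof -
    have "R * (f y - t * y) = - (R * h t) + R * w (y - y0)"
      unfolding w_def h_def y0_def by (simp add: algebra_simps)
    then show ?thesis by (simp only: ee_add)
  qed
  have "integral {\<alpha>..\<beta>} (\<lambda>y. ee (R * (f y - t * y))) = ee (- (R * h t)) * integral {\<alpha>..\<beta>} (\<lambda>y. ee (R * w (y - y0)))"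
    unfolding eq by simp
  also have "\<dots> = ee (- (R * h t)) * (E (\<beta> - y0) - E (\<alpha> - y0))"
    using antiderivative_integral[OF dEs al] by simp
  finally have I: "integral {\<alpha>..\<beta>} (\<lambda>y. ee (R * (f y - t * y))) = ee (- (R * h t)) * (E (\<beta> - y0) - E (\<alpha> - y0))" .
  have sgs: "(if \<alpha> < y0 \<and> y0 \<le> \<beta> then 2 else 0) = sg (\<beta> - y0) - sg (\<alpha> - y0)"
    using al by (auto simp: sg_def)
  have "integral {\<alpha>..\<beta>} (\<lambda>y. ee (R * (f y - t * y))) - (if \<alpha> < y0 \<and> y0 \<le> \<beta> then 2 else 0) * M * ee (- (R * h t))
    = ee (- (R * h t)) * ((E (\<beta> - y0) - sg (\<beta> - y0) * M) - (E (\<alpha> - y0) - sg (\<alpha> - y0) * M))"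
    unfolding I sgs by (simp add: algebra_simps)
  also have "norm \<dots> \<le> er \<bar>\<beta> - y0\<bar> + er \<bar>\<alpha> - y0\<bar>"
    unfolding norm_mult norm_ee mult_1_left
    by (intro norm_triangle_le_diff add_mono both) (use D in \<open>auto simp: y0_def\<close>)
  finally show ?thesis unfolding M_def er_def y0_def by simp
qed

lemma integral_scale:
  fixes u :: "real \<Rightarrow> complex"
  assumes c: "continuous_on UNIV u" and q: "0 < q" and ab: "a \<le> b"
  shows "integral {a..b} u = of_real q * integral {a / q..b / q} (\<lambda>y. u (q * y))"
proof -
  obtain G where G: "\<And>x. (G has_vector_derivative u x) (at x)" "G 0 = 0"
    using antiderivative_exists[OF c] by blast
  have "((\<lambda>y. G (q * y)) has_vector_derivative q *\<^sub>R u (q * y)) (at y)" for y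
  proof -
    have "((\<lambda>y. q * y) has_vector_derivative q) (at y)" by (auto intro!: derivative_eq_intros)
    from vector_diff_chain_at[OF this G(1)] show ?thesis by (simp add: o_def)
  qed
  then have "integral {a / q..b / q} (\<lambda>y. q *\<^sub>R u (q * y)) = G (q * (b / q)) - G (q * (a / q))"
    by (rule antiderivative_integral) (use ab q in \<open>auto intro: divide_right_mono\<close>)
  also have "\<dots> = integral {a..b} u" using q antiderivative_integral[OF G(1) ab] by simp
  finally show ?thesis by (simp add: scaleR_conv_of_real)
qed

definition slopes :: "real \<Rightarrow> real \<Rightarrow> nat \<Rightarrow> int set" where
  "slopes a b j = {k. a < g (of_int k / real j) \<and> g (of_int k / real j) \<le> b}"

lemma slopes_eq:
  assumes "0 < j"
  shows "slopes a b j = {\<lfloor>real j * f1 a\<rfloor> + 1..\<lfloor>real j * f1 b\<rfloor>}"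
proof -
  have "a < g (of_int k / real j) \<longleftrightarrow> real j * f1 a < of_int k" for k
    using f1_less_iff[of a "g (of_int k / real j)"] assms by (simp add: g field_simps)
  moreover have "g (of_int k / real j) \<le> b \<longleftrightarrow> of_int k \<le> real j * f1 b" for k
    using f1_le_iff[of "g (of_int k / real j)" b] assms by (simp add: g field_simps)
  ultimately show ?thesis unfolding slopes_def by (auto simp: floor_less_iff le_floor_iff) (linarith+)?
qed

lemma card_slopes:
  assumes "0 < j" "a \<le> b"
  shows "real (card (slopes a b j)) \<le> real j * (c2 * (b - a)) + 1"
proof -
  have "real j * (f1 b - f1 a) \<le> real j * (c2 * (b - a))" using f1_diff(2)[OF assms(2)] by (intro mult_left_mono) auto
  moreover have "real j * f1 a \<le> real j * f1 b" using f1_le_iff assms by (intro mult_left_mono) auto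
  ultimately show ?thesis unfolding slopes_eq[OF assms(1)] by (simp add: right_diff_distrib) linarith
qed

end

section \<open>Exponential sums over the rational points of a curve\<close>

text \<open>\<open>l\<close> is the length of the interval and \<open>n0\<close> the norm of the
  Fresnel constant \<open>C0\<close>.\<close>

definition exp_sum_const :: "real \<Rightarrow> real \<Rightarrow> real \<Rightarrow> real \<Rightarrow> real \<Rightarrow> real" where
  "exp_sum_const c1 c2 L l n0 = 3 * (1 + ln (1 + 2 * (c2 * l + 3))) + 2 * (c2 * l + 3) * phase_const c1 c2 L ((c2 * l + 1) / c1)
     + 2 * (endpoint_const c1 * max 1 c2) * (3 + ln (1 + 2 * (c2 * l + 3))) + 8 * n0 / sqrt (2 * c1) * (c2 + 1)"

locale fresnel_curve = convex_curve +
  fixes Fr :: "real \<Rightarrow> complex" and C0 :: complex and \<eta> \<xi> :: real and j q :: nat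
  assumes Fr: "\<And>x. (Fr has_vector_derivative ee (x\<^sup>2)) (at x)" "Fr 0 = 0"
    and C0: "\<And>z. 0 \<le> z \<Longrightarrow> norm (Fr z - C0) \<le> 6 / (1 + z)"
    and I: "\<eta> < \<xi>" and jq: "1 \<le> j" "1 \<le> q"
begin

text \<open>The main term of stationary phase with parameter \<open>j * q\<close>, times the factor
  \<open>q\<close> from rescaling. What remains of \<open>q\<close> is \<open>sqrt q\<close> and a
  phase linear in \<open>q\<close>, so that the sum over \<open>q\<close> can be carried
  out.\<close>

definition "T k = of_real (sqrt (real q)) * (of_real (4 / sqrt (2 * f2 (g (of_int k / real j)) * real j)) * C0)
   * ee (- (real q * (real j * h (of_int k / real j))))"

definition "term_bound = 4 * norm C0 / sqrt (2 * c1) * sqrt (real q / real j)"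

lemma jq0: "0 < real j" "0 < real q" using jq by auto

lemma norm_T: "norm (T k) \<le> term_bound"
proof -
  have "2 * c1 * real j \<le> 2 * f2 (g (of_int k / real j)) * real j"
    using f2(1) jq0 by (intro mult_right_mono) auto
  then have "4 / sqrt (2 * f2 (g (of_int k / real j)) * real j) \<le> 4 / sqrt (2 * c1 * real j)"
    using c1 jq0 by (intro divide_left_mono) auto
  moreover have "0 < f2 (g (of_int k / real j))" using f2(1)[of "g (of_int k / real j)"] c1 by linarith
  ultimately have "norm (T k) \<le> sqrt (real q) * (4 / sqrt (2 * c1 * real j) * norm C0)"
    unfolding T_def norm_mult norm_ee mult_1_right norm_of_real
    using jq0 c1 by (intro mult_mono) auto
  also have "\<dots> = term_bound" unfolding term_bound_def by (simp add: real_sqrt_mult real_sqrt_divide)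
  finally show ?thesis .
qed

lemma finite_slopes: "finite (slopes a b j)"
  using slopes_eq[of j a b] jq by simp

text \<open>The sum over \<open>a\<close> ends at fractions within \<open>1 / q\<close> of
  \<open>\<eta>\<close> and \<open>\<xi>\<close>; moving the ends back adds about
  \<open>j / q\<close> slopes on either side.\<close>

lemma T_diff:
  assumes ab: "\<eta> \<le> a" "a \<le> b" "b \<le> \<xi>" "a - \<eta> \<le> 1 / real q" "\<xi> - b \<le> 1 / real q"
  shows "norm ((\<Sum>k\<in>slopes a b j. T k) - (\<Sum>k\<in>slopes \<eta> \<xi> j. T k)) \<le> (2 * (real j * c2 / real q) + 2) * term_bound"
proof -
  have sub: "slopes a b j \<subseteq> slopes \<eta> \<xi> j" using ab unfolding slopes_def by auto
  have "slopes \<eta> \<xi> j - slopes a b j \<subseteq> slopes \<eta> a j \<union> slopes b \<xi> j" unfolding slopes_def by auto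
  then have "card (slopes \<eta> \<xi> j - slopes a b j) \<le> card (slopes \<eta> a j \<union> slopes b \<xi> j)"
    by (intro card_mono) (auto simp: finite_slopes)
  also have "\<dots> \<le> card (slopes \<eta> a j) + card (slopes b \<xi> j)" by (rule card_Un_le)
  finally have "real (card (slopes \<eta> \<xi> j - slopes a b j)) \<le> real (card (slopes \<eta> a j)) + real (card (slopes b \<xi> j))" by simp
  also have "\<dots> \<le> (real j * (c2 * (a - \<eta>)) + 1) + (real j * (c2 * (\<xi> - b)) + 1)"
    using jq ab by (intro add_mono card_slopes) auto
  also have "\<dots> \<le> (real j * (c2 * (1 / real q)) + 1) + (real j * (c2 * (1 / real q)) + 1)"
    using ab c2 jq0 by (intro add_mono mult_left_mono) auto
  also have "\<dots> = 2 * (real j * c2 / real q) + 2" by simp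
  finally have cd: "real (card (slopes \<eta> \<xi> j - slopes a b j)) \<le> 2 * (real j * c2 / real q) + 2" .
  have "(\<Sum>k\<in>slopes a b j. T k) - (\<Sum>k\<in>slopes \<eta> \<xi> j. T k) = - (\<Sum>k\<in>slopes \<eta> \<xi> j - slopes a b j. T k)"
    using sum.subset_diff[OF sub finite_slopes, of T] by simp
  then have "norm ((\<Sum>k\<in>slopes a b j. T k) - (\<Sum>k\<in>slopes \<eta> \<xi> j. T k)) \<le> (\<Sum>k\<in>slopes \<eta> \<xi> j - slopes a b j. term_bound)"
    by (simp only: norm_minus_cancel) (intro sum_norm_le norm_T)
  also have "\<dots> = real (card (slopes \<eta> \<xi> j - slopes a b j)) * term_bound" by simp
  also have "\<dots> \<le> (2 * (real j * c2 / real q) + 2) * term_bound"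
    using cd c1 jq0 by (intro mult_right_mono) (auto simp: term_bound_def)
  finally show ?thesis .
qed

text \<open>Covers an interval without fractions of denominator \<open>q\<close>, where the sum over
  \<open>a\<close> is empty and the whole dual sum counts as error.\<close>

lemma T_all:
  assumes "\<xi> - \<eta> \<le> 1 / real q"
  shows "norm (\<Sum>k\<in>slopes \<eta> \<xi> j. T k) \<le> (2 * (real j * c2 / real q) + 2) * term_bound"
proof -
  have "real (card (slopes \<eta> \<xi> j)) \<le> real j * (c2 * (\<xi> - \<eta>)) + 1" using jq I by (intro card_slopes) auto
  also have "\<dots> \<le> real j * (c2 * (1 / real q)) + 1" using assms c2 jq0 by (intro add_mono mult_left_mono) auto
  also have "\<dots> \<le> 2 * (real j * c2 / real q) + 2"
  proof -
    have "0 \<le> real j * c2 / real q" using c2 by simp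
    moreover have "real j * (c2 * (1 / real q)) = real j * c2 / real q" by simp
    ultimately show ?thesis by linarith
  qed
  finally have cd: "real (card (slopes \<eta> \<xi> j)) \<le> 2 * (real j * c2 / real q) + 2" .
  have "norm (\<Sum>k\<in>slopes \<eta> \<xi> j. T k) \<le> (\<Sum>k\<in>slopes \<eta> \<xi> j. term_bound)" by (intro sum_norm_le norm_T)
  also have "\<dots> = real (card (slopes \<eta> \<xi> j)) * term_bound" by simp
  also have "\<dots> \<le> (2 * (real j * c2 / real q) + 2) * term_bound"
    using cd c1 jq0 by (intro mult_right_mono) (auto simp: term_bound_def)
  finally show ?thesis .
qed

text \<open>The first term is the size of one dual term, the second that of the \<open>j / q\<close>
  terms which the ends may add; the logarithm comes from Poisson summation and stationary
  phase.\<close>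

definition "U = sqrt (real q / real j) + sqrt (real j / real q) + 1 + ln (1 + real j * real q)"

lemma ln_jq: "0 \<le> ln (1 + real j * real q)" by simp

lemma term_bound_U: "(2 * (real j * c2 / real q) + 2) * term_bound \<le> 8 * norm C0 / sqrt (2 * c1) * (c2 + 1) * U"
proof -
  define s where "s = sqrt (real q / real j)"
  define s' where "s' = sqrt (real j / real q)"
  have ss: "0 \<le> s" "0 \<le> s'" unfolding s_def s'_def by auto
  have "real j / real q * s = s'"
  proof -
    have "s * s' = 1" unfolding s_def s'_def using jq0 by (simp add: real_sqrt_mult[symmetric])
    moreover have "real j / real q = s' * s'" unfolding s'_def using jq0 by simp
    ultimately show ?thesis by (metis mult.assoc mult.commute mult.right_neutral)
  qed
  moreover have "(2 * (real j * c2 / real q) + 2) * s = 2 * c2 * (real j / real q * s) + 2 * s"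
    by (simp add: distrib_right)
  ultimately have "(2 * (real j * c2 / real q) + 2) * s = 2 * c2 * s' + 2 * s" by (simp only:)
  also have "\<dots> \<le> 2 * (c2 + 1) * (s + s')" using ss c2 by (simp add: algebra_simps)
  also have "\<dots> \<le> 2 * (c2 + 1) * U" unfolding U_def s_def[symmetric] s'_def[symmetric]
    using c2 by (intro mult_left_mono) auto
  finally have "4 * norm C0 / sqrt (2 * c1) * ((2 * (real j * c2 / real q) + 2) * s) \<le> 4 * norm C0 / sqrt (2 * c1) * (2 * (c2 + 1) * U)"
    using c1 by (intro mult_left_mono) auto
  then show ?thesis unfolding term_bound_def s_def[symmetric] by (simp add: mult_ac)
qed

lemma exp_sum_const_parts:
  defines "l \<equiv> \<xi> - \<eta>"
  shows "0 \<le> ln (1 + 2 * (c2 * l + 3))" "0 \<le> phase_const c1 c2 L ((c2 * l + 1) / c1)" "0 \<le> endpoint_const c1"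
    "0 \<le> 8 * norm C0 / sqrt (2 * c1) * (c2 + 1)" "0 \<le> c2 * l"
proof -
  show cl: "0 \<le> c2 * l" unfolding l_def using I c2 by simp
  then show "0 \<le> ln (1 + 2 * (c2 * l + 3))" by simp
  have "0 \<le> ln (1 + (c2 * l + 1) / c1)" using cl c1 by simp
  then show "0 \<le> phase_const c1 c2 L ((c2 * l + 1) / c1)" unfolding phase_const_def using c1 c2 L
    by (intro add_nonneg_nonneg mult_nonneg_nonneg divide_nonneg_nonneg) auto
  show "0 \<le> endpoint_const c1" unfolding endpoint_const_def using c1 by simp
  show "0 \<le> 8 * norm C0 / sqrt (2 * c1) * (c2 + 1)" using c1 c2 by simp
qed

text \<open>Poisson summation in \<open>a\<close> leaves about \<open>j\<close> integrals with
  stationary slopes \<open>t m = (K0 + m) / j\<close>, and the substitution \<open>x = q * y\<close>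
  gives each the large parameter \<open>R = j * q\<close>. After multiplication by \<open>q\<close>,
  the interior errors \<open>(1 + ln (1 + R)) / j\<close> add up to a logarithm and the endpoint
  errors to a harmonic sum.\<close>

lemma exp_sum_asymptotic:
  "norm ((\<Sum>a\<in>{\<lceil>real q * \<eta>\<rceil>..\<lfloor>real q * \<xi>\<rfloor>}. ee (real j * real q * f (of_int a / real q))) - (\<Sum>k\<in>slopes \<eta> \<xi> j. T k))
    \<le> exp_sum_const c1 c2 L (\<xi> - \<eta>) (norm C0) * U"
proof -
  define A where "A = \<lceil>real q * \<eta>\<rceil>"
  define B where "B = \<lfloor>real q * \<xi>\<rfloor>"
  define l where "l = \<xi> - \<eta>"
  define V where "V = ln (1 + 2 * (c2 * l + 3))"
  define A1 where "A1 = phase_const c1 c2 L ((c2 * l + 1) / c1)"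
  define A2 where "A2 = endpoint_const c1 * max 1 c2"
  have nn: "0 \<le> V" "0 \<le> A1" "0 \<le> A2" "0 \<le> c2 * l" unfolding V_def A1_def A2_def l_def using exp_sum_const_parts by auto
  have U0: "1 \<le> U" "1 + ln (1 + real j * real q) \<le> U" "sqrt (real q / real j) \<le> U" unfolding U_def using ln_jq by auto
  have es: "exp_sum_const c1 c2 L (\<xi> - \<eta>) (norm C0) = 3 * (1 + V) + 2 * (c2 * l + 3) * A1 + 2 * A2 * (3 + V) + 8 * norm C0 / sqrt (2 * c1) * (c2 + 1)"
    unfolding exp_sum_const_def V_def A1_def A2_def l_def by simp
  show ?thesis
  proof (cases "A \<le> B")
    case False
    then have "real q * \<xi> - real q * \<eta> \<le> 1" unfolding A_def B_def by linarith
    then have "\<xi> - \<eta> \<le> 1 / real q" using jq0 by (simp add: field_simps)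
    then have "norm (\<Sum>k\<in>slopes \<eta> \<xi> j. T k) \<le> 8 * norm C0 / sqrt (2 * c1) * (c2 + 1) * U"
      using T_all term_bound_U by linarith
    also have "\<dots> \<le> exp_sum_const c1 c2 L (\<xi> - \<eta>) (norm C0) * U"
      unfolding es using nn U0 by (intro mult_right_mono) auto
    finally show ?thesis using False unfolding A_def[symmetric] B_def[symmetric] by simp
  next
    case True
    define k where "k = nat (B - A)"
    have Bk: "of_int A + real k = of_int B" unfolding k_def using True by simp
    define a where "a = of_int A / real q"
    define b where "b = of_int B / real q"
    have ab: "\<eta> \<le> a" "a \<le> b" "b \<le> \<xi>" "a - \<eta> \<le> 1 / real q" "\<xi> - b \<le> 1 / real q"
    proof -
      have "real q * \<eta> \<le> of_int A" "of_int A \<le> real q * \<eta> + 1" "of_int B \<le> real q * \<xi>" "real q * \<xi> - 1 \<le> of_int B"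
        unfolding A_def B_def by linarith+
      moreover have "a - \<eta> = (of_int A - real q * \<eta>) / real q" "\<xi> - b = (real q * \<xi> - of_int B) / real q"
        unfolding a_def b_def using jq0 by (auto simp: diff_divide_distrib)
      ultimately show "\<eta> \<le> a" "b \<le> \<xi>" "a - \<eta> \<le> 1 / real q" "\<xi> - b \<le> 1 / real q"
        unfolding a_def b_def using jq0 by (auto simp: pos_le_divide_eq pos_divide_le_eq mult.commute intro!: divide_right_mono)
      show "a \<le> b" unfolding a_def b_def using True jq0 by (intro divide_right_mono) auto
    qed
    define F where "F x = real j * real q * f (x / real q)" for x
    define F1 where "F1 x = real j * f1 (x / real q)" for x
    define F2 where "F2 x = real j / real q * f2 (x / real q)" for x
    have sc: "((\<lambda>x. x / real q) has_real_derivative 1 / real q) (at x)" for x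
      using jq by (auto intro!: derivative_eq_intros)
    have dF: "(F has_real_derivative F1 x) (at x)" for x
      unfolding F_def F1_def using DERIV_cmult[OF DERIV_chain'[OF sc df], of "real j * real q" x] jq0 by simp
    have dF1: "(F1 has_real_derivative F2 x) (at x)" for x
      unfolding F1_def F2_def using DERIV_cmult[OF DERIV_chain'[OF sc df1], of "real j" x] jq0 by (simp add: mult_ac)
    have F2: "0 \<le> F2 x" for x unfolding F2_def using f2(1)[of "x / real q"] c1 jq0 by (intro mult_nonneg_nonneg) auto
    define K0 where "K0 = \<lfloor>F1 (of_int A)\<rfloor>"
    define K where "K = nat (\<lceil>F1 (of_int A + of_nat k)\<rceil> - \<lfloor>F1 (of_int A)\<rfloor>)"
    have FA: "F1 (of_int A) = real j * f1 a" "F1 (of_int A + of_nat k) = real j * f1 b"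
      unfolding F1_def a_def b_def Bk by auto
    have fab: "f1 b - f1 a \<le> c2 * l" 
    proof -
      have "f1 b - f1 a \<le> c2 * (b - a)" by (rule f1_diff(2)[OF ab(2)])
      also have "\<dots> \<le> c2 * l" unfolding l_def using ab c2 by (intro mult_left_mono) auto
      finally show ?thesis .
    qed
    have jf: "real j * f1 a \<le> real j * f1 b" using f1_le_iff ab by (intro mult_left_mono) auto
    have K0K: "of_int K0 \<le> real j * f1 a" "real j * f1 a < of_int K0 + 1" "K0 + int K = \<lceil>real j * f1 b\<rceil>"
      unfolding K_def K0_def FA using jf by linarith+
    have Kb: "real K + 1 \<le> (c2 * l + 3) * real j"
    proof -
      have "real_of_int (\<lceil>real j * f1 b\<rceil>) < real j * f1 b + 1" by linarith
      then have "real K < real j * (f1 b - f1 a) + 2" using K0K by (simp add: right_diff_distrib)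
      also have "real j * (f1 b - f1 a) \<le> real j * (c2 * l)" using fab by (intro mult_left_mono) auto
      also have "real j * (c2 * l) + 2 \<le> (c2 * l + 3) * real j - real j * 1" using jq by (simp add: algebra_simps)
      finally show ?thesis using jq by simp
    qed
    define S where "S = (\<Sum>i\<le>k. ee (F (of_int A + of_nat i)))"
    have S: "(\<Sum>a\<in>{A..B}. ee (real j * real q * f (of_int a / real q))) = S"
      unfolding S_def F_def
      by (rule sum.reindex_bij_witness[of _ "\<lambda>i. A + int i" "\<lambda>a. nat (a - A)"])
        (use True in \<open>auto simp: k_def\<close>)
    define R where "R = real j * real q"
    have R1: "1 \<le> R" unfolding R_def using jq mult_mono[of 1 "real j" 1 "real q"] by simp
    define t where "t m = of_int (K0 + int m) / real j" for m
    define J where "J m = integral {a..b} (\<lambda>y. ee (R * (f y - t m * y)))" for m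
    have P: "norm (S - (\<Sum>m\<le>K. of_real (real q) * J m)) \<le> 1 + 2 * harm (2 * K)"
    proof -
      have "integral {of_int A..of_int A + of_nat k} (\<lambda>x. ee (F x - (of_int K0 + real m) * x)) = of_real (real q) * J m" for m
      proof -
        have "integral {of_int A..of_int A + of_nat k} (\<lambda>x. ee (F x - (of_int K0 + real m) * x))
          = of_real (real q) * integral {of_int A / real q..(of_int A + real k) / real q} (\<lambda>y. ee (F (real q * y) - (of_int K0 + real m) * (real q * y)))"
          by (rule integral_scale)
            (use jq0 in \<open>auto intro!: continuous_intros DERIV_continuous_on[OF DERIV_subset[OF dF subset_UNIV]]\<close>)
        moreover have "F (real q * y) - (of_int K0 + real m) * (real q * y) = R * (f y - t m * y)" for y
          unfolding F_def R_def t_def using jq0 by (simp add: field_simps)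
        ultimately show ?thesis unfolding J_def a_def b_def Bk by (simp only:)
      qed
      then show ?thesis
        using truncated_poisson[OF dF dF1 F2, of A k] unfolding S_def K_def K0_def by simp
    qed
    define W where "W m = (if a < g (t m) \<and> g (t m) \<le> b then 2 else 0) * (of_real (2 / sqrt (2 * f2 (g (t m)) * R)) * C0) * ee (- (R * h (t m)))" for m
    \<comment> \<open>\<open>sqrt R = q * s\<close>: the endpoint scale, measured so that
      consecutive frequencies are 1 apart.\<close>
    define s where "s = sqrt (real j / real q)"
    have s: "0 < s" "1 / s = sqrt (real q / real j)" unfolding s_def using jq0 by (auto simp: real_sqrt_divide)
    define da where "da m = \<bar>real j * f1 a - of_int (K0 + int m)\<bar>" for m
    define db where "db m = \<bar>real j * f1 b - of_int (K0 + int m)\<bar>" for m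
    have Jerr: "norm (of_real (real q) * J m - of_real (real q) * W m) \<le>
        2 * (A1 * (1 + ln (1 + R)) / real j) + A2 / (s + da m) + A2 / (s + db m)" if m: "m \<le> K" for m
    proof -
      define D where "D = (c2 * l + 1) / c1"
      have ft: "f1 (g (t m)) = t m" by (rule g(2))
      have km: "K0 + int m \<le> \<lceil>real j * f1 b\<rceil>" using m K0K(3) by linarith
      have t1: "t m - f1 b \<le> 1"
      proof -
        have "of_int (K0 + int m) \<le> real j * f1 b + 1" using km by linarith
        also have "\<dots> \<le> real j * (f1 b + 1)" using jq by (simp add: distrib_left)
        finally have "t m \<le> f1 b + 1" unfolding t_def using jq0 by (simp add: field_simps)
        then show ?thesis by simp
      qed
      have t2: "f1 a - t m \<le> 1"
      proof -
        have "real j * f1 a \<le> of_int (K0 + int m) + 1" using K0K(2) by simp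
        also have "\<dots> \<le> of_int (K0 + int m) + real j" using jq by simp
        finally have "f1 a \<le> t m + 1" unfolding t_def using jq0 by (simp add: field_simps)
        then show ?thesis by simp
      qed
      have D: "\<bar>x - g (t m)\<bar> \<le> D" if x: "x = a \<or> x = b" for x
      proof -
        have "c1 * \<bar>x - g (t m)\<bar> \<le> \<bar>f1 x - f1 (g (t m))\<bar>" by (rule f1_abs(1))
        also have "\<dots> \<le> c2 * l + 1" unfolding ft using x t1 t2 fab f1_le_iff[of a b] ab nn by auto
        finally show ?thesis unfolding D_def using c1 by (simp add: field_simps)
      qed
      \<comment> \<open>The distance from the endpoint to the stationary point becomes the distance
        from \<open>j * f1 x\<close> to the integer \<open>K0 + m\<close>; since these integers are
        consecutive, the sum over \<open>m\<close> is harmonic.\<close>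
      have e: "real q * (endpoint_const c1 / (sqrt R + R * \<bar>x - g (t m)\<bar>)) \<le> A2 / (s + \<bar>real j * f1 x - of_int (K0 + int m)\<bar>)" for x
      proof -
        define d where "d = \<bar>real j * f1 x - of_int (K0 + int m)\<bar>"
        have "d = real j * \<bar>f1 x - f1 (g (t m))\<bar>"
        proof -
          have "real j * f1 x - of_int (K0 + int m) = real j * (f1 x - t m)"
            unfolding t_def using jq0 by (simp add: field_simps)
          then show ?thesis unfolding d_def ft by (simp add: abs_mult)
        qed
        also have "\<dots> \<le> real j * (c2 * \<bar>x - g (t m)\<bar>)" using f1_abs(2) by (intro mult_left_mono) auto
        also have "\<dots> \<le> real j * (max 1 c2 * \<bar>x - g (t m)\<bar>)" by (intro mult_left_mono mult_right_mono) auto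
        finally have d: "d \<le> max 1 c2 * (real j * \<bar>x - g (t m)\<bar>)" by (simp add: mult_ac)
        have sR: "sqrt R = real q * s"
        proof -
          have "(real q * s)\<^sup>2 = R" unfolding s_def R_def power_mult_distrib using jq0 by (simp add: power2_eq_square[of "real q"])
          then show ?thesis using jq0 s by (intro real_sqrt_unique) auto
        qed
        have "1 * s \<le> max 1 c2 * s" using s by (intro mult_right_mono) auto
        then have sd: "s + d \<le> max 1 c2 * (s + real j * \<bar>x - g (t m)\<bar>)" using d by (simp add: distrib_left)
        have "real q * (endpoint_const c1 / (sqrt R + R * \<bar>x - g (t m)\<bar>)) = real q * endpoint_const c1 / (real q * (s + real j * \<bar>x - g (t m)\<bar>))"
          unfolding sR unfolding R_def by (simp add: algebra_simps)
        also have "\<dots> = endpoint_const c1 / (s + real j * \<bar>x - g (t m)\<bar>)" using jq0 by simp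
        also have "\<dots> = A2 / (max 1 c2 * (s + real j * \<bar>x - g (t m)\<bar>))" unfolding A2_def by simp
        also have "\<dots> \<le> A2 / (s + d)" using sd s nn unfolding d_def by (intro frac_le) (auto intro: add_pos_nonneg)
        finally show ?thesis unfolding d_def .
      qed
      have "norm (of_real (real q) * J m - of_real (real q) * W m) = real q * norm (J m - W m)"
        by (simp add: right_diff_distrib[symmetric] norm_mult del: of_real_of_nat_eq)
      also have "\<dots> \<le> real q * (2 * (phase_const c1 c2 L D * (1 + ln (1 + R)) / R) + endpoint_const c1 / (sqrt R + R * \<bar>a - g (t m)\<bar>) + endpoint_const c1 / (sqrt R + R * \<bar>b - g (t m)\<bar>))"
        unfolding J_def W_def using D by (intro mult_left_mono stationary_phase[OF Fr C0 R1 ab(2)]) auto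
      also have "\<dots> = 2 * (A1 * (1 + ln (1 + R)) / real j) + real q * (endpoint_const c1 / (sqrt R + R * \<bar>a - g (t m)\<bar>)) + real q * (endpoint_const c1 / (sqrt R + R * \<bar>b - g (t m)\<bar>))"
      proof -
        have "real q * (2 * (phase_const c1 c2 L D * (1 + ln (1 + R)) / R)) = 2 * (A1 * (1 + ln (1 + R)) / real j)"
          unfolding A1_def D_def R_def using jq0 by simp
        then show ?thesis by (simp only: distrib_left)
      qed
      also have "\<dots> \<le> 2 * (A1 * (1 + ln (1 + R)) / real j) + A2 / (s + da m) + A2 / (s + db m)"
        unfolding da_def db_def by (intro add_mono e order_refl)
      finally show ?thesis .
    qed
    have hK: "harm (2 * K) \<le> 1 + V + ln (1 + R)"
    proof -
      have "harm (2 * K) \<le> 1 + ln (1 + real (2 * K))" by (rule harm_le_ln1)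
      also have "1 + real (2 * K) \<le> (1 + 2 * (c2 * l + 3)) * (1 + R)"
      proof -
        have "real (2 * K) \<le> 2 * ((c2 * l + 3) * real j)" using Kb unfolding of_nat_mult of_nat_numeral by linarith
        also have "\<dots> = 2 * (c2 * l + 3) * real j" by (simp only: mult.assoc)
        also have "\<dots> \<le> 2 * (c2 * l + 3) * R" unfolding R_def using jq nn by (intro mult_left_mono) auto
        finally show ?thesis using nn R1 by (simp add: algebra_simps)
      qed
      then have "ln (1 + real (2 * K)) \<le> ln ((1 + 2 * (c2 * l + 3)) * (1 + R))" by (intro ln_mono) auto
      also have "\<dots> = V + ln (1 + R)" unfolding V_def by (subst ln_mult) (use nn R1 in auto)
      finally show ?thesis by simp
    qed
    have hK1: "harm K \<le> 1 + V + ln (1 + R)" using hK harm_mono[of K "2 * K", where ?'a = real] by simp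
    have sa: "(\<Sum>m\<le>K. 1 / (s + da m)) \<le> 2 / s + harm K"
      by (rule sum_reciprocal_floor[OF s(1)]) (use K0K in \<open>auto simp: da_def\<close>)
    \<comment> \<open>At the right end the integers are counted downwards from
      \<open>\<lceil>real j * f1 b\<rceil>\<close>.\<close>
    have sb: "(\<Sum>m\<le>K. 1 / (s + db m)) \<le> 2 / s + harm K"
    proof -
      have "(\<Sum>m\<le>K. 1 / (s + db m)) = (\<Sum>m\<le>K. 1 / (s + db (K - m)))"
        by (rule sum.reindex_bij_witness[of _ "\<lambda>m. K - m" "\<lambda>m. K - m"]) auto
      also have "\<dots> \<le> 2 / s + harm K"
      proof (rule sum_reciprocal_floor[OF s(1)])
        fix m assume m: "m \<le> K"
        have "K0 + int (K - m) = \<lceil>real j * f1 b\<rceil> - int m" using K0K(3) m by simp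
        then have "of_int (K0 + int (K - m)) \<le> real j * f1 b + 1 - real m" by linarith
        then show "real m - 1 \<le> db (K - m)" unfolding db_def by linarith
      qed (simp add: db_def)
      finally show ?thesis .
    qed
    have Werr: "norm ((\<Sum>m\<le>K. of_real (real q) * J m) - (\<Sum>m\<le>K. of_real (real q) * W m))
       \<le> 2 * (c2 * l + 3) * A1 * (1 + ln (1 + R)) + 2 * A2 * (2 / s + harm K)"
    proof -
      have "norm ((\<Sum>m\<le>K. of_real (real q) * J m) - (\<Sum>m\<le>K. of_real (real q) * W m)) \<le>
         (\<Sum>m\<le>K. 2 * (A1 * (1 + ln (1 + R)) / real j) + A2 / (s + da m) + A2 / (s + db m))"
        unfolding sum_subtractf[symmetric] by (rule sum_norm_le) (rule Jerr, simp)
      also have "\<dots> = (real K + 1) * (2 * (A1 * (1 + ln (1 + R)) / real j)) + A2 * (\<Sum>m\<le>K. 1 / (s + da m)) + A2 * (\<Sum>m\<le>K. 1 / (s + db m))"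
        by (simp add: sum.distrib sum_distrib_left)
      also have "\<dots> \<le> ((c2 * l + 3) * real j) * (2 * (A1 * (1 + ln (1 + R)) / real j)) + A2 * (2 / s + harm K) + A2 * (2 / s + harm K)"
      proof (intro add_mono)
        show "(real K + 1) * (2 * (A1 * (1 + ln (1 + R)) / real j)) \<le> ((c2 * l + 3) * real j) * (2 * (A1 * (1 + ln (1 + R)) / real j))"
          using Kb nn R1 by (intro mult_right_mono) auto
      qed (use sa sb nn in \<open>auto intro!: mult_left_mono\<close>)
      also have "\<dots> = 2 * (c2 * l + 3) * A1 * (1 + ln (1 + R)) + 2 * A2 * (2 / s + harm K)"
      proof -
        have "(e * real j) * (2 * (A1 * u / real j)) = 2 * e * A1 * u" for e u using jq0 by simp
        then show ?thesis by simp
      qed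
      finally show ?thesis .
    qed
    have WT: "(\<Sum>m\<le>K. of_real (real q) * W m) = (\<Sum>k\<in>slopes a b j. T k)"
    proof -
      \<comment> \<open>Frequencies whose stationary point lies outside the half-open interval have
        weight 0 in \<open>W\<close>, and \<open>K0..K0 + K\<close> contains all slopes of the
        interval.\<close>
      define ks where "ks = {m \<in> {..K}. K0 + int m \<in> slopes a b j}"
      have "of_real (real q) * W m = (if K0 + int m \<in> slopes a b j then T (K0 + int m) else 0)" for m
      proof -
        have "real q * (2 * (2 / sqrt (2 * f2 (g (t m)) * R))) = sqrt (real q) * (4 / sqrt (2 * f2 (g (t m)) * real j))"
        proof -
          define x where "x = sqrt (2 * f2 (g (t m)) * real j)"
          define y where "y = sqrt (real q)"
          have y0: "0 < y" and qy: "real q = y * y" unfolding y_def using jq0 by auto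
          have sx: "sqrt (2 * f2 (g (t m)) * R) = x * y" unfolding R_def x_def y_def by (simp add: real_sqrt_mult)
          have "y * y * (2 * (2 / (x * y))) = y * (4 / x)" using y0 by simp
          then show ?thesis unfolding sx x_def[symmetric] y_def[symmetric] by (simp only: qy)
        qed
        then have e: "of_real (real q) * (2 * of_real (2 / sqrt (2 * f2 (g (t m)) * R))) = complex_of_real (sqrt (real q)) * of_real (4 / sqrt (2 * f2 (g (t m)) * real j))"
          by (metis of_real_mult of_real_numeral)
        have "of_real (real q) * (2 * (of_real (2 / sqrt (2 * f2 (g (t m)) * R)) * C0) * ee (- (R * h (t m)))) = T (K0 + int m)"
        proof -
          have "of_real (real q) * (2 * (of_real (2 / sqrt (2 * f2 (g (t m)) * R)) * C0) * ee (- (R * h (t m))))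
            = (of_real (real q) * (2 * of_real (2 / sqrt (2 * f2 (g (t m)) * R)))) * C0 * ee (- (R * h (t m)))"
            by (simp only: mult.assoc)
          also have "\<dots> = T (K0 + int m)" unfolding e unfolding T_def R_def t_def by (simp only: mult_ac)
          finally show ?thesis .
        qed
        moreover have "(a < g (t m) \<and> g (t m) \<le> b) \<longleftrightarrow> K0 + int m \<in> slopes a b j" unfolding slopes_def t_def by simp
        ultimately show ?thesis unfolding W_def by simp
      qed
      then have "(\<Sum>m\<le>K. of_real (real q) * W m) = (\<Sum>m\<le>K. if K0 + int m \<in> slopes a b j then T (K0 + int m) else 0)" by simp
      also have "\<dots> = (\<Sum>m\<in>ks. T (K0 + int m))" unfolding ks_def by (rule sum.inter_filter[symmetric]) simp
      also have "\<dots> = (\<Sum>k\<in>slopes a b j. T k)"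
      proof (rule sum.reindex_bij_witness[of _ "\<lambda>k. nat (k - K0)" "\<lambda>m. K0 + int m"])
        fix k assume k: "k \<in> slopes a b j"
        have j0: "0 < j" using jq by simp
        have "\<lfloor>real j * f1 a\<rfloor> + 1 \<le> k" "k \<le> \<lfloor>real j * f1 b\<rfloor>" using k unfolding slopes_eq[OF j0] by auto
        then have "K0 \<le> k" "k \<le> \<lceil>real j * f1 b\<rceil>" unfolding K0_def FA by linarith+
        then have k1: "K0 \<le> k" "k \<le> K0 + int K" using K0K(3) by linarith+
        then show "K0 + int (nat (k - K0)) = k" by simp
        then show "nat (k - K0) \<in> ks" unfolding ks_def using k k1 by auto
      qed (auto simp: ks_def)
      finally show ?thesis .
    qed
    have "norm (S - (\<Sum>k\<in>slopes \<eta> \<xi> j. T k)) = norm ((S - (\<Sum>m\<le>K. of_real (real q) * J m))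
       + ((\<Sum>m\<le>K. of_real (real q) * J m) - (\<Sum>m\<le>K. of_real (real q) * W m)) + ((\<Sum>k\<in>slopes a b j. T k) - (\<Sum>k\<in>slopes \<eta> \<xi> j. T k)))"
      unfolding WT by simp
    also have "\<dots> \<le> (1 + 2 * harm (2 * K)) + (2 * (c2 * l + 3) * A1 * (1 + ln (1 + R)) + 2 * A2 * (2 / s + harm K))
       + (2 * (real j * c2 / real q) + 2) * term_bound"
      by (intro norm_triangle_le add_mono P Werr T_diff ab)
    also have "\<dots> \<le> 3 * (1 + V) * U + (2 * (c2 * l + 3) * A1 * U + 2 * A2 * ((3 + V) * U)) + 8 * norm C0 / sqrt (2 * c1) * (c2 + 1) * U"
    proof (intro add_mono term_bound_U)
      define P where "P = V * U"
      have "V * 1 \<le> V * U" using U0 nn by (intro mult_left_mono) auto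
      then have VU: "V \<le> P" by (simp add: P_def)
      have RU: "1 + ln (1 + R) \<le> U" using U0 unfolding R_def by simp
      have "1 + 2 * harm (2 * K) \<le> 1 + 2 * (1 + V + ln (1 + R))" using hK by simp
      also have "\<dots> = 1 + 2 * V + 2 * (1 + ln (1 + R))" by simp
      also have "\<dots> \<le> U + 3 * P + 2 * U"
        
      proof (intro add_mono)
        show "2 * V \<le> 3 * P" using VU nn(1) by (intro mult_mono) auto
        show "2 * (1 + ln (1 + R)) \<le> 2 * U" by (intro mult_left_mono RU) simp
      qed (rule U0(1))
      also have "\<dots> = 3 * (1 + V) * U" unfolding P_def by (simp add: algebra_simps)
      finally show "1 + 2 * harm (2 * K) \<le> 3 * (1 + V) * U" .
      show "2 * (c2 * l + 3) * A1 * (1 + ln (1 + R)) \<le> 2 * (c2 * l + 3) * A1 * U"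
        using RU nn by (intro mult_left_mono) auto
      have "2 / s + harm K \<le> 2 * (1 / s) + V + (1 + ln (1 + R))" using hK1 by simp
      also have "\<dots> \<le> 2 * U + P + U"
        unfolding s(2) by (intro add_mono mult_left_mono VU RU U0(3)) simp
      also have "\<dots> = (3 + V) * U" unfolding P_def by (simp add: algebra_simps)
      finally show "2 * A2 * (2 / s + harm K) \<le> 2 * A2 * ((3 + V) * U)" using nn by (intro mult_left_mono) auto
    qed
    also have "\<dots> = exp_sum_const c1 c2 L (\<xi> - \<eta>) (norm C0) * U" unfolding es by (simp add: algebra_simps)
    finally show ?thesis using S unfolding A_def[symmetric] B_def[symmetric] by simp
  qed
qed

end

section \<open>Summation over the denominators\<close>

lemma norm_sum_ee_bound:
  assumes d: "0 < d" "d \<le> 1 / 2" and th: "\<theta> = of_int m + d \<or> \<theta> = of_int m - d"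
  shows "norm (\<Sum>q\<in>{1..n}. ee (- (real q * \<theta>))) \<le> 2 / d"
proof -
  define z where "z = ee (- \<theta>)"
  have zp: "ee (- (real q * \<theta>)) = z ^ q" for q
  proof (induction q)
    case (Suc q)
    have "- (real (Suc q) * \<theta>) = - \<theta> + - (real q * \<theta>)" by (simp add: algebra_simps)
    then show ?case using Suc unfolding z_def by (simp only: ee_add power_Suc)
  qed simp
  have nz: "norm z = 1" by (simp add: z_def)
  have sd: "d / 2 \<le> sin (pi * d)" using sin_pi_lower[of d] d by simp
  have "norm (1 - z) \<ge> d"
  proof -
    have "z = ee d \<or> z = ee (- d)"
    proof -
      have "- \<theta> = - d + of_int (- m) \<or> - \<theta> = d + of_int (- m)" using th by auto
      then show ?thesis unfolding z_def by (metis ee_add ee_int mult_1_right)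
    qed
    then have "(norm (1 - z))\<^sup>2 = (1 - cos (2 * pi * d))\<^sup>2 + (sin (2 * pi * d))\<^sup>2"
      by (auto simp: ee_def cmod_power2)
    also have "\<dots> = 2 - 2 * cos (2 * pi * d)"
      using sin_cos_squared_add[of "2 * pi * d"] by (simp add: power2_eq_square algebra_simps)
    also have "\<dots> = (2 * sin (pi * d))\<^sup>2"
      using cos_double_sin[of "pi * d"] by (simp add: power2_eq_square mult_ac)
    finally have "(norm (1 - z))\<^sup>2 = (2 * sin (pi * d))\<^sup>2" .
    then have "norm (1 - z) = 2 * sin (pi * d)" by (rule power2_eq_imp_eq) (use sd d in auto)
    then show ?thesis using sd by simp
  qed
  then have z1: "0 < norm (1 - z)" "d \<le> norm (1 - z)" using d by auto
  have "(1 - z) * (\<Sum>q\<in>{1..n}. z ^ q) = z - z ^ Suc n"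
  proof (induction n)
    case (Suc n)
    have "(\<Sum>q\<in>{1..Suc n}. z ^ q) = (\<Sum>q\<in>{1..n}. z ^ q) + z ^ Suc n" by simp
    then have "(1 - z) * (\<Sum>q\<in>{1..Suc n}. z ^ q) = (z - z ^ Suc n) + (1 - z) * z ^ Suc n"
      by (simp only: distrib_left Suc.IH)
    also have "\<dots> = z - z ^ Suc (Suc n)" by (simp add: algebra_simps)
    finally show ?case .
  qed simp
  then have "norm (1 - z) * norm (\<Sum>q\<in>{1..n}. z ^ q) = norm (z - z ^ Suc n)" by (metis norm_mult)
  also have "\<dots> \<le> 2" using norm_triangle_ineq4[of z "z ^ Suc n"] nz by (simp add: norm_power norm_mult)
  finally have "d * norm (\<Sum>q\<in>{1..n}. z ^ q) \<le> 2"
    using z1 by (meson mult_right_mono norm_ge_zero order_trans)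
  then show ?thesis unfolding zp using d by (simp add: field_simps)
qed

text \<open>Partial summation; the weights increase, so their total variation is
  \<open>sqrt n\<close>.\<close>

lemma abel_sqrt_bound:
  fixes a :: "nat \<Rightarrow> complex"
  assumes B: "\<And>n. norm (\<Sum>q\<in>{1..n}. a q) \<le> B"
  shows "norm (\<Sum>q\<in>{1..n}. of_real (sqrt (real q)) * a q) \<le> 2 * sqrt (real n) * B"
proof -
  have "norm ((\<Sum>q\<in>{1..n}. of_real (sqrt (real q)) * a q) - of_real (sqrt (real n)) * (\<Sum>q\<in>{1..n}. a q)) \<le> sqrt (real n) * B"
  proof (induction n)
    case (Suc n)
    define X where "X = (\<Sum>q\<in>{1..n}. of_real (sqrt (real q)) * a q) - of_real (sqrt (real n)) * (\<Sum>q\<in>{1..n}. a q)"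
    have "(\<Sum>q\<in>{1..Suc n}. of_real (sqrt (real q)) * a q) - of_real (sqrt (real (Suc n))) * (\<Sum>q\<in>{1..Suc n}. a q)
      = X + of_real (sqrt (real n) - sqrt (real (Suc n))) * (\<Sum>q\<in>{1..n}. a q)"
      unfolding X_def by (simp add: algebra_simps)
    also have "norm \<dots> \<le> sqrt (real n) * B + (sqrt (real (Suc n)) - sqrt (real n)) * B"
    proof (intro norm_triangle_le add_mono)
      show "norm X \<le> sqrt (real n) * B" unfolding X_def by (rule Suc.IH)
      have "sqrt (real n) \<le> sqrt (real (Suc n))" by simp
      then have "\<bar>sqrt (real n) - sqrt (real (Suc n))\<bar> = sqrt (real (Suc n)) - sqrt (real n)" by linarith
      then show "norm (of_real (sqrt (real n) - sqrt (real (Suc n))) * (\<Sum>q\<in>{1..n}. a q)) \<le> (sqrt (real (Suc n)) - sqrt (real n)) * B"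
        unfolding norm_mult norm_of_real using B[of n] by (simp add: mult_left_mono)
    qed
    also have "\<dots> = sqrt (real (Suc n)) * B" by (simp add: algebra_simps)
    finally show ?case .
  qed simp
  moreover have "norm (of_real (sqrt (real n)) * (\<Sum>q\<in>{1..n}. a q)) \<le> sqrt (real n) * B"
    unfolding norm_mult norm_of_real using B[of n] by (simp add: mult_left_mono)
  ultimately show ?thesis
    using norm_triangle_sub[of "\<Sum>q\<in>{1..n}. of_real (sqrt (real q)) * a q" "of_real (sqrt (real n)) * (\<Sum>q\<in>{1..n}. a q)"]
    by linarith
qed

text \<open>With \<open>d\<close> the distance of \<open>\<theta>\<close> from the integers, the sum
  is of order \<open>sqrt Q\<close> times the minimum of \<open>Q\<close> and \<open>1 / d\<close>,
  and the dyadic layers dominate this minimum. In this form a sum over many \<open>\<theta>\<close>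
  turns into counts of those near an integer.\<close>

lemma abel_layers:
  assumes Q: "Q < 2 * 2 ^ n"
  shows "norm (\<Sum>q\<in>{1..Q}. of_real (sqrt (real q)) * ee (- (real q * \<theta>))) \<le>
    8 * sqrt (real Q) * (\<Sum>s\<le>n. if \<exists>m::int. \<bar>\<theta> - of_int m\<bar> \<le> 1 / 2 ^ s then 2 ^ s else 0)"
proof -
  define m where "m = round \<theta>"
  define d where "d = \<bar>\<theta> - of_int m\<bar>"
  have d: "0 \<le> d" "d \<le> 1 / 2" unfolding d_def m_def using of_int_round_abs_le[of \<theta>] by (auto simp: abs_minus_commute)
  define ind where "ind s = (if \<exists>m::int. \<bar>\<theta> - of_int m\<bar> \<le> 1 / 2 ^ s then 2 ^ s else (0::real))" for s :: nat
  have ind: "2 ^ s \<le> (\<Sum>s\<le>n. ind s)" if "s \<le> n" "d \<le> 1 / 2 ^ s" for s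
  proof -
    have "ind s = 2 ^ s" unfolding ind_def using that(2) unfolding d_def by auto
    moreover have "ind s \<le> (\<Sum>s\<le>n. ind s)" by (rule member_le_sum) (use that in \<open>auto simp: ind_def\<close>)
    ultimately show ?thesis by simp
  qed
  show ?thesis
  proof (cases "d \<le> 1 / 2 ^ n")
    case True
    have "norm (\<Sum>q\<in>{1..Q}. of_real (sqrt (real q)) * ee (- (real q * \<theta>))) \<le> (\<Sum>q\<in>{1..Q}. sqrt (real Q))"
      by (rule sum_norm_le) (simp add: norm_mult)
    also have "\<dots> = real Q * sqrt (real Q)" by simp
    also have "\<dots> \<le> (8 * (\<Sum>s\<le>n. ind s)) * sqrt (real Q)"
    proof (rule mult_right_mono)
      have "real Q \<le> real (2 * 2 ^ n)" using Q by (simp only: of_nat_le_iff)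
      then show "real Q \<le> 8 * (\<Sum>s\<le>n. ind s)" using ind[OF order_refl True] by simp
    qed simp
    finally show ?thesis unfolding ind_def by (simp add: mult_ac)
  next
    case False
    \<comment> \<open>The first level that \<open>d\<close> fails; the level \<open>s'\<close>
      before it still counts, and \<open>1 / d < 2 * 2 ^ s'\<close>.\<close>
    define s where "s = (LEAST s. \<not> d \<le> 1 / 2 ^ s)"
    have s: "\<not> d \<le> 1 / 2 ^ s" unfolding s_def by (rule LeastI[of "\<lambda>s. \<not> d \<le> 1 / 2 ^ s", OF False])
    have sn: "s \<le> n" unfolding s_def by (rule Least_le[of "\<lambda>s. \<not> d \<le> 1 / 2 ^ s", OF False])
    have "s \<noteq> 0" using s d by (cases s) auto
    then obtain s' where s': "s = Suc s'" by (cases s) auto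
    have ds': "d \<le> 1 / 2 ^ s'" using not_less_Least[of s' "\<lambda>s. \<not> d \<le> 1 / 2 ^ s"] s' unfolding s_def by auto
    have d0: "0 < d" using s by (metis d(1) less_eq_real_def linorder_not_le zero_le_divide_1_iff zero_le_numeral zero_le_power)
    have th: "\<theta> = of_int m + d \<or> \<theta> = of_int m - d" unfolding d_def by linarith
    have "norm (\<Sum>q\<in>{1..Q}. of_real (sqrt (real q)) * ee (- (real q * \<theta>))) \<le> 2 * sqrt (real Q) * (2 / d)"
      by (rule abel_sqrt_bound) (rule norm_sum_ee_bound[OF d0 d(2) th])
    also have "\<dots> \<le> 2 * sqrt (real Q) * (4 * 2 ^ s')"
    proof (rule mult_left_mono)
      have "1 / 2 ^ s < d" using s by simp
      then have "1 < d * (2 * 2 ^ s')" unfolding s' by (simp add: field_simps)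
      then show "2 / d \<le> 4 * 2 ^ s'" using d0 by (simp add: field_simps)
    qed simp
    also have "\<dots> \<le> 2 * sqrt (real Q) * (4 * (\<Sum>s\<le>n. ind s))"
      using ind[of s'] ds' sn s' by (intro mult_left_mono) auto
    finally show ?thesis unfolding ind_def by (simp add: mult_ac)
  qed
qed

lemma sum_inverse_sqrt: "(\<Sum>q\<in>{1..n}. 1 / sqrt (real q)) \<le> 2 * sqrt (real n)"
proof (induction n)
  case (Suc n)
  define u where "u = sqrt (real (Suc n))"
  define v where "v = sqrt (real n)"
  have u: "0 < u" "v \<le> u" "0 \<le> v" "u * u - v * v = 1" unfolding u_def v_def by auto
  have "(u - v) * (u + v) = 1" using u(4) by (simp add: algebra_simps)
  moreover have "(u - v) * (u + v) \<le> (u - v) * (2 * u)" using u by (intro mult_left_mono) auto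
  ultimately have "1 \<le> 2 * (u - v) * u" by (simp add: mult_ac)
  then have "1 / u \<le> 2 * (u - v)" using u by (simp add: pos_divide_le_eq)
  then show ?case using Suc unfolding u_def v_def by simp
qed simp

definition curve_sum :: "(real \<Rightarrow> real) \<Rightarrow> real \<Rightarrow> real \<Rightarrow> nat \<Rightarrow> nat \<Rightarrow> complex" where
  "curve_sum f \<eta> \<xi> Q j = (\<Sum>q\<in>{1..Q}. \<Sum>a\<in>{\<lceil>real q * \<eta>\<rceil>..\<lfloor>real q * \<xi>\<rfloor>}. ee (real j * (real q * f (of_int a / real q))))"

context convex_curve
begin

text \<open>Up to a constant, \<open>layer\<close> sums \<open>min (2^n) (1 / \<parallel>j h(k/j)\<parallel>)\<close> over the slopes \<open>k/j\<close>, sampled at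
  powers of two.\<close>

definition "layer n \<eta> \<xi> j = (\<Sum>k\<in>slopes \<eta> \<xi> j. \<Sum>s\<le>n.
   if \<exists>m::int. \<bar>real j * h (of_int k / real j) - of_int m\<bar> \<le> 1 / 2 ^ s then 2 ^ s else (0::real))"

lemma layer_nonneg: "0 \<le> layer n \<eta> \<xi> j"
  unfolding layer_def by (intro sum_nonneg) auto

text \<open>In the main term of \<open>exp_sum_asymptotic\<close> only \<open>sqrt q\<close> and the
  linear phase depend on \<open>q\<close>, so the sums are exchanged and \<open>abel_layers\<close>
  is applied slope by slope. The errors \<open>U\<close> add up to the terms without
  \<open>layer\<close>.\<close>

lemma curve_sum_bound:
  fixes Fr :: "real \<Rightarrow> complex" and C0 :: complex
  assumes Fr: "\<And>x. (Fr has_vector_derivative ee (x\<^sup>2)) (at x)" "Fr 0 = 0"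
    and C0: "\<And>z. 0 \<le> z \<Longrightarrow> norm (Fr z - C0) \<le> 6 / (1 + z)"
    and I: "\<eta> < \<xi>" and j: "1 \<le> j" and Q: "Q < 2 * 2 ^ n" "1 \<le> Q"
  shows "norm (curve_sum f \<eta> \<xi> Q j) \<le>
    (2 * exp_sum_const c1 c2 L (\<xi> - \<eta>) (norm C0) + 32 * norm C0 / sqrt (2 * c1)) *
      (sqrt (real Q / real j) * (layer n \<eta> \<xi> j + real Q + real j) + real Q * (1 + ln (1 + real j * real Q)))"
proof -
  define es where "es = exp_sum_const c1 c2 L (\<xi> - \<eta>) (norm C0)"
  define gm where "gm k = of_real (4 / sqrt (2 * f2 (g (of_int k / real j)) * real j)) * C0" for k
  define Tq where "Tq q k = of_real (sqrt (real q)) * gm k * ee (- (real q * (real j * h (of_int k / real j))))" for q k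
  define E where "E q = (\<Sum>a\<in>{\<lceil>real q * \<eta>\<rceil>..\<lfloor>real q * \<xi>\<rfloor>}. ee (real j * (real q * f (of_int a / real q))))" for q
  define U where "U q = sqrt (real q / real j) + sqrt (real j / real q) + 1 + ln (1 + real j * real q)" for q :: nat
  have j0: "0 < real j" using j by simp
  have fc: "fresnel_curve f f1 f2 g c1 c2 L Fr C0 \<eta> \<xi> j q" if "1 \<le> q" for q
    by unfold_locales (use Fr C0 I j that in auto)
  have as: "norm (E q - (\<Sum>k\<in>slopes \<eta> \<xi> j. Tq q k)) \<le> es * U q" if q: "q \<in> {1..Q}" for q
  proof -
    have q1: "1 \<le> q" using q by simp
    show ?thesis
      using fresnel_curve.exp_sum_asymptotic[OF fc[OF q1]]
      unfolding fresnel_curve.T_def[OF fc[OF q1]] fresnel_curve.U_def[OF fc[OF q1]]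
        E_def Tq_def gm_def es_def U_def by (simp add: mult.assoc)
  qed
  have es0: "0 \<le> es"
  proof -
    have "0 \<le> es * U 1" by (rule order_trans[OF norm_ge_zero as]) (use Q in simp)
    moreover have "1 \<le> U 1" unfolding U_def using j by simp
    ultimately show ?thesis by (simp add: zero_le_mult_iff)
  qed
  have 1: "norm (\<Sum>q\<in>{1..Q}. E q - (\<Sum>k\<in>slopes \<eta> \<xi> j. Tq q k)) \<le> es * (\<Sum>q\<in>{1..Q}. U q)"
    unfolding sum_distrib_left by (rule sum_norm_le) (rule as)
  have 2: "(\<Sum>q\<in>{1..Q}. U q) \<le> sqrt (real Q / real j) * (real Q + 2 * real j) + real Q * (1 + ln (1 + real j * real Q))"
  proof -
    have "(\<Sum>q\<in>{1..Q}. U q) \<le> (\<Sum>q\<in>{1..Q}. sqrt (real Q / real j) + sqrt (real j) * (1 / sqrt (real q)) + (1 + ln (1 + real j * real Q)))"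
    proof (rule sum_mono)
      fix q assume q: "q \<in> {1..Q}"
      have "sqrt (real q / real j) \<le> sqrt (real Q / real j)" using q j0 by (simp add: divide_right_mono)
      moreover have "sqrt (real j / real q) = sqrt (real j) * (1 / sqrt (real q))" by (simp add: real_sqrt_divide)
      moreover have "ln (1 + real j * real q) \<le> ln (1 + real j * real Q)"
      proof -
        have "real j * real q \<le> real j * real Q" using q by (intro mult_left_mono) auto
        then show ?thesis by (intro ln_mono) (auto intro: add_pos_nonneg)
      qed
      ultimately show "U q \<le> sqrt (real Q / real j) + sqrt (real j) * (1 / sqrt (real q)) + (1 + ln (1 + real j * real Q))"
        unfolding U_def by linarith
    qed
    also have "\<dots> = real Q * sqrt (real Q / real j) + sqrt (real j) * (\<Sum>q\<in>{1..Q}. 1 / sqrt (real q)) + real Q * (1 + ln (1 + real j * real Q))"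
      by (simp add: sum.distrib sum_distrib_left)
    also have "sqrt (real j) * (\<Sum>q\<in>{1..Q}. 1 / sqrt (real q)) \<le> sqrt (real j) * (2 * sqrt (real Q))"
      using sum_inverse_sqrt by (intro mult_left_mono) auto
    also have "sqrt (real j) * (2 * sqrt (real Q)) = sqrt (real Q / real j) * (2 * real j)"
    proof -
      have "real j = sqrt (real j) * sqrt (real j)" by simp
      then show ?thesis using j0 by (simp add: real_sqrt_divide field_simps)
    qed
    finally show ?thesis by (simp add: algebra_simps)
  qed
  have 3: "norm (\<Sum>q\<in>{1..Q}. \<Sum>k\<in>slopes \<eta> \<xi> j. Tq q k) \<le> 32 * norm C0 / sqrt (2 * c1) * (sqrt (real Q / real j) * layer n \<eta> \<xi> j)"
  proof -
    define ly where "ly k = (\<Sum>s\<le>n. if \<exists>m::int. \<bar>real j * h (of_int k / real j) - of_int m\<bar> \<le> 1 / 2 ^ s then 2 ^ s else (0::real))" for k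
    have "(\<Sum>q\<in>{1..Q}. \<Sum>k\<in>slopes \<eta> \<xi> j. Tq q k) = (\<Sum>k\<in>slopes \<eta> \<xi> j. \<Sum>q\<in>{1..Q}. Tq q k)" by (rule sum.swap)
    also have "norm \<dots> \<le> (\<Sum>k\<in>slopes \<eta> \<xi> j. 32 * norm C0 / sqrt (2 * c1) * sqrt (real Q / real j) * ly k)"
    proof (rule sum_norm_le)
      fix k
      have "(\<Sum>q\<in>{1..Q}. Tq q k) = gm k * (\<Sum>q\<in>{1..Q}. of_real (sqrt (real q)) * ee (- (real q * (real j * h (of_int k / real j)))))"
        unfolding Tq_def sum_distrib_left by (simp only: mult_ac)
      then have "norm (\<Sum>q\<in>{1..Q}. Tq q k) = norm (gm k) * norm (\<Sum>q\<in>{1..Q}. of_real (sqrt (real q)) * ee (- (real q * (real j * h (of_int k / real j)))))"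
        by (simp only: norm_mult)
      also have "\<dots> \<le> (4 / sqrt (2 * c1 * real j) * norm C0) * (8 * sqrt (real Q) * ly k)"
      proof (rule mult_mono)
        have fp: "0 < f2 (g (of_int k / real j))" using f2(1)[of "g (of_int k / real j)"] c1 by linarith
        have "2 * c1 * real j \<le> 2 * f2 (g (of_int k / real j)) * real j"
          using f2(1) j0 by (intro mult_right_mono) auto
        then have "4 / sqrt (2 * f2 (g (of_int k / real j)) * real j) \<le> 4 / sqrt (2 * c1 * real j)"
          using c1 j0 by (intro divide_left_mono) auto
        then show "norm (gm k) \<le> 4 / sqrt (2 * c1 * real j) * norm C0"
          unfolding gm_def norm_mult norm_of_real using fp by (intro mult_right_mono) auto
        show "norm (\<Sum>q\<in>{1..Q}. of_real (sqrt (real q)) * ee (- (real q * (real j * h (of_int k / real j))))) \<le> 8 * sqrt (real Q) * ly k"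
          unfolding ly_def by (rule abel_layers[OF Q(1)])
      qed (use c1 in auto)
      also have "\<dots> = 32 * norm C0 / sqrt (2 * c1) * sqrt (real Q / real j) * ly k"
        by (simp add: real_sqrt_mult real_sqrt_divide)
      finally show "norm (\<Sum>q\<in>{1..Q}. Tq q k) \<le> 32 * norm C0 / sqrt (2 * c1) * sqrt (real Q / real j) * ly k" .
    qed
    also have "\<dots> = 32 * norm C0 / sqrt (2 * c1) * (sqrt (real Q / real j) * layer n \<eta> \<xi> j)"
      unfolding layer_def ly_def[symmetric] sum_distrib_left by (simp only: mult.assoc)
    finally show ?thesis .
  qed
  define ct where "ct = 32 * norm C0 / sqrt (2 * c1)"
  define X where "X = sqrt (real Q / real j) * (real Q + real j) + real Q * (1 + ln (1 + real j * real Q))"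
  define Ly where "Ly = sqrt (real Q / real j) * layer n \<eta> \<xi> j"
  have ct0: "0 \<le> ct" unfolding ct_def using c1 by simp
  have ln0: "0 \<le> ln (1 + real j * real Q)" by simp
  have X0: "0 \<le> X" unfolding X_def using ln0 by simp
  have L0: "0 \<le> Ly" unfolding Ly_def using layer_nonneg by simp
  have "sqrt (real Q / real j) * (real Q + 2 * real j) \<le> 2 * (sqrt (real Q / real j) * (real Q + real j))"
  proof -
    have "sqrt (real Q / real j) * (real Q + 2 * real j) \<le> sqrt (real Q / real j) * (2 * (real Q + real j))" by (intro mult_left_mono) auto
    then show ?thesis by (simp only: mult.left_commute[of "sqrt (real Q / real j)" 2])
  qed
  moreover have "real Q * (1 + ln (1 + real j * real Q)) \<le> 2 * (real Q * (1 + ln (1 + real j * real Q)))" using ln0 by simp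
  ultimately have "(\<Sum>q\<in>{1..Q}. U q) \<le> 2 * (sqrt (real Q / real j) * (real Q + real j)) + 2 * (real Q * (1 + ln (1 + real j * real Q)))"
    by (intro order_trans[OF 2] add_mono)
  then have U2: "(\<Sum>q\<in>{1..Q}. U q) \<le> 2 * X" unfolding X_def by (simp only: distrib_left[of 2])
  have "curve_sum f \<eta> \<xi> Q j = (\<Sum>q\<in>{1..Q}. E q - (\<Sum>k\<in>slopes \<eta> \<xi> j. Tq q k)) + (\<Sum>q\<in>{1..Q}. \<Sum>k\<in>slopes \<eta> \<xi> j. Tq q k)"
    unfolding curve_sum_def E_def by (simp add: sum_subtractf)
  also have "norm \<dots> \<le> es * (2 * X) + ct * Ly"
  proof (intro norm_triangle_le add_mono)
    show "norm (\<Sum>q\<in>{1..Q}. E q - (\<Sum>k\<in>slopes \<eta> \<xi> j. Tq q k)) \<le> es * (2 * X)"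
      using 1 mult_left_mono[OF U2 es0] by linarith
    show "norm (\<Sum>q\<in>{1..Q}. \<Sum>k\<in>slopes \<eta> \<xi> j. Tq q k) \<le> ct * Ly" using 3 unfolding ct_def Ly_def .
  qed
  also have "\<dots> \<le> (2 * es + ct) * (Ly + X)"
  proof -
    have "0 \<le> es * Ly" "0 \<le> ct * X" using es0 ct0 X0 L0 by auto
    then show ?thesis by (simp add: algebra_simps)
  qed
  finally show ?thesis unfolding es_def ct_def Ly_def X_def by (simp add: algebra_simps)
qed

end

text \<open>A sum of the constants that the conditions of \<open>dual_pair\<close> require, so that
  it exceeds each of them.\<close>

definition duality_const :: "real \<Rightarrow> real \<Rightarrow> real" where
  "duality_const c1 c2 = 1 + c2 + 2 / c1 + 2 * c2\<^sup>2 / c1 + c2 / c1\<^sup>2"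

section \<open>Counting slopes through the dual curve\<close>

context convex_curve
begin

lemma tangent_bounds:
  "c1 / 2 * (x - y)\<^sup>2 \<le> f x - f y - f1 y * (x - y)"
  "f x - f y - f1 y * (x - y) \<le> c2 / 2 * (x - y)\<^sup>2"
proof -
  have "c1 / 2 * (x - y)\<^sup>2 \<le> f x - f y - f1 y * (x - y) \<and> f x - f y - f1 y * (x - y) \<le> c2 / 2 * (x - y)\<^sup>2"
  proof (cases "y \<le> x")
    case True
    then have "0 \<le> x - y" by simp
    from phase.w_bounds[OF phase_right[of y] this] show ?thesis by simp
  next
    case False
    then have "0 \<le> y - x" by simp
    from phase.w_bounds[OF phase_left[of y] this] show ?thesis
      by (simp add: power2_commute algebra_simps)
  qed
  then show "c1 / 2 * (x - y)\<^sup>2 \<le> f x - f y - f1 y * (x - y)"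
    "f x - f y - f1 y * (x - y) \<le> c2 / 2 * (x - y)\<^sup>2" by auto
qed

text \<open>The tangent gap of \<open>h\<close> from \<open>y\<close> to \<open>x\<close> is the
  tangent gap of \<open>f\<close> from \<open>g x\<close> to \<open>g y\<close>: duality exchanges
  base point and moving point. The quadratic bounds for \<open>h\<close> thus follow from those for
  \<open>f\<close> and the two-sided Lipschitz bounds for \<open>g\<close>.\<close>

lemma dual_pair: "dual_pair (duality_const c1 c2) f f1 h g"
proof -
  define k where "k = duality_const c1 c2"
  have kk: "1 \<le> k" "c2 \<le> k" "2 / c1 \<le> k" "2 * c2\<^sup>2 / c1 \<le> k" "c2 / c1\<^sup>2 \<le> k"
  proof -
    have "0 \<le> c2" "0 \<le> 2 / c1" "0 \<le> 2 * c2\<^sup>2 / c1" "0 \<le> c2 / c1\<^sup>2" using c1 c2 by auto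
    then show "1 \<le> k" "c2 \<le> k" "2 / c1 \<le> k" "2 * c2\<^sup>2 / c1 \<le> k" "c2 / c1\<^sup>2 \<le> k"
      unfolding k_def duality_const_def by linarith+
  qed
  have gd: "\<bar>g x - g y\<bar> \<le> (1 / c1) * \<bar>x - y\<bar>" "\<bar>x - y\<bar> \<le> c2 * \<bar>g x - g y\<bar>" for x y
    using f1_abs[of "g x" "g y"] c1 unfolding g by (auto simp: field_simps)
  have L1: "f x + h (f1 x) = x * f1 x" for x unfolding h_def g by (simp add: mult.commute)
  have A: "\<bar>f1 x - f1 y\<bar> \<le> k * \<bar>x - y\<bar>" for x y
  proof -
    have "c2 * \<bar>x - y\<bar> \<le> k * \<bar>x - y\<bar>" using kk by (intro mult_right_mono) auto
    then show ?thesis using f1_abs(2)[of x y] by linarith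
  qed
  have B: "\<bar>g x - g y\<bar> \<le> k * \<bar>x - y\<bar>" for x y
  proof -
    have "1 / c1 \<le> 2 / c1" using c1 by (intro divide_right_mono) auto
    then have "(1 / c1) * \<bar>x - y\<bar> \<le> k * \<bar>x - y\<bar>" using kk by (intro mult_right_mono) auto
    then show ?thesis using gd(1)[of x y] by linarith
  qed
  have k0: "0 < k" using kk by linarith
  have C: "(x - y)\<^sup>2 / k \<le> f x - f y - f1 y * (x - y)" "f x - f y - f1 y * (x - y) \<le> k * (x - y)\<^sup>2" for x y
  proof -
    have "1 / k \<le> c1 / 2" using kk(3) k0 c1 by (simp add: field_simps)
    then have "1 / k * (x - y)\<^sup>2 \<le> c1 / 2 * (x - y)\<^sup>2" by (intro mult_right_mono) auto
    moreover have "(x - y)\<^sup>2 / k = 1 / k * (x - y)\<^sup>2" by simp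
    ultimately show "(x - y)\<^sup>2 / k \<le> f x - f y - f1 y * (x - y)" using tangent_bounds(1)[of x y] by linarith
    have "c2 / 2 \<le> k" using kk(2) c2 by linarith
    then have "c2 / 2 * (x - y)\<^sup>2 \<le> k * (x - y)\<^sup>2" by (intro mult_right_mono) auto
    then show "f x - f y - f1 y * (x - y) \<le> k * (x - y)\<^sup>2" using tangent_bounds(2)[of x y] by linarith
  qed
  have E: "(x - y)\<^sup>2 / k \<le> h x - h y - g y * (x - y)" "h x - h y - g y * (x - y) \<le> k * (x - y)\<^sup>2" for x y
  proof -
    have eq: "h x - h y - g y * (x - y) = f (g y) - f (g x) - f1 (g x) * (g y - g x)"
      unfolding h_def g by (simp add: algebra_simps)
    have "(x - y)\<^sup>2 \<le> c2\<^sup>2 * (g y - g x)\<^sup>2"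
    proof -
      have "\<bar>x - y\<bar>\<^sup>2 \<le> (c2 * \<bar>g x - g y\<bar>)\<^sup>2" using gd(2)[of x y] by (intro power_mono) auto
      then show ?thesis by (simp add: power_mult_distrib power2_commute)
    qed
    moreover have "1 / k \<le> c1 / (2 * c2\<^sup>2)" using kk(4) k0 c1 c2 by (simp add: field_simps)
    ultimately have "1 / k * (x - y)\<^sup>2 \<le> c1 / (2 * c2\<^sup>2) * (c2\<^sup>2 * (g y - g x)\<^sup>2)" using c1 by (intro mult_mono) auto
    also have "\<dots> = c1 / 2 * (g y - g x)\<^sup>2" using c2 by simp
    finally have "1 / k * (x - y)\<^sup>2 \<le> c1 / 2 * (g y - g x)\<^sup>2" .
    moreover have "(x - y)\<^sup>2 / k = 1 / k * (x - y)\<^sup>2" by simp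
    ultimately show "(x - y)\<^sup>2 / k \<le> h x - h y - g y * (x - y)" unfolding eq using tangent_bounds(1)[of "g y" "g x"] by linarith
    have "(g y - g x)\<^sup>2 \<le> (1 / c1)\<^sup>2 * (x - y)\<^sup>2"
    proof -
      have "\<bar>g x - g y\<bar>\<^sup>2 \<le> (1 / c1 * \<bar>x - y\<bar>)\<^sup>2" using gd(1)[of x y] by (intro power_mono) auto
      then show ?thesis by (simp add: power_mult_distrib power_divide power2_commute)
    qed
    then have "c2 / 2 * (g y - g x)\<^sup>2 \<le> c2 / 2 * ((1 / c1)\<^sup>2 * (x - y)\<^sup>2)" using c2 by (intro mult_left_mono) auto
    also have "\<dots> = (c2 / c1\<^sup>2) / 2 * (x - y)\<^sup>2" by (simp add: power_divide)
    also have "\<dots> \<le> k * (x - y)\<^sup>2"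
    proof (rule mult_right_mono)
      have "0 \<le> c2 / c1\<^sup>2" using c2 by simp
      then have "(c2 / c1\<^sup>2) / 2 \<le> c2 / c1\<^sup>2" by simp
      then show "(c2 / c1\<^sup>2) / 2 \<le> k" using kk(5) by (rule order_trans)
    qed simp
    finally show "h x - h y - g y * (x - y) \<le> k * (x - y)\<^sup>2" unfolding eq using tangent_bounds(2)[of "g y" "g x"] by linarith
  qed
  show ?thesis unfolding dual_pair_def k_def[symmetric] using kk(1) g L1 A B C E by auto
qed

text \<open>After exchanging the sums, layer \<open>s\<close> counts pairs \<open>(j, k)\<close>
  with \<open>j * h (k / j)\<close> within \<open>1 / 2 ^ s\<close> of an integer, that is, near
  points of the dual curve with \<open>V = 1 / 2 ^ s\<close>. The weight \<open>2 ^ s\<close>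
  cancels this \<open>V\<close> in the expected term, so each of the \<open>n + 1\<close> layers
  adds \<open>4 ^ i * r ^ i\<close>.\<close>

lemma layer_sum_bound:
  assumes bd: "\<And>n f p h g X V. dual_pair (duality_const c1 c2) f p h g \<Longrightarrow> 0 < V \<Longrightarrow> V \<le> 1 \<Longrightarrow>
       real (card (near_pts f X n V)) \<le> C * (real n * 2 ^ n + V * 4 ^ n * r ^ n)"
    and I: "\<eta> < \<xi>" and C: "0 < C" and r: "1 < r"
  shows "(\<Sum>j\<in>{1..<2 ^ i}. layer n \<eta> \<xi> j) \<le>
    (c2 * (\<xi> - \<eta>) + 1) * C * (2 * 2 ^ n * (real i * 2 ^ i) + (real n + 1) * (4 ^ i * r ^ i))"
proof -
  define P where "P s = {(j, k). j \<in> {1..<2 ^ i} \<and> k \<in> slopes \<eta> \<xi> j \<and>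
     (\<exists>m::int. \<bar>real j * h (of_int k / real j) - of_int m\<bar> \<le> 1 / 2 ^ s)}" for s :: nat
  define W where "W = {..nat \<lfloor>c2 * (\<xi> - \<eta>)\<rfloor>}"
  define Y where "Y w = f1 \<eta> + real w" for w :: nat
  have fin: "finite (slopes \<eta> \<xi> j)" if "j \<in> {1..<2 ^ i}" for j using slopes_eq[of j \<eta> \<xi>] that by simp
  have l0: "0 \<le> c2 * (\<xi> - \<eta>)" using I c2 by simp
  have "(\<Sum>j\<in>{1..<2 ^ i}. layer n \<eta> \<xi> j) = (\<Sum>s\<le>n. 2 ^ s * real (card (P s)))"
  proof -
    define ind where "ind j k s = (if \<exists>m::int. \<bar>real j * h (of_int k / real j) - of_int m\<bar> \<le> 1 / 2 ^ s then 2 ^ s else (0::real))" for j k and s :: nat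
    have "(\<Sum>j\<in>{1..<2 ^ i}. layer n \<eta> \<xi> j) = (\<Sum>(j, k)\<in>Sigma {1..<2 ^ i} (slopes \<eta> \<xi>). \<Sum>s\<le>n. ind j k s)"
      unfolding layer_def ind_def[symmetric] by (rule sum.Sigma) (use fin in auto)
    also have "\<dots> = (\<Sum>s\<le>n. \<Sum>(j, k)\<in>Sigma {1..<2 ^ i} (slopes \<eta> \<xi>). ind j k s)"
      unfolding case_prod_unfold by (rule sum.swap)
    also have "\<dots> = (\<Sum>s\<le>n. 2 ^ s * real (card (P s)))"
    proof (rule sum.cong[OF refl])
      fix s
      have "(\<Sum>(j, k)\<in>Sigma {1..<2 ^ i} (slopes \<eta> \<xi>). ind j k s) = (\<Sum>z\<in>P s. 2 ^ s)"
        unfolding P_def ind_def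
        by (rule sum.mono_neutral_cong_right) (use fin in \<open>auto split: if_splits\<close>)
      then show "(\<Sum>(j, k)\<in>Sigma {1..<2 ^ i} (slopes \<eta> \<xi>). ind j k s) = 2 ^ s * real (card (P s))" by simp
    qed
    finally show ?thesis .
  qed
  also have "\<dots> \<le> (\<Sum>s\<le>n. (c2 * (\<xi> - \<eta>) + 1) * C * (2 ^ s * (real i * 2 ^ i) + 4 ^ i * r ^ i))"
  proof (rule sum_mono)
    fix s
    have sub: "P s \<subseteq> (\<Union>w\<in>W. (\<lambda>(q, a, b). (nat q, a)) ` near_pts h (Y w) i (1 / 2 ^ s))"
    proof
      fix z assume z: "z \<in> P s"
      then obtain j k m where jk: "z = (j, k)" "1 \<le> j" "j < 2 ^ i" "k \<in> slopes \<eta> \<xi> j"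
        and m: "\<bar>real j * h (of_int k / real j) - of_int m\<bar> \<le> 1 / 2 ^ s" unfolding P_def by auto
      define t where "t = of_int k / real j"
      have gt: "\<eta> < g t" "g t \<le> \<xi>" using jk(4) unfolding slopes_def t_def by auto
      have "f1 \<eta> < t" "t \<le> f1 \<xi>" using f1_less_iff[of \<eta> "g t"] f1_le_iff[of "g t" \<xi>] gt g by auto
      moreover have "f1 \<xi> - f1 \<eta> \<le> c2 * (\<xi> - \<eta>)" using f1_diff(2)[of \<eta> \<xi>] I by simp
      ultimately have t: "0 \<le> t - f1 \<eta>" "t - f1 \<eta> \<le> c2 * (\<xi> - \<eta>)" by auto
      define w where "w = nat \<lfloor>t - f1 \<eta>\<rfloor>"
      have w: "real w \<le> t - f1 \<eta>" "t - f1 \<eta> \<le> real w + 1" using t unfolding w_def by linarith+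
      have "w \<in> W" unfolding W_def w_def using t by (auto intro!: nat_mono floor_mono)
      have "int j < 2 ^ i" using jk(3) by (metis of_nat_less_iff of_nat_numeral of_nat_power)
      then have "(int j, k, m) \<in> near_pts h (Y w) i (1 / 2 ^ s)"
        unfolding near_pts_def Y_def using jk(2) m w unfolding t_def by auto
      then have "(\<lambda>(q, a, b). (nat q, a)) (int j, k, m) \<in> (\<lambda>(q, a, b). (nat q, a)) ` near_pts h (Y w) i (1 / 2 ^ s)"
        by (rule imageI)
      then have "z \<in> (\<lambda>(q, a, b). (nat q, a)) ` near_pts h (Y w) i (1 / 2 ^ s)" by (simp only: jk(1) prod.case nat_int)
      then show "z \<in> (\<Union>w\<in>W. (\<lambda>(q, a, b). (nat q, a)) ` near_pts h (Y w) i (1 / 2 ^ s))"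
        by (rule UN_I[OF \<open>w \<in> W\<close>])
    qed
    have "card (P s) \<le> card (\<Union>w\<in>W. (\<lambda>(q, a, b). (nat q, a)) ` near_pts h (Y w) i (1 / 2 ^ s))"
      by (rule card_mono[OF _ sub]) (auto simp: W_def finite_near_pts)
    then have "real (card (P s)) \<le> (\<Sum>w\<in>W. real (card ((\<lambda>(q, a, b). (nat q, a)) ` near_pts h (Y w) i (1 / 2 ^ s))))"
      using real_card_UN_le[of W "\<lambda>w. (\<lambda>(q, a, b). (nat q, a)) ` near_pts h (Y w) i (1 / 2 ^ s)"] by (simp add: W_def)
    also have "\<dots> \<le> (\<Sum>w\<in>W. C * (real i * 2 ^ i + 1 / 2 ^ s * 4 ^ i * r ^ i))"
    proof (rule sum_mono)
      fix w
      have "card ((\<lambda>(q, a, b). (nat q, a)) ` near_pts h (Y w) i (1 / 2 ^ s)) \<le> card (near_pts h (Y w) i (1 / 2 ^ s))"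
        by (rule card_image_le) (rule finite_near_pts)
      moreover have "real (card (near_pts h (Y w) i (1 / 2 ^ s))) \<le> C * (real i * 2 ^ i + 1 / 2 ^ s * 4 ^ i * r ^ i)"
        by (rule bd[OF dual_pair_sym[OF dual_pair]]) auto
      ultimately show "real (card ((\<lambda>(q, a, b). (nat q, a)) ` near_pts h (Y w) i (1 / 2 ^ s))) \<le> C * (real i * 2 ^ i + 1 / 2 ^ s * 4 ^ i * r ^ i)"
        by linarith
    qed
    also have "\<dots> = real (card W) * (C * (real i * 2 ^ i + 1 / 2 ^ s * 4 ^ i * r ^ i))" by simp
    also have "\<dots> \<le> (c2 * (\<xi> - \<eta>) + 1) * (C * (real i * 2 ^ i + 1 / 2 ^ s * 4 ^ i * r ^ i))"
    proof (rule mult_right_mono)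
      show "real (card W) \<le> c2 * (\<xi> - \<eta>) + 1" unfolding W_def using l0 by simp
      show "0 \<le> C * (real i * 2 ^ i + 1 / 2 ^ s * 4 ^ i * r ^ i)" using C r by simp
    qed
    finally have "2 ^ s * real (card (P s)) \<le> 2 ^ s * ((c2 * (\<xi> - \<eta>) + 1) * (C * (real i * 2 ^ i + 1 / 2 ^ s * 4 ^ i * r ^ i)))"
      by (intro mult_left_mono) auto
    also have "\<dots> = (c2 * (\<xi> - \<eta>) + 1) * C * (2 ^ s * (real i * 2 ^ i) + 4 ^ i * r ^ i)"
    proof -
      have "2 ^ s * (e * (C * (u + 1 / 2 ^ s * 4 ^ i * r ^ i))) = e * C * (2 ^ s * u + 4 ^ i * r ^ i)" for e u :: real
        by (simp add: distrib_left mult_ac)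
      then show ?thesis .
    qed
    finally show "2 ^ s * real (card (P s)) \<le> (c2 * (\<xi> - \<eta>) + 1) * C * (2 ^ s * (real i * 2 ^ i) + 4 ^ i * r ^ i)" .
  qed
  also have "\<dots> = (c2 * (\<xi> - \<eta>) + 1) * C * ((\<Sum>s\<le>n. 2 ^ s) * (real i * 2 ^ i) + (real n + 1) * (4 ^ i * r ^ i))"
    by (simp add: sum_distrib_left[symmetric] sum_distrib_right[symmetric] sum.distrib)
  also have "\<dots> \<le> (c2 * (\<xi> - \<eta>) + 1) * C * (2 * 2 ^ n * (real i * 2 ^ i) + (real n + 1) * (4 ^ i * r ^ i))"
  proof (intro mult_left_mono add_right_mono mult_right_mono)
    have "(\<Sum>s\<le>n. (2::real) ^ s) = 2 ^ Suc n - 1"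
      by (induction n) auto
    then show "(\<Sum>s\<le>n. (2::real) ^ s) \<le> 2 * 2 ^ n" by simp
  qed (use C l0 in auto)
  finally show ?thesis .
qed

end

section \<open>Dyadic summation over the frequencies\<close>

lemma sum_dyadic_blocks:
  fixes \<phi> :: "nat \<Rightarrow> real"
  shows "(\<Sum>j\<in>{1..<2 ^ n}. \<phi> j) = (\<Sum>i<n. \<Sum>j\<in>{2 ^ i..<2 ^ Suc i}. \<phi> j)"
proof (induction n)
  case (Suc n)
  have "(\<Sum>j\<in>{1..<2 ^ Suc n}. \<phi> j) = (\<Sum>j\<in>{1..<2 ^ n}. \<phi> j) + (\<Sum>j\<in>{2 ^ n..<2 ^ Suc n}. \<phi> j)"
    by (rule sum.atLeastLessThan_concat[symmetric]) auto
  then show ?case using Suc by simp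
qed simp

lemma sum_Suc_geometric_le:
  fixes y :: real
  assumes "0 \<le> y" "y < 1"
  shows "(\<Sum>d<n. (real d + 1) * y ^ d) \<le> 1 / (1 - y)\<^sup>2"
proof -
  have "(1 - y)\<^sup>2 * (\<Sum>d<n. (real d + 1) * y ^ d) = 1 - (real n + 1) * y ^ n + real n * y ^ Suc n"
    by (induction n) (simp_all add: algebra_simps power2_eq_square)
  also have "\<dots> \<le> 1"
  proof -
    have "y ^ Suc n \<le> y ^ n" using assms by (intro power_decreasing) auto
    then have "real n * y ^ Suc n \<le> real n * y ^ n" by (intro mult_left_mono) auto
    also have "\<dots> \<le> (real n + 1) * y ^ n" using assms by (intro mult_right_mono) auto
    finally show ?thesis by simp
  qed
  finally show ?thesis using assms by (simp add: field_simps)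
qed

text \<open>While \<open>2 ^ i\<close> is below \<open>1 / \<rho>\<close> the terms grow like
  \<open>\<rho> * sqrt (2 ^ i)\<close>, and beyond they decay like \<open>1 / sqrt (2 ^ i)\<close>.
  Both geometric sums are dominated by the crossing, where the value is about
  \<open>sqrt \<rho>\<close> and \<open>i\<close> about \<open>log 2 (1 / \<rho>)\<close>.\<close>

lemma dyadic_log_sum:
  obtains C where "0 < C"
    "\<And>\<rho> N. 0 < \<rho> \<Longrightarrow> \<rho> \<le> 1 \<Longrightarrow> (\<Sum>i<N. (real i + 1) * min \<rho> (1 / 2 ^ i) * sqrt (2 ^ i)) \<le> C * (sqrt \<rho> * (1 + ln (1 / \<rho>)))"
proof -
  define a where "a = sqrt 2"
  have a: "1 < a" unfolding a_def by simp
  have a2: "a * a = 2" unfolding a_def by simp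
  have sa: "sqrt (2 ^ i) = a ^ i" for i unfolding a_def by (rule real_sqrt_power)
  have aa: "a ^ i * a ^ i = 2 ^ i" for i by (simp add: power_mult_distrib[symmetric] a2)
  define y where "y = 1 / a"
  have y: "0 \<le> y" "y < 1" unfolding y_def using a by auto
  define G where "G = a * a / (a - 1) + 1 / (1 - y)\<^sup>2"
  have G: "0 < G" unfolding G_def using a y by (intro add_pos_nonneg) auto
  have "(\<Sum>i<N. (real i + 1) * min \<rho> (1 / 2 ^ i) * sqrt (2 ^ i)) \<le> (3 * G) * (sqrt \<rho> * (1 + ln (1 / \<rho>)))"
    if \<rho>: "0 < \<rho>" "\<rho> \<le> 1" for \<rho> N
  proof -
    define l where "l = log 2 (1 / \<rho>)"
    define i0 where "i0 = nat \<lceil>l\<rceil>"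
    have l0: "0 \<le> l" unfolding l_def using \<rho> by simp
    have i0: "l \<le> real i0" "real i0 \<le> l + 1" unfolding i0_def using l0 by linarith+
    have pl: "2 powr l = 1 / \<rho>" unfolding l_def using \<rho> by simp
    have "2 powr l \<le> 2 powr (real i0)" "2 powr (real i0) \<le> 2 powr (l + 1)" using i0 by (auto intro: powr_mono)
    then have p: "1 / \<rho> \<le> 2 ^ i0" "2 ^ i0 \<le> 2 / \<rho>" using pl by (auto simp: powr_realpow powr_add)
    define sr where "sr = sqrt \<rho>"
    have sr: "0 < sr" "sr * sr = \<rho>" unfolding sr_def using \<rho> by auto
    have u1: "1 / a ^ i0 \<le> sr"
    proof -
      have "sqrt (1 / \<rho>) \<le> sqrt (2 ^ i0)" using p by (intro real_sqrt_le_mono)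
      then have "1 / sr \<le> a ^ i0" unfolding sa sr_def by (simp add: real_sqrt_divide)
      then show ?thesis using sr a by (simp add: field_simps)
    qed
    have u2: "a ^ i0 * sr \<le> a"
    proof -
      have "sqrt (2 ^ i0) \<le> sqrt (2 / \<rho>)" using p by (intro real_sqrt_le_mono)
      then have "a ^ i0 \<le> a / sr" unfolding sa sr_def a_def by (simp add: real_sqrt_divide)
      then show ?thesis using sr by (simp add: field_simps)
    qed
    define t where "t i = (real i + 1) * min \<rho> (1 / 2 ^ i) * sqrt (2 ^ i)" for i :: nat
    have t0: "0 \<le> t i" for i unfolding t_def using \<rho> by simp
    have "(\<Sum>i<N. t i) \<le> (\<Sum>i<i0 + N. t i)" using t0 by (intro sum_mono2) auto
    also have "\<dots> = (\<Sum>i<i0. t i) + (\<Sum>d<N. t (i0 + d))"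
      by (induction N) (auto simp: add.assoc)
    also have "(\<Sum>i<i0. t i) \<le> (\<Sum>i<i0. ((real i0 + 1) * \<rho>) * a ^ i)"
      unfolding t_def sa using \<rho> a by (intro sum_mono mult_right_mono mult_mono) auto
    also have "(\<Sum>i<i0. ((real i0 + 1) * \<rho>) * a ^ i) = (real i0 + 1) * \<rho> * ((a ^ i0 - 1) / (a - 1))"
      unfolding sum_distrib_left[symmetric] using a by (simp add: geometric_sum)
    also have "\<dots> \<le> (real i0 + 1) * (sr * (a * a / (a - 1)))"
    proof -
      have "\<rho> * ((a ^ i0 - 1) / (a - 1)) \<le> \<rho> * (a ^ i0 / (a - 1))"
        using \<rho> a by (intro mult_left_mono divide_right_mono) auto
      also have "\<dots> = sr * (a ^ i0 * sr) / (a - 1)" unfolding sr(2)[symmetric] by simp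
      also have "\<dots> \<le> sr * a / (a - 1)" using u2 sr a by (intro divide_right_mono mult_left_mono) auto
      also have "\<dots> \<le> sr * (a * a) / (a - 1)" using sr a by (intro divide_right_mono mult_left_mono) auto
      finally have "\<rho> * ((a ^ i0 - 1) / (a - 1)) \<le> sr * (a * a / (a - 1))" by simp
      then show ?thesis unfolding mult.assoc by (intro mult_left_mono) auto
    qed
    also have "(\<Sum>d<N. t (i0 + d)) \<le> (\<Sum>d<N. (real i0 + 1) * sr * ((real d + 1) * y ^ d))"
    proof (rule sum_mono)
      fix d
      have "t (i0 + d) \<le> (real (i0 + d) + 1) * (1 / 2 ^ (i0 + d)) * a ^ (i0 + d)"
        unfolding t_def sa using a by (intro mult_right_mono mult_left_mono) auto
      also have "\<dots> = (real (i0 + d) + 1) * ((1 / a ^ i0) * y ^ d)"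
        unfolding aa[symmetric] y_def using a by (simp add: power_add power_divide)
      also have "\<dots> \<le> ((real i0 + 1) * (real d + 1)) * (sr * y ^ d)"
        using u1 y sr a by (intro mult_mono mult_right_mono) (auto simp: algebra_simps)
      finally show "t (i0 + d) \<le> (real i0 + 1) * sr * ((real d + 1) * y ^ d)" by (simp add: mult_ac)
    qed
    also have "\<dots> \<le> (real i0 + 1) * sr * (1 / (1 - y)\<^sup>2)"
      unfolding sum_distrib_left[symmetric] using sum_Suc_geometric_le[OF y] sr by (intro mult_left_mono) auto
    finally have "(\<Sum>i<N. t i) \<le> (real i0 + 1) * (sr * G)" unfolding G_def by (simp add: algebra_simps)
    also have "\<dots> \<le> (3 * (1 + ln (1 / \<rho>))) * (sr * G)"
    proof (rule mult_right_mono)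
      have "l = ln (1 / \<rho>) / ln 2" unfolding l_def log_def ..
      moreover have "ln (1 / 2 :: real) \<le> 1 / 2 - 1" by (rule ln_le_minus_one) simp
      then have "1 / 2 \<le> ln (2::real)" by (simp add: ln_div)
      moreover have "0 \<le> ln (1 / \<rho>)" using \<rho> by simp
      ultimately have "l \<le> ln (1 / \<rho>) / (1 / 2)" by (simp only:) (intro divide_left_mono, auto)
      then show "real i0 + 1 \<le> 3 * (1 + ln (1 / \<rho>))" using i0 \<open>0 \<le> ln (1 / \<rho>)\<close> by simp
    qed (use sr G in simp)
    finally show ?thesis unfolding t_def sr_def by (simp add: mult_ac)
  qed
  then show thesis using that[of "3 * G"] G by simp
qed

lemma duality_const_ge_1: "0 < c1 \<Longrightarrow> c1 \<le> c2 \<Longrightarrow> 1 \<le> duality_const c1 c2"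
  unfolding duality_const_def by (smt (verit) divide_nonneg_pos mult_nonneg_nonneg zero_le_power2 zero_less_power)

text \<open>The left side is the minimum of \<open>x\<close> and \<open>Q / x\<close>. With
  \<open>x\<^sup>2 = 2 ^ i\<close> the crossing is at \<open>2 ^ i = Q\<close>: this is how the
  coefficient bound \<open>Q / j\<^sup>2\<close> tames the part of the layer sum that grows like
  \<open>4 ^ i\<close>.\<close>

lemma min_sqrt_balance:
  fixes x Q :: real
  assumes x: "0 < x" and Q: "0 < Q"
  shows "min (1 / x\<^sup>2) (Q / x ^ 4) * x ^ 3 \<le> sqrt Q"
proof (cases "x \<le> sqrt Q")
  case True
  have "min (1 / x\<^sup>2) (Q / x ^ 4) * x ^ 3 \<le> 1 / x\<^sup>2 * x ^ 3" using x by (intro mult_right_mono) auto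
  also have "\<dots> = x" using x by (simp add: power2_eq_square power3_eq_cube)
  finally show ?thesis using True by linarith
next
  case False
  have "min (1 / x\<^sup>2) (Q / x ^ 4) * x ^ 3 \<le> Q / x ^ 4 * x ^ 3" using x by (intro mult_right_mono) auto
  also have "\<dots> = Q / x" using x by (simp add: eval_nat_numeral)
  also have "\<dots> \<le> Q / sqrt Q" using False x Q by (intro divide_left_mono) auto
  also have "\<dots> = sqrt Q" using Q by (simp add: real_div_sqrt)
  finally show ?thesis .
qed

lemma sum_reciprocal_dyadic: "(\<Sum>j\<in>{1..<2 ^ n}. 1 / real j) \<le> real n"
proof -
  have "(\<Sum>j\<in>{1..<2 ^ n}. 1 / real j) = (\<Sum>i<n. \<Sum>j\<in>{2 ^ i..<2 ^ Suc i}. 1 / real j)"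
    by (rule sum_dyadic_blocks)
  also have "\<dots> \<le> (\<Sum>i<n. 1)"
  proof (rule sum_mono)
    fix i
    have "(\<Sum>j\<in>{2 ^ i..<2 ^ Suc i}. 1 / real j) \<le> (\<Sum>j\<in>{(2::nat) ^ i..<2 ^ Suc i}. 1 / 2 ^ i)"
    proof (rule sum_mono)
      fix j :: nat assume "j \<in> {2 ^ i..<2 ^ Suc i}"
      then have "real (2 ^ i) \<le> real j" by (simp only: of_nat_le_iff atLeastLessThan_iff)
      then show "1 / real j \<le> 1 / 2 ^ i" by (intro frac_le) auto
    qed
    then show "(\<Sum>j\<in>{2 ^ i..<2 ^ Suc i}. 1 / real j) \<le> 1" by simp
  qed
  finally show ?thesis by simp
qed

text \<open>On a dyadic block the bounds for \<open>b j\<close> are used differently on two parts of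
  the layer sum: \<open>\<rho>\<close> and \<open>1 / j\<close> against the part of order
  \<open>Q * 2 ^ i\<close>, which gives \<open>sqrt \<rho>\<close> with its logarithm, and
  \<open>1 / j\<close> and \<open>Q / j\<^sup>2\<close> against the part of order
  \<open>4 ^ i\<close>, which gives about \<open>Q\<close> per block.\<close>

lemma exponential_sum_average:
  fixes c1 c2 L l \<epsilon> :: real
  assumes c: "0 < c1" "c1 \<le> c2" and l: "0 < l" and \<epsilon>: "0 < \<epsilon>"
  obtains C where "0 < C"
    "\<And>f f1 f2 g \<eta> \<xi> Q n b \<rho>. convex_curve f f1 f2 g c1 c2 L \<Longrightarrow> \<xi> - \<eta> = l \<Longrightarrow> 2 ^ n \<le> Q \<Longrightarrow> Q < 2 * 2 ^ n \<Longrightarrow>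
       0 < \<rho> \<Longrightarrow> \<rho> \<le> 1 \<Longrightarrow>
       (\<And>j. 1 \<le> j \<Longrightarrow> 0 \<le> b j \<and> b j \<le> \<rho> \<and> b j \<le> 1 / real j \<and> b j \<le> real Q / (real j)\<^sup>2) \<Longrightarrow>
       (\<Sum>j\<in>{1..<2 ^ (4 * (n + 1))}. b j * norm (curve_sum f \<eta> \<xi> Q j)) \<le>
         C * (sqrt \<rho> * (1 + ln (1 / \<rho>)) * (real Q * sqrt (real Q)) + real Q * real Q powr \<epsilon>)"
proof -
  \<comment> \<open>The point counts cost up to \<open>r ^ (4 * (n + 1))\<close> and the polynomial
    factor \<open>(n + 1)\<^sup>2\<close> another \<open>r ^ (2 * (n + 1))\<close>; together this is
    \<open>2 powr (\<epsilon> * (n + 1))\<close>.\<close>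
  define r where "r = 2 powr (\<epsilon> / 6)"
  have r: "1 < r" unfolding r_def using \<epsilon> by simp
  obtain C1 where C1: "0 < C1" and np: "\<And>n f p h g X V. dual_pair (duality_const c1 c2) f p h g \<Longrightarrow> 0 < V \<Longrightarrow> V \<le> 1 \<Longrightarrow>
       real (card (near_pts f X n V)) \<le> C1 * (real n * 2 ^ n + V * 4 ^ n * r ^ n)"
    using near_pts_bound[OF duality_const_ge_1[OF c] r] by blast
  obtain Fr C0 where Fr: "\<And>x. (Fr has_vector_derivative ee (x\<^sup>2)) (at x)" "Fr 0 = 0"
    and C0: "\<And>z. 0 \<le> z \<Longrightarrow> norm (Fr z - C0) \<le> 6 / (1 + z)"
    using fresnel_limit by blast
  obtain C3 where C3: "0 < C3" and dl: "\<And>\<rho> N. 0 < \<rho> \<Longrightarrow> \<rho> \<le> 1 \<Longrightarrow>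
      (\<Sum>i<N. (real i + 1) * min \<rho> (1 / 2 ^ i) * sqrt (2 ^ i)) \<le> C3 * (sqrt \<rho> * (1 + ln (1 / \<rho>)))"
    using dyadic_log_sum by blast
  define D0 where "D0 = \<bar>2 * exp_sum_const c1 c2 L l (norm C0) + 32 * norm C0 / sqrt (2 * c1)\<bar>"
  define W where "W = (c2 * l + 1) * C1"
  \<comment> \<open>\<open>4 * W\<close> comes from the layer sum with \<open>Suc i\<close> in place
    of \<open>i\<close>, and 2 from the terms \<open>real Q + real j\<close> of
    \<open>X\<close>.\<close>
  define D1 where "D1 = 4 * W + 2"
  have W0: "0 \<le> W" unfolding W_def using c l C1 by simp
  have D: "0 \<le> D0" "0 < D1" unfolding D0_def D1_def using W0 by auto
  define K where "K = D0 * (D1 * C3) + D0 * ((4 * D1 + 28) * (2 powr \<epsilon> / (r - 1)\<^sup>2)) + 1"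
  have K: "0 < K" unfolding K_def using D C3 r by (intro add_nonneg_pos add_nonneg_nonneg mult_nonneg_nonneg) auto
  have main: "(\<Sum>j\<in>{1..<2 ^ (4 * (n + 1))}. b j * norm (curve_sum f \<eta> \<xi> Q j)) \<le>
         K * (sqrt \<rho> * (1 + ln (1 / \<rho>)) * (real Q * sqrt (real Q)) + real Q * real Q powr \<epsilon>)"
    if cc: "convex_curve f f1 f2 g c1 c2 L" and len: "\<xi> - \<eta> = l" and Q: "2 ^ n \<le> Q" "Q < 2 * 2 ^ n"
      and \<rho>: "0 < \<rho>" "\<rho> \<le> 1"
      and b: "\<And>j. 1 \<le> j \<Longrightarrow> 0 \<le> b j \<and> b j \<le> \<rho> \<and> b j \<le> 1 / real j \<and> b j \<le> real Q / (real j)\<^sup>2"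
    for f f1 f2 g \<eta> \<xi> Q n b \<rho>
  proof -
    interpret convex_curve f f1 f2 g c1 c2 L by (rule cc)
    define I where "I = 4 * (n + 1)"
    have Q0: "1 \<le> Q" using Q(1) by (meson one_le_numeral one_le_power order_trans)
    then have Qr: "1 \<le> real Q" "0 < real Q" by auto
    have Q2: "2 ^ n \<le> real Q" 
    proof -
      have "real (2 ^ n) \<le> real Q" using Q(1) by (simp only: of_nat_le_iff)
      then show ?thesis by simp
    qed
    have Q3: "real Q \<le> 2 * 2 ^ n" 
    proof -
      have "real Q \<le> real (2 * 2 ^ n)" using Q(2) by (simp only: of_nat_le_iff)
      then show ?thesis by simp
    qed
    have I\<eta>: "\<eta> < \<xi>" using len l by simp
    define X where "X j = layer n \<eta> \<xi> j + real Q + real j" for j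
    have X0: "0 \<le> X j" for j unfolding X_def using layer_nonneg by (intro add_nonneg_nonneg) auto
    have tm: "b j * norm (curve_sum f \<eta> \<xi> Q j) \<le>
       D0 * (b j * sqrt (real Q / real j) * X j) + D0 * (1 / real j * (real Q * (1 + ln (1 + 2 ^ I * real Q))))"
      if j: "j \<in> {1..<2 ^ I}" for j
    proof -
      have j1: "1 \<le> j" using j by simp
      have ln0: "0 \<le> ln (1 + real j * real Q)" by simp
      define Z where "Z = sqrt (real Q / real j) * X j + real Q * (1 + ln (1 + real j * real Q))"
      have Z0: "0 \<le> Z" unfolding Z_def using X0 ln0 by simp
      have "norm (curve_sum f \<eta> \<xi> Q j) \<le> (2 * exp_sum_const c1 c2 L l (norm C0) + 32 * norm C0 / sqrt (2 * c1)) * Z"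
        using curve_sum_bound[OF Fr C0 I\<eta> j1 Q(2) Q0] unfolding len Z_def X_def .
      also have "\<dots> \<le> D0 * Z" unfolding D0_def using Z0 by (intro mult_right_mono) auto
      finally have "b j * norm (curve_sum f \<eta> \<xi> Q j) \<le> b j * (D0 * Z)" using b[OF j1] by (intro mult_left_mono) auto
      also have "\<dots> = D0 * (b j * sqrt (real Q / real j) * X j) + D0 * (b j * (real Q * (1 + ln (1 + real j * real Q))))"
        unfolding Z_def by (simp add: algebra_simps)
      also have "b j * (real Q * (1 + ln (1 + real j * real Q))) \<le> 1 / real j * (real Q * (1 + ln (1 + 2 ^ I * real Q)))"
      proof (intro mult_mono)
        have "real j \<le> real (2 ^ I)" using j by (simp only: of_nat_le_iff atLeastLessThan_iff) simp
        then have "real j * real Q \<le> 2 ^ I * real Q" by (intro mult_right_mono) auto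
        then have "ln (1 + real j * real Q) \<le> ln (1 + 2 ^ I * real Q)" by (intro ln_mono) (auto intro: add_pos_nonneg)
        then show "1 + ln (1 + real j * real Q) \<le> 1 + ln (1 + 2 ^ I * real Q)" by simp
      qed (use b[OF j1] ln0 in auto)
      finally show ?thesis using D by (simp add: mult_left_mono)
    qed
    have "(\<Sum>j\<in>{1..<2 ^ I}. b j * norm (curve_sum f \<eta> \<xi> Q j)) \<le>
       D0 * (\<Sum>j\<in>{1..<2 ^ I}. b j * sqrt (real Q / real j) * X j)
       + D0 * ((\<Sum>j\<in>{1..<2 ^ I}. 1 / real j) * (real Q * (1 + ln (1 + 2 ^ I * real Q))))"
      using sum_mono[OF tm] by (simp only: sum.distrib sum_distrib_left sum_distrib_right)
    also have "\<dots> \<le> D0 * (D1 * C3 * (sqrt \<rho> * (1 + ln (1 / \<rho>)) * (real Q * sqrt (real Q))) + real I * (D1 * (real n + 1) * r ^ I * real Q))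
       + D0 * (28 * (real n + 1)\<^sup>2 * real Q)"
    proof (intro add_mono mult_left_mono)
      have "(\<Sum>j\<in>{1..<2 ^ I}. b j * sqrt (real Q / real j) * X j) = (\<Sum>i<I. \<Sum>j\<in>{2 ^ i..<2 ^ Suc i}. b j * sqrt (real Q / real j) * X j)"
        by (rule sum_dyadic_blocks)
      also have "\<dots> \<le> (\<Sum>i<I. D1 * (real Q * sqrt (real Q)) * ((real i + 1) * min \<rho> (1 / 2 ^ i) * sqrt (2 ^ i)) + D1 * (real n + 1) * r ^ I * real Q)"
      proof (rule sum_mono)
        fix i assume "i \<in> {..<I}"
        then have i: "Suc i \<le> I" by simp
        define x where "x = sqrt (2 ^ i :: real)"
        have x: "0 < x" "x\<^sup>2 = 2 ^ i" "x ^ 4 = 4 ^ i"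
        proof -
          show "0 < x" unfolding x_def by simp
          show x2: "x\<^sup>2 = 2 ^ i" unfolding x_def by simp
          have "x ^ 4 = (x\<^sup>2)\<^sup>2" by simp
          also have "\<dots> = 4 ^ i" unfolding x2 by (simp add: power2_eq_square power_mult_distrib[symmetric])
          finally show "x ^ 4 = 4 ^ i" .
        qed
        define bm where "bm = min \<rho> (min (1 / 2 ^ i) (real Q / 4 ^ i))"
        have bm0: "0 \<le> bm" unfolding bm_def using \<rho> by simp
        have "(\<Sum>j\<in>{2 ^ i..<2 ^ Suc i}. b j * sqrt (real Q / real j) * X j) \<le> (\<Sum>j\<in>{2 ^ i..<2 ^ Suc i}. bm * (sqrt (real Q) / x) * X j)"
        proof (rule sum_mono)
          fix j :: nat assume j: "j \<in> {2 ^ i..<2 ^ Suc i}"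
          then have "real (2 ^ i) \<le> real j" by (simp only: of_nat_le_iff atLeastLessThan_iff)
          then have j2: "2 ^ i \<le> real j" by simp
          have "1 \<le> (2::real) ^ i" by simp
          then have j1: "1 \<le> j" using j2 by linarith
          have "b j \<le> bm" unfolding bm_def
          proof (intro min.boundedI)
            show "b j \<le> \<rho>" using b[OF j1] by simp
            have "1 / real j \<le> 1 / 2 ^ i" using j2 by (intro frac_le) auto
            then show "b j \<le> 1 / 2 ^ i" using b[OF j1] by linarith
            have "(2 ^ i)\<^sup>2 \<le> (real j)\<^sup>2" using j2 by (intro power_mono) auto
            then have "4 ^ i \<le> (real j)\<^sup>2" by (simp add: power2_eq_square power_mult_distrib[symmetric])
            then have "real Q / (real j)\<^sup>2 \<le> real Q / 4 ^ i" by (intro frac_le) auto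
            then show "b j \<le> real Q / 4 ^ i" using b[OF j1] by linarith
          qed
          moreover have "sqrt (real Q / real j) \<le> sqrt (real Q) / x"
            unfolding x_def real_sqrt_divide using j2 by (intro frac_le) auto
          ultimately show "b j * sqrt (real Q / real j) * X j \<le> bm * (sqrt (real Q) / x) * X j"
            using bm0 X0 by (intro mult_right_mono mult_mono) auto
        qed
        also have "\<dots> = bm * (sqrt (real Q) / x) * (\<Sum>j\<in>{2 ^ i..<2 ^ Suc i}. X j)" by (simp add: sum_distrib_left)
        also have "\<dots> \<le> bm * (sqrt (real Q) / x) * (D1 * real Q * (real i + 1) * 2 ^ i + D1 * (real n + 1) * r ^ I * 4 ^ i)"
        proof (rule mult_left_mono)
          have "(\<Sum>j\<in>{2 ^ i..<2 ^ Suc i}. X j) = (\<Sum>j\<in>{2 ^ i..<2 ^ Suc i}. layer n \<eta> \<xi> j) + (\<Sum>j\<in>{(2::nat) ^ i..<2 ^ Suc i}. real Q) + (\<Sum>j\<in>{2 ^ i..<2 ^ Suc i}. real j)"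
            unfolding X_def by (simp only: sum.distrib)
          also have "(\<Sum>j\<in>{2 ^ i..<2 ^ Suc i}. layer n \<eta> \<xi> j) \<le> (\<Sum>j\<in>{1..<2 ^ Suc i}. layer n \<eta> \<xi> j)"
            using layer_nonneg by (intro sum_mono2) auto
          also have "\<dots> \<le> W * (2 * 2 ^ n * (real (Suc i) * 2 ^ Suc i) + (real n + 1) * (4 ^ Suc i * r ^ Suc i))"
            using layer_sum_bound[where i = "Suc i" and n = n, OF np I\<eta> C1 r] unfolding W_def len by simp
          also have "\<dots> \<le> W * (2 * real Q * (real (Suc i) * 2 ^ Suc i) + (real n + 1) * (4 ^ Suc i * r ^ I))"
            using Q2 W0 r i by (intro mult_left_mono add_mono mult_right_mono power_increasing) auto
          also have "(\<Sum>j\<in>{(2::nat) ^ i..<2 ^ Suc i}. real Q) = 2 ^ i * real Q" by simp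
          also have "(\<Sum>j\<in>{2 ^ i..<2 ^ Suc i}. real j) \<le> (\<Sum>j\<in>{(2::nat) ^ i..<2 ^ Suc i}. 2 * 2 ^ i)"
          proof (rule sum_mono)
            fix j :: nat assume "j \<in> {2 ^ i..<2 ^ Suc i}"
            then have "real j \<le> real (2 ^ Suc i)" by (simp only: of_nat_le_iff atLeastLessThan_iff) simp
            then show "real j \<le> 2 * 2 ^ i" by simp
          qed
          also have "(\<Sum>j\<in>{(2::nat) ^ i..<2 ^ Suc i}. 2 * 2 ^ i) = 2 * (4::real) ^ i"
            by (simp add: power_mult_distrib[symmetric])
          finally have "(\<Sum>j\<in>{2 ^ i..<2 ^ Suc i}. X j) \<le> W * (2 * real Q * (real (Suc i) * 2 ^ Suc i) + (real n + 1) * (4 ^ Suc i * r ^ I))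
             + 2 ^ i * real Q + 2 * 4 ^ i" by simp
          also have "\<dots> = 4 * W * (real Q * (real i + 1) * 2 ^ i) + 4 * W * ((real n + 1) * r ^ I * 4 ^ i) + real Q * 1 * 2 ^ i + 2 * (1 * 1 * 4 ^ i)"
            by (simp add: algebra_simps)
          also have "\<dots> \<le> 4 * W * (real Q * (real i + 1) * 2 ^ i) + 4 * W * ((real n + 1) * r ^ I * 4 ^ i) + real Q * (real i + 1) * 2 ^ i + 2 * ((real n + 1) * r ^ I * 4 ^ i)"
            using r by (intro add_mono mult_left_mono mult_right_mono mult_mono) (auto simp: one_le_power)
          also have "\<dots> \<le> D1 * real Q * (real i + 1) * 2 ^ i + D1 * (real n + 1) * r ^ I * 4 ^ i"
            unfolding D1_def by (simp add: algebra_simps)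
          finally show "(\<Sum>j\<in>{2 ^ i..<2 ^ Suc i}. X j) \<le> D1 * real Q * (real i + 1) * 2 ^ i + D1 * (real n + 1) * r ^ I * 4 ^ i" .
        qed (use bm0 x in simp)
        also have "\<dots> = bm * ((sqrt (real Q) / x) * (D1 * real Q * (real i + 1) * 2 ^ i)) + bm * ((sqrt (real Q) / x) * (D1 * (real n + 1) * r ^ I * 4 ^ i))"
          by (simp only: distrib_left mult.assoc)
        also have "\<dots> \<le> min \<rho> (1 / 2 ^ i) * ((sqrt (real Q) / x) * (D1 * real Q * (real i + 1) * 2 ^ i))
           + min (1 / 2 ^ i) (real Q / 4 ^ i) * ((sqrt (real Q) / x) * (D1 * (real n + 1) * r ^ I * 4 ^ i))"
          using D x r unfolding bm_def by (intro add_mono mult_right_mono) auto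
        also have "min \<rho> (1 / 2 ^ i) * ((sqrt (real Q) / x) * (D1 * real Q * (real i + 1) * 2 ^ i)) = D1 * (real Q * sqrt (real Q)) * ((real i + 1) * min \<rho> (1 / 2 ^ i) * sqrt (2 ^ i))"
        proof -
          have "2 ^ i / x = x" using x by (simp add: power2_eq_square[symmetric] divide_eq_eq)
          moreover have "min \<rho> (1 / 2 ^ i) * ((sqrt (real Q) / x) * (D1 * real Q * (real i + 1) * 2 ^ i))
             = D1 * (real Q * sqrt (real Q)) * ((real i + 1) * min \<rho> (1 / 2 ^ i) * (2 ^ i / x))" by simp
          ultimately show ?thesis unfolding x_def[symmetric] by (simp only:)
        qed
        also have "min (1 / 2 ^ i) (real Q / 4 ^ i) * ((sqrt (real Q) / x) * (D1 * (real n + 1) * r ^ I * 4 ^ i))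
            \<le> D1 * (real n + 1) * r ^ I * real Q"
        proof -
          have "4 ^ i / x = x ^ 3" using x by (simp add: x(3)[symmetric] eval_nat_numeral)
          then have "min (1 / 2 ^ i) (real Q / 4 ^ i) * ((sqrt (real Q) / x) * (D1 * (real n + 1) * r ^ I * 4 ^ i))
            = (D1 * (real n + 1) * r ^ I * sqrt (real Q)) * (min (1 / 2 ^ i) (real Q / 4 ^ i) * x ^ 3)"
          proof -
            show ?thesis unfolding \<open>4 ^ i / x = x ^ 3\<close>[symmetric] by simp
          qed
          also have "\<dots> \<le> (D1 * (real n + 1) * r ^ I * sqrt (real Q)) * sqrt (real Q)"
            using min_sqrt_balance[OF x(1) Qr(2)] D r unfolding x(2,3) by (intro mult_left_mono) auto
          also have "\<dots> = D1 * (real n + 1) * r ^ I * real Q" by simp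
          finally show ?thesis .
        qed
        finally show "(\<Sum>j\<in>{2 ^ i..<2 ^ Suc i}. b j * sqrt (real Q / real j) * X j) \<le>
           D1 * (real Q * sqrt (real Q)) * ((real i + 1) * min \<rho> (1 / 2 ^ i) * sqrt (2 ^ i)) + D1 * (real n + 1) * r ^ I * real Q" by simp
      qed
      also have "\<dots> = D1 * (real Q * sqrt (real Q)) * (\<Sum>i<I. (real i + 1) * min \<rho> (1 / 2 ^ i) * sqrt (2 ^ i)) + real I * (D1 * (real n + 1) * r ^ I * real Q)"
        by (simp add: sum.distrib sum_distrib_left)
      also have "\<dots> \<le> D1 * (real Q * sqrt (real Q)) * (C3 * (sqrt \<rho> * (1 + ln (1 / \<rho>)))) + real I * (D1 * (real n + 1) * r ^ I * real Q)"
        using dl[OF \<rho>] D by (intro add_right_mono mult_left_mono) auto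
      finally show "(\<Sum>j\<in>{1..<2 ^ I}. b j * sqrt (real Q / real j) * X j) \<le>
         D1 * C3 * (sqrt \<rho> * (1 + ln (1 / \<rho>)) * (real Q * sqrt (real Q))) + real I * (D1 * (real n + 1) * r ^ I * real Q)"
        by (simp only: mult_ac)
      have "ln (1 + 2 ^ I * real Q) \<le> real (I + n + 2)"
      proof -
        have "1 + 2 ^ I * real Q \<le> 2 ^ I * real Q + 2 ^ I * real Q"
          using Qr mult_mono[of 1 "2 ^ I" 1 "real Q"] by (simp add: mult.commute)
        also have "\<dots> \<le> 2 ^ I * (2 * 2 ^ n) + 2 ^ I * (2 * 2 ^ n)" using Q3 by (intro add_mono mult_left_mono) auto
        also have "\<dots> = 2 ^ (I + n + 2)" by (simp add: power_add)
        finally have "ln (1 + 2 ^ I * real Q) \<le> ln (2 ^ (I + n + 2))" using Qr by (intro ln_mono) (auto intro: add_pos_nonneg)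
        also have "\<dots> = real (I + n + 2) * ln 2" by (rule ln_realpow)
        also have "\<dots> \<le> real (I + n + 2) * 1" using ln_le_minus_one[of 2] by (intro mult_left_mono) auto
        finally show ?thesis by simp
      qed
      then have "1 + ln (1 + 2 ^ I * real Q) \<le> 7 * (real n + 1)" unfolding I_def by simp
      moreover have "(\<Sum>j\<in>{1..<2 ^ I}. 1 / real j) \<le> 4 * (real n + 1)" using sum_reciprocal_dyadic[of I] unfolding I_def by simp
      ultimately have "(\<Sum>j\<in>{1..<2 ^ I}. 1 / real j) * (real Q * (1 + ln (1 + 2 ^ I * real Q))) \<le> (4 * (real n + 1)) * (real Q * (7 * (real n + 1)))"
        using Qr by (intro mult_mono) (auto intro!: mult_left_mono add_nonneg_nonneg)
      then show "(\<Sum>j\<in>{1..<2 ^ I}. 1 / real j) * (real Q * (1 + ln (1 + 2 ^ I * real Q))) \<le> 28 * (real n + 1)\<^sup>2 * real Q"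
        by (simp add: power2_eq_square algebra_simps)
    qed (use D in auto)
    also have "\<dots> \<le> D0 * (D1 * C3 * (sqrt \<rho> * (1 + ln (1 / \<rho>)) * (real Q * sqrt (real Q)))) + D0 * ((4 * D1 + 28) * ((real n + 1)\<^sup>2 * r ^ I) * real Q)"
    proof -
      have "real I * (D1 * (real n + 1) * r ^ I * real Q) = 4 * D1 * ((real n + 1)\<^sup>2 * r ^ I) * real Q"
        unfolding I_def by (simp add: power2_eq_square)
      moreover have "28 * (real n + 1)\<^sup>2 * real Q \<le> 28 * ((real n + 1)\<^sup>2 * r ^ I) * real Q"
        using r by (intro mult_right_mono mult_left_mono) (auto simp: one_le_power)
      then have "D0 * (28 * (real n + 1)\<^sup>2 * real Q) \<le> D0 * (28 * ((real n + 1)\<^sup>2 * r ^ I) * real Q)" using D by (intro mult_left_mono) auto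
      ultimately show ?thesis by (simp only: distrib_left distrib_right)
    qed
    also have "(real n + 1)\<^sup>2 * r ^ I \<le> 2 powr \<epsilon> / (r - 1)\<^sup>2 * real Q powr \<epsilon>"
    proof -
      have "real n + 1 \<le> r ^ (n + 1) / (r - 1)" using nat_le_geometric[OF r, of "n + 1"] by simp
      then have "(real n + 1)\<^sup>2 * r ^ I \<le> (r ^ (n + 1) / (r - 1))\<^sup>2 * r ^ I" using r by (intro mult_right_mono power_mono) auto
      also have "\<dots> = r ^ (6 * (n + 1)) / (r - 1)\<^sup>2"
      proof -
        have "(r ^ (n + 1))\<^sup>2 * r ^ I = r ^ (6 * (n + 1))" unfolding I_def power_mult[symmetric] power_add[symmetric] by (simp add: algebra_simps)
        then show ?thesis by (simp add: power_divide)
      qed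
      also have "r ^ (6 * (n + 1)) = 2 powr \<epsilon> * (2 ^ n) powr \<epsilon>"
      proof -
        have "r ^ (6 * (n + 1)) = r powr (real (6 * (n + 1)))" using r by (subst powr_realpow) auto
        also have "\<dots> = 2 powr (\<epsilon> * (real n + 1))" unfolding r_def powr_powr by (simp add: algebra_simps)
        also have "\<dots> = 2 powr \<epsilon> * (2 powr real n) powr \<epsilon>" unfolding powr_powr by (simp add: powr_add[symmetric] algebra_simps)
        finally show ?thesis by (simp add: powr_realpow)
      qed
      also have "2 powr \<epsilon> * (2 ^ n) powr \<epsilon> / (r - 1)\<^sup>2 \<le> 2 powr \<epsilon> * real Q powr \<epsilon> / (r - 1)\<^sup>2"
        using Q2 \<epsilon> by (intro divide_right_mono mult_left_mono powr_mono2) auto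
      finally show ?thesis by simp
    qed
    then have "D0 * (D1 * C3 * (sqrt \<rho> * (1 + ln (1 / \<rho>)) * (real Q * sqrt (real Q)))) + D0 * ((4 * D1 + 28) * ((real n + 1)\<^sup>2 * r ^ I) * real Q)
      \<le> D0 * (D1 * C3 * (sqrt \<rho> * (1 + ln (1 / \<rho>)) * (real Q * sqrt (real Q)))) + D0 * ((4 * D1 + 28) * (2 powr \<epsilon> / (r - 1)\<^sup>2 * real Q powr \<epsilon>) * real Q)"
      using D by (intro add_left_mono mult_left_mono mult_right_mono) auto
    also have "\<dots> = (D0 * (D1 * C3)) * (sqrt \<rho> * (1 + ln (1 / \<rho>)) * (real Q * sqrt (real Q))) + (D0 * ((4 * D1 + 28) * (2 powr \<epsilon> / (r - 1)\<^sup>2))) * (real Q * real Q powr \<epsilon>)"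
      by (simp only: mult_ac)
    also have "\<dots> \<le> K * (sqrt \<rho> * (1 + ln (1 / \<rho>)) * (real Q * sqrt (real Q))) + K * (real Q * real Q powr \<epsilon>)"
    proof (intro add_mono mult_right_mono)
      have n1: "0 \<le> D0 * (D1 * C3)" using D C3 by simp
      have n2: "0 \<le> D0 * ((4 * D1 + 28) * (2 powr \<epsilon> / (r - 1)\<^sup>2))" using D by simp
      show "D0 * (D1 * C3) \<le> K" "D0 * ((4 * D1 + 28) * (2 powr \<epsilon> / (r - 1)\<^sup>2)) \<le> K" unfolding K_def using n1 n2 by linarith+
    qed (use \<rho> in auto)
    finally show ?thesis unfolding I_def by (simp only: distrib_left)
  qed
  show thesis by (rule that[OF K main])
qed

section \<open>Trapezoids\<close>

definition tent :: "real \<Rightarrow> real \<Rightarrow> real" where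
  "tent r u = max 0 (r - \<bar>u\<bar>)"

text \<open>\<open>{- 2..2}\<close> contains the support of the shifted tent, because
  \<open>\<bar>y\<bar> \<le> 1 / 2\<close> and \<open>r \<le> 1\<close>, and has integer ends, as
  \<open>fejer_interval\<close> requires.\<close>

lemma tent_pieces:
  fixes w :: "real \<Rightarrow> complex"
  assumes r: "0 \<le> r" "r \<le> 1" and y: "\<bar>y\<bar> \<le> 1 / 2"
    and 1: "((\<lambda>x. of_real (r + y + x) * w x) has_integral I1) {- y - r..- y}"
    and 2: "((\<lambda>x. of_real (r - y - x) * w x) has_integral I2) {- y..- y + r}"
  shows "((\<lambda>x. of_real (tent r (y + x)) * w x) has_integral I1 + I2) {- 2..2}"
proof -
  have a: "((\<lambda>x. of_real (tent r (y + x)) * w x) has_integral I1) {- y - r..- y}"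
    by (rule has_integral_eq[OF _ 1]) (auto simp: tent_def)
  have b: "((\<lambda>x. of_real (tent r (y + x)) * w x) has_integral I2) {- y..- y + r}"
    by (rule has_integral_eq[OF _ 2]) (auto simp: tent_def)
  have "((\<lambda>x. of_real (tent r (y + x)) * w x) has_integral I1 + I2) {- y - r..- y + r}"
    by (rule has_integral_combine[OF _ _ a b]) (use r in auto)
  then show ?thesis
    by (rule has_integral_on_superset) (use r y in \<open>auto simp: tent_def\<close>)
qed

lemma tent_fourier_0:
  assumes r: "0 \<le> r" "r \<le> 1" and y: "\<bar>y\<bar> \<le> 1 / 2"
  shows "((\<lambda>x. complex_of_real (tent r (y + x))) has_integral of_real (r\<^sup>2)) {- 2..2}"
proof -
  have d1: "((\<lambda>x. (r + y + x)\<^sup>2 / 2) has_real_derivative r + y + x) (at x within S)" for x S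
    by (auto intro!: derivative_eq_intros)
  have d2: "((\<lambda>x. - (r - y - x)\<^sup>2 / 2) has_real_derivative r - y - x) (at x within S)" for x S
    by (auto intro!: derivative_eq_intros simp: field_simps)
  have 1: "((\<lambda>x. complex_of_real (r + y + x)) has_integral of_real ((r + y + - y)\<^sup>2 / 2) - of_real ((r + y + (- y - r))\<^sup>2 / 2)) {- y - r..- y}"
    by (rule fundamental_theorem_of_calculus[OF _ has_vector_derivative_of_real[OF d1]]) (use r in simp)
  have 2: "((\<lambda>x. complex_of_real (r - y - x)) has_integral of_real (- (r - y - (- y + r))\<^sup>2 / 2) - of_real (- (r - y - (- y))\<^sup>2 / 2)) {- y..- y + r}"
    by (rule fundamental_theorem_of_calculus[OF _ has_vector_derivative_of_real[OF d2]]) (use r in simp)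
  have "((\<lambda>x. of_real (tent r (y + x)) * 1) has_integral
    (of_real ((r + y + - y)\<^sup>2 / 2) - of_real ((r + y + (- y - r))\<^sup>2 / 2)) + (of_real (- (r - y - (- y + r))\<^sup>2 / 2) - of_real (- (r - y - (- y))\<^sup>2 / 2) :: complex)) {- 2..2}"
    by (rule tent_pieces[OF r y]) (use 1 2 in \<open>simp_all only: mult_1_right\<close>)
  moreover have "(of_real ((r + y + - y)\<^sup>2 / 2) - of_real ((r + y + (- y - r))\<^sup>2 / 2)) + (of_real (- (r - y - (- y + r))\<^sup>2 / 2) - of_real (- (r - y - (- y))\<^sup>2 / 2)) = complex_of_real (r\<^sup>2)"
    by (simp add: algebra_simps)
  ultimately show ?thesis by simp
qed

lemma tent_fourier:
  assumes r: "0 \<le> r" "r \<le> 1" and y: "\<bar>y\<bar> \<le> 1 / 2" and m: "m \<noteq> 0"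
  shows "((\<lambda>x. of_real (tent r (y + x)) * ee (- (m * x))) has_integral
    ee (m * y) * of_real ((1 - cos (2 * pi * (m * r))) / (2 * pi\<^sup>2 * m\<^sup>2))) {- 2..2}"
proof -
  define c where "c = 2 * of_real pi * \<i> * complex_of_real m"
  have c: "c \<noteq> 0" unfolding c_def using m by simp
  define E where "E x = ee (- (m * x))" for x
  have dE: "(E has_vector_derivative - (c * E x)) (at x within S)" for x S
  proof -
    have "((\<lambda>x. - (m * x)) has_real_derivative - m) (at x within S)" by (auto intro!: derivative_eq_intros)
    from has_vector_derivative_ee[OF this] show ?thesis
      unfolding E_def c_def by (simp add: scaleR_conv_of_real mult_ac)
  qed
  \<comment> \<open>Antiderivatives on the rising and on the falling side, found by integrating by
    parts.\<close>
  define Pm where "Pm x = - (of_real (r + y + x) * E x / c) - E x / c\<^sup>2" for x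
  define Pp where "Pp x = - (of_real (r - y - x) * E x / c) + E x / c\<^sup>2" for x
  have o1: "((\<lambda>x. complex_of_real (r + y + x)) has_vector_derivative of_real 1) (at x within S)" for x S
    by (rule has_vector_derivative_of_real) (auto intro!: derivative_eq_intros)
  have o2: "((\<lambda>x. complex_of_real (r - y - x)) has_vector_derivative of_real (- 1)) (at x within S)" for x S
    by (rule has_vector_derivative_of_real) (auto intro!: derivative_eq_intros)
  have dPm: "(Pm has_vector_derivative of_real (r + y + x) * E x) (at x within S)" for x S
  proof -
    have "(Pm has_vector_derivative - ((of_real (r + y + x) * - (c * E x) + of_real 1 * E x) / c) - (- (c * E x)) / c\<^sup>2) (at x within S)"
      unfolding Pm_def
      by (intro has_vector_derivative_diff has_vector_derivative_minus has_vector_derivative_divide has_vector_derivative_mult o1 dE)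
    moreover have "- ((of_real (r + y + x) * - (c * E x) + of_real 1 * E x) / c) - (- (c * E x)) / c\<^sup>2 = of_real (r + y + x) * E x"
      using c by (simp add: field_simps power2_eq_square)
    ultimately show ?thesis by simp
  qed
  have dPp: "(Pp has_vector_derivative of_real (r - y - x) * E x) (at x within S)" for x S
  proof -
    have "(Pp has_vector_derivative - ((of_real (r - y - x) * - (c * E x) + of_real (- 1) * E x) / c) + (- (c * E x)) / c\<^sup>2) (at x within S)"
      unfolding Pp_def
      by (intro has_vector_derivative_add has_vector_derivative_minus has_vector_derivative_divide has_vector_derivative_mult o2 dE)
    moreover have "- ((of_real (r - y - x) * - (c * E x) + of_real (- 1) * E x) / c) + (- (c * E x)) / c\<^sup>2 = of_real (r - y - x) * E x"
      using c by (simp add: field_simps power2_eq_square)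
    ultimately show ?thesis by simp
  qed
  have 1: "((\<lambda>x. of_real (r + y + x) * E x) has_integral Pm (- y) - Pm (- y - r)) {- y - r..- y}"
    by (rule fundamental_theorem_of_calculus) (use r dPm in auto)
  have 2: "((\<lambda>x. of_real (r - y - x) * E x) has_integral Pp (- y + r) - Pp (- y)) {- y..- y + r}"
    by (rule fundamental_theorem_of_calculus) (use r dPp in auto)
  have "((\<lambda>x. of_real (tent r (y + x)) * E x) has_integral (Pm (- y) - Pm (- y - r)) + (Pp (- y + r) - Pp (- y))) {- 2..2}"
    by (rule tent_pieces[OF r y 1 2])
  moreover have "(Pm (- y) - Pm (- y - r)) + (Pp (- y + r) - Pp (- y)) = ee (m * y) * of_real ((1 - cos (2 * pi * (m * r))) / (2 * pi\<^sup>2 * m\<^sup>2))"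
  proof -
    have ar: "- (m * (- y)) = m * y" "- (m * (- y - r)) = m * y + m * r" "- (m * (- y + r)) = m * y + - (m * r)"
      by (simp_all add: algebra_simps)
    have e: "E (- y) = ee (m * y)" "E (- y - r) = ee (m * y) * ee (m * r)" "E (- y + r) = ee (m * y) * ee (- (m * r))"
      unfolding E_def ar by (simp_all only: ee_add)
    have "(Pm (- y) - Pm (- y - r)) + (Pp (- y + r) - Pp (- y)) = (E (- y - r) + E (- y + r) - 2 * E (- y)) / c\<^sup>2"
      unfolding Pm_def Pp_def using c by (simp add: field_simps)
    also have "\<dots> = ee (m * y) * ((ee (m * r) + ee (- (m * r)) - 2) / c\<^sup>2)"
      unfolding e by (simp add: algebra_simps)
    also have "(ee (m * r) + ee (- (m * r)) - 2) / c\<^sup>2 = of_real ((1 - cos (2 * pi * (m * r))) / (2 * pi\<^sup>2 * m\<^sup>2))"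
    proof -
      have "c\<^sup>2 = of_real (- (4 * pi\<^sup>2 * m\<^sup>2))" unfolding c_def by (simp add: power_mult_distrib)
      then have "(ee (m * r) + ee (- (m * r)) - 2) / c\<^sup>2 = of_real ((2 * cos (2 * pi * (m * r)) - 2) / (- (4 * pi\<^sup>2 * m\<^sup>2)))"
        unfolding ee_cos by simp
      also have "(2 * cos (2 * pi * (m * r)) - 2) / (- (4 * pi\<^sup>2 * m\<^sup>2)) = (1 - cos (2 * pi * (m * r))) / (2 * pi\<^sup>2 * m\<^sup>2)"
        using m by (simp add: field_simps)
      finally show ?thesis .
    qed
    finally show ?thesis .
  qed
  ultimately show ?thesis unfolding E_def by simp
qed

text \<open>Written with tents so that its Fourier coefficients are differences of those of tents.
  The difference of the tents is \<open>h\<close> for \<open>\<bar>u\<bar> \<le> d\<close> and 0 for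
  \<open>\<bar>u\<bar> \<ge> d + h\<close>.\<close>

definition trapezoid :: "real \<Rightarrow> real \<Rightarrow> real \<Rightarrow> real" where
  "trapezoid d h u = (tent (d + h) u - tent d u) / h"

definition trap_coeff :: "real \<Rightarrow> real \<Rightarrow> nat \<Rightarrow> real" where
  "trap_coeff d h m = (cos (2 * pi * (real m * d)) - cos (2 * pi * (real m * (d + h)))) / (2 * pi\<^sup>2 * (real m)\<^sup>2) / h"

lemma trapezoid_bounds:
  assumes "0 \<le> d" "0 < h"
  shows "0 \<le> trapezoid d h u" "trapezoid d h u \<le> 1" "\<bar>u\<bar> \<le> d \<Longrightarrow> trapezoid d h u = 1" "d + h \<le> \<bar>u\<bar> \<Longrightarrow> trapezoid d h u = 0"
  using assms by (auto simp: trapezoid_def tent_def field_simps)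

lemma trapezoid_lipschitz:
  assumes "0 < h"
  shows "\<bar>trapezoid d h u - trapezoid d h v\<bar> \<le> 2 / h * \<bar>u - v\<bar>"
proof -
  have "\<bar>(tent (d + h) u - tent d u) - (tent (d + h) v - tent d v)\<bar> \<le> 2 * \<bar>u - v\<bar>"
    unfolding tent_def by (simp add: max_def abs_if)
  then have "\<bar>(tent (d + h) u - tent d u) - (tent (d + h) v - tent d v)\<bar> / h \<le> 2 * \<bar>u - v\<bar> / h"
    using assms by (intro divide_right_mono) auto
  then show ?thesis unfolding trapezoid_def using assms by (simp add: diff_divide_distrib[symmetric] abs_divide)
qed

text \<open>The difference of cosines is twice a product of sines with arguments proportional to
  \<open>2 * d + h\<close> and to \<open>h\<close>. Bounding both, one or none of the sines by its
  argument, and the rest by 1, gives the three estimates.\<close>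

lemma trap_coeff_bounds:
  assumes d: "0 \<le> d" "0 < h" and m: "1 \<le> m"
  shows "\<bar>trap_coeff d h m\<bar> \<le> 2 * d + h" "\<bar>trap_coeff d h m\<bar> \<le> 1 / real m" "\<bar>trap_coeff d h m\<bar> \<le> 1 / h / (real m)\<^sup>2"
proof -
  have m0: "0 < real m" using m by simp
  define D where "D = 2 * pi\<^sup>2 * (real m)\<^sup>2"
  have D0: "0 < D" unfolding D_def using m0 by simp
  define a where "a = 2 * pi * (real m * d)"
  define b where "b = 2 * pi * (real m * (d + h))"
  have tc: "\<bar>trap_coeff d h m\<bar> = \<bar>cos a - cos b\<bar> / D / h"
    unfolding trap_coeff_def a_def b_def D_def using d by (simp add: abs_divide abs_mult)
  have cd: "cos a - cos b = 2 * sin ((a + b) / 2) * sin ((b - a) / 2)" by (rule cos_diff_cos)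
  have ba: "(b - a) / 2 = pi * real m * h" "(a + b) / 2 = pi * real m * (2 * d + h)"
    unfolding a_def b_def by (simp_all add: field_simps)
  have p1: "0 \<le> pi * real m * h" "0 \<le> pi * real m * (2 * d + h)" using d by auto
  have s: "\<bar>sin ((b - a) / 2)\<bar> \<le> pi * real m * h" "\<bar>sin ((a + b) / 2)\<bar> \<le> pi * real m * (2 * d + h)"
    unfolding ba using abs_sin_x_le_abs_x[of "pi * real m * h"] abs_sin_x_le_abs_x[of "pi * real m * (2 * d + h)"] p1 by simp_all
  have "\<bar>cos a - cos b\<bar> = 2 * (\<bar>sin ((a + b) / 2)\<bar> * \<bar>sin ((b - a) / 2)\<bar>)" unfolding cd by (simp add: abs_mult)
  note ce = this
  have "\<bar>sin ((a + b) / 2)\<bar> * \<bar>sin ((b - a) / 2)\<bar> \<le> (pi * real m * (2 * d + h)) * (pi * real m * h)"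
    using s p1 by (intro mult_mono) auto
  then have "\<bar>cos a - cos b\<bar> \<le> 2 * ((pi * real m * (2 * d + h)) * (pi * real m * h))"
    unfolding ce by (intro mult_left_mono) auto
  also have "\<dots> = (2 * d + h) * h * D" unfolding D_def by (simp add: power2_eq_square algebra_simps)
  finally have "\<bar>cos a - cos b\<bar> \<le> (2 * d + h) * h * D" .
  then have "\<bar>cos a - cos b\<bar> / D \<le> (2 * d + h) * h" using D0 by (simp add: pos_divide_le_eq)
  then show "\<bar>trap_coeff d h m\<bar> \<le> 2 * d + h" unfolding tc using d by (simp only: pos_divide_le_eq)
  have "\<bar>sin ((a + b) / 2)\<bar> * \<bar>sin ((b - a) / 2)\<bar> \<le> 1 * (pi * real m * h)"
    using s p1 by (intro mult_mono) auto
  then have "\<bar>cos a - cos b\<bar> \<le> 2 * pi * real m * h" unfolding ce by simp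
  also have "\<dots> = (1 / real m * h) * D / pi" unfolding D_def using m0 by (simp add: power2_eq_square)
  also have "\<dots> \<le> (1 / real m * h) * D / 1" using d m0 D0 pi_ge_two by (intro divide_left_mono) auto
  finally have "\<bar>cos a - cos b\<bar> / D \<le> 1 / real m * h" using D0 by (simp only: pos_divide_le_eq div_by_1)
  then show "\<bar>trap_coeff d h m\<bar> \<le> 1 / real m" unfolding tc using d by (simp only: pos_divide_le_eq)
  have "\<bar>cos a - cos b\<bar> \<le> 2" using cos_le_one[of a] cos_le_one[of b] cos_ge_minus_one[of a] cos_ge_minus_one[of b] by linarith
  then have "\<bar>cos a - cos b\<bar> / D / h \<le> 2 / D / h" using D0 d by (intro divide_right_mono) auto
  also have "\<dots> = 1 / h / (real m)\<^sup>2 / pi\<^sup>2" unfolding D_def by (simp add: mult_ac)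
  also have "\<dots> \<le> 1 / h / (real m)\<^sup>2 / 1"
  proof -
    have "1 * 1 \<le> pi * pi" using pi_ge_two by (intro mult_mono) auto
    then show ?thesis using d by (intro divide_left_mono) (auto simp: power2_eq_square)
  qed
  finally show "\<bar>trap_coeff d h m\<bar> \<le> 1 / h / (real m)\<^sup>2" unfolding tc by simp
qed

text \<open>\<open>fejer_interval\<close> for the trapezoid shifted by \<open>y\<close>, on
  \<open>{- 2..2}\<close>. Because \<open>d + h \<le> 1 / 2\<close>, the only integer where it can
  be nonzero is 0, and there it has the value at \<open>y\<close>. The 32 is 4 unit intervals times
  4 times the Lipschitz constant \<open>2 / h\<close>.\<close>

lemma trapezoid_fourier:
  assumes d: "0 \<le> d" "0 < h" "d + h \<le> 1 / 2" and y: "\<bar>y\<bar> \<le> 1 / 2" and M: "0 < M"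
  shows "norm (of_real (trapezoid d h y) - (of_real (2 * d + h) +
     (\<Sum>m\<in>{1..<M}. of_real (1 - real m / real M) * (of_real (trap_coeff d h m) * (ee (real m * y) + ee (- (real m * y)))))))
     \<le> 32 / h / sqrt (real M)"
proof -
  define G where "G x = complex_of_real (trapezoid d h (y + x))" for x
  have dh: "0 \<le> d + h" "d + h \<le> 1" "d \<le> 1" using d by auto
  have lip: "norm (G x - G x') \<le> 2 / h * \<bar>x - x'\<bar>" for x x'
    unfolding G_def of_real_diff[symmetric] norm_of_real using trapezoid_lipschitz[OF d(2), of d "y + x" "y + x'"] by simp
  have "(2 / h)-lipschitz_on UNIV G" by (rule lipschitz_onI) (use lip d in \<open>auto simp: dist_norm\<close>)
  then have cG: "continuous_on {- 2..2} G" using lipschitz_on_continuous_on continuous_on_subset by blast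
  have Ge: "G x = (of_real (tent (d + h) (y + x)) - of_real (tent d (y + x))) / of_real h" for x
    unfolding G_def trapezoid_def by simp
  have Gfun: "G = (\<lambda>x. (of_real (tent (d + h) (y + x)) - of_real (tent d (y + x))) / of_real h)"
    by (rule ext) (rule Ge)
  have I0: "integral {- 2..2} G = of_real (2 * d + h)"
  proof -
    have "((\<lambda>x. (of_real (tent (d + h) (y + x)) - of_real (tent d (y + x))) / of_real h) has_integral
       (of_real ((d + h)\<^sup>2) - of_real (d\<^sup>2)) / complex_of_real h) {- 2..2}"
      by (intro has_integral_divide has_integral_diff tent_fourier_0 dh d y)
    moreover have "(of_real ((d + h)\<^sup>2) - of_real (d\<^sup>2)) / complex_of_real h = of_real (((d + h)\<^sup>2 - d\<^sup>2) / h)" by simp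
    moreover have "((d + h)\<^sup>2 - d\<^sup>2) / h = 2 * d + h" using d by (simp add: field_simps power2_eq_square)
    ultimately show ?thesis unfolding Gfun by (simp only: integral_unique)
  qed
  have Im: "integral {- 2..2} (\<lambda>x. ee (- (m * x)) * G x) = of_real ((cos (2 * pi * (m * d)) - cos (2 * pi * (m * (d + h)))) / (2 * pi\<^sup>2 * m\<^sup>2) / h) * ee (m * y)"
    if m: "m \<noteq> 0" for m
  proof -
    have "((\<lambda>x. (of_real (tent (d + h) (y + x)) * ee (- (m * x)) - of_real (tent d (y + x)) * ee (- (m * x))) / of_real h) has_integral
       (ee (m * y) * of_real ((1 - cos (2 * pi * (m * (d + h)))) / (2 * pi\<^sup>2 * m\<^sup>2)) - ee (m * y) * of_real ((1 - cos (2 * pi * (m * d))) / (2 * pi\<^sup>2 * m\<^sup>2))) / complex_of_real h) {- 2..2}"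
      by (intro has_integral_divide has_integral_diff tent_fourier dh d y m)
    moreover have "(\<lambda>x. (of_real (tent (d + h) (y + x)) * ee (- (m * x)) - of_real (tent d (y + x)) * ee (- (m * x))) / of_real h) = (\<lambda>x. ee (- (m * x)) * G x)"
      unfolding Ge by (rule ext) (simp add: algebra_simps diff_divide_distrib)
    moreover have "(ee (m * y) * of_real ((1 - cos (2 * pi * (m * (d + h)))) / (2 * pi\<^sup>2 * m\<^sup>2)) - ee (m * y) * of_real ((1 - cos (2 * pi * (m * d))) / (2 * pi\<^sup>2 * m\<^sup>2))) / complex_of_real h
      = of_real ((cos (2 * pi * (m * d)) - cos (2 * pi * (m * (d + h)))) / (2 * pi\<^sup>2 * m\<^sup>2) / h) * ee (m * y)"
    proof -
      have "(ee (m * y) * of_real u - ee (m * y) * of_real v) / complex_of_real h = of_real ((u - v) / h) * ee (m * y)" for u v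
        by (simp add: algebra_simps diff_divide_distrib)
      moreover have "(1 - cos (2 * pi * (m * (d + h)))) / (2 * pi\<^sup>2 * m\<^sup>2) - (1 - cos (2 * pi * (m * d))) / (2 * pi\<^sup>2 * m\<^sup>2)
        = (cos (2 * pi * (m * d)) - cos (2 * pi * (m * (d + h)))) / (2 * pi\<^sup>2 * m\<^sup>2)"
        by (simp add: diff_divide_distrib)
      ultimately show ?thesis by (simp only:)
    qed
    ultimately show ?thesis by (simp only: integral_unique)
  qed
  have Ip: "integral {- 2..2} (\<lambda>x. ee (- (real m * x)) * G x) = of_real (trap_coeff d h m) * ee (real m * y)"
    and In: "integral {- 2..2} (\<lambda>x. ee (real m * x) * G x) = of_real (trap_coeff d h m) * ee (- (real m * y))"
    if m: "m \<in> {1..<M}" for m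
  proof -
    have m0: "real m \<noteq> 0" "- real m \<noteq> 0" using m by auto
    show "integral {- 2..2} (\<lambda>x. ee (- (real m * x)) * G x) = of_real (trap_coeff d h m) * ee (real m * y)"
      using Im[OF m0(1)] unfolding trap_coeff_def .
    show "integral {- 2..2} (\<lambda>x. ee (real m * x) * G x) = of_real (trap_coeff d h m) * ee (- (real m * y))"
      using Im[OF m0(2)] unfolding trap_coeff_def by simp
  qed
  have z: "G x = 0" if "1 / 2 \<le> \<bar>y + x\<bar>" for x
    unfolding G_def using trapezoid_bounds(4)[OF d(1,2), of "y + x"] that d(3) by simp
  have S: "(\<Sum>i<4. (G (of_int (- 2) + of_nat i) + G (of_int (- 2) + of_nat (Suc i))) / 2) = G 0"
  proof -
    have "(\<Sum>i<4. (G (of_int (- 2) + of_nat i) + G (of_int (- 2) + of_nat (Suc i))) / 2)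
      = (G (- 2) + G (- 1)) / 2 + (G (- 1) + G 0) / 2 + (G 0 + G 1) / 2 + (G 1 + G 2) / 2"
      by (simp add: eval_nat_numeral)
    moreover have "G (- 2) = 0" "G (- 1) = 0" "G 1 = 0" "G 2 = 0" using y by (intro z; linarith)+
    ultimately show ?thesis by simp
  qed
  have "norm (integral {of_int (- 2)..of_int (- 2) + of_nat 4} (\<lambda>x. fejer M x *\<^sub>R G x)
     - (\<Sum>i<4. (G (of_int (- 2) + of_nat i) + G (of_int (- 2) + of_nat (Suc i))) / 2)) \<le> real 4 * (4 * (2 / h) / sqrt (real M))"
    by (rule fejer_interval[OF M]) (use lip d in auto)
  then have "norm (integral {- 2..2} (\<lambda>x. fejer M x *\<^sub>R G x) - G 0) \<le> 32 / h / sqrt (real M)" unfolding S by simp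
  moreover have "integral {- 2..2} (\<lambda>x. fejer M x *\<^sub>R G x) = of_real (2 * d + h) +
     (\<Sum>m\<in>{1..<M}. of_real (1 - real m / real M) * (of_real (trap_coeff d h m) * (ee (real m * y) + ee (- (real m * y)))))"
    unfolding fejer_integral_expand[OF cG] I0
    by (intro arg_cong2[where f = "(+)"] refl sum.cong) (simp only: Ip In distrib_left)
  ultimately show ?thesis unfolding G_def by (simp add: norm_minus_commute)
qed

section \<open>Counting rational points\<close>

lemma deriv_on_works:
  assumes "f differentiable_on I" "x \<in> I"
  shows "(f has_real_derivative deriv_on I f x) (at x within I)"
  using assms unfolding deriv_on_def has_real_derivative_iff_has_vector_derivative differentiable_on_def
  by (simp add: vector_derivative_works[symmetric])

section \<open>Extension from the interval to the line\<close>

lemma constant_sign: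
  fixes u :: "real \<Rightarrow> real"
  assumes c: "0 < c" and u: "continuous_on {a..b} u" "\<And>x. x \<in> {a..b} \<Longrightarrow> c \<le> \<bar>u x\<bar>"
  obtains s where "s = 1 \<or> s = - 1" "\<And>x. x \<in> {a..b} \<Longrightarrow> s * u x = \<bar>u x\<bar>"
proof -
  define s :: real where "s = (if 0 < u a then 1 else - 1)"
  have "s * u x = \<bar>u x\<bar>" if x: "x \<in> {a..b}" for x
  proof (rule ccontr)
    assume "s * u x \<noteq> \<bar>u x\<bar>"
    then have neg: "s * u x \<le> 0" unfolding s_def by (auto simp: abs_if split: if_splits)
    have "continuous_on {a..x} (\<lambda>z. s * u z)"
      using continuous_on_subset[OF u(1)] x by (intro continuous_intros) auto
    moreover have "0 \<le> s * u a" unfolding s_def by auto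
    ultimately obtain z where "a \<le> z" "z \<le> x" "s * u z = 0"
      using IVT2'[of "\<lambda>z. s * u z" x 0 a] neg x by auto
    then show False using u(2)[of z] x c unfolding s_def by (auto split: if_splits)
  qed
  moreover have "s = 1 \<or> s = - 1" unfolding s_def by auto
  ultimately show thesis using that by blast
qed

lemma increasing_inverse:
  fixes F :: "real \<Rightarrow> real"
  assumes c: "0 < c" and F: "\<And>x. (F has_real_derivative F' x) (at x)" "\<And>x. c \<le> F' x"
  shows "bij F"
proof -
  have incr: "c * (y - x) \<le> F y - F x" if "x \<le> y" for x y
  proof (cases "x = y")
    case False
    then have xy: "x < y" using that by simp
    obtain z where "F y - F x = (y - x) * F' z" using MVT2[OF xy, of F F'] F(1) by blast
    then show ?thesis using F(2)[of z] xy by (simp add: mult.commute mult_left_mono)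
  qed simp
  have "inj F"
  proof (rule linorder_injI)
    fix x y :: real assume "x < y"
    then have "0 < c * (y - x)" using c by simp
    then show "F x \<noteq> F y" using incr[of x y] \<open>x < y\<close> by linarith
  qed
  moreover have "\<exists>x. y = F x" for y
  proof -
    define K where "K = \<bar>y - F 0\<bar> / c"
    have K: "0 \<le> K" "c * K = \<bar>y - F 0\<bar>" unfolding K_def using c by auto
    have up: "y \<le> F K" and lo: "F (- K) \<le> y" using incr[of 0 K] incr[of "- K" 0] K by auto
    have "continuous_on {- K..K} F" using F(1) by (intro continuous_at_imp_continuous_on) (auto intro: DERIV_isCont)
    from IVT'[of F "- K" y K, OF lo up _ this] K show ?thesis by auto
  qed
  then have "surj F" by (auto simp: surj_def)
  ultimately show ?thesis by (simp add: bij_def)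
qed

text \<open>The second derivative is continued by its end values, which preserves its bounds and its
  Lipschitz constant, and integrated twice with the data of \<open>f\<close> at
  \<open>\<eta>\<close>. If it is negative, \<open>f\<close> is replaced by \<open>- f\<close>,
  which does not affect distances to the integers.\<close>

lemma convex_curve_extension:
  fixes f :: "real \<Rightarrow> real"
  assumes ab: "\<eta> < \<xi>" and c1: "0 < c1" and f: "f \<in> F_class {\<eta>..\<xi>} c1 c2"
    and lip: "L-lipschitz_on {\<eta>..\<xi>} (deriv_on {\<eta>..\<xi>} (deriv_on {\<eta>..\<xi>} f))"
  obtains F F1 F2 g s where "s = 1 \<or> s = - 1" "convex_curve F F1 F2 g c1 c2 L" "\<forall>x\<in>{\<eta>..\<xi>}. F x = s * f x"
proof -
  define I where "I = {\<eta>..\<xi>}"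
  define d1 where "d1 = deriv_on I f"
  define d2 where "d2 = deriv_on I d1"
  have diff: "f differentiable_on I" "d1 differentiable_on I" and cont: "continuous_on I d2"
    and bd: "\<And>x. x \<in> I \<Longrightarrow> c1 \<le> \<bar>d2 x\<bar> \<and> \<bar>d2 x\<bar> \<le> c2"
    using f unfolding F_class_def C2_on_def d1_def d2_def I_def by auto
  have D: "(f has_real_derivative d1 x) (at x within I)" "(d1 has_real_derivative d2 x) (at x within I)" if "x \<in> I" for x
    using deriv_on_works[OF diff(1) that] deriv_on_works[OF diff(2) that] unfolding d1_def[symmetric] d2_def[symmetric] .
  obtain s where s: "s = 1 \<or> s = - 1" and sd: "\<And>x. x \<in> I \<Longrightarrow> s * d2 x = \<bar>d2 x\<bar>"
    using constant_sign[OF c1 cont[unfolded I_def]] bd unfolding I_def by blast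
  define p where "p x = max \<eta> (min \<xi> x)" for x
  have p: "p x \<in> I" "x \<in> I \<Longrightarrow> p x = x" for x using ab unfolding p_def I_def by auto
  define F2 where "F2 x = s * d2 (p x)" for x
  have L0: "0 \<le> L" using lipschitz_on_nonneg[OF lip] .
  have F2L: "\<bar>F2 x - F2 y\<bar> \<le> L * \<bar>x - y\<bar>" for x y
  proof -
    have "\<bar>F2 x - F2 y\<bar> = \<bar>d2 (p x) - d2 (p y)\<bar>" using s unfolding F2_def by (auto simp: abs_minus_commute)
    also have "\<dots> \<le> L * \<bar>p x - p y\<bar>"
      using lipschitz_onD[OF lip[folded I_def, folded d1_def, folded d2_def] p(1) p(1)] by (simp add: dist_real_def)
    also have "\<dots> \<le> L * \<bar>x - y\<bar>" by (intro mult_left_mono L0) (simp add: p_def max_def min_def)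
    finally show ?thesis .
  qed
  have F2b: "c1 \<le> F2 x" "F2 x \<le> c2" for x unfolding F2_def using sd[OF p(1)] bd[OF p(1)] by simp_all
  have "L-lipschitz_on UNIV F2" by (rule lipschitz_onI) (use F2L L0 in \<open>auto simp: dist_real_def\<close>)
  then have "continuous_on UNIV F2" by (rule lipschitz_on_continuous_on)
  then obtain G where G: "\<And>x. (G has_vector_derivative F2 x) (at x)" using antiderivative_exists by blast
  define F1 where "F1 x = G x - G \<eta> + s * d1 \<eta>" for x
  have dF1: "(F1 has_real_derivative F2 x) (at x)" for x
    unfolding F1_def using G[of x] by (auto intro!: derivative_eq_intros simp: has_real_derivative_iff_has_vector_derivative[symmetric])
  then have "continuous_on UNIV F1" by (intro continuous_at_imp_continuous_on) (auto intro: DERIV_isCont)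
  then obtain H where H: "\<And>x. (H has_vector_derivative F1 x) (at x)" using antiderivative_exists by blast
  define F where "F x = H x - H \<eta> + s * f \<eta>" for x
  have dF: "(F has_real_derivative F1 x) (at x)" for x
    unfolding F_def using H[of x] by (auto intro!: derivative_eq_intros simp: has_real_derivative_iff_has_vector_derivative[symmetric])
  have \<eta>: "\<eta> \<in> I" using ab unfolding I_def by simp
  have cI: "convex I" unfolding I_def by simp
  \<comment> \<open>Equal derivatives and equal values at \<open>\<eta>\<close>. The derivative of
    \<open>v\<close> is one-sided at the ends, so constancy is derived within the convex set
    \<open>I\<close>.\<close>
  have agree: "u x = s * v x"
    if u: "\<And>x. x \<in> I \<Longrightarrow> (u has_real_derivative w x) (at x)" and v: "\<And>x. x \<in> I \<Longrightarrow> (v has_real_derivative z x) (at x within I)"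
      and wz: "\<And>x. x \<in> I \<Longrightarrow> w x = s * z x" and e: "u \<eta> = s * v \<eta>" and x: "x \<in> I" for u v w z x
  proof -
    have "((\<lambda>x. u x - s * v x) has_real_derivative 0) (at y within I)" if y: "y \<in> I" for y
      using DERIV_diff[OF has_field_derivative_at_within[OF u[OF y]] DERIV_cmult[OF v[OF y], of s]] wz[OF y] by simp
    then obtain k where "\<forall>y\<in>I. u y - s * v y = k" using has_field_derivative_zero_constant[OF cI] by blast
    then have "u \<eta> - s * v \<eta> = k" "u x - s * v x = k" using \<eta> x by blast+
    then show ?thesis using e by linarith
  qed
  have F1I: "F1 x = s * d1 x" if "x \<in> I" for x
    by (rule agree[OF dF1 D(2) _ _ that]) (simp_all add: F1_def F2_def p)
  have FI: "F x = s * f x" if "x \<in> I" for x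
    by (rule agree[OF dF D(1) F1I _ that]) (simp_all add: F_def)
  have "bij F1" by (rule increasing_inverse[OF c1 dF1 F2b(1)])
  then have "inv F1 (F1 x) = x" "F1 (inv F1 x) = x" for x by (simp_all add: bij_is_inj bij_is_surj surj_f_inv_f)
  then have "convex_curve F F1 F2 (inv F1) c1 c2 L"
    by unfold_locales (use dF dF1 c1 F2b L0 F2L in auto)
  then show thesis using that s FI unfolding I_def by blast
qed

section \<open>Sums over the rational points\<close>

lemma dist_int_round: "dist_int x = \<bar>x - of_int (round x)\<bar>"
proof -
  have "\<bar>x - of_int (round x)\<bar> \<le> \<bar>x - of_int k\<bar>" for k :: int by (rule round_diff_minimal)
  then show ?thesis unfolding dist_int_def by (intro cInf_eq_minimum) auto
qed

lemma dist_int_le: "dist_int x \<le> \<bar>x - of_int k\<bar>"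
  unfolding dist_int_round by (rule round_diff_minimal)

lemma dist_int_minus: "dist_int (- x) = dist_int x"
proof (rule antisym)
  show "dist_int (- x) \<le> dist_int x"
    using dist_int_le[of "- x" "- round x"] unfolding dist_int_round[of x] by simp
  show "dist_int x \<le> dist_int (- x)"
    using dist_int_le[of x "- round (- x)"] unfolding dist_int_round[of "- x"] by simp
qed

text \<open>Polymorphic in its values, so that the real trapezoids and their complex Fourier sums
  share the linearity lemmas.\<close>

definition grid_sum :: "(real \<Rightarrow> real) \<Rightarrow> real \<Rightarrow> real \<Rightarrow> nat \<Rightarrow> (real \<Rightarrow> 'a::real_normed_vector) \<Rightarrow> 'a" where
  "grid_sum f \<eta> \<xi> Q \<phi> = (\<Sum>q\<in>{1..Q}. \<Sum>a\<in>{\<lceil>real q * \<eta>\<rceil>..\<lfloor>real q * \<xi>\<rfloor>}. \<phi> (real q * f (of_int a / real q)))"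

lemma grid_sum_simps:
  "grid_sum f \<eta> \<xi> Q (\<lambda>t. u t + v t) = grid_sum f \<eta> \<xi> Q u + grid_sum f \<eta> \<xi> Q v"
  "grid_sum f \<eta> \<xi> Q (\<lambda>t. u t - v t) = grid_sum f \<eta> \<xi> Q u - grid_sum f \<eta> \<xi> Q v"
  by (simp_all add: grid_sum_def sum.distrib sum_subtractf)

lemma grid_sum_cmult: "grid_sum f \<eta> \<xi> Q (\<lambda>t. c * u t) = c * grid_sum f \<eta> \<xi> Q u"
  for c :: "'a::real_normed_algebra"
  by (simp add: grid_sum_def sum_distrib_left)

lemma grid_sum_sum: "grid_sum f \<eta> \<xi> Q (\<lambda>t. \<Sum>m\<in>A. u m t) = (\<Sum>m\<in>A. grid_sum f \<eta> \<xi> Q (u m))"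
proof -
  have "grid_sum f \<eta> \<xi> Q (\<lambda>t. \<Sum>m\<in>A. u m t) = (\<Sum>q\<in>{1..Q}. \<Sum>m\<in>A. \<Sum>a\<in>{\<lceil>real q * \<eta>\<rceil>..\<lfloor>real q * \<xi>\<rfloor>}. u m (real q * f (of_int a / real q)))"
    unfolding grid_sum_def by (rule sum.cong[OF refl], rule sum.swap)
  also have "\<dots> = (\<Sum>m\<in>A. grid_sum f \<eta> \<xi> Q (u m))" unfolding grid_sum_def by (rule sum.swap)
  finally show ?thesis .
qed

lemma grid_sum_mono:
  fixes u v :: "real \<Rightarrow> real"
  assumes "\<And>t. u t \<le> v t"
  shows "grid_sum f \<eta> \<xi> Q u \<le> grid_sum f \<eta> \<xi> Q v"
  unfolding grid_sum_def by (intro sum_mono assms)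

lemma norm_grid_sum: "norm (grid_sum f \<eta> \<xi> Q u) \<le> grid_sum f \<eta> \<xi> Q (\<lambda>t. norm (u t))"
  unfolding grid_sum_def by (intro order_trans[OF norm_sum] sum_mono norm_sum)

lemma of_real_grid_sum: "grid_sum f \<eta> \<xi> Q (\<lambda>t. complex_of_real (u t)) = of_real (grid_sum f \<eta> \<xi> Q u)"
  by (simp add: grid_sum_def)

lemma grid_sum_ee: "grid_sum f \<eta> \<xi> Q (\<lambda>t. ee (real m * t)) = curve_sum f \<eta> \<xi> Q m"
  by (simp add: grid_sum_def curve_sum_def)

lemma grid_sum_ee_minus: "grid_sum f \<eta> \<xi> Q (\<lambda>t. ee (- (real m * t))) = cnj (curve_sum f \<eta> \<xi> Q m)"
  by (simp add: grid_sum_def curve_sum_def ee_minus)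

lemma grid_points:
  assumes "1 \<le> q"
  shows "of_int a / real q \<in> {\<eta>..\<xi>} \<longleftrightarrow> a \<in> {\<lceil>real q * \<eta>\<rceil>..\<lfloor>real q * \<xi>\<rfloor>}"
  using assms by (simp add: field_simps ceiling_le_iff le_floor_iff)

lemma N_count_grid_sum:
  "real (N_count {\<eta>..\<xi>} f (real Q) \<delta>) = grid_sum f \<eta> \<xi> Q (\<lambda>t. if dist_int t < \<delta> then 1 else 0)"
proof -
  define A where "A q = {a \<in> {\<lceil>real q * \<eta>\<rceil>..\<lfloor>real q * \<xi>\<rfloor>}. dist_int (real q * f (of_int a / real q)) < \<delta>}" for q
  have "rat_pts {\<eta>..\<xi>} f (real Q) \<delta> = prod.swap ` (SIGMA q:{1..Q}. A q)"
  proof (rule set_eqI)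
    fix x :: "int \<times> nat"
    obtain a q where x: "x = (a, q)" by (cases x)
    have "x \<in> prod.swap ` (SIGMA q:{1..Q}. A q) \<longleftrightarrow> q \<in> {1..Q} \<and> a \<in> A q" unfolding x by (auto simp: image_iff)
    also have "\<dots> \<longleftrightarrow> x \<in> rat_pts {\<eta>..\<xi>} f (real Q) \<delta>"
      using grid_points[of q a \<eta> \<xi>] unfolding x rat_pts_def A_def by auto
    finally show "x \<in> rat_pts {\<eta>..\<xi>} f (real Q) \<delta> \<longleftrightarrow> x \<in> prod.swap ` (SIGMA q:{1..Q}. A q)" by simp
  qed
  then have "N_count {\<eta>..\<xi>} f (real Q) \<delta> = card (SIGMA q:{1..Q}. A q)"
    unfolding N_count_def by (simp add: card_image inj_on_def)
  also have "\<dots> = (\<Sum>q\<in>{1..Q}. card (A q))" 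
  proof (rule card_SigmaI)
    have "finite (A q)" for q unfolding A_def by (rule finite_subset[of _ "{\<lceil>real q * \<eta>\<rceil>..\<lfloor>real q * \<xi>\<rfloor>}"]) auto
    then show "\<forall>q\<in>{1..Q}. finite (A q)" by blast
  qed simp
  finally have "real (N_count {\<eta>..\<xi>} f (real Q) \<delta>) = (\<Sum>q\<in>{1..Q}. real (card (A q)))" by simp
  also have "\<dots> = grid_sum f \<eta> \<xi> Q (\<lambda>t. if dist_int t < \<delta> then 1 else 0)"
    unfolding grid_sum_def
  proof (rule sum.cong[OF refl])
    fix q
    show "real (card (A q)) = (\<Sum>a\<in>{\<lceil>real q * \<eta>\<rceil>..\<lfloor>real q * \<xi>\<rfloor>}. if dist_int (real q * f (of_int a / real q)) < \<delta> then 1 else 0)"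
      unfolding A_def by (subst sum.inter_filter[symmetric]) auto
  qed
  finally show ?thesis .
qed

text \<open>Row \<open>q\<close> holds \<open>q * (\<xi> - \<eta>)\<close> points up to 1. The half
  of \<open>Q\<^sup>2\<close> meets the width \<open>2 * \<delta>\<close> of the target in the main
  term.\<close>

lemma grid_size:
  assumes "\<eta> \<le> \<xi>"
  shows "\<bar>grid_sum f \<eta> \<xi> Q (\<lambda>t. 1 :: real) - (\<xi> - \<eta>) * (real Q)\<^sup>2 / 2\<bar> \<le> (1 + (\<xi> - \<eta>)) * real Q"
proof -
  have row: "\<bar>(\<Sum>a\<in>{\<lceil>real q * \<eta>\<rceil>..\<lfloor>real q * \<xi>\<rfloor>}. 1) - real q * (\<xi> - \<eta>)\<bar> \<le> 1" for q
  proof -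
    have "real q * \<eta> \<le> real q * \<xi>" using assms by (intro mult_left_mono) auto
    then have "\<lceil>real q * \<eta>\<rceil> \<le> \<lfloor>real q * \<xi>\<rfloor> + 1" by linarith
    then have "(\<Sum>a\<in>{\<lceil>real q * \<eta>\<rceil>..\<lfloor>real q * \<xi>\<rfloor>}. 1 :: real) = of_int (\<lfloor>real q * \<xi>\<rfloor> - \<lceil>real q * \<eta>\<rceil> + 1)" by simp
    then show ?thesis unfolding right_diff_distrib by linarith
  qed
  have "\<bar>grid_sum f \<eta> \<xi> Q (\<lambda>t. 1 :: real) - (\<Sum>q\<in>{1..Q}. real q * (\<xi> - \<eta>))\<bar> \<le> (\<Sum>q\<in>{1..Q}. 1)"
    unfolding grid_sum_def sum_subtractf[symmetric] by (rule order_trans[OF sum_abs sum_mono]) (rule row)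
  moreover have "(\<Sum>q\<in>{1..Q}. real q * (\<xi> - \<eta>)) = (\<xi> - \<eta>) * (real Q)\<^sup>2 / 2 + (\<xi> - \<eta>) * real Q / 2"
    by (induction Q) (auto simp: field_simps power2_eq_square)
  moreover have "0 \<le> (\<xi> - \<eta>) * real Q" using assms by simp
  ultimately show ?thesis unfolding distrib_right by simp
qed

lemma trapezoid_grid_sum:
  assumes d: "0 \<le> d" "0 < h" "d + h \<le> 1 / 2" and M: "0 < M"
  shows "\<bar>grid_sum f \<eta> \<xi> Q (\<lambda>t. trapezoid d h (dist_int t)) - (2 * d + h) * grid_sum f \<eta> \<xi> Q (\<lambda>t. 1)\<bar>
    \<le> 32 / h / sqrt (real M) * grid_sum f \<eta> \<xi> Q (\<lambda>t. 1)
      + 2 * (\<Sum>m\<in>{1..<M}. \<bar>trap_coeff d h m\<bar> * norm (curve_sum f \<eta> \<xi> Q m))"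
proof -
  define S where "S = (\<lambda>\<phi> :: real \<Rightarrow> complex. grid_sum f \<eta> \<xi> Q \<phi>)"
  define n where "n = grid_sum f \<eta> \<xi> Q (\<lambda>t. 1 :: real)"
  define w where "w m = (1 - real m / real M) * trap_coeff d h m" for m
  define T where "T t = (\<Sum>m\<in>{1..<M}. of_real (w m) * (ee (real m * t) + ee (- (real m * t))))" for t
  define a where "a t = trapezoid d h (dist_int t)" for t
  have pt: "norm (of_real (a t - (2 * d + h)) - T t) \<le> 32 / h / sqrt (real M)" for t
  proof -
    \<comment> \<open>Reduction modulo 1 changes neither the trapezoid of \<open>dist_int t\<close>
      nor the exponentials, and brings \<open>t\<close> into the range of
      \<open>trapezoid_fourier\<close>.\<close>
    define y where "y = t - of_int (round t)"
    have y: "\<bar>y\<bar> \<le> 1 / 2" unfolding y_def using of_int_round_abs_le[of t] by (simp add: abs_minus_commute)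
    have a: "a t = trapezoid d h y" unfolding a_def y_def dist_int_round trapezoid_def tent_def by simp
    have e: "ee (real m * y) = ee (real m * t)" for m
    proof -
      have "real m * t = real m * y + of_int (int m * round t)" unfolding y_def by (simp add: algebra_simps)
      then show ?thesis by (simp only: ee_add ee_int mult_1_right)
    qed
    have "(\<Sum>m\<in>{1..<M}. of_real (1 - real m / real M) * (of_real (trap_coeff d h m) * (ee (real m * y) + ee (- (real m * y))))) = T t"
      unfolding T_def w_def ee_minus e by (simp add: mult_ac)
    then show ?thesis using trapezoid_fourier[OF d y M] unfolding a by (simp add: diff_diff_eq)
  qed
  have "norm (S (\<lambda>t. of_real (a t - (2 * d + h)) - T t)) \<le> grid_sum f \<eta> \<xi> Q (\<lambda>t. 32 / h / sqrt (real M) * 1)"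
    unfolding S_def mult_1_right by (rule order_trans[OF norm_grid_sum grid_sum_mono]) (rule pt)
  also have "\<dots> = 32 / h / sqrt (real M) * n" unfolding n_def by (rule grid_sum_cmult)
  finally have 1: "norm (S (\<lambda>t. of_real (a t - (2 * d + h))) - S T) \<le> 32 / h / sqrt (real M) * n"
    unfolding S_def grid_sum_simps .
  have "S (\<lambda>t. of_real (a t - (2 * d + h))) = of_real (grid_sum f \<eta> \<xi> Q (\<lambda>t. a t - (2 * d + h) * 1))"
    unfolding S_def of_real_grid_sum by simp
  also have "grid_sum f \<eta> \<xi> Q (\<lambda>t. a t - (2 * d + h) * 1) = grid_sum f \<eta> \<xi> Q a - (2 * d + h) * n"
    unfolding n_def grid_sum_simps grid_sum_cmult ..
  finally have 2: "S (\<lambda>t. of_real (a t - (2 * d + h))) = of_real (grid_sum f \<eta> \<xi> Q a - (2 * d + h) * n)" .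
  have "S T = (\<Sum>m\<in>{1..<M}. of_real (w m) * (curve_sum f \<eta> \<xi> Q m + cnj (curve_sum f \<eta> \<xi> Q m)))"
    unfolding S_def T_def grid_sum_sum grid_sum_cmult grid_sum_simps grid_sum_ee grid_sum_ee_minus ..
  then have "norm (S T) \<le> (\<Sum>m\<in>{1..<M}. norm (of_real (w m) * (curve_sum f \<eta> \<xi> Q m + cnj (curve_sum f \<eta> \<xi> Q m))))"
    by (simp only: norm_sum)
  also have "\<dots> \<le> (\<Sum>m\<in>{1..<M}. 2 * (\<bar>trap_coeff d h m\<bar> * norm (curve_sum f \<eta> \<xi> Q m)))"
  proof (rule sum_mono)
    fix m assume m: "m \<in> {1..<M}"
    have "\<bar>w m\<bar> \<le> 1 * \<bar>trap_coeff d h m\<bar>" unfolding w_def abs_mult using m by (intro mult_right_mono) auto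
    moreover have "norm (curve_sum f \<eta> \<xi> Q m + cnj (curve_sum f \<eta> \<xi> Q m)) \<le> 2 * norm (curve_sum f \<eta> \<xi> Q m)"
      by (rule order_trans[OF norm_triangle_ineq]) simp
    ultimately have "\<bar>w m\<bar> * norm (curve_sum f \<eta> \<xi> Q m + cnj (curve_sum f \<eta> \<xi> Q m)) \<le> (1 * \<bar>trap_coeff d h m\<bar>) * (2 * norm (curve_sum f \<eta> \<xi> Q m))"
      by (rule mult_mono) auto
    then show "norm (of_real (w m) * (curve_sum f \<eta> \<xi> Q m + cnj (curve_sum f \<eta> \<xi> Q m))) \<le> 2 * (\<bar>trap_coeff d h m\<bar> * norm (curve_sum f \<eta> \<xi> Q m))"
      by (simp add: norm_mult mult_ac)
  qed
  finally have 3: "norm (S T) \<le> 2 * (\<Sum>m\<in>{1..<M}. \<bar>trap_coeff d h m\<bar> * norm (curve_sum f \<eta> \<xi> Q m))"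
    by (simp only: sum_distrib_left)
  have "norm (S (\<lambda>t. of_real (a t - (2 * d + h)))) \<le> norm (S (\<lambda>t. of_real (a t - (2 * d + h))) - S T) + norm (S T)"
    using norm_triangle_ineq[of "S (\<lambda>t. of_real (a t - (2 * d + h))) - S T" "S T"] by simp
  then have "\<bar>grid_sum f \<eta> \<xi> Q a - (2 * d + h) * n\<bar> \<le> norm (S (\<lambda>t. of_real (a t - (2 * d + h))) - S T) + norm (S T)"
    unfolding 2 norm_of_real .
  then show ?thesis using 1 3 unfolding a_def n_def by linarith
qed

lemma trapezoid_error:
  fixes c1 c2 L \<eta> \<xi> \<epsilon> :: real
  assumes c: "0 < c1" "c1 \<le> c2" and l: "\<eta> < \<xi>" and \<epsilon>: "0 < \<epsilon>"
  obtains K where "0 < K"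
    "\<And>f f1 f2 g Q d. convex_curve f f1 f2 g c1 c2 L \<Longrightarrow> 1 \<le> Q \<Longrightarrow> 0 \<le> d \<Longrightarrow> d + 1 / real Q \<le> 1 / 2 \<Longrightarrow>
       \<bar>grid_sum f \<eta> \<xi> Q (\<lambda>t. trapezoid d (1 / real Q) (dist_int t)) - (2 * d + 1 / real Q) * grid_sum f \<eta> \<xi> Q (\<lambda>t. 1)\<bar>
       \<le> K * (sqrt (2 * d + 1 / real Q) * (1 + ln (1 / (2 * d + 1 / real Q))) * (real Q * sqrt (real Q)) + real Q * real Q powr \<epsilon>)"
proof -
  have l0: "0 < \<xi> - \<eta>" using l by simp
  obtain C where C: "0 < C" and av: "\<And>f f1 f2 g \<eta>' \<xi>' Q n b \<rho>. convex_curve f f1 f2 g c1 c2 L \<Longrightarrow> \<xi>' - \<eta>' = \<xi> - \<eta> \<Longrightarrow> 2 ^ n \<le> Q \<Longrightarrow> Q < 2 * 2 ^ n \<Longrightarrow>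
       0 < \<rho> \<Longrightarrow> \<rho> \<le> 1 \<Longrightarrow>
       (\<And>j. 1 \<le> j \<Longrightarrow> 0 \<le> b j \<and> b j \<le> \<rho> \<and> b j \<le> 1 / real j \<and> b j \<le> real Q / (real j)\<^sup>2) \<Longrightarrow>
       (\<Sum>j\<in>{1..<2 ^ (4 * (n + 1))}. b j * norm (curve_sum f \<eta>' \<xi>' Q j)) \<le>
         C * (sqrt \<rho> * (1 + ln (1 / \<rho>)) * (real Q * sqrt (real Q)) + real Q * real Q powr \<epsilon>)"
    using exponential_sum_average[OF c l0 \<epsilon>, of L] by blast
  define K where "K = 32 * (1 + 2 * (\<xi> - \<eta>)) + 2 * C"
  have "0 < K" unfolding K_def using C l0 by simp
  moreover have "\<bar>grid_sum f \<eta> \<xi> Q (\<lambda>t. trapezoid d (1 / real Q) (dist_int t)) - (2 * d + 1 / real Q) * grid_sum f \<eta> \<xi> Q (\<lambda>t. 1)\<bar>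
       \<le> K * (sqrt (2 * d + 1 / real Q) * (1 + ln (1 / (2 * d + 1 / real Q))) * (real Q * sqrt (real Q)) + real Q * real Q powr \<epsilon>)"
    if cc: "convex_curve f f1 f2 g c1 c2 L" and Q: "1 \<le> Q" and d: "0 \<le> d" "d + 1 / real Q \<le> 1 / 2" for f f1 f2 g Q d
  proof -
    define h where "h = 1 / real Q"
    define \<rho> where "\<rho> = 2 * d + h"
    define E where "E = sqrt \<rho> * (1 + ln (1 / \<rho>)) * (real Q * sqrt (real Q))"
    have Qr: "1 \<le> real Q" using Q by simp
    have h: "0 < h" "h \<le> 1 / 2" "1 / h = real Q" using Qr d unfolding h_def by (simp, linarith, simp)
    have \<rho>: "0 < \<rho>" "\<rho> \<le> 1" using h d unfolding \<rho>_def h_def[symmetric] by auto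
    have E0: "0 \<le> E" unfolding E_def using \<rho> by (intro mult_nonneg_nonneg) auto
    obtain n where n: "2 ^ n \<le> Q" "Q < 2 * 2 ^ n" using ex_power_ivl1[of 2 Q] Q by auto
    \<comment> \<open>\<open>M\<close> is at least \<open>Q ^ 4\<close>: the Fejer error is of order
      \<open>Q / sqrt M\<close> at each of about \<open>Q\<^sup>2\<close> points and has to total
      \<open>O(Q)\<close>. This fixes the range of frequencies in
      \<open>exponential_sum_average\<close>.\<close>
    define M :: nat where "M = 2 ^ (4 * (n + 1))"
    have M0: "0 < M" unfolding M_def by simp
    define n0 where "n0 = grid_sum f \<eta> \<xi> Q (\<lambda>t. 1 :: real)"
    have "real Q * 1 \<le> real Q * real Q" using Qr by (intro mult_left_mono) auto
    then have "(1 + (\<xi> - \<eta>)) * real Q \<le> (1 + (\<xi> - \<eta>)) * (real Q)\<^sup>2" using l0 by (intro mult_left_mono) (auto simp: power2_eq_square)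
    moreover have "0 \<le> (\<xi> - \<eta>) * (real Q)\<^sup>2" using l0 by simp
    moreover have "(1 + 2 * (\<xi> - \<eta>)) * (real Q)\<^sup>2 = (1 + (\<xi> - \<eta>)) * (real Q)\<^sup>2 + (\<xi> - \<eta>) * (real Q)\<^sup>2" by (simp add: algebra_simps)
    ultimately have n0: "n0 \<le> (1 + 2 * (\<xi> - \<eta>)) * (real Q)\<^sup>2"
      using grid_size[of \<eta> \<xi> f Q] l unfolding n0_def by linarith
    have n00: "0 \<le> n0" unfolding n0_def grid_sum_def by (intro sum_nonneg) auto
    have "Q < 2 ^ (n + 1)" using n by simp
    then have "real Q \<le> 2 ^ (n + 1)" by (metis of_nat_less_iff of_nat_numeral of_nat_power less_imp_le)
    then have "(real Q)\<^sup>2 \<le> (2 ^ (n + 1))\<^sup>2" by (intro power_mono) auto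
    also have "(2 ^ (n + 1))\<^sup>2 = sqrt (((2 ^ (n + 1))\<^sup>2)\<^sup>2)" by (simp only: real_sqrt_abs abs_power2)
    also have "((2 ^ (n + 1))\<^sup>2)\<^sup>2 = real M" unfolding M_def power_mult[symmetric] by (simp add: algebra_simps power_add)
    finally have sM: "(real Q)\<^sup>2 \<le> sqrt (real M)" .
    have "32 / h / sqrt (real M) * n0 \<le> 32 * (1 + 2 * (\<xi> - \<eta>)) * real Q"
    proof -
      have "32 / h / sqrt (real M) * n0 \<le> 32 / h / (real Q)\<^sup>2 * ((1 + 2 * (\<xi> - \<eta>)) * (real Q)\<^sup>2)"
        by (intro mult_mono divide_left_mono sM n0) (use n00 h M0 Qr l0 in auto)
      also have "\<dots> = 32 * (1 + 2 * (\<xi> - \<eta>)) * real Q" using Qr unfolding h_def by (simp add: field_simps)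
      finally show ?thesis .
    qed
    also have "\<dots> \<le> 32 * (1 + 2 * (\<xi> - \<eta>)) * (real Q * real Q powr \<epsilon>)"
    proof -
      have "1 \<le> real Q powr \<epsilon>" using Qr \<epsilon> by (intro ge_one_powr_ge_zero) auto
      then have "real Q * 1 \<le> real Q * real Q powr \<epsilon>" by (intro mult_left_mono) auto
      then show ?thesis using l0 by (intro mult_left_mono) auto
    qed
    finally have 1: "32 / h / sqrt (real M) * n0 \<le> 32 * (1 + 2 * (\<xi> - \<eta>)) * (E + real Q * real Q powr \<epsilon>)"
    proof (rule order_trans)
      show "32 * (1 + 2 * (\<xi> - \<eta>)) * (real Q * real Q powr \<epsilon>) \<le> 32 * (1 + 2 * (\<xi> - \<eta>)) * (E + real Q * real Q powr \<epsilon>)"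
        using E0 l0 by (intro mult_left_mono) auto
    qed
    have 2: "(\<Sum>m\<in>{1..<M}. \<bar>trap_coeff d h m\<bar> * norm (curve_sum f \<eta> \<xi> Q m)) \<le> C * (E + real Q * real Q powr \<epsilon>)"
      unfolding M_def E_def
    proof (rule av[OF cc refl n \<rho>])
      fix j :: nat assume j: "1 \<le> j"
      show "0 \<le> \<bar>trap_coeff d h j\<bar> \<and> \<bar>trap_coeff d h j\<bar> \<le> \<rho> \<and> \<bar>trap_coeff d h j\<bar> \<le> 1 / real j \<and> \<bar>trap_coeff d h j\<bar> \<le> real Q / (real j)\<^sup>2"
        using trap_coeff_bounds[OF d(1) h(1) j] unfolding \<rho>_def h(3) by simp
    qed
    have "\<bar>grid_sum f \<eta> \<xi> Q (\<lambda>t. trapezoid d h (dist_int t)) - \<rho> * n0\<bar> \<le> 32 / h / sqrt (real M) * n0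
        + 2 * (\<Sum>m\<in>{1..<M}. \<bar>trap_coeff d h m\<bar> * norm (curve_sum f \<eta> \<xi> Q m))"
      unfolding \<rho>_def n0_def by (rule trapezoid_grid_sum[OF d(1) h(1) _ M0]) (use d(2) h_def in simp)
    also have "\<dots> \<le> 32 * (1 + 2 * (\<xi> - \<eta>)) * (E + real Q * real Q powr \<epsilon>) + 2 * (C * (E + real Q * real Q powr \<epsilon>))"
      by (intro add_mono mult_left_mono 1 2) auto
    also have "\<dots> = K * (E + real Q * real Q powr \<epsilon>)" unfolding K_def by (simp only: distrib_right mult.assoc)
    finally show ?thesis unfolding E_def \<rho>_def n0_def h_def .
  qed
  ultimately show thesis using that by blast
qed

text \<open>\<open>sqrt \<rho>\<close> is at most \<open>2 * sqrt \<delta> + sqrt (1 / Q)\<close>,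
  and the logarithm is estimated differently with each part: by \<open>3 * ln (1 / \<delta>)\<close>
  with the first, by a power of \<open>Q\<close> with the second. The bound
  \<open>\<delta> \<le> 1 / 2\<close> keeps \<open>ln (1 / \<delta>)\<close> away from 0, so that it
  can absorb the summand 1.\<close>

lemma error_term_bound:
  assumes \<delta>: "0 < \<delta>" "\<delta> \<le> 1 / 2" and Q: "1 \<le> Q" and \<epsilon>: "0 < \<epsilon>"
    and \<rho>: "\<delta> \<le> \<rho>" "1 / Q \<le> \<rho>" "\<rho> \<le> 2 * \<delta> + 1 / Q" "\<rho> \<le> 1"
  shows "sqrt \<rho> * (1 + ln (1 / \<rho>)) * (Q * sqrt Q) \<le> 6 * (sqrt \<delta> * ln (1 / \<delta>) * (Q * sqrt Q)) + (1 + 1 / \<epsilon>) * (Q * Q powr \<epsilon>)"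
proof -
  define B where "B = 1 + ln (1 / \<rho>)"
  have \<rho>0: "0 < \<rho>" using \<delta> \<rho> by simp
  have B0: "0 \<le> B" unfolding B_def using \<rho>0 \<rho>(4) by simp
  have Q0: "0 < Q" using Q by simp
  have "1 / 2 \<le> ln (2 :: real)" using ln_one_minus_pos_upper_bound[of "1 / 2"] by (simp add: ln_div)
  also have "ln 2 \<le> ln (1 / \<delta>)" using \<delta> by (intro ln_mono) (auto simp: field_simps)
  finally have half: "1 / 2 \<le> ln (1 / \<delta>)" .
  have B1: "B \<le> 3 * ln (1 / \<delta>)"
  proof -
    have "ln (1 / \<rho>) \<le> ln (1 / \<delta>)" using \<rho> \<delta> \<rho>0 by (intro ln_mono divide_left_mono) auto
    then show ?thesis using half unfolding B_def by simp
  qed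
  have pw: "1 \<le> Q powr \<epsilon>" using Q \<epsilon> by (intro ge_one_powr_ge_zero) auto
  have B2: "B \<le> (1 + 1 / \<epsilon>) * Q powr \<epsilon>"
  proof -
    have "1 / \<rho> \<le> Q" using \<rho>(2) \<rho>0 Q0 by (simp add: field_simps)
    then have "ln (1 / \<rho>) \<le> ln Q" using \<rho>0 by (intro ln_mono) auto
    also have "\<dots> \<le> Q powr \<epsilon> / \<epsilon>" by (rule ln_powr_bound[OF Q \<epsilon>])
    finally show ?thesis using pw unfolding B_def by (simp add: distrib_right)
  qed
  have "sqrt \<rho> \<le> sqrt (2 * \<delta> + 1 / Q)" using \<rho> by simp
  also have "\<dots> \<le> sqrt (2 * \<delta>) + sqrt (1 / Q)" using \<delta> Q0 by (intro sqrt_add_le_add_sqrt) auto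
  also have "sqrt (2 * \<delta>) \<le> sqrt (2\<^sup>2 * \<delta>)" using \<delta> by simp
  also have "sqrt (2\<^sup>2 * \<delta>) = 2 * sqrt \<delta>" by (simp only: real_sqrt_mult real_sqrt_abs abs_numeral)
  finally have "sqrt \<rho> \<le> 2 * sqrt \<delta> + sqrt (1 / Q)" by simp
  then have "sqrt \<rho> * B * (Q * sqrt Q) \<le> (2 * sqrt \<delta> + sqrt (1 / Q)) * B * (Q * sqrt Q)"
    using B0 Q0 by (intro mult_right_mono) auto
  also have "\<dots> = 2 * sqrt \<delta> * B * (Q * sqrt Q) + Q * B"
  proof -
    have "sqrt (1 / Q) * sqrt Q = 1" using Q0 by (simp add: real_sqrt_mult[symmetric])
    then have "sqrt (1 / Q) * B * (Q * sqrt Q) = Q * B" by (metis mult.assoc mult.commute mult_1_left)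
    then show ?thesis by (simp only: distrib_right)
  qed
  also have "\<dots> \<le> 2 * sqrt \<delta> * (3 * ln (1 / \<delta>)) * (Q * sqrt Q) + Q * ((1 + 1 / \<epsilon>) * Q powr \<epsilon>)"
    using B1 B2 \<delta> Q0 by (intro add_mono mult_left_mono mult_right_mono) auto
  finally show ?thesis unfolding B_def by (simp only: mult_ac)
qed

text \<open>The indicator lies between the trapezoids with \<open>d = \<delta> - h\<close> and
  \<open>d = \<delta>\<close>, where \<open>h = 1 / Q\<close>. Their means \<open>2 * d + h\<close>
  differ from \<open>2 * \<delta>\<close> by \<open>h\<close>, which times the number of grid points
  is \<open>O(Q)\<close>.\<close>

lemma count_asymptotic:
  fixes c1 c2 L \<eta> \<xi> \<epsilon> :: real
  assumes c: "0 < c1" "c1 \<le> c2" and l: "\<eta> < \<xi>" and \<epsilon>: "0 < \<epsilon>"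
  obtains C where
    "\<And>f f1 f2 g \<delta> Q. convex_curve f f1 f2 g c1 c2 L \<Longrightarrow> 0 < \<delta> \<Longrightarrow> \<delta> \<le> 1 / 2 \<Longrightarrow> 1 \<le> Q \<Longrightarrow>
       \<bar>real (N_count {\<eta>..\<xi>} f (real Q) \<delta>) - (\<xi> - \<eta>) * \<delta> * (real Q)\<^sup>2\<bar>
       \<le> C * (sqrt \<delta> * ln (1 / \<delta>) * (real Q * sqrt (real Q)) + real Q * real Q powr \<epsilon>)"
proof -
  obtain K where K: "0 < K" and te: "\<And>f f1 f2 g Q d. convex_curve f f1 f2 g c1 c2 L \<Longrightarrow> 1 \<le> Q \<Longrightarrow> 0 \<le> d \<Longrightarrow> d + 1 / real Q \<le> 1 / 2 \<Longrightarrow>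
       \<bar>grid_sum f \<eta> \<xi> Q (\<lambda>t. trapezoid d (1 / real Q) (dist_int t)) - (2 * d + 1 / real Q) * grid_sum f \<eta> \<xi> Q (\<lambda>t. 1)\<bar>
       \<le> K * (sqrt (2 * d + 1 / real Q) * (1 + ln (1 / (2 * d + 1 / real Q))) * (real Q * sqrt (real Q)) + real Q * real Q powr \<epsilon>)"
    using trapezoid_error[OF c l \<epsilon>] by blast
  define l where "l = \<xi> - \<eta>"
  have l0: "0 < l" unfolding l_def using assms by simp
  define C where "C = K * (7 + 1 / \<epsilon>) + 2 + 3 * l"
  have "\<bar>real (N_count {\<eta>..\<xi>} f (real Q) \<delta>) - (\<xi> - \<eta>) * \<delta> * (real Q)\<^sup>2\<bar>
       \<le> C * (sqrt \<delta> * ln (1 / \<delta>) * (real Q * sqrt (real Q)) + real Q * real Q powr \<epsilon>)"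
    if cc: "convex_curve f f1 f2 g c1 c2 L" and \<delta>: "0 < \<delta>" "\<delta> \<le> 1 / 2" and Q: "1 \<le> Q" for f f1 f2 g \<delta> Q
  proof -
    define h where "h = 1 / real Q"
    define N where "N = real (N_count {\<eta>..\<xi>} f (real Q) \<delta>)"
    define n0 where "n0 = grid_sum f \<eta> \<xi> Q (\<lambda>t. 1 :: real)"
    define S where "S d = grid_sum f \<eta> \<xi> Q (\<lambda>t. trapezoid d h (dist_int t))" for d
    define E where "E = sqrt \<delta> * ln (1 / \<delta>) * (real Q * sqrt (real Q))"
    define R where "R = real Q * real Q powr \<epsilon>"
    have Qr: "1 \<le> real Q" using Q by simp
    have h: "0 < h" "h \<le> 1" using Qr unfolding h_def by auto
    have N: "N = grid_sum f \<eta> \<xi> Q (\<lambda>t. if dist_int t < \<delta> then 1 else 0)" unfolding N_def by (rule N_count_grid_sum)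
    have E0: "0 \<le> E" unfolding E_def using \<delta> by (intro mult_nonneg_nonneg) auto
    have R0: "real Q \<le> R"
    proof -
      have "1 \<le> real Q powr \<epsilon>" using Qr \<epsilon> by (intro ge_one_powr_ge_zero) auto
      then have "real Q * 1 \<le> real Q * real Q powr \<epsilon>" by (intro mult_left_mono) auto
      then show ?thesis unfolding R_def by simp
    qed
    have err: "\<bar>S d - (2 * d + h) * n0\<bar> \<le> K * (7 + 1 / \<epsilon>) * (E + R)"
      if d: "0 \<le> d" "d + h \<le> 1 / 2" "\<delta> \<le> 2 * d + h" "d \<le> \<delta>" for d
    proof -
      have "sqrt (2 * d + h) * (1 + ln (1 / (2 * d + h))) * (real Q * sqrt (real Q)) \<le> 6 * E + (1 + 1 / \<epsilon>) * R"
        unfolding E_def R_def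
      proof (rule error_term_bound[OF \<delta> Qr \<epsilon> d(3)])
        show "1 / real Q \<le> 2 * d + h" "2 * d + h \<le> 2 * \<delta> + 1 / real Q" using d unfolding h_def by linarith+
        show "2 * d + h \<le> 1" using d h by linarith
      qed
      then have "sqrt (2 * d + h) * (1 + ln (1 / (2 * d + h))) * (real Q * sqrt (real Q)) + R \<le> (7 + 1 / \<epsilon>) * (E + R)"
      proof (rule order_trans[OF add_right_mono])
        have "(7 + 1 / \<epsilon>) * (E + R) = (6 * E + (1 + 1 / \<epsilon>) * R + R) + (E + 1 / \<epsilon> * E + 5 * R)" by (simp add: algebra_simps add_divide_distrib)
        moreover have "0 \<le> E + 1 / \<epsilon> * E + 5 * R" using E0 R0 Qr \<epsilon> by (intro add_nonneg_nonneg mult_nonneg_nonneg) auto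
        ultimately show "6 * E + (1 + 1 / \<epsilon>) * R + R \<le> (7 + 1 / \<epsilon>) * (E + R)" by linarith
      qed
      then have "K * (sqrt (2 * d + h) * (1 + ln (1 / (2 * d + h))) * (real Q * sqrt (real Q)) + R) \<le> K * ((7 + 1 / \<epsilon>) * (E + R))"
        using K by (intro mult_left_mono) auto
      then show ?thesis
        using te[OF cc Q d(1) d(2)[unfolded h_def]] unfolding S_def n0_def R_def h_def mult.assoc[symmetric] by linarith
    qed
    have n0: "\<bar>n0 - l * (real Q)\<^sup>2 / 2\<bar> \<le> (1 + l) * real Q"
      unfolding n0_def l_def using grid_size[of \<eta> \<xi> f Q] assms by simp
    have hQ: "h * (real Q)\<^sup>2 = real Q" unfolding h_def using Qr by (simp add: power2_eq_square)
    have two\<delta>: "\<bar>2 * \<delta> * n0 - l * \<delta> * (real Q)\<^sup>2\<bar> \<le> (1 + l) * real Q"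
    proof -
      have "2 * \<delta> * n0 - l * \<delta> * (real Q)\<^sup>2 = 2 * \<delta> * (n0 - l * (real Q)\<^sup>2 / 2)" by (simp add: algebra_simps)
      then have "\<bar>2 * \<delta> * n0 - l * \<delta> * (real Q)\<^sup>2\<bar> = 2 * \<delta> * \<bar>n0 - l * (real Q)\<^sup>2 / 2\<bar>" using \<delta> by (simp add: abs_mult)
      also have "\<dots> \<le> 1 * ((1 + l) * real Q)" using \<delta> l0 by (intro mult_mono n0) auto
      finally show ?thesis by simp
    qed
    have hn: "h * n0 \<le> (1 + 2 * l) * real Q"
    proof -
      have "h * n0 \<le> h * (l * (real Q)\<^sup>2 / 2 + (1 + l) * real Q)" using n0 h by (intro mult_left_mono) auto
      also have "\<dots> = l * real Q / 2 + h * ((1 + l) * real Q)" using hQ by (simp add: distrib_left)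
      also have "h * ((1 + l) * real Q) = 1 + l" unfolding h_def using Qr by simp
      also have "l * real Q / 2 + (1 + l) \<le> (1 + 2 * l) * real Q"
      proof -
        have "(1 + l) * 1 \<le> (1 + l) * real Q" using Qr l0 by (intro mult_left_mono) auto
        moreover have "0 \<le> l * real Q" using l0 by simp
        ultimately show ?thesis by (simp add: algebra_simps)
      qed
      finally show ?thesis .
    qed
    have n00: "0 \<le> n0" unfolding n0_def grid_sum_def by (intro sum_nonneg) auto
    have lQ: "0 \<le> l * real Q" using l0 by simp
    have main0: "0 \<le> K * (7 + 1 / \<epsilon>) * (E + R)" using K \<epsilon> E0 R0 Qr by (intro mult_nonneg_nonneg add_nonneg_nonneg) auto
    have tot: "K * (7 + 1 / \<epsilon>) * (E + R) + (2 + 3 * l) * real Q \<le> C * (E + R)"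
    proof -
      have "(2 + 3 * l) * real Q \<le> (2 + 3 * l) * (E + R)" using l0 R0 E0 by (intro mult_left_mono) auto
      moreover have "C * (E + R) = K * (7 + 1 / \<epsilon>) * (E + R) + (2 + 3 * l) * (E + R)"
        unfolding C_def by (simp only: distrib_right add.assoc)
      ultimately show ?thesis by linarith
    qed
    have q3: "(2 + 3 * l) * real Q = 2 * real Q + 3 * (l * real Q)" "(1 + l) * real Q = real Q + l * real Q"
      "(1 + 2 * l) * real Q = real Q + 2 * (l * real Q)" by (simp_all add: algebra_simps)
    have up: "N \<le> l * \<delta> * (real Q)\<^sup>2 + (K * (7 + 1 / \<epsilon>) * (E + R) + (2 + 3 * l) * real Q)"
    proof (cases "\<delta> + h \<le> 1 / 2")
      case True
      have "N \<le> S \<delta>" unfolding N S_def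
        using trapezoid_bounds[of \<delta> h] \<delta> h by (intro grid_sum_mono) (auto simp: dist_int_round)
      also have "\<dots> \<le> (2 * \<delta> + h) * n0 + K * (7 + 1 / \<epsilon>) * (E + R)"
        using err[of \<delta>] True \<delta> h by (simp add: abs_le_iff)
      also have "(2 * \<delta> + h) * n0 = 2 * \<delta> * n0 + h * n0" by (simp only: distrib_right)
      finally show ?thesis using two\<delta> hn unfolding q3 abs_le_iff by linarith
    next
      case False
      \<comment> \<open>Here \<open>\<delta>\<close> is so near \<open>1 / 2\<close> that the upper
        trapezoid does not fit into a period; counting every point then loses only
        \<open>O(Q)\<close>.\<close>
      have "N \<le> n0" unfolding N n0_def by (intro grid_sum_mono) simp
      also have "n0 \<le> l * (real Q)\<^sup>2 / 2 + (1 + l) * real Q" using n0 by linarith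
      also have "l * (real Q)\<^sup>2 / 2 \<le> l * \<delta> * (real Q)\<^sup>2 + l * real Q"
      proof -
        have "(l * (real Q)\<^sup>2) * (1 / 2) \<le> (l * (real Q)\<^sup>2) * (\<delta> + h)" using False l0 by (intro mult_left_mono) auto
        also have "\<dots> = l * \<delta> * (real Q)\<^sup>2 + l * (h * (real Q)\<^sup>2)" by (simp add: algebra_simps)
        finally show ?thesis unfolding hQ by simp
      qed
      finally show ?thesis using main0 lQ Qr unfolding q3 by linarith
    qed
    have lo: "l * \<delta> * (real Q)\<^sup>2 \<le> N + (K * (7 + 1 / \<epsilon>) * (E + R) + (2 + 3 * l) * real Q)"
    proof (cases "h \<le> \<delta>")
      case True
      have "(2 * (\<delta> - h) + h) * n0 - K * (7 + 1 / \<epsilon>) * (E + R) \<le> S (\<delta> - h)"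
        using err[of "\<delta> - h"] True \<delta> h by (simp add: abs_le_iff)
      also have "\<dots> \<le> N" unfolding N S_def
        using trapezoid_bounds[of "\<delta> - h" h] True \<delta> h by (intro grid_sum_mono) (auto simp: dist_int_round)
      also have "(2 * (\<delta> - h) + h) * n0 = 2 * \<delta> * n0 - h * n0" by (simp add: algebra_simps)
      finally show ?thesis using two\<delta> hn unfolding q3 abs_le_iff by linarith
    next
      case False
      \<comment> \<open>Here \<open>\<delta> < 1 / Q\<close>, and the main term itself is
        \<open>O(Q)\<close>.\<close>
      have "l * \<delta> * (real Q)\<^sup>2 \<le> l * h * (real Q)\<^sup>2" using False l0 by (intro mult_right_mono mult_left_mono) auto
      also have "\<dots> = l * real Q" unfolding mult.assoc hQ ..
      also have "\<dots> \<le> N + (K * (7 + 1 / \<epsilon>) * (E + R) + (2 + 3 * l) * real Q)"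
        using main0 lQ Qr unfolding q3 N_def by linarith
      finally show ?thesis .
    qed
    have "\<bar>N - l * \<delta> * (real Q)\<^sup>2\<bar> \<le> C * (E + R)" using up lo tot unfolding abs_le_iff by linarith
    then show ?thesis unfolding N_def l_def E_def R_def .
  qed
  then show thesis using that by blast
qed

theorem theorem3:
  fixes \<eta> \<xi> c1 c2 L \<epsilon> :: real
  assumes "\<eta> < \<xi>" and "0 < c1" and "c1 \<le> c2" and "0 < \<epsilon>"
  shows "\<exists>C::real. \<forall>f\<in>F_class {\<eta>..\<xi>} c1 c2.
           L-lipschitz_on {\<eta>..\<xi>} (deriv_on {\<eta>..\<xi>} (deriv_on {\<eta>..\<xi>} f)) \<longrightarrow>
           (\<forall>(\<delta>::real) (Q::nat). 0 < \<delta> \<and> \<delta> \<le> 1 / 2 \<and> 1 < Q \<longrightarrow>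
              \<bar>real (N_count {\<eta>..\<xi>} f (real Q) \<delta>) - (\<xi> - \<eta>) * \<delta> * (real Q)\<^sup>2\<bar>
                \<le> C * (\<delta> powr (1 / 2) * ln (1 / \<delta>) * real Q powr (3 / 2) + real Q powr (1 + \<epsilon>)))"
proof -
  obtain C where C: "\<And>f f1 f2 g \<delta> Q. convex_curve f f1 f2 g c1 c2 L \<Longrightarrow> 0 < \<delta> \<Longrightarrow> \<delta> \<le> 1 / 2 \<Longrightarrow> 1 \<le> Q \<Longrightarrow>
       \<bar>real (N_count {\<eta>..\<xi>} f (real Q) \<delta>) - (\<xi> - \<eta>) * \<delta> * (real Q)\<^sup>2\<bar>
       \<le> C * (sqrt \<delta> * ln (1 / \<delta>) * (real Q * sqrt (real Q)) + real Q * real Q powr \<epsilon>)"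
    using count_asymptotic[OF assms(2,3,1,4)] by blast
  show ?thesis
  proof (intro exI[of _ C] ballI impI allI)
    fix f and \<delta> :: real and Q :: nat
    assume f: "f \<in> F_class {\<eta>..\<xi>} c1 c2" and lip: "L-lipschitz_on {\<eta>..\<xi>} (deriv_on {\<eta>..\<xi>} (deriv_on {\<eta>..\<xi>} f))"
      and dQ: "0 < \<delta> \<and> \<delta> \<le> 1 / 2 \<and> 1 < Q"
    obtain F F1 F2 g s where s: "s = 1 \<or> s = - 1" and cc: "convex_curve F F1 F2 g c1 c2 L"
      and Ff: "\<forall>x\<in>{\<eta>..\<xi>}. F x = s * f x"
      by (rule convex_curve_extension[OF assms(1,2) f lip]) (rule that, assumption+)
    \<comment> \<open>The extension equals \<open>f\<close> up to sign on the interval, so it counts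
      the same points.\<close>
    have "dist_int (real q * F (of_int a / real q)) = dist_int (real q * f (of_int a / real q))"
      if "of_int a / real q \<in> {\<eta>..\<xi>}" for a q
      using s bspec[OF Ff that] by (auto simp: dist_int_minus)
    then have "rat_pts {\<eta>..\<xi>} F (real Q) \<delta> = rat_pts {\<eta>..\<xi>} f (real Q) \<delta>"
      unfolding rat_pts_def by auto
    then have "N_count {\<eta>..\<xi>} F (real Q) \<delta> = N_count {\<eta>..\<xi>} f (real Q) \<delta>" unfolding N_count_def by simp
    moreover have "\<delta> powr (1 / 2) = sqrt \<delta>" using dQ by (simp add: powr_half_sqrt)
    moreover have "real Q powr (3 / 2) = real Q * sqrt (real Q)"
      using dQ powr_add[of "real Q" 1 "1 / 2"] by (simp add: powr_half_sqrt)
    moreover have "real Q powr (1 + \<epsilon>) = real Q * real Q powr \<epsilon>" using dQ by (simp add: powr_add)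
    ultimately show "\<bar>real (N_count {\<eta>..\<xi>} f (real Q) \<delta>) - (\<xi> - \<eta>) * \<delta> * (real Q)\<^sup>2\<bar>
                \<le> C * (\<delta> powr (1 / 2) * ln (1 / \<delta>) * real Q powr (3 / 2) + real Q powr (1 + \<epsilon>))"
      using C[OF cc, of \<delta> Q] dQ by simp
  qed
qed

end
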